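(* Let $(U(t,s))_{t\ge s}$ be an evolution family on a real separable Hilbert space $\mathbb{H}$, and let $(\mu_{t,s})_{t\ge s}$ be infinitely divisible probability measures on $\mathbb{H}$, $\mu_{t,s}=[a_{t,s},R_{t,s},m_{t,s}]$, with $\mu_{t,s}=\mu_{t,r}*(\mu_{r,s}\circ U(t,r)^{-1})$ for all $t\ge r\ge s$. Let $p_{s,t}f(x)=\int_{\mathbb{H}}f(U(t,s)x+y)\,\mu_{t,s}(dy)$ and let $(\tilde\nu_t)_{t\in\mathbb{R}}$ be an evolution system of measures for $(p_{s,t})_{t\ge s}$. Consider the conditions (H3) for every $t\in\mathbb{R}$, the limit $a_{t,-\infty}:=\lim_{s\to-\infty}a_{t,s}$ exists; (H4) for every $t\in\mathbb{R}$, $\tilde\nu_s\circ U(t,s)^{-1}\Rightarrow\sigma_t$ as $s\to-\infty$, for some probability measure $\sigma_t$ on $\mathbb{H}$. Then: (1) For every $t\in\mathbb{R}$, $\sup_{s\le t}\operatorname{tr}R_{t,s}<\infty$ and $\sup_{s\le t}\int_{\mathbb{H}}(1\wedge|x|^2)\,m_{t,s}(dx)<\infty$, and $[0,R_{t,s},m_{t,s}]\Rightarrow[0,R_{t,-\infty},m_{t,-\infty}]$ as $s\to-\infty$. (2) For every $t\in\mathbb{R}$ there exists a probability measure $\tilde\sigma_t$ such that $\delta_{a_{t,s}}*(\tilde\nu_s\circ U(t,s)^{-1})\Rightarrow\tilde\sigma_t$ as $s\to-\infty$. Moreover, $\tilde\nu_t=[0,R_{t,-\infty},m_{t,-\infty}]*\tilde\sigma_t$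 for every $t\in\mathbb{R}$. (3) Assume in addition that (H4) holds. If $\sigma_t$ is infinitely divisible for every $t\in\mathbb{R}$, then the limit in (H3) exists and, with $\nu_t:=[a_{t,-\infty},R_{t,-\infty},m_{t,-\infty}]$, $\nu_t$ is a factor of $\tilde\nu_t$: $$\tilde\nu_t=\nu_t*\sigma_t,\qquad t\in\mathbb{R}.$$ Moreover, $$\sigma_t=\sigma_s\circ U(t,s)^{-1},\qquad t\ge s.$$ Especially, if $\sigma_t=\delta_0$ for all $t\in\mathbb{R}$, then $\tilde\nu_t=\nu_t$ for all $t\in\mathbb{R}$. That is, the evolution system of measures is unique. (4) On the other hand, if the limit in (H3) exists, then the limit in (H4) exists, and hence $\tilde\nu_t=\nu_t*\sigma_t$ for $t\in\mathbb{R}$ and $\sigma_t=\sigma_s\circ U(t,s)^{-1}$ for $t\ge s$ hold, where $\nu_t=[a_{t,-\infty},R_{t,-\infty},m_{t,-\infty}]$.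
   Context: Evolution family: bounded linear operators $U(t,s)$, $t\ge s$, on $\mathbb{H}$ with $U(s,s)=I$, $U(t,r)U(r,s)=U(t,s)$ for $t\ge r\ge s$, and $(t,s)\mapsto U(t,s)x$ continuous for each $x$. $\Rightarrow$ is weak convergence. $\mu=[a,R,m]$ means that $\mu$ is infinitely divisible with $\hat\mu(\xi)=\int e^{i\langle x,\xi\rangle}\mu(dx)=e^{-\psi(\xi)}$, $\psi(\xi)=-i\langle a,\xi\rangle+\frac12\langle R\xi,\xi\rangle-\int_{\mathbb{H}}\bigl(e^{i\langle\xi,x\rangle}-1-\frac{i\langle\xi,x\rangle}{1+|x|^2}\bigr)m(dx)$, where $a\in\mathbb{H}$, $R$ is a non-negative definite symmetric trace class operator and $m$ is a Lévy measure (a $\sigma$-finite measure concentrated on $\mathbb{H}\setminus\{0\}$ with $\int(1\wedge|x|^2)\,dm<\infty$). A probability measure $\mu$ is a factor of $\nu$ if $\nu=\mu*\sigma$ for some probability measure $\sigma$. For fixed $t$, $m_{t,s}(A)$ and $\langle R_{t,s}x,x\rangle$ are non-increasing in $s\le t$. Define $m_{t,-\infty}(\{0\})=0$, $m_{t,-\infty}(A)=\lim_{s\to-\infty}m_{t,s}(A)$ for Borel $A\subset\mathbb{H}\setminus\{0\}$, and, when $\sup_{s\le t}\operatorname{tr}R_{t,s}<\infty$, the trace class operator $R_{t,-\infty}$ by $\langle R_{t,-\infty}x,y\rangle=\lim_{s\to-\infty}\langle R_{t,s}x,y\rangle$, $x,y\in\mathbb{H}$. An evolution system of measures for $(p_{s,t})_{t\ge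 s}$ is a family of Borel probability measures $(\nu_t)_{t\in\mathbb{R}}$ on $\mathbb{H}$ with $\int_{\mathbb{H}}p_{s,t}f\,d\nu_s=\int_{\mathbb{H}}f\,d\nu_t$ for all $s\le t$ and all bounded Borel $f$.
   Formalization: In (3), uniqueness is stated among evolution systems of measures that satisfy (H4) with σ_t = δ_0 for all t; without this it fails: for μ_{t,s} = δ_0 and U(t,s) = e^{-(t-s)}, both δ_0 and δ_{e^{-t}x} are evolution systems. *)

theory Defs
  imports "HOL-Probability.Probability"
begin

text \<open>
  A real separable Hilbert space is a type of sort \<open>{real_inner, banach, polish_space}\<close>; beyond
  the inner product this only asks for completeness and second countability.

  Families indexed by pairs \<open>t \<ge> s\<close> are total functions of \<open>(t, s)\<close>, and their values for
  \<open>t < s\<close> are never used. Limits as \<open>s \<rightarrow> -\<infinity>\<close> are limits along the filter \<open>at_bot\<close>.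
\<close>

subsection \<open>Trace class operators\<close>

definition orthonormal :: "'h::real_inner set \<Rightarrow> bool" where
  "orthonormal B \<longleftrightarrow> pairwise orthogonal B \<and> (\<forall>e\<in>B. norm e = 1)"

definition orthonormal_basis :: "'h::real_inner set \<Rightarrow> bool" where
  "orthonormal_basis B \<longleftrightarrow> orthonormal B \<and> closure (span B) = UNIV"

lemma orthonormal_extend:
  fixes x :: "'h::real_inner"
  assumes "finite F" "orthonormal F"
  shows "\<exists>G. finite G \<and> orthonormal G \<and> F \<subseteq> G \<and> x \<in> span G"
proof -
  define p where "p = (\<Sum>e\<in>F. (x \<bullet> e) *\<^sub>R e)"
  define y where "y = x - p"
  have p: "p \<in> span F"
    unfolding p_def by (intro span_sum span_scale span_base)
  have y: "y \<bullet> f = 0" if f: "f \<in> F" for f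
  proof -
    have "p \<bullet> f = (\<Sum>e\<in>F. if e = f then x \<bullet> f else 0)"
      unfolding p_def inner_sum_left
    proof (intro sum.cong refl)
      fix e assume e: "e \<in> F"
      show "((x \<bullet> e) *\<^sub>R e) \<bullet> f = (if e = f then x \<bullet> f else 0)"
        using assms(2) e f
        by (auto simp: orthonormal_def pairwise_def orthogonal_def dot_square_norm)
    qed
    then show ?thesis
      using assms(1) f by (simp add: y_def inner_diff_left)
  qed
  show ?thesis
  proof (cases "y = 0")
    case True
    then show ?thesis using p assms by (intro exI[of _ F]) (auto simp: y_def)
  next
    case False
    let ?G = "insert (y /\<^sub>R norm y) F"
    have "y /\<^sub>R norm y \<in> span ?G" by (intro span_base) simp
    then have "norm y *\<^sub>R (y /\<^sub>R norm y) \<in> span ?G" by (rule span_scale)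
    then have "y \<in> span ?G" using False by simp
    moreover have "p \<in> span ?G" using p span_mono[of F ?G] by blast
    ultimately have "y + p \<in> span ?G" by (rule span_add)
    then have "x \<in> span ?G" by (simp add: y_def)
    moreover have "orthonormal ?G"
      using assms(2) y False
      by (auto simp: orthonormal_def pairwise_insert orthogonal_def inner_commute)
    ultimately show ?thesis
      using assms(1) by (intro exI[of _ ?G]) auto
  qed
qed

lemma orthonormal_basis_exists:
  "\<exists>B :: 'h::{real_inner, second_countable_topology} set. orthonormal_basis B"
proof -
  obtain D :: "'h set" where D: "countable D" "\<And>X. open X \<Longrightarrow> X \<noteq> {} \<Longrightarrow> \<exists>d\<in>D. d \<in> X"
    using countable_dense_setE by blast
  have ne: "D \<noteq> {}" using D(2)[of UNIV] by auto
  define d where "d = from_nat_into D"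
  have d: "range d = D" using D(1) ne by (simp add: d_def range_from_nat_into)
  have "\<exists>F. \<forall>n. (finite (F n) \<and> orthonormal (F n)) \<and> (F n \<subseteq> F (Suc n) \<and> d n \<in> span (F (Suc n)))"
  proof (rule dependent_nat_choice)
    show "\<exists>F::'h set. finite F \<and> orthonormal F"
      by (intro exI[of _ "{}"]) (simp add: orthonormal_def)
  next
    fix F :: "'h set" and n
    assume "finite F \<and> orthonormal F"
    then show "\<exists>G. (finite G \<and> orthonormal G) \<and> (F \<subseteq> G \<and> d n \<in> span G)"
      using orthonormal_extend[of F "d n"] by blast
  qed
  then obtain F where F: "\<And>n. orthonormal (F n)" "\<And>n. F n \<subseteq> F (Suc n)"
      "\<And>n. d n \<in> span (F (Suc n))" by blast
  have mono: "F m \<subseteq> F n" if "m \<le> n" for m n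
    using F(2) that by (rule lift_Suc_mono_le)
  let ?B = "\<Union>n. F n"
  have "orthonormal ?B"
    unfolding orthonormal_def
  proof (intro conjI pairwiseI ballI)
    fix x y assume "x \<in> ?B" "y \<in> ?B" "x \<noteq> y"
    then obtain m n where "x \<in> F m" "y \<in> F n" by blast
    then have "x \<in> F (max m n)" "y \<in> F (max m n)"
      using mono[of m "max m n"] mono[of n "max m n"] by auto
    then show "orthogonal x y"
      using F(1)[of "max m n"] \<open>x \<noteq> y\<close> by (auto simp: orthonormal_def pairwise_def)
  next
    fix e assume "e \<in> ?B"
    then show "norm e = 1" using F(1) by (auto simp: orthonormal_def)
  qed
  moreover have "D \<subseteq> span ?B"
  proof
    fix x assume "x \<in> D"
    then obtain n where "x = d n" using d by blast
    then show "x \<in> span ?B"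
      using F(3)[of n] span_mono[of "F (Suc n)" ?B] by blast
  qed
  moreover have "closure D = UNIV"
    unfolding closure_interior
    using D(2)[of "interior (- D)"] interior_subset[of "- D"] by fastforce
  ultimately show ?thesis
    unfolding orthonormal_basis_def by (metis closure_mono top.extremum_unique)
qed

text \<open>
  The trace is only meant for non-negative definite operators: \<open>ennreal\<close> sends negative numbers
  to \<open>0\<close>. For these it does not depend on the choice of the basis, and such an operator is
  trace class iff its trace is finite.
\<close>

definition op_trace :: "('h::real_inner \<Rightarrow>\<^sub>L 'h) \<Rightarrow> ennreal" where
  "op_trace R = (\<Sum>\<^sub>\<infinity>e\<in>(SOME B. orthonormal_basis B). ennreal (R e \<bullet> e))"

definition covariance_operator :: "('h::real_inner \<Rightarrow>\<^sub>L 'h) \<Rightarrow> bool" where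
  "covariance_operator R \<longleftrightarrow>
     (\<forall>x y. R x \<bullet> y = x \<bullet> R y) \<and> (\<forall>x. 0 \<le> R x \<bullet> x) \<and> op_trace R < \<infinity>"


subsection \<open>Probability measures, convolution and weak convergence\<close>

definition borel_prob :: "'h::topological_space measure \<Rightarrow> bool" where
  "borel_prob M \<longleftrightarrow> prob_space M \<and> sets M = sets borel"

text \<open>The library's \<^const>\<open>convolution\<close> is restricted to Euclidean spaces.\<close>

definition conv :: "'h::real_normed_vector measure \<Rightarrow> 'h measure \<Rightarrow> 'h measure"
    (infixl \<open>\<^bold>*\<close> 70) where
  "M \<^bold>* N = distr (M \<Otimes>\<^sub>M N) borel (\<lambda>(x, y). x + y)"

primrec conv_power :: "'h::real_normed_vector measure \<Rightarrow> nat \<Rightarrow> 'h measure" where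
  "conv_power M 0 = return borel 0"
| "conv_power M (Suc n) = conv_power M n \<^bold>* M"

abbreviation dirac :: "'h::topological_space \<Rightarrow> 'h measure" where
  "dirac \<equiv> return borel"

abbreviation push :: "('h::real_normed_vector \<Rightarrow>\<^sub>L 'h) \<Rightarrow> 'h measure \<Rightarrow> 'h measure" where
  "push T M \<equiv> distr M borel (blinfun_apply T)"

definition factor :: "'h::real_normed_vector measure \<Rightarrow> 'h measure \<Rightarrow> bool" where
  "factor M N \<longleftrightarrow> (\<exists>S. borel_prob S \<and> N = M \<^bold>* S)"

definition weakly_converges ::
    "('i \<Rightarrow> 'h::topological_space measure) \<Rightarrow> 'h measure \<Rightarrow> 'i filter \<Rightarrow> bool" where
  "weakly_converges M N F \<longleftrightarrow>
     (\<forall>f :: 'h \<Rightarrow> real. continuous_on UNIV f \<and> bounded (range f) \<longrightarrow>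
        ((\<lambda>i. \<integral>x. f x \<partial>M i) \<longlongrightarrow> (\<integral>x. f x \<partial>N)) F)"


subsection \<open>Infinitely divisible measures\<close>

definition infinitely_divisible :: "'h::real_normed_vector measure \<Rightarrow> bool" where
  "infinitely_divisible M \<longleftrightarrow>
     borel_prob M \<and> (\<forall>n\<ge>1. \<exists>N. borel_prob N \<and> M = conv_power N n)"

definition char_fun :: "'h::real_inner measure \<Rightarrow> 'h \<Rightarrow> complex" where
  "char_fun M \<xi> = (CLINT x|M. iexp (x \<bullet> \<xi>))"

definition levy_measure :: "'h::real_normed_vector measure \<Rightarrow> bool" where
  "levy_measure m \<longleftrightarrow>
     sets m = sets borel \<and> sigma_finite_measure m \<and> emeasure m {0} = 0 \<and>
     (\<integral>\<^sup>+x. ennreal (min 1 ((norm x)\<^sup>2)) \<partial>m) < \<infinity>"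

definition levy_exponent :: "'h::real_inner \<Rightarrow> ('h \<Rightarrow>\<^sub>L 'h) \<Rightarrow> 'h measure \<Rightarrow> 'h \<Rightarrow> complex" where
  "levy_exponent a R m \<xi> =
     - \<i> * complex_of_real (a \<bullet> \<xi>) + complex_of_real (1/2 * (R \<xi> \<bullet> \<xi>)) -
     (CLINT x|m. iexp (\<xi> \<bullet> x) - 1 - \<i> * complex_of_real ((\<xi> \<bullet> x) / (1 + (norm x)\<^sup>2)))"

definition has_triplet ::
    "'h::real_inner measure \<Rightarrow> 'h \<Rightarrow> ('h \<Rightarrow>\<^sub>L 'h) \<Rightarrow> 'h measure \<Rightarrow> bool" where
  "has_triplet M a R m \<longleftrightarrow>
     infinitely_divisible M \<and> covariance_operator R \<and> levy_measure m \<and>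
     (\<forall>\<xi>. char_fun M \<xi> = exp (- levy_exponent a R m \<xi>))"

text \<open>
  The law \<open>[a, R, m]\<close>. Since the characteristic function determines the measure, it is well
  defined as soon as some measure satisfies \<^const>\<open>has_triplet\<close>.
\<close>

definition id_law :: "'h::real_inner \<Rightarrow> ('h \<Rightarrow>\<^sub>L 'h) \<Rightarrow> 'h measure \<Rightarrow> 'h measure" where
  "id_law a R m = (THE M. has_triplet M a R m)"


subsection \<open>Evolution families, generalized Mehler semigroups and their evolution systems\<close>

definition evolution_family :: "(real \<Rightarrow> real \<Rightarrow> 'h::real_normed_vector \<Rightarrow>\<^sub>L 'h) \<Rightarrow> bool" where
  "evolution_family U \<longleftrightarrow>
     (\<forall>s. U s s = id_blinfun) \<and>
     (\<forall>t r s. s \<le> r \<and> r \<le> t \<longrightarrow> U t r o\<^sub>L U r s = U t s) \<and>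
     (\<forall>x. continuous_on {(t, s). s \<le> t} (\<lambda>(t, s). U t s x))"

text \<open>\<open>mehler U \<mu> s t\<close> is the operator \<open>p\<^bsub>s,t\<^esub>\<close>; note the order of the time arguments.\<close>

definition mehler ::
    "(real \<Rightarrow> real \<Rightarrow> 'h::real_normed_vector \<Rightarrow>\<^sub>L 'h) \<Rightarrow> (real \<Rightarrow> real \<Rightarrow> 'h measure) \<Rightarrow>
     real \<Rightarrow> real \<Rightarrow> ('h \<Rightarrow> real) \<Rightarrow> 'h \<Rightarrow> real" where
  "mehler U \<mu> s t f x = (\<integral>y. f (U t s x + y) \<partial>\<mu> t s)"

definition evolution_system ::
    "(real \<Rightarrow> real \<Rightarrow> ('h::topological_space \<Rightarrow> real) \<Rightarrow> 'h \<Rightarrow> real) \<Rightarrow> (real \<Rightarrow> 'h measure) \<Rightarrow> bool" where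
  "evolution_system p \<nu> \<longleftrightarrow>
     (\<forall>t. borel_prob (\<nu> t)) \<and>
     (\<forall>s t f. s \<le> t \<and> f \<in> borel_measurable borel \<and> bounded (range f) \<longrightarrow>
        (\<integral>x. p s t f x \<partial>\<nu> s) = (\<integral>x. f x \<partial>\<nu> t))"


subsection \<open>Limits of the triplets\<close>

definition R_inf :: "(real \<Rightarrow> real \<Rightarrow> 'h::real_inner \<Rightarrow>\<^sub>L 'h) \<Rightarrow> real \<Rightarrow> 'h \<Rightarrow>\<^sub>L 'h" where
  "R_inf R t = (THE S :: 'h \<Rightarrow>\<^sub>L 'h. \<forall>x y. ((\<lambda>s. R t s x \<bullet> y) \<longlongrightarrow> S x \<bullet> y) at_bot)"

definition m_inf :: "(real \<Rightarrow> real \<Rightarrow> 'h::real_normed_vector measure) \<Rightarrow> real \<Rightarrow> 'h measure" where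
  "m_inf m t = measure_of UNIV (sets borel) (\<lambda>A. Lim at_bot (\<lambda>s. emeasure (m t s) (A - {0})))"

definition a_inf :: "(real \<Rightarrow> real \<Rightarrow> 'h::real_normed_vector) \<Rightarrow> real \<Rightarrow> 'h" where
  "a_inf a t = Lim at_bot (\<lambda>s. a t s)"

definition H3 :: "(real \<Rightarrow> real \<Rightarrow> 'h::real_normed_vector) \<Rightarrow> bool" where
  "H3 a \<longleftrightarrow> (\<forall>t. \<exists>l. ((\<lambda>s. a t s) \<longlongrightarrow> l) at_bot)"

definition H4 ::
    "(real \<Rightarrow> real \<Rightarrow> 'h::real_normed_vector \<Rightarrow>\<^sub>L 'h) \<Rightarrow> (real \<Rightarrow> 'h measure) \<Rightarrow> (real \<Rightarrow> 'h measure) \<Rightarrow> bool"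
    where
  "H4 U \<nu> \<sigma> \<longleftrightarrow>
     (\<forall>t. borel_prob (\<sigma> t) \<and> weakly_converges (\<lambda>s. push (U t s) (\<nu> s)) (\<sigma> t) at_bot)"

end

theory Submission
  imports Defs
begin

text \<open>
  The evolution system satisfies \<open>\<nu>' t = \<mu> t s \<^bold>* push (U t s) (\<nu>' s)\<close> for all \<open>s \<le> t\<close>. Thus for fixed
  \<open>t\<close> all the infinitely divisible laws \<open>\<mu> t s\<close> are factors of the single probability measure \<open>\<nu>' t\<close>,
  and everything follows from a quantitative form of the statement that the factors of a given measure
  form a relatively compact set up to translations.

  The quantitative form (\<open>factor_bound\<close>) bounds the trace of \<open>R\<close>, the operator \<open>R\<close>, and the integral
  of \<open>min 1 \<bar>x\<bar>\<^sup>2\<close> against the Levy measure, for every infinitely divisible factor of a measure \<open>\<nu>\<close>. It comes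
  from averaging in the argument \<open>\<xi>\<close> of the characteristic function over a centred Gaussian law \<open>\<gamma>\<close>
  with covariance \<open>c\<close> times a coordinate projection of rank \<open>n\<close>. With \<open>Q = 2 Re \<psi>\<close>, where \<open>\<psi>\<close> is the
  exponent of the factor, \<open>exp (- Q)\<close> dominates the square of the modulus of the characteristic function
  of \<open>\<nu>\<close>. Hence \<open>\<integral> (1 - exp (- Q)) d\<gamma>\<close> is small for small \<open>c\<close>, uniformly in \<open>n\<close> and in the
  factor. A reverse Jensen inequality turns this into a bound for \<open>\<integral> Q d\<gamma>\<close>, and this integral is \<open>c\<close> times a
  partial trace of \<open>R\<close> plus twice the integral of \<open>1 - exp (- c \<bar>proj x\<bar>\<^sup>2 / 2)\<close> against the Levy measure.
  Letting \<open>n\<close> tend to infinity gives the bounds. The moment inequality behind the reverse Jensen inequality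
  holds for the averages of \<open>1 - cos (\<xi> \<bullet> x)\<close> over any probability measure in \<open>x\<close>, and infinite divisibility
  is used by applying it to the convolution roots.

  The triplet is recovered from the exponent by symmetric second differences, which are the
  characteristic functions of finite measures (\<open>triplet_difference\<close>). So the skew convolution
  equation splits \<open>R t s'\<close> and \<open>m t s'\<close>, for \<open>s' \<le> s\<close>, into \<open>R t s\<close> and \<open>m t s\<close> plus non-negative
  increments. Being monotone and bounded, the triplets converge, and the increments become small. The
  same Gaussian averages show that a centred law with a small triplet is concentrated near
  the origin (\<open>increment_bound\<close>). Hence the centred laws, and likewise
  \<open>dirac (a t s) \<^bold>* push (U t s) (\<nu>' s)\<close>, are Cauchy in the bounded Lipschitz metric. This metric is
  complete on the probability measures of a Polish space: a Cauchy sequence is tight, and a tight positive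
  functional on the bounded Lipschitz functions is an integral. This proves the first two parts. That the
  limit of the centred laws is infinitely divisible follows by applying the argument to
  all their convolution roots.

  In the last two parts the drift \<open>a t s\<close> is the only quantity left to control. If it converges, then
  translating back gives the convergence of \<open>push (U t s) (\<nu>' s)\<close>. Conversely, if
  the laws \<open>push (U t s) (\<nu>' s)\<close> and their translates by \<open>a t s\<close> both converge, then by tightness the \<open>a t s\<close>
  stay in a compact set along each sequence of times. Their phases converge wherever the
  characteristic function of the limit does not vanish. The characteristic function of an infinitely divisible law has
  no zeros, so that the cluster point is unique.
\<close>

section \<open>Orthonormal expansions\<close>

text \<open>
  An enumeration of the orthonormal basis that defines \<^const>\<open>op_trace\<close>, padded with zero vectors: in
  finite dimension there are only finitely many basis vectors, and the zeros contribute nothing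
  to any of the sums below.
\<close>

definition onb :: "nat \<Rightarrow> 'h::real_inner" where
  "onb n = (let B = (SOME B. orthonormal_basis B) in
     if n \<in> to_nat_on B ` B then from_nat_into B n else 0)"

lemma orthonormal_countable:
  fixes B :: "'h::{real_inner, second_countable_topology} set"
  assumes "orthonormal B"
  shows "countable B"
proof -
  let ?f = "\<lambda>e::'h. ball e (1/2)"
  have dist: "1 < dist x y" if "x \<in> B" "y \<in> B" "x \<noteq> y" for x y
  proof -
    have "x \<bullet> x = 1" "y \<bullet> y = 1" "x \<bullet> y = 0" "y \<bullet> x = 0"
      using assms that by (auto simp: orthonormal_def pairwise_def orthogonal_def dot_square_norm)
    then have "(dist x y)\<^sup>2 = 2"
      by (simp add: dist_norm power2_norm_eq_inner inner_diff_left inner_diff_right)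
    then show ?thesis
      by (intro power_less_imp_less_base[of 1 2]) auto
  qed
  have disj: "x = y" if "x \<in> B" "y \<in> B" "z \<in> ?f x" "z \<in> ?f y" for x y z
  proof (rule ccontr)
    assume "x \<noteq> y"
    then have "1 < dist x y" using dist that by blast
    also have "\<dots> \<le> dist x z + dist y z" by (rule dist_triangle2)
    finally show False using that by simp
  qed
  have inj: "inj_on ?f B"
  proof (rule inj_onI)
    fix x y assume "x \<in> B" "y \<in> B" "?f x = ?f y"
    moreover have "x \<in> ?f x" by simp
    ultimately show "x = y" using disj by metis
  qed
  have "countable (?f ` B)"
  proof (rule countable_disjoint_open_subsets)
    show "pairwise disjnt (?f ` B)"
      unfolding pairwise_def disjnt_def using disj by (auto simp del: mem_ball)
  qed auto
  then show ?thesis using inj by (rule countable_image_inj_on)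
qed

context
  fixes B :: "'h::{real_inner, second_countable_topology} set"
  assumes B_def: "B = (SOME B. orthonormal_basis B)"
begin

lemma onb_B: "orthonormal B" "closure (span B) = UNIV" "countable B"
proof -
  have "orthonormal_basis B"
    unfolding B_def using orthonormal_basis_exists by (rule someI_ex)
  then show *: "orthonormal B" and "closure (span B) = UNIV"
    by (simp_all add: orthonormal_basis_def)
  show "countable B" by (rule orthonormal_countable[OF *])
qed

lemma onb_eq: "(onb n :: 'h) = (if n \<in> to_nat_on B ` B then from_nat_into B n else 0)"
  unfolding onb_def Let_def B_def by (rule refl)

lemma onb_to_nat: "e \<in> B \<Longrightarrow> onb (to_nat_on B e) = e"
  by (simp add: onb_eq from_nat_into_to_nat_on onb_B(3))

lemma onb_in:
  assumes "n \<in> to_nat_on B ` B"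
  shows "onb n \<in> B \<and> to_nat_on B (onb n) = n"
proof -
  from assms obtain e where e: "e \<in> B" "n = to_nat_on B e" by blast
  then have "onb n = e" by (simp add: onb_to_nat)
  with e show ?thesis by simp
qed

lemma onb_notin: "n \<notin> to_nat_on B ` B \<Longrightarrow> onb n = (0::'h)"
  by (simp only: onb_eq if_False)

lemma onb_trace: "(\<Sum>\<^sub>\<infinity>e\<in>B. ennreal (R e \<bullet> e)) = (\<Sum>n. ennreal (R (onb n) \<bullet> onb n))"
proof -
  let ?f = "\<lambda>n. ennreal (R (onb n) \<bullet> (onb n :: 'h))"
  have "(\<Sum>\<^sub>\<infinity>e\<in>B. ennreal (R e \<bullet> e)) = (\<Sum>\<^sub>\<infinity>n\<in>to_nat_on B ` B. ?f n)"
    by (subst infsum_reindex)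
      (simp_all add: inj_on_to_nat_on onb_B(3) onb_to_nat cong: infsum_cong)
  also have "\<dots> = (\<Sum>\<^sub>\<infinity>n. ?f n)"
    by (rule infsum_cong_neutral) (auto simp: onb_notin)
  also have "\<dots> = (\<Sum>n. ?f n)"
  proof -
    have "?f summable_on UNIV" by (simp add: nonneg_summable_on_complete)
    then have "(?f has_sum infsum ?f UNIV) UNIV" by (rule has_sum_infsum)
    then have "?f sums infsum ?f UNIV" by (rule has_sum_imp_sums)
    then show ?thesis by (simp add: sums_iff)
  qed
  finally show ?thesis .
qed

end

lemma op_trace_onb:
  fixes R :: "'h::{real_inner, second_countable_topology} \<Rightarrow>\<^sub>L 'h"
  shows "op_trace R = (\<Sum>n. ennreal (R (onb n) \<bullet> onb n))"
  unfolding op_trace_def by (rule onb_trace) simp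

lemma onb_orthogonal:
  fixes i j :: nat
  assumes "i \<noteq> j"
  shows "onb i \<bullet> (onb j :: 'h::{real_inner, second_countable_topology}) = 0"
proof -
  define B where "B = (SOME B :: 'h set. orthonormal_basis B)"
  show ?thesis
  proof (cases "i \<in> to_nat_on B ` B \<and> j \<in> to_nat_on B ` B")
    case True
    then have "onb i \<in> B" "onb j \<in> B" "onb i \<noteq> (onb j :: 'h)"
      using onb_in[OF B_def, of i] onb_in[OF B_def, of j] assms by metis+
    then show ?thesis
      using onb_B(1)[OF B_def] unfolding orthonormal_def pairwise_def orthogonal_def by blast
  next
    case False
    then show ?thesis using onb_notin[OF B_def, of i] onb_notin[OF B_def, of j] by auto
  qed
qed

lemma onb_normalized:
  "onb i = (0 :: 'h::{real_inner, second_countable_topology}) \<or> onb i \<bullet> (onb i :: 'h) = 1"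
proof -
  define B where "B = (SOME B :: 'h set. orthonormal_basis B)"
  show ?thesis
    using onb_B(1)[OF B_def] onb_in[OF B_def, of i] onb_notin[OF B_def, of i]
    unfolding orthonormal_def dot_square_norm
    by (cases "i \<in> to_nat_on B ` B") auto
qed

definition onb_proj :: "nat \<Rightarrow> 'h::real_inner \<Rightarrow> 'h" where
  "onb_proj N x = (\<Sum>n<N. (x \<bullet> onb n) *\<^sub>R onb n)"

lemma onb_proj_inner_onb:
  fixes x :: "'h::{real_inner, second_countable_topology}"
  shows "onb_proj N x \<bullet> onb k = (if k < N then x \<bullet> onb k else 0)"
proof -
  have "onb_proj N x \<bullet> onb k = (\<Sum>n<N. if n = k then x \<bullet> onb k else 0)"
    unfolding onb_proj_def inner_sum_left
  proof (intro sum.cong refl)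
    fix n assume "n \<in> {..<N}"
    have "n \<noteq> k \<Longrightarrow> onb n \<bullet> (onb k :: 'h) = 0" by (rule onb_orthogonal)
    moreover have "onb k = (0 :: 'h) \<or> onb k \<bullet> (onb k :: 'h) = 1" by (rule onb_normalized)
    ultimately show "((x \<bullet> onb n) *\<^sub>R onb n) \<bullet> (onb k :: 'h) = (if n = k then x \<bullet> onb k else 0)"
      by auto
  qed
  then show ?thesis by simp
qed

lemma onb_proj_self_inner:
  fixes x :: "'h::{real_inner, second_countable_topology}"
  shows "onb_proj N x \<bullet> onb_proj N x = x \<bullet> onb_proj N x"
proof -
  have "onb_proj N x \<bullet> onb_proj N x = (\<Sum>n<N. (x \<bullet> onb n) * (onb_proj N x \<bullet> onb n))"
    by (subst (2) onb_proj_def) (simp add: inner_sum_right)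
  also have "\<dots> = (\<Sum>n<N. (x \<bullet> onb n) * (x \<bullet> onb n))"
    by (intro sum.cong refl) (simp add: onb_proj_inner_onb)
  also have "\<dots> = x \<bullet> onb_proj N x"
    by (simp add: onb_proj_def inner_sum_right)
  finally show ?thesis .
qed

lemma norm_onb_proj:
  fixes x :: "'h::{real_inner, second_countable_topology}"
  shows "(norm (onb_proj N x))\<^sup>2 = (\<Sum>n<N. (x \<bullet> onb n)\<^sup>2)"
  unfolding power2_norm_eq_inner onb_proj_self_inner
  by (simp add: onb_proj_def inner_sum_right power2_eq_square)

lemma norm_onb_proj_le:
  fixes x :: "'h::{real_inner, second_countable_topology}"
  shows "norm (onb_proj N x) \<le> norm x"
proof -
  have "norm (onb_proj N x) * norm (onb_proj N x) \<le> norm x * norm (onb_proj N x)"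
    using norm_cauchy_schwarz[of x "onb_proj N x"]
    unfolding onb_proj_self_inner[symmetric] dot_square_norm power2_eq_square .
  then show ?thesis
    by (cases "onb_proj N x = 0") simp_all
qed

lemma onb_proj_diff: "onb_proj N (x - y) = onb_proj N x - onb_proj N y"
  by (simp add: onb_proj_def inner_diff_left scaleR_diff_left sum_subtractf)

lemma onb_proj_tendsto:
  fixes x :: "'h::{real_inner, second_countable_topology}"
  shows "(\<lambda>N. onb_proj N x) \<longlonglongrightarrow> x"
proof -
  define B where "B = (SOME B :: 'h set. orthonormal_basis B)"
  note B = onb_B[OF B_def]
  \<comment> \<open>vectors in the span are reproduced exactly by all late projections\<close>
  have span: "\<exists>N0. \<forall>N\<ge>N0. onb_proj N y = y" if "y \<in> span B" for y
    using that
  proof (induction rule: span_induct_alt)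
    case base
    then show ?case by (auto simp: onb_proj_def)
  next
    case (step c e y)
    then obtain N0 where N0: "\<forall>N\<ge>N0. onb_proj N y = y" by blast
    define k where "k = to_nat_on B e"
    have k: "onb k = e" using onb_to_nat[OF B_def] step(1) k_def by blast
    have "onb_proj N e = e" if "N > k" for N
    proof -
      have "onb_proj N e = (\<Sum>n<N. if n = k then e else 0)"
        unfolding onb_proj_def
      proof (intro sum.cong refl)
        fix n
        have "e \<bullet> e = 1" using B(1) step(1) by (auto simp: orthonormal_def dot_square_norm)
        moreover have "n \<noteq> k \<Longrightarrow> onb k \<bullet> (onb n :: 'h) = 0" using onb_orthogonal by metis
        ultimately show "(e \<bullet> onb n) *\<^sub>R onb n = (if n = k then e else 0)"
          using k by auto
      qed
      then show ?thesis using that by simp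
    qed
    moreover have "onb_proj N (c *\<^sub>R e + y) = c *\<^sub>R onb_proj N e + onb_proj N y" for N
      by (simp add: onb_proj_def inner_add_left scaleR_add_left sum.distrib scaleR_sum_right)
    ultimately have "\<forall>N\<ge>max N0 (Suc k). onb_proj N (c *\<^sub>R e + y) = c *\<^sub>R e + y"
      using N0 by simp
    then show ?case by blast
  qed
  show ?thesis
  proof (rule LIMSEQ_I)
    fix r :: real assume r: "0 < r"
    have "x \<in> closure (span B)" using B(2) by simp
    then obtain y where y: "y \<in> span B" "dist y x < r/2"
      using r closure_approachable[of x "span B"] by (metis half_gt_zero)
    from span[OF y(1)] obtain N0 where N0: "\<And>N. N \<ge> N0 \<Longrightarrow> onb_proj N y = y" by blast
    have "norm (onb_proj N x - x) < r" if "N \<ge> N0" for N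
    proof -
      have "onb_proj N x - x = onb_proj N (x - y) + (y - x)"
        using N0[OF that] by (simp add: onb_proj_diff)
      then have "norm (onb_proj N x - x) \<le> norm (onb_proj N (x - y)) + norm (y - x)"
        by (metis norm_triangle_ineq)
      also have "\<dots> \<le> norm (x - y) + norm (y - x)" by (simp add: norm_onb_proj_le)
      also have "\<dots> < r" using y(2) by (simp add: dist_norm norm_minus_commute)
      finally show ?thesis .
    qed
    then show "\<exists>no. \<forall>n\<ge>no. norm (onb_proj n x - x) < r" by blast
  qed
qed

lemma norm_onb_proj_tendsto:
  fixes x :: "'h::{real_inner, second_countable_topology}"
  shows "(\<lambda>N. norm (onb_proj N x)) \<longlonglongrightarrow> norm x"
  by (rule tendsto_norm[OF onb_proj_tendsto])

section \<open>Bounded bilinear forms\<close>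

text \<open>
  The representing vector minimises \<open>x \<bullet> x - 2 f x\<close>. The parallelogram law makes minimising
  sequences Cauchy, and the first variation at the minimum gives the claim.
\<close>

lemma riesz_representation:
  fixes f :: "'h::{real_inner, complete_space} \<Rightarrow> real"
  assumes "bounded_linear f"
  shows "\<exists>z. \<forall>y. f y = z \<bullet> y"
proof -
  interpret f: bounded_linear f by fact
  obtain K where K: "K > 0" "\<And>x. norm (f x) \<le> norm x * K" using f.pos_bounded by blast
  define g where "g x = x \<bullet> x - 2 * f x" for x
  have lower: "- K\<^sup>2 \<le> g x" for x
  proof -
    have "f x \<le> norm x * K" using K(2)[of x] by simp
    moreover have "0 \<le> (norm x)\<^sup>2 + K\<^sup>2 - 2 * norm x * K"
      by (metis power2_diff zero_le_power2)
    ultimately show ?thesis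
      by (simp add: g_def dot_square_norm)
  qed
  define m where "m = (INF x. g x)"
  have bdd: "bdd_below (range g)" using lower by (auto intro!: bdd_belowI2)
  have m: "m \<le> g x" for x unfolding m_def by (rule cINF_lower[OF bdd]) simp
  have "\<exists>x. g x < m + 1 / real (Suc n)" for n
  proof -
    have "m < m + 1 / real (Suc n)" by simp
    then show ?thesis unfolding m_def using cINF_less_iff[of UNIV g] bdd by blast
  qed
  then obtain x where x: "\<And>n. g (x n) < m + 1 / real (Suc n)" by metis
  have par: "(norm (u - v))\<^sup>2 \<le> 2 * (g u - m) + 2 * (g v - m)" for u v
  proof -
    have "(norm (u - v))\<^sup>2 = 2 * g u + 2 * g v - 4 * g ((1/2) *\<^sub>R (u + v))"
      unfolding power2_norm_eq_inner g_def f.scaleR f.add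
      by (simp add: inner_simps inner_commute algebra_simps)
    then show ?thesis using m[of "(1/2) *\<^sub>R (u + v)"] by simp
  qed
  have "Cauchy x"
  proof (rule metric_CauchyI)
    fix e :: real assume e: "0 < e"
    obtain N where N: "4 / e\<^sup>2 < real N" using reals_Archimedean2 by blast
    have small: "g (x n) - m < e\<^sup>2 / 4" if "n \<ge> N" for n
    proof -
      have "4 / e\<^sup>2 < real (Suc n)" using N that by simp
      then have "1 / real (Suc n) < e\<^sup>2 / 4" using e by (simp add: field_simps)
      then show ?thesis using x[of n] by linarith
    qed
    have "dist (x i) (x j) < e" if "i \<ge> N" "j \<ge> N" for i j
    proof -
      have "(dist (x i) (x j))\<^sup>2 < e\<^sup>2"
        using par[of "x i" "x j"] small[OF that(1)] small[OF that(2)] by (simp add: dist_norm)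
      then show ?thesis using e power2_less_imp_less by fastforce
    qed
    then show "\<exists>M. \<forall>m\<ge>M. \<forall>n\<ge>M. dist (x m) (x n) < e" by blast
  qed
  then obtain z where z: "x \<longlonglongrightarrow> z" using Cauchy_convergent convergent_def by blast
  have "(\<lambda>n. g (x n)) \<longlonglongrightarrow> g z"
    unfolding g_def by (intro tendsto_intros z f.tendsto)
  moreover have "(\<lambda>n. m + 1 / real (Suc n)) \<longlonglongrightarrow> m + 0"
    by (intro tendsto_intros LIMSEQ_Suc[OF lim_1_over_n])
  ultimately have "g z \<le> m"
    using x by (intro LIMSEQ_le[where X="\<lambda>n. g (x n)"]) (auto intro: less_imp_le)
  then have gz: "g z \<le> g y" for y using m order_trans by blast
  have "f y = z \<bullet> y" for y
  proof (rule ccontr)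
    assume ne: "f y \<noteq> z \<bullet> y"
    define d where "d = f y - z \<bullet> y"
    have "y \<noteq> 0" using ne by (auto simp: f.zero)
    then have yy: "y \<bullet> y > 0" by simp
    have expand: "g (z + c *\<^sub>R y) = g z + c\<^sup>2 * (y \<bullet> y) - 2 * c * d" for c
      by (simp add: g_def f.scaleR f.add d_def inner_simps inner_commute algebra_simps power2_eq_square)
    have "g z \<le> g (z + (d / (y \<bullet> y)) *\<^sub>R y)" by (rule gz)
    also have "\<dots> = g z - d\<^sup>2 / (y \<bullet> y)"
      unfolding expand using yy by (simp add: field_simps power2_eq_square)
    finally have "d\<^sup>2 / (y \<bullet> y) \<le> 0" by simp
    then show False using ne yy by (simp add: d_def divide_le_0_iff)
  qed
  then show ?thesis by blast
qed

lemma bounded_bilinear_form_operator: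
  fixes b :: "'h::{real_inner, complete_space} \<Rightarrow> 'h \<Rightarrow> real"
  assumes "bounded_bilinear b"
  shows "\<exists>S :: 'h \<Rightarrow>\<^sub>L 'h. \<forall>x y. S x \<bullet> y = b x y"
proof -
  interpret b: bounded_bilinear b by fact
  have "\<exists>z. \<forall>y. b x y = z \<bullet> y" for x
    by (rule riesz_representation) (rule b.bounded_linear_right)
  then obtain S where S: "\<And>x y. b x y = S x \<bullet> y" by metis
  obtain K where K: "K > 0" "\<And>x y. norm (b x y) \<le> norm x * norm y * K" using b.pos_bounded by blast
  have eqI: "u = v" if "\<And>y. u \<bullet> y = v \<bullet> y" for u v :: 'h
    using that by (intro vector_eq_rdot[THEN iffD1]) auto
  have "bounded_linear S"
  proof (rule bounded_linear_intro)
    show "S (x + y) = S x + S y" for x y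
      by (rule eqI) (simp add: S[symmetric] inner_add_left b.add_left)
    show "S (r *\<^sub>R x) = r *\<^sub>R S x" for r x
      by (rule eqI) (simp add: S[symmetric] inner_scaleR_left b.scaleR_left)
    show "norm (S x) \<le> norm x * K" for x
    proof (cases "S x = 0")
      case False
      have "norm (S x) * norm (S x) \<le> norm x * norm (S x) * K"
        using K(2)[of x "S x"] unfolding S dot_square_norm by (simp add: power2_eq_square)
      then have "norm (S x) * norm (S x) \<le> (norm x * K) * norm (S x)"
        by (simp add: ac_simps)
      then show ?thesis using False by simp
    qed (use K in auto)
  qed
  then show ?thesis
    by (intro exI[of _ "Blinfun S"]) (simp add: bounded_linear_Blinfun_apply S)
qed

lemma adjoint_exists:
  fixes T :: "'h::{real_inner, complete_space} \<Rightarrow>\<^sub>L 'h"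
  shows "\<exists>T' :: 'h \<Rightarrow>\<^sub>L 'h. \<forall>x y. T' x \<bullet> y = x \<bullet> T y"
proof -
  have "bounded_bilinear (\<lambda>x y. x \<bullet> T y)"
    by (rule bounded_bilinear.comp[OF bounded_bilinear_inner, where f="\<lambda>x. x" and g="blinfun_apply T"])
      (auto intro: bounded_linear_ident blinfun.bounded_linear_right)
  from bounded_bilinear_form_operator[OF this] show ?thesis .
qed

section \<open>Convolutions and characteristic functions\<close>

lemma borel_probD:
  assumes "borel_prob M"
  shows "prob_space M" "finite_measure M" "sets M = sets borel" "space M = UNIV"
  using assms sets_eq_imp_space_eq[of M borel]
  by (auto simp: borel_prob_def intro: prob_space.finite_measure)

lemma borel_prob_dirac [simp]: "borel_prob (dirac x)"
  by (simp add: borel_prob_def prob_space_return)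

lemma borel_prob_distr:
  assumes "borel_prob M" "f \<in> borel_measurable borel"
  shows "borel_prob (distr M borel f)"
proof -
  note M = borel_probD[OF assms(1)]
  have "f \<in> borel_measurable M" using assms(2) by (simp add: measurable_cong_sets[OF M(3) refl])
  then show ?thesis
    using M(1) by (simp add: borel_prob_def prob_space.prob_space_distr)
qed

lemma blinfun_measurable [measurable]: "blinfun_apply T \<in> borel_measurable borel"
  by (intro borel_measurable_continuous_onI continuous_intros)

lemma borel_prob_push: "borel_prob M \<Longrightarrow> borel_prob (push T M)"
  by (rule borel_prob_distr) simp_all

context
  fixes M N :: "'h::{real_normed_vector, second_countable_topology} measure"
  assumes M: "borel_prob M" and N: "borel_prob N"
begin

lemma pair_measurable_add: "(\<lambda>(x, y). x + y) \<in> borel_measurable (M \<Otimes>\<^sub>M N)"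
proof -
  have [measurable_cong]: "sets M = sets borel" "sets N = sets borel"
    using borel_probD M N by auto
  show ?thesis by measurable
qed

lemma borel_prob_conv: "borel_prob (M \<^bold>* N)"
proof -
  interpret M: prob_space M using borel_probD(1)[OF M] .
  interpret N: prob_space N using borel_probD(1)[OF N] .
  interpret pair_prob_space M N ..
  show ?thesis
    unfolding borel_prob_def conv_def using prob_space_distr[OF pair_measurable_add] by simp
qed

lemma nn_integral_conv:
  assumes f [measurable]: "f \<in> borel_measurable borel"
  shows "(\<integral>\<^sup>+z. f z \<partial>(M \<^bold>* N)) = (\<integral>\<^sup>+x. \<integral>\<^sup>+y. f (x + y) \<partial>N \<partial>M)"
proof -
  have [measurable_cong]: "sets M = sets borel" "sets N = sets borel"
    using borel_probD M N by auto
  interpret N: prob_space N using borel_probD(1)[OF N] .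
  have "(\<integral>\<^sup>+z. f z \<partial>(M \<^bold>* N)) = (\<integral>\<^sup>+p. f (fst p + snd p) \<partial>(M \<Otimes>\<^sub>M N))"
    unfolding conv_def by (subst nn_integral_distr) (auto simp: pair_measurable_add split_beta')
  also have "\<dots> = (\<integral>\<^sup>+x. \<integral>\<^sup>+y. f (x + y) \<partial>N \<partial>M)"
    by (subst N.nn_integral_fst[symmetric]) simp_all
  finally show ?thesis .
qed

lemma integral_conv:
  fixes f :: "'h \<Rightarrow> 'b::{banach, second_countable_topology}"
  assumes f [measurable]: "f \<in> borel_measurable borel" and b: "\<And>x. norm (f x) \<le> B"
  shows "(\<integral>z. f z \<partial>(M \<^bold>* N)) = (\<integral>x. \<integral>y. f (x + y) \<partial>N \<partial>M)"
proof -
  have [measurable_cong]: "sets M = sets borel" "sets N = sets borel"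
    using borel_probD M N by auto
  interpret M: prob_space M using borel_probD(1)[OF M] .
  interpret N: prob_space N using borel_probD(1)[OF N] .
  interpret P: pair_prob_space M N ..
  have "(\<integral>z. f z \<partial>(M \<^bold>* N)) = (\<integral>p. f (fst p + snd p) \<partial>(M \<Otimes>\<^sub>M N))"
    unfolding conv_def by (subst integral_distr) (auto simp: pair_measurable_add split_beta')
  also have "\<dots> = (\<integral>x. \<integral>y. f (x + y) \<partial>N \<partial>M)"
    by (subst P.integral_fst'[symmetric])
      (auto intro!: P.integrable_const_bound[where B=B] simp: b)
  finally show ?thesis .
qed

end

lemma iexp_add: "iexp (x + y) = iexp x * iexp y"
  by (simp add: exp_add[symmetric] algebra_simps)

lemma char_fun_conv:
  fixes M N :: "'h::{real_inner, second_countable_topology} measure"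
  assumes "borel_prob M" "borel_prob N"
  shows "char_fun (M \<^bold>* N) \<xi> = char_fun M \<xi> * char_fun N \<xi>"
  unfolding char_fun_def
  by (subst integral_conv[OF assms, where B=1]) (simp_all add: inner_add_left iexp_add del: of_real_add)

lemma char_fun_dirac:
  fixes x :: "'h::{real_inner, second_countable_topology}"
  shows "char_fun (dirac x) \<xi> = iexp (x \<bullet> \<xi>)"
  unfolding char_fun_def by (subst integral_return) simp_all

lemma char_fun_push:
  fixes M :: "'h::{real_inner, second_countable_topology} measure"
  assumes "sets M = sets borel" "\<And>y. T' \<xi> \<bullet> y = \<xi> \<bullet> blinfun_apply T y"
  shows "char_fun (push T M) \<xi> = char_fun M (T' \<xi>)"
proof -
  have [measurable_cong]: "sets M = sets borel" by fact
  show ?thesis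
    unfolding char_fun_def by (subst integral_distr) (simp_all add: assms(2) inner_commute[of _ "T' \<xi>"] inner_commute[of _ \<xi>])
qed

lemma char_fun_bound:
  assumes "borel_prob M"
  shows "norm (char_fun M \<xi>) \<le> 1"
proof -
  interpret prob_space M using borel_probD(1)[OF assms] .
  show ?thesis
    unfolding char_fun_def
    by (rule order_trans[OF integral_norm_bound]) (simp add: prob_space)
qed

lemma char_fun_0:
  assumes "borel_prob M"
  shows "char_fun M 0 = 1"
proof -
  interpret prob_space M using borel_probD(1)[OF assms] .
  show ?thesis by (simp add: char_fun_def prob_space)
qed

lemma integrable_bounded_borel:
  fixes f :: "'h::topological_space \<Rightarrow> 'b::{banach, second_countable_topology}"
  assumes "finite_measure M" "sets M = sets borel" "f \<in> borel_measurable borel" "\<And>x. norm (f x) \<le> B"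
  shows "integrable M f"
proof -
  interpret finite_measure M by fact
  have "f \<in> borel_measurable M" using assms(3) by (simp add: measurable_cong_sets[OF assms(2) refl])
  then show ?thesis using assms(4) by (intro integrable_const_bound[where B=B]) auto
qed

lemma char_fun_integrable:
  fixes M :: "'h::{real_inner, second_countable_topology} measure"
  assumes "finite_measure M" "sets M = sets borel"
  shows "integrable M (\<lambda>x. iexp (x \<bullet> \<xi>))"
  by (rule integrable_bounded_borel[OF assms, where B=1]) simp_all

lemma continuous_char_fun:
  fixes M :: "'h::{real_inner, second_countable_topology} measure"
  assumes "finite_measure M" "sets M = sets borel"
  shows "continuous_on UNIV (char_fun M)"
proof -
  interpret finite_measure M by fact
  have [measurable_cong]: "sets M = sets borel" by fact
  show ?thesis
    unfolding continuous_on_sequentially char_fun_def comp_def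
  proof (intro allI ballI impI)
    fix X and \<xi> :: 'h
    assume X: "(\<forall>n. X n \<in> UNIV) \<and> X \<longlonglongrightarrow> \<xi>"
    show "(\<lambda>n. CLINT x|M. iexp (x \<bullet> X n)) \<longlonglongrightarrow> (CLINT x|M. iexp (x \<bullet> \<xi>))"
    proof (rule integral_dominated_convergence[where w="\<lambda>_. 1"])
      show "AE x in M. (\<lambda>n. iexp (x \<bullet> X n)) \<longlonglongrightarrow> iexp (x \<bullet> \<xi>)"
        using X by (intro always_eventually allI tendsto_intros) auto
    qed simp_all
  qed
qed

section \<open>Uniqueness of characteristic functions\<close>

text \<open>
  Levy's uniqueness theorem after normalisation; the common total mass is the value at \<open>0\<close>.
\<close>

lemma real_finite_measure_eqI:
  fixes M N :: "real measure"
  assumes M: "finite_measure M" "sets M = sets borel"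
    and N: "finite_measure N" "sets N = sets borel"
    and eq: "\<And>t. char M t = char N t"
  shows "M = N"
proof -
  interpret M: finite_measure M by fact
  interpret N: finite_measure N by fact
  have [measurable_cong]: "sets M = sets borel" "sets N = sets borel" by fact+
  have sp: "space M = UNIV" "space N = UNIV" 
    using sets_eq_imp_space_eq[OF M(2)] sets_eq_imp_space_eq[OF N(2)] by simp_all
  define c where "c = measure M UNIV"
  have c: "c = measure N UNIV"
  proof -
    have "char M 0 = complex_of_real (measure M UNIV)" "char N 0 = complex_of_real (measure N UNIV)"
      by (simp_all add: char_def sp scaleR_conv_of_real)
    then show ?thesis using eq[of 0] unfolding c_def by (metis of_real_eq_iff)
  qed
  show ?thesis
  proof (cases "c = 0")
    case True
    have "emeasure M A = emeasure N A" if "A \<in> sets M" for A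
    proof -
      have "measure M A \<le> 0" "measure N A \<le> 0"
        using True c M.bounded_measure[of A] N.bounded_measure[of A] by (auto simp: c_def sp)
      then show ?thesis by (simp add: M.emeasure_eq_measure N.emeasure_eq_measure measure_le_0_iff)
    qed
    then show ?thesis using M N by (intro measure_eqI) auto
  next
    case False
    then have cpos: "c > 0" by (simp add: c_def order_less_le)
    let ?s = "\<lambda>M::real measure. density M (\<lambda>_. ennreal (1 / c))"
    have rd: "real_distribution (?s K)" if "finite_measure K" "sets K = sets borel" "measure K UNIV = c" for K
    proof -
      interpret K: finite_measure K by fact
      have "emeasure (?s K) (space (?s K)) = 1"
        using that(2,3) cpos sets_eq_imp_space_eq[OF that(2)]
        by (simp add: emeasure_density K.emeasure_eq_measure nn_integral_cmult_indicator
            flip: ennreal_mult)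
      then show ?thesis
        by (intro real_distribution.intro prob_spaceI real_distribution_axioms.intro) (auto simp: that)
    qed
    have ch: "char (?s K) t = (1 / c) *\<^sub>R char K t" if "sets K = sets borel" for K t
    proof -
      have [measurable_cong]: "sets K = sets borel" by fact
      show ?thesis
        unfolding char_def using cpos by (subst integral_density) auto
    qed
    have "?s M = ?s N"
    proof (rule Levy_uniqueness)
      show "char (?s M) = char (?s N)"
        using eq by (auto simp: ch M(2) N(2))
      show "real_distribution (?s M)" by (rule rd[OF M]) (simp add: c_def)
      show "real_distribution (?s N)" by (rule rd[OF N]) (simp add: c)
    qed
    then have "density (?s M) (\<lambda>_. ennreal c) = density (?s N) (\<lambda>_. ennreal c)" by simp
    moreover have "density (?s K) (\<lambda>_. ennreal c) = K" if "sets K = sets borel" for K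
    proof -
      have "density (?s K) (\<lambda>_. ennreal c) = density K (\<lambda>_. ennreal (1/c) * ennreal c)"
        by (subst density_density_eq) auto
      also have "\<dots> = density K (\<lambda>_. 1)" using cpos by (simp flip: ennreal_mult)
      also have "\<dots> = K" by (rule density_1)
      finally show ?thesis .
    qed
    ultimately show ?thesis using M(2) N(2) by metis
  qed
qed

text \<open>
  The law of \<open>x \<bullet> h\<close> under the positive measures \<open>(1 + cos (x \<bullet> \<xi> - p)) dM\<close> is governed
  by the characteristic function of \<open>M\<close> at the points \<open>t h\<close> and \<open>t h \<plusminus> \<xi>\<close>. This is why
  restricting to \<open>{x. x \<bullet> h \<in> A}\<close> preserves equality of characteristic functions.
\<close>

lemma char_fun_restrict_eq:
  fixes M N :: "'h::{real_inner, second_countable_topology} measure" and h :: 'h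
  assumes M: "finite_measure M" "sets M = sets borel"
    and N: "finite_measure N" "sets N = sets borel"
    and eq: "\<And>\<xi>. char_fun M \<xi> = char_fun N \<xi>"
    and A [measurable]: "A \<in> sets borel"
  defines "S \<equiv> {x. x \<bullet> h \<in> A}"
  shows "char_fun (density M (indicator S)) \<xi> = char_fun (density N (indicator S)) \<xi>"
proof -
  have [measurable_cong]: "sets M = sets borel" "sets N = sets borel" by fact+
  have [measurable]: "S \<in> sets borel" unfolding S_def by measurable
  define g where "g p \<xi> x = 1 + cos (x \<bullet> \<xi> - p)" for p :: real and \<xi> x :: 'h
  have g0: "0 \<le> g p \<xi> x" for p \<xi> x unfolding g_def using cos_ge_minus_one[of "x \<bullet> \<xi> - p"] by linarith
  have g2: "g p \<xi> x \<le> 2" for p \<xi> x unfolding g_def using cos_le_one[of "x \<bullet> \<xi> - p"] by linarith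
  have [measurable]: "g p \<xi> \<in> borel_measurable borel" for p \<xi> unfolding g_def by measurable
  let ?d = "\<lambda>K p \<xi>. density K (\<lambda>x. ennreal (g p \<xi> x))"
  have fin: "finite_measure (?d K p \<xi>)" if "finite_measure K" "sets K = sets borel" for K p \<xi>
  proof (rule finite_measureI)
    interpret K: finite_measure K by fact
    have [measurable_cong]: "sets K = sets borel" by fact
    have "(\<integral>\<^sup>+x. ennreal (g p \<xi> x) \<partial>K) \<le> (\<integral>\<^sup>+x. 2 \<partial>K)"
      using g2 by (intro nn_integral_mono) (metis ennreal_leI ennreal_numeral)
    also have "\<dots> < \<infinity>" by (simp add: K.emeasure_eq_measure ennreal_mult_less_top)
    finally show "emeasure (?d K p \<xi>) (space (?d K p \<xi>)) \<noteq> \<infinity>"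
      by (simp add: emeasure_density cong: nn_integral_cong)
  qed
  have ch: "char (distr (?d K p \<xi>) borel (\<lambda>x. x \<bullet> h)) t =
      char_fun K (t *\<^sub>R h) + (1/2) * (iexp (- p) * char_fun K (t *\<^sub>R h + \<xi>)
        + iexp p * char_fun K (t *\<^sub>R h - \<xi>))"
    if K: "finite_measure K" "sets K = sets borel" for K p \<xi> t
  proof -
    have [measurable_cong]: "sets K = sets borel" by fact
    have "char (distr (?d K p \<xi>) borel (\<lambda>x. x \<bullet> h)) t = (CLINT x|?d K p \<xi>. iexp (t * (x \<bullet> h)))"
      unfolding char_def by (subst integral_distr) simp_all
    also have "\<dots> = (CLINT x|K. g p \<xi> x *\<^sub>R iexp (t * (x \<bullet> h)))"
      by (subst integral_density) (simp_all add: g0)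
    also have "\<dots> = (CLINT x|K. iexp (x \<bullet> (t *\<^sub>R h)) + (1/2) * (iexp (- p) * iexp (x \<bullet> (t *\<^sub>R h + \<xi>))
        + iexp p * iexp (x \<bullet> (t *\<^sub>R h - \<xi>))))"
    proof (rule Bochner_Integration.integral_cong[OF refl])
      fix x
      have "complex_of_real (cos (x \<bullet> \<xi> - p)) = (iexp (x \<bullet> \<xi> - p) + iexp (- (x \<bullet> \<xi> - p))) / 2"
        by (simp add: cos_of_real[symmetric] cos_exp_eq algebra_simps)
      then show "g p \<xi> x *\<^sub>R iexp (t * (x \<bullet> h)) = iexp (x \<bullet> (t *\<^sub>R h)) + (1/2) * (iexp (- p) * iexp (x \<bullet> (t *\<^sub>R h + \<xi>))
        + iexp p * iexp (x \<bullet> (t *\<^sub>R h - \<xi>)))"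
        unfolding g_def scaleR_conv_of_real of_real_add
        by (simp add: algebra_simps inner_add_right inner_diff_right exp_add exp_diff exp_minus add_divide_distrib)
          (simp add: field_simps)
    qed
    also have "\<dots> = char_fun K (t *\<^sub>R h) + (1/2) * (iexp (- p) * char_fun K (t *\<^sub>R h + \<xi>)
        + iexp p * char_fun K (t *\<^sub>R h - \<xi>))"
      unfolding char_fun_def
      by (simp only: char_fun_integrable[OF K] Bochner_Integration.integral_add
          Bochner_Integration.integral_mult_right_zero Bochner_Integration.integrable_add
          Bochner_Integration.integrable_mult_right)
    finally show ?thesis .
  qed
  have deq: "distr (?d M p \<xi>) borel (\<lambda>x. x \<bullet> h) = distr (?d N p \<xi>) borel (\<lambda>x. x \<bullet> h)" for p \<xi>
    by (rule real_finite_measure_eqI)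
      (auto simp: ch M N eq intro!: finite_measure.finite_measure_distr fin)
  have geq: "(\<integral>x. indicator S x * g p \<xi> x \<partial>M) = (\<integral>x. indicator S x * g p \<xi> x \<partial>N)" for p \<xi>
  proof -
    have "(\<integral>x. indicator S x * g p \<xi> x \<partial>K) = (\<integral>y. indicator A y \<partial>distr (?d K p \<xi>) borel (\<lambda>x. x \<bullet> h))"
      if [measurable_cong]: "sets K = sets borel" for K
    proof -
      have "(\<integral>y. indicator A y \<partial>distr (?d K p \<xi>) borel (\<lambda>x. x \<bullet> h))
        = (\<integral>x. indicator A (x \<bullet> h) \<partial>?d K p \<xi> :: real)"
        by (rule integral_distr) simp_all
      also have "\<dots> = (\<integral>x. g p \<xi> x *\<^sub>R indicator A (x \<bullet> h) \<partial>K)"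
        by (subst integral_density) (simp_all add: g0)
      also have "\<dots> = (\<integral>x. indicator S x * g p \<xi> x \<partial>K)"
        by (intro Bochner_Integration.integral_cong) (auto simp: S_def indicator_def)
      finally show ?thesis by simp
    qed
    then show ?thesis using deq M(2) N(2) by metis
  qed
  have int: "integrable K (\<lambda>x. indicator S x * cos (x \<bullet> \<xi> - p))" "integrable K (\<lambda>x. indicator S x :: real)"
    if "finite_measure K" "sets K = sets borel" for K p \<xi>
    by (rule integrable_bounded_borel[OF that, where B=1]; auto simp: indicator_def)+
  have split: "(\<integral>x. indicator S x * g p \<xi> x \<partial>K) = (\<integral>x. indicator S x \<partial>K) + (\<integral>x. indicator S x * cos (x \<bullet> \<xi> - p) \<partial>K)"
    if "finite_measure K" "sets K = sets borel" for K p \<xi>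
    unfolding g_def distrib_left using int[OF that] by simp
  have one: "(\<integral>x. indicator S x \<partial>M) = (\<integral>x. indicator S x \<partial>N :: real)"
    using geq[of "pi/2" 0] by (simp add: g_def)
  have cos: "(\<integral>x. indicator S x * cos (x \<bullet> \<xi> - p) \<partial>M) = (\<integral>x. indicator S x * cos (x \<bullet> \<xi> - p) \<partial>N)" for p
    using geq[of p \<xi>] one by (simp add: split M N)
  have final: "char_fun (density K (indicator S)) \<xi> =
     Complex (\<integral>x. indicator S x * cos (x \<bullet> \<xi> - 0) \<partial>K) (\<integral>x. indicator S x * cos (x \<bullet> \<xi> - pi/2) \<partial>K)"
    if K: "finite_measure K" "sets K = sets borel" for K
  proof -
    have [measurable_cong]: "sets K = sets borel" by fact
    have ind: "(\<lambda>x. ennreal (indicator S x)) = indicator S" by (auto simp: indicator_def)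
    have "char_fun (density K (indicator S)) \<xi> = (CLINT x|K. indicator S x *\<^sub>R iexp (x \<bullet> \<xi>))"
      unfolding char_fun_def ind[symmetric] by (subst integral_density) simp_all
    moreover have I: "integrable K (\<lambda>x. indicator S x *\<^sub>R iexp (x \<bullet> \<xi>))"
    proof (rule integrable_bounded_borel[OF K, where B=1])
      show "(\<lambda>x. indicator S x *\<^sub>R iexp (x \<bullet> \<xi>)) \<in> borel_measurable borel" by measurable
      show "norm (indicator S x *\<^sub>R iexp (x \<bullet> \<xi>)) \<le> 1" for x
        by (simp add: indicator_def)
    qed
    moreover have "(\<integral>x. Re (indicator S x *\<^sub>R iexp (x \<bullet> \<xi>)) \<partial>K) = (\<integral>x. indicator S x * cos (x \<bullet> \<xi> - 0) \<partial>K)"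
      "(\<integral>x. Im (indicator S x *\<^sub>R iexp (x \<bullet> \<xi>)) \<partial>K) = (\<integral>x. indicator S x * cos (x \<bullet> \<xi> - pi/2) \<partial>K)"
      by (simp_all add: Re_exp Im_exp cos_diff)
    ultimately show ?thesis
      by (simp add: complex_eq_iff flip: integral_Re[OF I] integral_Im[OF I])
  qed
  show ?thesis unfolding final[OF M] final[OF N] cos ..
qed

text \<open>
  Restrict to one coordinate condition after the other: by the preceding lemma each restriction
  preserves the hypothesis.
\<close>

lemma emeasure_cylinder_eq:
  fixes M N :: "'h::{real_inner, second_countable_topology} measure"
  assumes "finite_measure M" "sets M = sets borel" "finite_measure N" "sets N = sets borel"
    and "\<And>\<xi>. char_fun M \<xi> = char_fun N \<xi>"
    and "\<And>h A. (h, A) \<in> set l \<Longrightarrow> A \<in> sets borel"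
  shows "emeasure M {x. \<forall>(h, A)\<in>set l. x \<bullet> h \<in> A} = emeasure N {x. \<forall>(h, A)\<in>set l. x \<bullet> h \<in> A}"
  using assms
proof (induction l arbitrary: M N)
  case Nil
  have "measure M UNIV = measure N UNIV"
  proof -
    have "char_fun K 0 = complex_of_real (measure K UNIV)" if "sets K = sets borel" for K :: "'h measure"
      using sets_eq_imp_space_eq[OF that] by (simp add: char_fun_def scaleR_conv_of_real)
    then show ?thesis using Nil.prems(5)[of 0] Nil.prems(2,4) by (metis of_real_eq_iff)
  qed
  then show ?case
    using Nil.prems(1,3) by (simp add: finite_measure.emeasure_eq_measure)
next
  case (Cons p l)
  obtain h A where p: "p = (h, A)" by (cases p)
  have A [measurable]: "A \<in> sets borel" using Cons.prems(6)[of h A] p by simp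
  have Al: "B \<in> sets borel" if "(k, B) \<in> set l" for k B using Cons.prems(6)[of k B] that by simp
  define S where "S = {x. x \<bullet> h \<in> A}"
  define C where "C = {x. \<forall>(h, A)\<in>set l. x \<bullet> h \<in> A}"
  have S [measurable]: "S \<in> sets borel" unfolding S_def by measurable
  have C [measurable]: "C \<in> sets borel"
  proof -
    have "C = (\<Inter>q\<in>set l. {x. x \<bullet> fst q \<in> snd q}) \<inter> UNIV" by (force simp: C_def)
    moreover have "{x. x \<bullet> fst q \<in> snd q} \<in> sets borel" if "q \<in> set l" for q
    proof -
      have [measurable]: "snd q \<in> sets borel" using Al[of "fst q" "snd q"] that by simp
      show ?thesis by measurable
    qed
    ultimately show ?thesis by (cases "l = []") auto
  qed
  have eq: "emeasure (density K (indicator S)) C = emeasure K {x. \<forall>(h, A)\<in>set (p # l). x \<bullet> h \<in> A}"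
    if [measurable_cong]: "sets K = sets borel" for K
  proof -
    have "emeasure (density K (indicator S)) C = (\<integral>\<^sup>+x. indicator S x * indicator C x \<partial>K)"
      by (rule emeasure_density) measurable
    also have "\<dots> = (\<integral>\<^sup>+x. indicator (S \<inter> C) x \<partial>K)"
      by (simp add: indicator_inter_arith)
    also have "\<dots> = emeasure K (S \<inter> C)" by (rule nn_integral_indicator) measurable
    also have "S \<inter> C = {x. \<forall>(h, A)\<in>set (p # l). x \<bullet> h \<in> A}" by (auto simp: S_def C_def p)
    finally show ?thesis .
  qed
  have fin: "finite_measure (density K (indicator S))" if "finite_measure K" "sets K = sets borel" for K
  proof -
    interpret K: finite_measure K by fact
    have [measurable_cong]: "sets K = sets borel" by fact
    have "emeasure (density K (indicator S)) (space K) = (\<integral>\<^sup>+x. indicator S x * indicator (space K) x \<partial>K)"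
      by (rule emeasure_density) measurable
    also have "\<dots> \<le> (\<integral>\<^sup>+x. 1 \<partial>K)"
      by (intro nn_integral_mono) (simp add: indicator_def)
    also have "\<dots> < \<infinity>" by (simp add: K.emeasure_eq_measure)
    finally show ?thesis by (intro finite_measureI) simp
  qed
  have "emeasure (density M (indicator S)) C = emeasure (density N (indicator S)) C"
    unfolding C_def
  proof (rule Cons.IH)
    show "char_fun (density M (indicator S)) \<xi> = char_fun (density N (indicator S)) \<xi>" for \<xi>
      unfolding S_def by (rule char_fun_restrict_eq[OF Cons.prems(1-5) A])
    show "finite_measure (density M (indicator S))" by (rule fin[OF Cons.prems(1,2)])
    show "finite_measure (density N (indicator S))" by (rule fin[OF Cons.prems(3,4)])
    show "B \<in> sets borel" if "(k, B) \<in> set l" for k B by (rule Al[OF that])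
  qed (simp_all add: Cons.prems(2,4))
  then show ?case using eq[OF Cons.prems(2)] eq[OF Cons.prems(4)] by metis
qed

text \<open>
  The cylinder sets are closed under intersections, and in a separable space they generate the Borel sets.
\<close>

theorem char_fun_unique:
  fixes M N :: "'h::{real_inner, second_countable_topology} measure"
  assumes M: "finite_measure M" "sets M = sets borel"
    and N: "finite_measure N" "sets N = sets borel"
    and eq: "\<And>\<xi>. char_fun M \<xi> = char_fun N \<xi>"
  shows "M = N"
proof -
  let ?cyl = "\<lambda>l :: ('h \<times> real set) list. {x. \<forall>(h, A)\<in>set l. x \<bullet> h \<in> A}"
  define E where "E = ?cyl ` {l. \<forall>(h, A)\<in>set l. A \<in> sets borel}"
  have gen: "sets borel \<subseteq> sigma_sets UNIV E"
  proof -
    let ?S = "sigma UNIV E"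
    have coord [measurable]: "(\<lambda>x. x \<bullet> h) \<in> borel_measurable ?S" for h :: 'h
    proof (rule measurableI)
      fix A :: "real set" assume "A \<in> sets borel"
      then have "?cyl [(h, A)] \<in> E" unfolding E_def by (intro imageI) simp
      then show "(\<lambda>x. x \<bullet> h) -` A \<inter> space ?S \<in> sets ?S"
        by (auto simp: vimage_def intro: sigma_sets.Basic)
    qed simp
    \<comment> \<open>the identity is the limit of its finite expansions, which only see coordinates\<close>
    have "(\<lambda>x::'h. x) \<in> borel_measurable ?S"
    proof (rule borel_measurable_LIMSEQ_metric)
      show "(\<lambda>x. onb_proj i x) \<in> borel_measurable ?S" for i
        unfolding onb_proj_def by measurable
    qed (rule onb_proj_tendsto)
    then have "(\<lambda>x. x) -` A \<inter> space ?S \<in> sets ?S" if "A \<in> sets borel" for A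
      using that by (rule measurable_sets)
    then show ?thesis by auto
  qed
  have E_borel: "?cyl l \<in> sets borel" if "\<forall>(h, A)\<in>set l. A \<in> sets borel" for l
    using that
  proof (induction l)
    case (Cons p l)
    obtain h A where p: "p = (h, A)" by (cases p)
    have [measurable]: "A \<in> sets borel" "?cyl l \<in> sets borel" using Cons p by auto
    have "?cyl (p # l) = {x. x \<bullet> h \<in> A} \<inter> ?cyl l" by (auto simp: p)
    also have "\<dots> \<in> sets borel" by measurable
    finally show ?case .
  qed simp
  have sets: "sets borel = sigma_sets UNIV E"
  proof
    show "sigma_sets UNIV E \<subseteq> sets borel"
      using sets.sigma_sets_subset[of E borel] E_borel by (force simp: E_def)
  qed (rule gen)
  show ?thesis
  proof (rule measure_eqI_generator_eq[where \<Omega>=UNIV and E=E and A="\<lambda>_. UNIV"])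
    show "Int_stable E"
    proof (rule Int_stableI)
      fix a b assume "a \<in> E" "b \<in> E"
      then obtain l k where lk: "a = ?cyl l" "b = ?cyl k" "\<forall>(h, A)\<in>set l. A \<in> sets borel"
          "\<forall>(h, A)\<in>set k. A \<in> sets borel" unfolding E_def by blast
      then have "a \<inter> b = ?cyl (l @ k)" by auto
      then show "a \<inter> b \<in> E" unfolding E_def using lk by (auto intro!: image_eqI[of _ _ "l @ k"])
    qed
    show "emeasure M X = emeasure N X" if "X \<in> E" for X
    proof -
      from that obtain l where l: "X = ?cyl l" "\<forall>(h, A)\<in>set l. A \<in> sets borel"
        unfolding E_def by blast
      show ?thesis unfolding l(1) by (rule emeasure_cylinder_eq[OF M N eq]) (use l(2) in blast)
    qed
    show "range (\<lambda>_::nat. UNIV) \<subseteq> E" unfolding E_def by (auto intro!: image_eqI[of _ _ "[]"])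
    show "emeasure M UNIV \<noteq> \<infinity>" for i :: nat
      using finite_measure.emeasure_finite[OF M(1)] by simp
  qed (use M N sets in auto)
qed

lemma borel_prob_eqI:
  fixes M N :: "'h::{real_inner, second_countable_topology} measure"
  assumes "borel_prob M" "borel_prob N" "\<And>\<xi>. char_fun M \<xi> = char_fun N \<xi>"
  shows "M = N"
  using assms by (intro char_fun_unique) (auto dest: borel_probD)

section \<open>Bounded Lipschitz functions\<close>

definition bl :: "('a::metric_space \<Rightarrow> real) \<Rightarrow> bool" where
  "bl f \<longleftrightarrow> (\<exists>L B. \<forall>x y. \<bar>f x - f y\<bar> \<le> L * dist x y \<and> \<bar>f x\<bar> \<le> B)"

lemma blI: "(\<And>x y. \<bar>f x - f y\<bar> \<le> L * dist x y) \<Longrightarrow> (\<And>x. \<bar>f x\<bar> \<le> B) \<Longrightarrow> bl f"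
  unfolding bl_def by blast

lemma blE:
  assumes "bl f"
  obtains L B where "L \<ge> 0" "B > 0" "\<And>x y. \<bar>f x - f y\<bar> \<le> L * dist x y" "\<And>x. \<bar>f x\<bar> \<le> B"
proof -
  obtain L B where LB: "\<And>x y. \<bar>f x - f y\<bar> \<le> L * dist x y" "\<And>x. \<bar>f x\<bar> \<le> B"
    using assms unfolding bl_def by blast
  show ?thesis
  proof (rule that[of "\<bar>L\<bar>" "\<bar>B\<bar> + 1"])
    show "\<bar>f x - f y\<bar> \<le> \<bar>L\<bar> * dist x y" for x y
      by (rule order_trans[OF LB(1)]) (simp add: mult_right_mono)
    show "\<bar>f x\<bar> \<le> \<bar>B\<bar> + 1" for x using LB(2)[of x] by linarith
  qed auto
qed

lemma bl_continuous: "bl f \<Longrightarrow> continuous_on UNIV f"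
proof -
  assume "bl f"
  then obtain L where "L \<ge> 0" "\<And>x y. \<bar>f x - f y\<bar> \<le> L * dist x y" by (elim blE) blast
  then have "L-lipschitz_on UNIV f" by (auto intro!: lipschitz_onI simp: dist_real_def)
  then show ?thesis by (rule lipschitz_on_continuous_on)
qed

lemma bl_measurable: "bl f \<Longrightarrow> f \<in> borel_measurable borel"
  by (intro borel_measurable_continuous_onI bl_continuous)

lemma bl_const [simp]: "bl (\<lambda>_. c)"
  by (rule blI[of _ 0 "\<bar>c\<bar>"]) auto

lemma bl_add: "bl f \<Longrightarrow> bl g \<Longrightarrow> bl (\<lambda>x. f x + g x)"
proof (elim blE)
  fix L B L' B'
  assume f: "\<And>x y. \<bar>f x - f y\<bar> \<le> L * dist x y" "\<And>x. \<bar>f x\<bar> \<le> B"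
    and g: "\<And>x y. \<bar>g x - g y\<bar> \<le> L' * dist x y" "\<And>x. \<bar>g x\<bar> \<le> B'"
  show ?thesis
  proof (rule blI)
    show "\<bar>(f x + g x) - (f y + g y)\<bar> \<le> (L + L') * dist x y" for x y
      using f(1)[of x y] g(1)[of x y] unfolding distrib_right by linarith
    show "\<bar>f x + g x\<bar> \<le> B + B'" for x using f(2)[of x] g(2)[of x] by linarith
  qed
qed

lemma bl_cmult: "bl f \<Longrightarrow> bl (\<lambda>x. c * f x)"
proof (elim blE)
  fix L B
  assume f: "\<And>x y. \<bar>f x - f y\<bar> \<le> L * dist x y" "\<And>x. \<bar>f x\<bar> \<le> B"
  show ?thesis
  proof (rule blI)
    show "\<bar>c * f x - c * f y\<bar> \<le> (\<bar>c\<bar> * L) * dist x y" for x y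
      using mult_left_mono[OF f(1)[of x y] abs_ge_zero[of c]]
      by (simp add: right_diff_distrib[symmetric] abs_mult mult.assoc)
    show "\<bar>c * f x\<bar> \<le> \<bar>c\<bar> * B" for x
      using f(2)[of x] by (simp add: abs_mult mult_left_mono)
  qed
qed

lemma bl_minus: "bl f \<Longrightarrow> bl (\<lambda>x. - f x)"
  using bl_cmult[of f "-1"] by simp

lemma bl_diff: "bl f \<Longrightarrow> bl g \<Longrightarrow> bl (\<lambda>x. f x - g x)"
  using bl_add[OF _ bl_minus, of f g] by simp

lemma bl_max: "bl f \<Longrightarrow> bl g \<Longrightarrow> bl (\<lambda>x. max (f x) (g x))"
proof (elim blE)
  fix L B L' B'
  assume f: "0 \<le> L" "\<And>x y. \<bar>f x - f y\<bar> \<le> L * dist x y" "\<And>x. \<bar>f x\<bar> \<le> B"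
    and g: "0 \<le> L'" "\<And>x y. \<bar>g x - g y\<bar> \<le> L' * dist x y" "\<And>x. \<bar>g x\<bar> \<le> B'"
  show ?thesis
  proof (rule blI)
    show "\<bar>max (f x) (g x) - max (f y) (g y)\<bar> \<le> (L + L') * dist x y" for x y
    proof -
      have "0 \<le> L * dist x y" "0 \<le> L' * dist x y" using f(1) g(1) by auto
      then show ?thesis using f(2)[of x y] g(2)[of x y] unfolding distrib_right by linarith
    qed
    show "\<bar>max (f x) (g x)\<bar> \<le> max B B'" for x using f(3)[of x] g(3)[of x] by linarith
  qed
qed

lemma bl_min: "bl f \<Longrightarrow> bl g \<Longrightarrow> bl (\<lambda>x. min (f x) (g x))"
proof -
  assume "bl f" "bl g"
  then have "bl (\<lambda>x. - max (- f x) (- g x))" by (intro bl_minus bl_max)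
  then show ?thesis by (simp add: minus_max_eq_min)
qed

lemma bl_sum: "(\<And>i. i \<in> I \<Longrightarrow> bl (f i)) \<Longrightarrow> bl (\<lambda>x. \<Sum>i\<in>I. f i x)"
  by (induction I rule: infinite_finite_induct) (auto intro: bl_add)

lemma bl_min_infdist:
  assumes "0 \<le> c" "0 \<le> b"
  shows "bl (\<lambda>x. min b (c * infdist x A))"
proof (rule blI)
  show "\<bar>min b (c * infdist x A)\<bar> \<le> b" for x
    using assms by (simp add: infdist_nonneg)
  show "\<bar>min b (c * infdist x A) - min b (c * infdist y A)\<bar> \<le> c * dist x y" for x y
  proof -
    have "\<bar>c * infdist x A - c * infdist y A\<bar> \<le> c * dist x y"
      using infdist_triangle_abs[of x A y] assms
      by (simp add: right_diff_distrib[symmetric] abs_mult mult_left_mono)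
    then show ?thesis by linarith
  qed
qed

section \<open>Tight functionals are integrals\<close>

text \<open>
  A Riesz representation theorem without local compactness. Tightness replaces the compactness of the
  supports of the test functions, and the indicator of an open set is approximated from below by
  bounded Lipschitz functions. The measure is obtained from an outer measure by Caratheodory's
  construction.
\<close>

locale tight_functional =
  fixes L :: "('a::metric_space \<Rightarrow> real) \<Rightarrow> real"
  assumes L_add: "bl f \<Longrightarrow> bl g \<Longrightarrow> L (\<lambda>x. f x + g x) = L f + L g"
    and L_cmult: "bl f \<Longrightarrow> L (\<lambda>x. c * f x) = c * L f"
    and L_mono: "bl f \<Longrightarrow> bl g \<Longrightarrow> (\<And>x. f x \<le> g x) \<Longrightarrow> L f \<le> L g"
    and L_one: "L (\<lambda>_. 1) = 1"
    and L_tight: "0 < e \<Longrightarrow> \<exists>K. compact K \<and>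
      (\<forall>f. bl f \<longrightarrow> (\<forall>x. 0 \<le> f x \<and> f x \<le> 1) \<longrightarrow> (\<forall>x\<in>K. f x = 0) \<longrightarrow> L f \<le> e)"
begin

lemma L_const: "L (\<lambda>_. c) = c"
  using L_cmult[of "\<lambda>_. 1" c] L_one by simp

lemma L_nonneg: "bl f \<Longrightarrow> (\<And>x. 0 \<le> f x) \<Longrightarrow> 0 \<le> L f"
  using L_mono[of "\<lambda>_. 0" f] L_const[of 0] by simp

lemma L_sum: "(\<And>i. i \<in> I \<Longrightarrow> bl (f i)) \<Longrightarrow> L (\<lambda>x. \<Sum>i\<in>I. f i x) = (\<Sum>i\<in>I. L (f i))"
  by (induction I rule: infinite_finite_induct) (auto simp: L_const L_add bl_sum)

definition below :: "'a set \<Rightarrow> ('a \<Rightarrow> real) set" where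
  "below G = {f. bl f \<and> (\<forall>x. 0 \<le> f x \<and> f x \<le> indicator G x)}"

definition content :: "'a set \<Rightarrow> ennreal" where
  "content G = (SUP f\<in>below G. ennreal (L f))"

definition outer :: "'a set \<Rightarrow> ennreal" where
  "outer A = (INF G\<in>{G. open G \<and> A \<subseteq> G}. content G)"

lemma below_zero: "(\<lambda>_. 0) \<in> below G"
  by (simp add: below_def)

lemma below_le_1: "f \<in> below G \<Longrightarrow> f x \<le> 1"
proof -
  assume "f \<in> below G"
  then have "f x \<le> indicator G x" by (simp add: below_def)
  also have "\<dots> \<le> 1" by (simp add: indicator_def)
  finally show ?thesis .
qed

lemma content_mono: "G \<subseteq> H \<Longrightarrow> content G \<le> content H"
proof -
  assume "G \<subseteq> H"
  then have ind: "indicator G x \<le> (indicator H x :: real)" for x by (auto simp: indicator_def)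
  have "below G \<subseteq> below H"
    unfolding below_def using order_trans[OF _ ind] by blast
  then show ?thesis unfolding content_def by (rule SUP_subset_mono) simp
qed

lemma content_UNIV: "content UNIV = 1"
proof (rule antisym)
  show "content UNIV \<le> 1"
    unfolding content_def
  proof (rule SUP_least)
    fix f :: "'a \<Rightarrow> real" assume "f \<in> below UNIV"
    then have "L f \<le> L (\<lambda>_. 1)" by (intro L_mono) (auto simp: below_def)
    then show "ennreal (L f) \<le> 1" by (simp add: L_one)
  qed
  have "(\<lambda>_. 1) \<in> below UNIV" by (simp add: below_def)
  then have "ennreal (L (\<lambda>_. 1)) \<le> content UNIV" unfolding content_def by (rule SUP_upper)
  then show "1 \<le> content UNIV" by (simp add: L_one)
qed

lemma content_empty: "content {} = 0"
proof -
  have "ennreal (L f) = 0" if "f \<in> below {}" for f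
  proof -
    have "f x = 0" for x using that by (simp add: below_def order_antisym)
    then have "f = (\<lambda>_. 0)" by (rule ext)
    then show ?thesis by (simp add: L_const)
  qed
  then show ?thesis unfolding content_def by (intro antisym SUP_least) auto
qed

lemma outer_open: "open G \<Longrightarrow> outer G = content G"
  unfolding outer_def by (rule antisym) (auto intro!: INF_lower INF_greatest content_mono)

lemma outer_le_content: "open G \<Longrightarrow> A \<subseteq> G \<Longrightarrow> outer A \<le> content G"
  unfolding outer_def by (rule INF_lower) simp

lemma outer_le_1: "outer A \<le> 1"
  using outer_le_content[of UNIV A] content_UNIV by simp

lemma outer_mono: "A \<subseteq> B \<Longrightarrow> outer A \<le> outer B"
  unfolding outer_def by (rule INF_superset_mono) auto

text \<open>
  Up to a small error \<open>f\<close> lives on the compact part \<open>S\<close> of a tightness set where \<open>f\<close> is at least \<open>d\<close>.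
  There, finitely many \<open>G i\<close> suffice, and a Lebesgue number \<open>r\<close> of this cover yields Lipschitz
  functions \<open>g i\<close> below the \<open>G i\<close> whose sum is at least \<open>1\<close> on \<open>S\<close>.
\<close>

lemma content_subadditive:
  fixes G :: "nat \<Rightarrow> 'a set"
  assumes G: "\<And>i. open (G i)"
  shows "content (\<Union>i. G i) \<le> (\<Sum>i. content (G i))"
  unfolding content_def[of "\<Union>i. G i"]
proof (rule SUP_least)
  fix f assume f: "f \<in> below (\<Union>i. G i)"
  show "ennreal (L f) \<le> (\<Sum>i. content (G i))"
  proof (rule ennreal_le_epsilon)
    fix e :: real assume e: "0 < e"
    define d where "d = e / 2"
    have d: "0 < d" using e by (simp add: d_def)
    from L_tight[OF d] obtain K where K1: "compact K" and
      K2: "\<forall>f. bl f \<longrightarrow> (\<forall>x. 0 \<le> f x \<and> f x \<le> 1) \<longrightarrow> (\<forall>x\<in>K. f x = 0) \<longrightarrow> L f \<le> d"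
      by (elim exE conjE) (rule that)
    note K = K1 K2[rule_format]
    have blf: "bl f" using f by (simp add: below_def)
    define S where "S = K \<inter> {x. d \<le> f x}"
    have "closed {x. d \<le> f x}" by (intro closed_Collect_le continuous_on_const bl_continuous[OF blf])
    then have S: "compact S" unfolding S_def using K(1) by (rule compact_Int_closed[rotated])
    have cov: "S \<subseteq> (\<Union>i\<in>UNIV. G i)"
    proof
      fix x assume "x \<in> S"
      then have "0 < f x" using d by (simp add: S_def)
      moreover have "f x \<le> indicator (\<Union>i. G i) x" using f by (simp add: below_def)
      ultimately show "x \<in> (\<Union>i\<in>UNIV. G i)" by (simp split: split_indicator_asm)
    qed
    obtain I where I: "finite I" "S \<subseteq> (\<Union>i\<in>I. G i)"
      by (rule compactE_image[OF S G cov]) (rule that)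
    have op: "open H" if "H \<in> G ` I" for H using that G by auto
    obtain r where r0: "0 < r" and r': "\<And>x. x \<in> S \<Longrightarrow> \<exists>H\<in>G ` I. ball x r \<subseteq> H"
      by (rule Heine_Borel_lemma[OF S I(2)]) (erule op, rule that)
    have r: "0 < r" "\<And>x. x \<in> S \<Longrightarrow> \<exists>i\<in>I. ball x r \<subseteq> G i" using r0 r' by auto
    \<comment> \<open>the case \<open>G i = UNIV\<close> is separate because \<open>infdist x {} = 0\<close>\<close>
    define g where "g i x = (if G i = UNIV then 1 else min 1 ((1 / r) * infdist x (- G i)))" for i x
    have blg: "bl (g i)" for i
      unfolding g_def using bl_min_infdist[of "1 / r" 1 "- G i"] r(1) by (cases "G i = UNIV") auto
    have g0: "0 \<le> g i x" for i x unfolding g_def using r(1) by (simp add: infdist_nonneg)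
    have g1: "g i x \<le> indicator (G i) x" for i x
      unfolding g_def by (auto simp: indicator_def)
    have gin: "g i \<in> below (G i)" for i using blg g0 g1 by (simp add: below_def)
    have cover: "1 \<le> (\<Sum>i\<in>I. g i x)" if x: "x \<in> S" for x
    proof -
      obtain i where i: "i \<in> I" "ball x r \<subseteq> G i" using r(2)[OF x] by blast
      have "1 \<le> g i x"
      proof (cases "G i = UNIV")
        case False
        have "r \<le> dist x y" if "y \<in> - G i" for y
          using i(2) that by (meson ComplD linorder_not_less mem_ball subsetD)
        moreover have "- G i \<noteq> {}" using False by blast
        ultimately have "r \<le> infdist x (- G i)"
          unfolding infdist_def by (simp only: if_False) (rule cINF_greatest)
        then show ?thesis using False r(1) by (simp add: g_def)
      qed (simp add: g_def)
      also have "\<dots> \<le> (\<Sum>i\<in>I. g i x)" by (rule member_le_sum) (rule i(1), rule g0, rule I(1))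
      finally show ?thesis .
    qed
    define h where "h x = max 0 (f x - (d + (\<Sum>i\<in>I. g i x)))" for x
    have blh: "bl h" unfolding h_def by (intro bl_max bl_diff bl_add bl_const bl_sum blf blg)
    have "L h \<le> d"
    proof (rule K(2)[OF blh])
      have sum0: "0 \<le> (\<Sum>i\<in>I. g i x)" for x by (intro sum_nonneg g0)
      show "0 \<le> h x \<and> h x \<le> 1" for x
        using below_le_1[OF f, of x] sum0[of x] d by (simp add: h_def)
      show "h x = 0" if "x \<in> K" for x
      proof (cases "x \<in> S")
        case True
        then show ?thesis using cover[OF True] below_le_1[OF f, of x] d by (simp add: h_def)
      next
        case False
        then show ?thesis using that sum0[of x] by (simp add: S_def h_def)
      qed
    qed
    have "L f \<le> L (\<lambda>x. (d + (\<Sum>i\<in>I. g i x)) + h x)"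
    proof (rule L_mono[OF blf])
      show "bl (\<lambda>x. (d + (\<Sum>i\<in>I. g i x)) + h x)" by (intro bl_add bl_const bl_sum blh blg)
    qed (simp add: h_def)
    also have "\<dots> = d + (\<Sum>i\<in>I. L (g i)) + L h"
      by (simp add: L_add L_const L_sum bl_add bl_sum blg blh)
    also have "\<dots> \<le> (\<Sum>i\<in>I. L (g i)) + e" using \<open>L h \<le> d\<close> by (simp add: d_def)
    finally have "ennreal (L f) \<le> ennreal ((\<Sum>i\<in>I. L (g i)) + e)" by (rule ennreal_leI)
    also have "\<dots> = (\<Sum>i\<in>I. ennreal (L (g i))) + ennreal e"
      using L_nonneg[OF blg g0] e by (simp add: ennreal_plus sum_nonneg sum_ennreal)
    also have "(\<Sum>i\<in>I. ennreal (L (g i))) \<le> (\<Sum>i\<in>I. content (G i))"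
      unfolding content_def by (intro sum_mono SUP_upper gin)
    also have "\<dots> \<le> (\<Sum>i. content (G i))" by (rule sum_le_suminf) (simp_all add: I)
    finally show "ennreal (L f) \<le> (\<Sum>i. content (G i)) + ennreal e" by (simp add: add_right_mono)
  qed
qed

lemma outer_measure: "outer_measure_space (Pow UNIV) outer"
  unfolding outer_measure_space_def
proof (intro conjI)
  show "positive (Pow UNIV) outer" using outer_open[of "{}"] by (simp add: positive_def content_empty)
  show "increasing (Pow UNIV) outer" by (simp add: increasing_def outer_mono)
  show "countably_subadditive (Pow UNIV) outer"
    unfolding countably_subadditive_def
  proof (intro allI impI)
    fix A :: "nat \<Rightarrow> 'a set"
    show "outer (\<Union>i. A i) \<le> (\<Sum>i. outer (A i))"
    proof (rule ennreal_le_epsilon)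
      fix e :: real assume e: "0 < e"
      have "\<exists>G. open G \<and> A i \<subseteq> G \<and> content G \<le> outer (A i) + ennreal (e * (1/2) ^ Suc i)" for i
      proof -
        obtain q where q: "outer (A i) = ennreal q" "0 \<le> q"
          using outer_le_1[of "A i"] by (cases "outer (A i)" rule: ennreal_cases) (auto simp: top_unique)
        have "outer (A i) < outer (A i) + ennreal (e * (1/2) ^ Suc i)"
          unfolding q(1) using q(2) e by (simp add: ennreal_less_iff flip: ennreal_plus)
        then have "\<exists>G\<in>{G. open G \<and> A i \<subseteq> G}. content G < outer (A i) + ennreal (e * (1/2) ^ Suc i)"
          by (subst (asm) (1) outer_def) (simp only: INF_less_iff)
        then show ?thesis by (auto intro: less_imp_le)
      qed
      then obtain G where G: "\<And>i. open (G i)" "\<And>i. A i \<subseteq> G i"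
        "\<And>i. content (G i) \<le> outer (A i) + ennreal (e * (1/2) ^ Suc i)" by metis
      have "outer (\<Union>i. A i) \<le> content (\<Union>i. G i)"
        using G(1,2) by (intro outer_le_content) blast+
      also have "\<dots> \<le> (\<Sum>i. content (G i))" by (rule content_subadditive[OF G(1)])
      also have "\<dots> \<le> (\<Sum>i. outer (A i) + ennreal (e * (1/2) ^ Suc i))"
        by (intro suminf_le G(3)) auto
      also have "\<dots> = (\<Sum>i. outer (A i)) + (\<Sum>i. ennreal (e * (1/2) ^ Suc i))"
        by (rule suminf_add[symmetric]) auto
      also have "(\<Sum>i. ennreal (e * (1/2) ^ Suc i)) = ennreal e"
      proof -
        have "(\<lambda>i. e * (1/2) ^ Suc i) sums (e * 1)" by (intro sums_mult power_half_series)
        then show ?thesis using e by (intro suminf_ennreal_eq) auto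
      qed
      finally show "outer (\<Union>i. A i) \<le> (\<Sum>i. outer (A i)) + ennreal e" .
    qed
  qed
qed

lemma outer_subadd: "outer X \<le> outer (F \<inter> X) + outer ((UNIV - F) \<inter> X)"
proof -
  interpret sigma_algebra UNIV "Pow (UNIV :: 'a set)" by (rule sigma_algebra_Pow)
  have "subadditive (Pow UNIV) outer"
    using outer_measure by (intro countably_subadditive_subadditive) (auto simp: outer_measure_space_def)
  then have "outer ((F \<inter> X) \<union> ((UNIV - F) \<inter> X)) \<le> outer (F \<inter> X) + outer ((UNIV - F) \<inter> X)"
    unfolding subadditive_def
    by (elim ballE[of _ _ "F \<inter> X"] ballE[of _ _ "(UNIV - F) \<inter> X"] impE) auto
  moreover have "(F \<inter> X) \<union> ((UNIV - F) \<inter> X) = X" by blast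
  ultimately show ?thesis by simp
qed

text \<open>
  If \<open>f\<close> lies below \<open>G - F\<close> and \<open>g\<close> below \<open>G \<inter> {f < d}\<close>, a neighbourhood of \<open>F \<inter> X\<close>, then
  \<open>max 0 (f - d) + g\<close> lies below \<open>G\<close>, because the two summands do not overlap. So the contents of
  the two pieces add up to at most the content of \<open>G\<close> plus \<open>d\<close>.
\<close>

lemma closed_caratheodory:
  assumes F: "closed F"
  shows "F \<in> lambda_system UNIV (Pow UNIV) outer"
  unfolding lambda_system_def
proof (intro CollectI conjI ballI antisym outer_subadd)
  fix X :: "'a set"
  show "outer (F \<inter> X) + outer ((UNIV - F) \<inter> X) \<le> outer X"
    unfolding outer_def[of X]
  proof (rule INF_greatest)
    fix G :: "'a set" assume "G \<in> {G. open G \<and> X \<subseteq> G}"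
    then have G: "open G" "X \<subseteq> G" by auto
    have main: "outer (F \<inter> X) + ennreal (L f) \<le> content G" if f: "f \<in> below (G - F)" for f
    proof (rule ennreal_le_epsilon)
      fix d :: real assume d: "0 < d"
      have blf: "bl f" and f0: "\<And>x. 0 \<le> f x" and f1: "\<And>x. f x \<le> indicator (G - F) x"
        using f by (auto simp: below_def)
      define H where "H = G \<inter> {x. f x < d}"
      have "open {x. f x < d}" by (intro open_Collect_less continuous_on_const bl_continuous[OF blf])
      then have H: "open H" unfolding H_def using G(1) by auto
      have "F \<inter> X \<subseteq> H"
      proof
        fix x assume "x \<in> F \<inter> X"
        then show "x \<in> H" using f1[of x] d G(2) by (auto simp: H_def split: split_indicator_asm)
      qed
      then have "outer (F \<inter> X) + ennreal (L f) \<le> content H + ennreal (L f)"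
        by (intro add_right_mono outer_le_content H)
      also have "content H + ennreal (L f) = (SUP g\<in>below H. ennreal (L g) + ennreal (L f))"
        unfolding content_def using below_zero by (intro ennreal_SUP_add_left[symmetric]) auto
      also have "\<dots> \<le> content G + ennreal d"
      proof (rule SUP_least)
        fix g assume g: "g \<in> below H"
        have blg: "bl g" and g0: "\<And>x. 0 \<le> g x" and g1: "\<And>x. g x \<le> indicator H x"
          using g by (auto simp: below_def)
        define k where "k x = max 0 (f x - d) + g x" for x
        have blk: "bl k" unfolding k_def by (intro bl_add bl_max bl_diff bl_const blf blg)
        have kin: "k \<in> below G"
        proof -
          have "0 \<le> k x \<and> k x \<le> indicator G x" for x
          proof (cases "f x < d")
            case True
            then show ?thesis using g0[of x] g1[of x]
              by (auto simp: k_def H_def split: split_indicator split_indicator_asm if_splits)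
          next
            case False
            then have "g x = 0" using g0[of x] g1[of x] by (simp add: H_def indicator_def)
            then show ?thesis using f0[of x] f1[of x] d False
              by (auto simp: k_def split: split_indicator split_indicator_asm if_splits)
          qed
          then show ?thesis using blk by (simp add: below_def)
        qed
        have "L g + L f = L (\<lambda>x. g x + f x)" using blf blg by (simp add: L_add)
        also have "\<dots> \<le> L (\<lambda>x. k x + d)"
        proof (rule L_mono)
          show "g x + f x \<le> k x + d" for x by (simp add: k_def)
        qed (intro bl_add bl_const blf blg blk)+
        also have "\<dots> = L k + d" using blk by (simp add: L_add L_const)
        finally have "ennreal (L g + L f) \<le> ennreal (L k + d)" by (rule ennreal_leI)
        then have "ennreal (L g) + ennreal (L f) \<le> ennreal (L k) + ennreal d"
          using d L_nonneg[OF blf f0] L_nonneg[OF blg g0] L_nonneg[OF blk] kin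
          by (simp add: ennreal_plus below_def)
        also have "ennreal (L k) \<le> content G" unfolding content_def by (rule SUP_upper[OF kin])
        finally show "ennreal (L g) + ennreal (L f) \<le> content G + ennreal d" by (simp add: add_right_mono)
      qed
      finally show "outer (F \<inter> X) + ennreal (L f) \<le> content G + ennreal d" .
    qed
    have "outer ((UNIV - F) \<inter> X) \<le> content (G - F)"
      using G F by (intro outer_le_content open_Diff) auto
    then have "outer (F \<inter> X) + outer ((UNIV - F) \<inter> X) \<le> outer (F \<inter> X) + content (G - F)"
      by (rule add_left_mono)
    also have "\<dots> = (SUP f\<in>below (G - F). outer (F \<inter> X) + ennreal (L f))"
      unfolding content_def using below_zero by (intro ennreal_SUP_add_right) auto
    also have "\<dots> \<le> content G" by (intro SUP_least main)
    finally show "outer (F \<inter> X) + outer ((UNIV - F) \<inter> X) \<le> content G" .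
  qed
qed simp

definition representing :: "'a measure" where
  "representing = measure_of UNIV (sets borel) outer"

lemma sets_representing [simp, measurable_cong]: "sets representing = sets borel"
  unfolding representing_def using sets.sigma_sets_eq[of "borel :: 'a measure"] by simp

lemma emeasure_representing: "A \<in> sets borel \<Longrightarrow> emeasure representing A = outer A"
proof -
  interpret S: sigma_algebra UNIV "Pow (UNIV :: 'a set)" by (rule sigma_algebra_Pow)
  have ms: "measure_space UNIV (lambda_system UNIV (Pow UNIV) outer) outer"
    by (rule S.caratheodory_lemma[OF outer_measure])
  then interpret lam: sigma_algebra UNIV "lambda_system UNIV (Pow UNIV) outer"
    by (simp add: measure_space_def)
  have "sets borel \<subseteq> lambda_system UNIV (Pow UNIV) outer"
  proof -
    have "sigma_sets UNIV (Collect closed) \<subseteq> lambda_system UNIV (Pow UNIV) outer"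
      by (rule lam.sigma_sets_subset) (use closed_caratheodory in blast)
    then show ?thesis by (simp add: borel_eq_closed)
  qed
  then have "measure_space UNIV (sets borel) outer"
    by (intro measure_down[OF ms]) (metis sets.sigma_algebra_axioms space_borel)
  then have "positive (sets borel) outer" "countably_additive (sets borel) outer"
    by (auto simp: measure_space_def)
  moreover assume "A \<in> sets borel"
  ultimately show ?thesis
    unfolding representing_def
    by (intro emeasure_measure_of_sigma) (metis sets.sigma_algebra_axioms space_borel)
qed

lemma borel_prob_representing: "borel_prob representing"
proof -
  have "space representing = UNIV" by (simp add: representing_def)
  then have "emeasure representing (space representing) = 1"
    by (simp add: emeasure_representing outer_open content_UNIV)
  then show ?thesis by (simp add: borel_prob_def prob_spaceI)
qed

text \<open>
  Cut \<open>f\<close> into horizontal slices of height \<open>\<delta>\<close>. Each slice, divided by \<open>\<delta>\<close>, lies below the level set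
  it starts from, and the sum of the indicators of these level sets times \<open>\<delta>\<close> exceeds \<open>f\<close> by at
  most \<open>\<delta>\<close>.
\<close>

lemma L_le_integral:
  assumes f: "bl f" "\<And>x. 0 \<le> f x" "\<And>x. f x \<le> 1"
  shows "L f \<le> (\<integral>x. f x \<partial>representing)"
proof (rule field_le_epsilon)
  interpret prob_space representing using borel_prob_representing by (simp add: borel_prob_def)
  note [measurable] = bl_measurable[OF f(1)]
  fix e :: real assume "0 < e"
  then obtain n where n: "1 / real (Suc n) < e" using nat_approx_posE by auto
  define N where "N = Suc n"
  define \<delta> where "\<delta> = 1 / real N"
  have \<delta>: "0 < \<delta>" "\<delta> < e" "\<delta> * real N = 1" using n by (auto simp: \<delta>_def N_def)
  define g where "g i x = min \<delta> (max 0 (f x - real i * \<delta>))" for i x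
  have blg: "bl (g i)" for i unfolding g_def by (intro bl_min bl_max bl_diff bl_const f)
  have slice: "(\<Sum>i<k. g i x) = min (real k * \<delta>) (f x)" for k x
  proof (induction k)
    case (Suc k)
    then show ?case using f(2)[of x] \<delta>(1) by (auto simp: g_def algebra_simps min_def max_def)
  qed (use f(2)[of x] in auto)
  let ?lev = "\<lambda>i. {x. real i * \<delta> < f x}"
  have lev: "open (?lev i)" for i by (intro open_Collect_less continuous_on_const bl_continuous f)
  have Lg: "L (g i) \<le> \<delta> * prob (?lev i)" for i
  proof -
    have "0 \<le> (1 / \<delta>) * g i x \<and> (1 / \<delta>) * g i x \<le> indicator (?lev i) x" for x
      using \<delta>(1) by (auto simp: g_def field_simps split: split_indicator)
    then have "(\<lambda>x. (1 / \<delta>) * g i x) \<in> below (?lev i)"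
      unfolding below_def using bl_cmult[OF blg] by blast
    then have "ennreal (L (\<lambda>x. (1 / \<delta>) * g i x)) \<le> content (?lev i)"
      unfolding content_def by (rule SUP_upper)
    also have "\<dots> = emeasure representing (?lev i)"
      using lev by (simp add: emeasure_representing outer_open)
    finally have "(1 / \<delta>) * L (g i) \<le> prob (?lev i)"
      unfolding L_cmult[OF blg] by (simp add: emeasure_eq_measure)
    then show ?thesis using \<delta>(1) by (simp add: field_simps)
  qed
  have "f x = (\<Sum>i<N. g i x)" for x
    using f(3)[of x] \<delta>(3) by (simp add: slice mult.commute)
  then have "f = (\<lambda>x. \<Sum>i<N. g i x)" by (rule ext)
  then have "L f = (\<Sum>i<N. L (g i))" using L_sum[of "{..<N}" g] blg by metis
  also have "\<dots> \<le> (\<Sum>i<N. \<delta> * prob (?lev i))" by (intro sum_mono Lg)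
  also have "\<dots> = (\<integral>x. (\<Sum>i<N. \<delta> * indicator (?lev i) x) \<partial>representing)"
    by (subst Bochner_Integration.integral_sum) (auto simp: emeasure_eq_measure)
  also have "\<dots> \<le> (\<integral>x. f x + \<delta> \<partial>representing)"
  proof (rule integral_mono)
    define w where "w i x = \<delta> * indicator (?lev i) x" for i x
    have w: "w i x = (if real i * \<delta> < f x then \<delta> else 0)" for i x by (simp add: w_def)
    have "(\<Sum>i<k. w i x) \<le> real k * \<delta> \<and> (\<Sum>i<k. w i x) \<le> f x + \<delta>" for k x
    proof (induction k)
      case (Suc k)
      then show ?case using \<delta>(1)
        by (cases "real k * \<delta> < f x") (auto simp: w algebra_simps simp del: sum.If_cases)
    qed (use f(2)[of x] \<delta>(1) in auto)
    then show "(\<Sum>i<N. \<delta> * indicator (?lev i) x) \<le> f x + \<delta>" for x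
      unfolding w_def by blast
    show "integrable representing (\<lambda>x. \<Sum>i<N. \<delta> * indicator (?lev i) x)"
      using lev by (intro Bochner_Integration.integrable_sum integrable_mult_right integrable_real_indicator)
        (auto simp: emeasure_eq_measure)
    show "integrable representing (\<lambda>x. f x + \<delta>)"
      using f(2,3) \<delta>(1) by (intro integrable_const_bound[where B="1 + \<delta>"]) auto
  qed
  also have "\<dots> = (\<integral>x. f x \<partial>representing) + \<delta>"
    using f(2,3) by (subst Bochner_Integration.integral_add)
      (auto intro!: integrable_const_bound[where B=1] simp: prob_space)
  finally show "L f \<le> (\<integral>x. f x \<partial>representing) + e" using \<delta>(2) by linarith
qed

text \<open>
  Apply the inequality to a rescaling \<open>g\<close> of \<open>f\<close> with values in the unit interval and to \<open>1 - g\<close>.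
\<close>

lemma L_eq_integral:
  assumes f: "bl f"
  shows "L f = (\<integral>x. f x \<partial>representing)"
proof -
  interpret prob_space representing using borel_prob_representing by (simp add: borel_prob_def)
  have int: "integrable representing g" if g: "bl g" for g
  proof -
    obtain B where B: "\<And>x. \<bar>g x\<bar> \<le> B" using g by (elim blE) blast
    have [measurable]: "g \<in> borel_measurable borel" by (rule bl_measurable[OF g])
    show ?thesis by (rule integrable_const_bound[where B=B]) (auto simp: B)
  qed
  obtain B where B: "B > 0" "\<And>x. \<bar>f x\<bar> \<le> B" using f by (elim blE) blast
  define g where "g x = (1 / (2 * B)) * (f x + B)" for x
  have blg: "bl g" unfolding g_def by (intro bl_cmult bl_add bl_const f)
  have g01: "0 \<le> g x \<and> g x \<le> 1" for x using B(1) B(2)[of x] by (auto simp: g_def field_simps abs_le_iff)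
  have "L g \<le> (\<integral>x. g x \<partial>representing)" using g01 by (intro L_le_integral blg) auto
  moreover have "L (\<lambda>x. 1 - g x) \<le> (\<integral>x. 1 - g x \<partial>representing)"
    using g01 by (intro L_le_integral bl_diff bl_const blg) auto
  moreover have "L (\<lambda>x. 1 - g x) = 1 - L g"
    using L_add[of "\<lambda>_. 1" "\<lambda>x. (-1) * g x"] L_cmult[OF blg, of "-1"] bl_cmult[OF blg, of "-1"]
    by (simp add: L_one)
  ultimately have "L g = (\<integral>x. g x \<partial>representing)" using int[OF blg] by (simp add: prob_space)
  moreover have "L g = (1 / (2 * B)) * (L f + B)"
    unfolding g_def using f by (simp only: L_cmult L_add L_const bl_add bl_const)
  moreover have "(\<integral>x. g x \<partial>representing) = (1 / (2 * B)) * ((\<integral>x. f x \<partial>representing) + B)"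
    unfolding g_def using int[OF f] by (simp add: prob_space)
  ultimately show ?thesis using B(1) by simp
qed

end

section \<open>Weak convergence and Lipschitz test functions\<close>

lemma bl_integrable:
  assumes "borel_prob M" "bl f"
  shows "integrable M f"
proof -
  obtain B where B: "\<And>x. \<bar>f x\<bar> \<le> B" using assms(2) by (elim blE) blast
  note M = borel_probD[OF assms(1)]
  show ?thesis
    by (rule integrable_bounded_borel[OF M(2,3) bl_measurable[OF assms(2)], where B=B]) (simp add: B)
qed

text \<open>
  The inf-convolutions \<open>x \<mapsto> inf\<^sub>y f y + k dist x y\<close> are Lipschitz and increase to \<open>f\<close>.
\<close>

lemma lipschitz_approximation:
  fixes f :: "'a::metric_space \<Rightarrow> real"
  assumes f: "continuous_on UNIV f" and B: "\<And>x. \<bar>f x\<bar> \<le> B"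
  obtains g :: "nat \<Rightarrow> 'a \<Rightarrow> real" where "\<And>k. bl (g k)" "\<And>k x. g k x \<le> f x"
    "\<And>k x. \<bar>g k x\<bar> \<le> B" "\<And>x. (\<lambda>k. g k x) \<longlonglongrightarrow> f x"
proof -
  define g where "g k x = (INF y. f y + real k * dist x y)" for k :: nat and x
  have low: "- B \<le> f y + real k * dist x y" for k x y
    using B[of y] zero_le_dist[of x y] by (smt (verit) mult_nonneg_nonneg of_nat_0_le_iff)
  have bdd: "bdd_below (range (\<lambda>y. f y + real k * dist x y))" for k x
    by (rule bdd_belowI2[of _ "- B"]) (rule low)
  have up: "g k x \<le> f y + real k * dist x y" for k x y
    unfolding g_def by (rule cINF_lower[OF bdd]) simp
  have gf: "g k x \<le> f x" for k x using up[of k x x] by simp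
  have gB: "- B \<le> g k x" for k x unfolding g_def by (rule cINF_greatest) (simp_all add: low)
  have absg: "\<bar>g k x\<bar> \<le> B" for k x using gf[of k x] gB[of k x] B[of x] by linarith
  have lip: "g k x - g k y \<le> real k * dist x y" for k x y
  proof -
    have "g k x - real k * dist x y \<le> g k y"
      unfolding g_def[of k y]
    proof (rule cINF_greatest)
      fix z
      have "real k * dist x z \<le> real k * (dist x y + dist y z)"
        by (intro mult_left_mono dist_triangle) simp
      then show "g k x - real k * dist x y \<le> f z + real k * dist y z"
        using up[of k x z] by (simp add: distrib_left)
    qed simp
    then show ?thesis by simp
  qed
  have "bl (g k)" for k
  proof (rule blI)
    show "\<bar>g k x - g k y\<bar> \<le> real k * dist x y" for x y
      using lip[of k x y] lip[of k y x] by (simp add: dist_commute abs_le_iff)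
  qed (rule absg)
  moreover have "(\<lambda>k. g k x) \<longlonglongrightarrow> f x" for x
  proof (rule LIMSEQ_I)
    fix e :: real assume e: "0 < e"
    have "isCont f x" using f by (simp add: continuous_on_eq_continuous_at)
    then obtain d where d: "0 < d" "\<And>y. dist y x < d \<Longrightarrow> dist (f y) (f x) < e / 2"
      using e unfolding continuous_at_eps_delta by (metis half_gt_zero)
    obtain N where N: "2 * B / d < real N" using reals_Archimedean2 by blast
    have "norm (g k x - f x) < e" if "N \<le> k" for k
    proof -
      have "f x - e / 2 \<le> g k x"
        unfolding g_def
      proof (rule cINF_greatest)
        fix y
        show "f x - e / 2 \<le> f y + real k * dist x y"
        proof (cases "dist y x < d")
          case True
          then have "f x - e / 2 \<le> f y" using d(2)[OF True] unfolding dist_real_def by linarith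
          then show ?thesis using add_increasing2[of "real k * dist x y"] by simp
        next
          case False
          have "2 * B \<le> real k * d"
          proof -
            have "2 * B < real N * d" using N d(1) by (simp add: field_simps)
            also have "\<dots> \<le> real k * d" using that d(1) by (simp add: mult_right_mono)
            finally show ?thesis by simp
          qed
          also have "\<dots> \<le> real k * dist x y" using False by (simp add: mult_left_mono dist_commute)
          finally show ?thesis using B[of x] B[of y] e by linarith
        qed
      qed simp
      then show ?thesis using gf[of k x] e by simp
    qed
    then show "\<exists>no. \<forall>n\<ge>no. norm (g n x - f x) < e" by blast
  qed
  ultimately show ?thesis using that gf absg by blast
qed

text \<open>
  Approximating \<open>f\<close> and \<open>- f\<close> from below gives the two halves of the convergence.
\<close>

lemma weakly_converges_lipschitz:
  fixes N :: "'a::metric_space measure"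
  assumes M: "eventually (\<lambda>i. borel_prob (M i)) F" and N: "borel_prob N"
    and lim: "\<And>f. bl f \<Longrightarrow> ((\<lambda>i. \<integral>x. f x \<partial>M i) \<longlongrightarrow> (\<integral>x. f x \<partial>N)) F"
  shows "weakly_converges M N F"
  unfolding weakly_converges_def
proof (intro allI impI)
  have lower: "eventually (\<lambda>i. (\<integral>x. f x \<partial>N) - e < (\<integral>x. f x \<partial>M i)) F"
    if f: "continuous_on UNIV f" and B: "\<And>x. \<bar>f x\<bar> \<le> B" and e: "0 < e" for f :: "'a \<Rightarrow> real" and B e
  proof -
    obtain g where g: "\<And>k. bl (g k)" "\<And>k x. g k x \<le> f x"
        "\<And>k x. \<bar>g k x\<bar> \<le> B" "\<And>x. (\<lambda>k. g k x) \<longlonglongrightarrow> f x"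
      using lipschitz_approximation[OF f B] by metis
    have fm: "f \<in> borel_measurable borel" by (rule borel_measurable_continuous_onI[OF f])
    note N' = borel_probD[OF N]
    interpret N: prob_space N by (rule N')
    have "(\<lambda>k. \<integral>x. g k x \<partial>N) \<longlonglongrightarrow> (\<integral>x. f x \<partial>N)"
    proof (rule integral_dominated_convergence[where w="\<lambda>_. B"])
      show "f \<in> borel_measurable N" "g k \<in> borel_measurable N" for k
        using fm bl_measurable[OF g(1)] by (simp_all add: measurable_cong_sets[OF N'(3) refl])
    qed (use g in auto)
    then have "eventually (\<lambda>k. (\<integral>x. f x \<partial>N) - e / 2 < (\<integral>x. g k x \<partial>N)) sequentially"
      by (rule order_tendstoD) (use e in simp)
    then obtain k where k: "(\<integral>x. f x \<partial>N) - e / 2 < (\<integral>x. g k x \<partial>N)"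
      using eventually_happens by fastforce
    have "eventually (\<lambda>i. (\<integral>x. g k x \<partial>N) - e / 2 < (\<integral>x. g k x \<partial>M i)) F"
      by (rule order_tendstoD(1)[OF lim[OF g(1)]]) (use e in simp)
    then show ?thesis
      using M
    proof eventually_elim
      case (elim i)
      note M' = borel_probD[OF elim(2)]
      have "(\<integral>x. g k x \<partial>M i) \<le> (\<integral>x. f x \<partial>M i)"
        using integrable_bounded_borel[OF M'(2,3) fm, of B] B g(2)
        by (intro integral_mono bl_integrable[OF elim(2) g(1)]) auto
      then show ?case using k elim(1) by linarith
    qed
  qed
  fix f :: "'a \<Rightarrow> real" assume "continuous_on UNIV f \<and> bounded (range f)"
  then have f: "continuous_on UNIV f" and "bounded (range f)" by auto
  then obtain B where B: "\<And>x. \<bar>f x\<bar> \<le> B" by (auto simp: bounded_iff)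
  show "((\<lambda>i. \<integral>x. f x \<partial>M i) \<longlongrightarrow> (\<integral>x. f x \<partial>N)) F"
  proof (rule tendstoI)
    fix e :: real assume e: "0 < e"
    have "eventually (\<lambda>i. (\<integral>x. f x \<partial>N) - e < (\<integral>x. f x \<partial>M i)) F" by (rule lower[OF f B e])
    moreover have "eventually (\<lambda>i. (\<integral>x. - f x \<partial>N) - e < (\<integral>x. - f x \<partial>M i)) F"
      using B by (intro lower[OF _ _ e, of _ B] continuous_on_minus f) simp
    ultimately show "eventually (\<lambda>i. dist (\<integral>x. f x \<partial>M i) (\<integral>x. f x \<partial>N) < e) F"
      by eventually_elim (simp add: dist_real_def abs_less_iff)
  qed
qed

section \<open>Tightness and completeness\<close>

lemma borel_prob_tight:
  fixes M :: "'a::polish_space measure"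
  assumes M: "borel_prob M" and e: "0 < e"
  shows "\<exists>K. compact K \<and> 1 - e \<le> measure M K"
proof -
  note M' = borel_probD[OF M]
  interpret prob_space M by (rule M')
  have "(SUP K \<in> {K. K \<subseteq> UNIV \<and> compact K}. emeasure M K) = emeasure M UNIV"
    by (rule inner_regular[symmetric]) (use M' in auto)
  also have "\<dots> = 1" using emeasure_space_1 M'(4) by simp
  finally have "ennreal (1 - e) < (SUP K \<in> {K. K \<subseteq> UNIV \<and> compact K}. emeasure M K)"
    using e by (simp add: ennreal_less_one_iff)
  then obtain K where K: "compact K" "ennreal (1 - e) < emeasure M K" by (auto simp: less_SUP_iff)
  then have "1 - e \<le> measure M K"
    by (simp add: emeasure_eq_measure ennreal_less_iff)
      (metis ennreal_less_iff less_imp_le linorder_not_le measure_nonneg ennreal_leI not_less)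
  then show ?thesis using K by blast
qed

text \<open>
  A sequence that asymptotically charges each neighbourhood of suitable compact sets is uniformly
  tight: intersect enlarged compacts over all radii, the finitely many early measures being tight
  individually.
\<close>

lemma tight_sequence:
  fixes M :: "nat \<Rightarrow> 'a::polish_space measure"
  assumes M: "\<And>n. borel_prob (M n)"
    and near: "\<And>e d. 0 < e \<Longrightarrow> 0 < d \<Longrightarrow>
      \<exists>K N. compact K \<and> (\<forall>n\<ge>N. 1 - e \<le> measure (M n) (\<Union>x\<in>K. ball x d))"
    and e: "0 < e"
  shows "\<exists>K. compact K \<and> (\<forall>n. 1 - e \<le> measure (M n) K)"
proof -
  define d where "d k = 1 / real (Suc k)" for k
  define c where "c k = e * (1/2) ^ Suc k" for k
  have d: "0 < d k" for k by (simp add: d_def)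
  have c: "0 < c k" for k using e by (simp add: c_def)
  have "\<exists>K. compact K \<and> (\<forall>n. 1 - c k \<le> measure (M n) (\<Union>x\<in>K. ball x (d k)))" for k
  proof -
    obtain K N where K: "compact K" "\<And>n. n \<ge> N \<Longrightarrow> 1 - c k \<le> measure (M n) (\<Union>x\<in>K. ball x (d k))"
      using near[OF c d, of k k] by auto
    obtain C where C: "\<And>n. compact (C n)" "\<And>n. 1 - c k \<le> measure (M n) (C n)"
    proof -
      have "\<exists>K. compact K \<and> 1 - c k \<le> measure (M n) K" for n by (rule borel_prob_tight[OF M c])
      then show ?thesis using that by metis
    qed
    define K' where "K' = K \<union> (\<Union>n<N. C n)"
    have "1 - c k \<le> measure (M n) (\<Union>x\<in>K'. ball x (d k))" for n
    proof -
      note M' = borel_probD[OF M[of n]]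
      interpret prob_space "M n" by (rule M')
      have op: "open (\<Union>x\<in>K'. ball x (d k))" by auto
      show ?thesis
      proof (cases "N \<le> n")
        case True
        have "measure (M n) (\<Union>x\<in>K. ball x (d k)) \<le> measure (M n) (\<Union>x\<in>K'. ball x (d k))"
          by (rule finite_measure_mono) (use op M'(3) in \<open>auto simp: K'_def\<close>)
        then show ?thesis using K(2)[OF True] by linarith
      next
        case False
        have "measure (M n) (C n) \<le> measure (M n) (\<Union>x\<in>K'. ball x (d k))"
        proof (rule finite_measure_mono)
          show "C n \<subseteq> (\<Union>x\<in>K'. ball x (d k))"
          proof
            fix x assume "x \<in> C n"
            then have "x \<in> K'" using False by (auto simp: K'_def not_le)
            then show "x \<in> (\<Union>x\<in>K'. ball x (d k))" using d[of k] by (auto intro!: bexI[of _ x])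
          qed
        qed (use op M'(3) in auto)
        then show ?thesis using C(2)[of n] by linarith
      qed
    qed
    moreover have "compact K'" unfolding K'_def by (intro compact_Un K compact_UN C) auto
    ultimately show ?thesis by blast
  qed
  then obtain K where K: "\<And>k. compact (K k)"
      "\<And>k n. 1 - c k \<le> measure (M n) (\<Union>x\<in>K k. ball x (d k))" by metis
  define A where "A k = (\<Union>x\<in>K k. ball x (d k))" for k
  have A: "open (A k)" for k unfolding A_def by auto
  define Q where "Q = (\<Inter>k. closure (A k))"
  have Qcl: "closed Q" unfolding Q_def by auto
  have "compact Q"
    unfolding compact_eq_totally_bounded
  proof (intro conjI allI impI)
    show "Topological_Spaces.complete Q" using Qcl by (simp add: complete_eq_closed)
    fix r :: real assume r: "0 < r"
    then obtain k where k: "1 / real (Suc k) < r / 3" by (metis nat_approx_posE zero_less_divide_iff zero_less_numeral)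
    obtain F where F: "finite F" "K k \<subseteq> (\<Union>x\<in>F. ball x (d k))"
      using K(1)[of k] d[of k] unfolding compact_eq_totally_bounded by blast
    have "Q \<subseteq> (\<Union>x\<in>F. ball x r)"
    proof
      fix x assume "x \<in> Q"
      then have "x \<in> closure (A k)" by (simp add: Q_def)
      then obtain y where y: "y \<in> A k" "dist y x < d k" using d[of k] closure_approachable by metis
      then obtain z where z: "z \<in> K k" "dist z y < d k" by (auto simp: A_def)
      then obtain w where w: "w \<in> F" "dist w z < d k" using F(2) by auto
      have "dist w x \<le> dist w z + dist z y + dist y x"
        by (meson dist_triangle add_mono order_refl order_trans)
      then have "dist w x < r" using y z w k by (simp add: d_def)
      then show "x \<in> (\<Union>x\<in>F. ball x r)" using w(1) by auto
    qed
    then show "\<exists>F. finite F \<and> Q \<subseteq> (\<Union>x\<in>F. ball x r)" using F(1) by blast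
  qed
  moreover have "1 - e \<le> measure (M n) Q" for n
  proof -
    note M' = borel_probD[OF M[of n]]
    interpret prob_space "M n" by (rule M')
    have Am: "closure (A k) \<in> sets (M n)" "A k \<in> sets (M n)" for k using M'(3) A by auto
    have one: "emeasure (M n) (- closure (A k)) \<le> ennreal (c k)" for k
    proof -
      have "measure (M n) (A k) \<le> measure (M n) (closure (A k))"
        by (rule finite_measure_mono) (use Am closure_subset in auto)
      moreover have "measure (M n) (- closure (A k)) = 1 - measure (M n) (closure (A k))"
        using prob_compl[OF Am(1), of k] M'(4) by (simp add: Compl_eq_Diff_UNIV)
      ultimately have "measure (M n) (- closure (A k)) \<le> c k" using K(2)[of k n] by (simp add: A_def)
      then show ?thesis by (simp add: emeasure_eq_measure ennreal_leI)
    qed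
    have "emeasure (M n) (- Q) = emeasure (M n) (\<Union>k. - closure (A k))" by (simp add: Q_def)
    also have "\<dots> \<le> (\<Sum>k. emeasure (M n) (- closure (A k)))"
      using Am M'(3) by (intro emeasure_subadditive_countably) auto
    also have "\<dots> \<le> (\<Sum>k. ennreal (c k))" by (intro suminf_le one) auto
    also have "\<dots> = ennreal e"
    proof -
      have "c sums (e * 1)" unfolding c_def by (intro sums_mult power_half_series)
      then show ?thesis using c by (intro suminf_ennreal_eq) (auto intro: less_imp_le)
    qed
    finally have "measure (M n) (- Q) \<le> e" using e by (simp add: emeasure_eq_measure)
    moreover have "measure (M n) (- Q) = 1 - measure (M n) Q"
      using prob_compl[of Q] Qcl M'(3,4) by (simp add: Compl_eq_Diff_UNIV)
    ultimately show ?thesis by simp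
  qed
  ultimately show ?thesis by blast
qed

lemma near_compact_if_small_integral:
  fixes M :: "'a::polish_space measure"
  assumes M: "borel_prob M" and K: "K \<noteq> {}" and d: "0 < d"
    and small: "(\<integral>x. min 1 ((1 / d) * infdist x K) \<partial>M) \<le> e"
  shows "1 - e \<le> measure M (\<Union>x\<in>K. ball x d)"
proof -
  note M' = borel_probD[OF M]
  interpret prob_space M by (rule M')
  let ?f = "\<lambda>x. min 1 ((1 / d) * infdist x K)" and ?U = "\<Union>x\<in>K. ball x d"
  have bl: "bl ?f" using d by (intro bl_min_infdist) auto
  have U: "?U \<in> sets M" unfolding M'(3) by (intro borel_open open_UN ballI open_ball)
  have cU: "- ?U \<in> sets M" using U M'(4) by (metis Compl_eq_Diff_UNIV sets.compl_sets)
  have ge: "indicator (- ?U) x \<le> ?f x" for x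
  proof (cases "x \<in> ?U")
    case False
    then have "d \<le> dist x y" if "y \<in> K" for y using that by (force simp: dist_commute not_less)
    then have "d \<le> infdist x K" unfolding infdist_def using K by (simp only: if_False) (rule cINF_greatest)
    then show ?thesis using d by (simp split: split_indicator)
  next
    case True
    then have "indicator (- ?U) x = (0 :: real)" by simp
    then show ?thesis using d by (simp add: infdist_nonneg)
  qed
  have "measure M (- ?U) = (\<integral>x. indicator (- ?U) x \<partial>M)" using M'(4) by simp
  also have "\<dots> \<le> (\<integral>x. ?f x \<partial>M)"
    using ge cU by (intro integral_mono bl_integrable[OF M bl] integrable_real_indicator)
      (auto simp: emeasure_eq_measure)
  also have "\<dots> \<le> e" by (rule small)
  finally show ?thesis
    using prob_compl[OF U] M'(4) by (simp add: Compl_eq_Diff_UNIV)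
qed

lemma small_integral_if_compact:
  fixes M :: "'a::polish_space measure"
  assumes M: "borel_prob M" and K: "compact K" "1 - e \<le> measure M K" and b: "0 \<le> b" and c: "0 \<le> c"
  shows "(\<integral>x. min b (c * infdist x K) \<partial>M) \<le> b * e"
proof -
  note M' = borel_probD[OF M]
  interpret prob_space M by (rule M')
  have Km: "K \<in> sets M" using K(1) M'(3) borel_compact by auto
  have cK: "- K \<in> sets M" using Km M'(4) by (metis Compl_eq_Diff_UNIV sets.compl_sets)
  have "(\<integral>x. min b (c * infdist x K) \<partial>M) \<le> (\<integral>x. b * indicator (- K) x \<partial>M)"
    using b c cK
    by (intro integral_mono bl_integrable[OF M bl_min_infdist])
      (auto simp: emeasure_eq_measure infdist_nonneg split: split_indicator)
  also have "\<dots> = b * measure M (- K)" using M'(4) by simp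
  also have "measure M (- K) = 1 - measure M K"
    using prob_compl[OF Km] M'(4) by (simp add: Compl_eq_Diff_UNIV)
  finally show ?thesis using mult_left_mono[OF _ b, of "1 - measure M K" e] K(2) by simp
qed

text \<open>
  A compact set that carries most of the limit has neighbourhoods that asymptotically carry most of the
  sequence; the functions \<open>min 1 (infdist x K / d)\<close> are the test functions for this.
\<close>

lemma tight_weakly_convergent:
  fixes M :: "nat \<Rightarrow> 'a::polish_space measure"
  assumes M: "\<And>n. borel_prob (M n)" and N: "borel_prob N"
    and conv: "weakly_converges M N sequentially" and e: "0 < e"
  shows "\<exists>K. compact K \<and> (\<forall>n. 1 - e \<le> measure (M n) K)"
proof (rule tight_sequence[OF M _ e])
  fix e d :: real assume e: "0 < e" and d: "0 < d"
  obtain K0 where K0: "compact K0" "1 - e/2 \<le> measure N K0"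
    using borel_prob_tight[OF N, of "e/2"] e by auto
  \<comment> \<open>made nonempty, since \<open>infdist x {} = 0\<close>\<close>
  define K where "K = insert undefined K0"
  note N' = borel_probD[OF N]
  interpret N: prob_space N by (rule N')
  have K: "compact K" "K \<noteq> {}" using K0 by (auto simp: K_def)
  have "measure N K0 \<le> measure N K"
    by (rule N.finite_measure_mono) (use K(1) N'(3) borel_compact in \<open>auto simp: K_def\<close>)
  then have NK: "1 - e/2 \<le> measure N K" using K0(2) by linarith
  let ?f = "\<lambda>x. min 1 ((1 / d) * infdist x K)"
  have bl: "bl ?f" using d by (intro bl_min_infdist) auto
  have "bounded (range ?f)" using d by (auto simp: bounded_iff infdist_nonneg intro!: exI[of _ 1])
  then have "(\<lambda>n. \<integral>x. ?f x \<partial>M n) \<longlonglongrightarrow> (\<integral>x. ?f x \<partial>N)"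
    using conv bl_continuous[OF bl] unfolding weakly_converges_def by blast
  moreover have "(\<integral>x. ?f x \<partial>N) < e"
    using small_integral_if_compact[OF N K(1) NK, of 1 "1/d"] d e by simp
  ultimately have "eventually (\<lambda>n. (\<integral>x. ?f x \<partial>M n) < e) sequentially" by (rule order_tendstoD(2))
  then obtain n0 where n0: "\<And>n. n \<ge> n0 \<Longrightarrow> (\<integral>x. ?f x \<partial>M n) < e" by (auto simp: eventually_sequentially)
  have "1 - e \<le> measure (M n) (\<Union>x\<in>K. ball x d)" if "n \<ge> n0" for n
    using n0[OF that] by (intro near_compact_if_small_integral M K d) simp
  then show "\<exists>K N. compact K \<and> (\<forall>n\<ge>N. 1 - e \<le> measure (M n) (\<Union>x\<in>K. ball x d))" using K(1) by blast
qed

text \<open>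
  Completeness of the bounded Lipschitz metric. Testing with \<open>min b (infdist x K)\<close>, for a compact \<open>K\<close> that
  carries most of one late member, shows that a Cauchy sequence is tight; so its limit
  functional is tight and hence an integral.
\<close>

theorem bounded_lipschitz_complete:
  fixes M :: "nat \<Rightarrow> 'a::polish_space measure"
  assumes M: "\<And>n. borel_prob (M n)"
    and cauchy: "\<And>e. 0 < e \<Longrightarrow> \<exists>N. \<forall>n\<ge>N. \<forall>f.
      (\<forall>x y. \<bar>f x - f y\<bar> \<le> dist x y) \<and> (\<forall>x. 0 \<le> f x \<and> f x \<le> 1) \<longrightarrow>
      \<bar>(\<integral>x. f x \<partial>M n) - (\<integral>x. f x \<partial>M N)\<bar> \<le> e"
  shows "\<exists>N. borel_prob N \<and> (\<forall>f. bl f \<longrightarrow> (\<lambda>n. \<integral>x. f x \<partial>M n) \<longlonglongrightarrow> (\<integral>x. f x \<partial>N))"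
proof -
  have prob: "(\<integral>x. c \<partial>M n) = c" for c :: real and n
    using prob_space.prob_space[OF borel_probD(1)[OF M[of n]]] by simp
  have tight: "\<exists>K. compact K \<and> (\<forall>n. 1 - e \<le> measure (M n) K)" if "0 < e" for e
  proof (rule tight_sequence[OF M _ that])
    fix e d :: real assume e: "0 < e" and d: "0 < d"
    define b where "b = min 1 d"
    have b: "0 < b" "b \<le> 1" "b \<le> d" using d by (auto simp: b_def)
    have "0 < b * e / 2" using b e by simp
    from cauchy[OF this] obtain N where N: "\<And>n f. n \<ge> N \<Longrightarrow> (\<And>x y. \<bar>f x - f y\<bar> \<le> dist x y) \<Longrightarrow>
        (\<And>x. 0 \<le> f x \<and> f x \<le> 1) \<Longrightarrow> \<bar>(\<integral>x. f x \<partial>M n) - (\<integral>x. f x \<partial>M N)\<bar> \<le> b * e / 2"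
      by metis
    obtain K0 where K0: "compact K0" "1 - e/2 \<le> measure (M N) K0"
      using borel_prob_tight[OF M, of "e/2" N] e by auto
    \<comment> \<open>made nonempty, since \<open>infdist x {} = 0\<close>\<close>
    define K where "K = insert undefined K0"
    note M' = borel_probD[OF M[of N]]
    interpret MN: prob_space "M N" by (rule M')
    have K: "compact K" "K \<noteq> {}" using K0 by (auto simp: K_def)
    have "measure (M N) K0 \<le> measure (M N) K"
      by (rule MN.finite_measure_mono) (use K(1) M'(3) borel_compact in \<open>auto simp: K_def\<close>)
    then have NK: "1 - e/2 \<le> measure (M N) K" using K0(2) by linarith
    define f where "f x = min b (infdist x K)" for x
    have lip: "\<bar>f x - f y\<bar> \<le> dist x y" for x y
      using infdist_triangle_abs[of x K y] unfolding f_def by linarith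
    have f01: "0 \<le> f x \<and> f x \<le> 1" for x using b by (auto simp: f_def infdist_nonneg)
    have fN: "(\<integral>x. f x \<partial>M N) \<le> b * (e/2)"
      unfolding f_def using small_integral_if_compact[OF M K(1) NK, of b 1] b by simp
    have "1 - e \<le> measure (M n) (\<Union>x\<in>K. ball x d)" if "n \<ge> N" for n
    proof -
      have "(\<integral>x. f x \<partial>M n) \<le> b * e" using N[OF that lip f01] fN unfolding abs_le_iff by (simp add: field_simps)
      moreover have "f x = b * min 1 ((1 / b) * infdist x K)" for x
        using b by (auto simp: f_def min_def field_simps)
      ultimately have "(\<integral>x. min 1 ((1 / b) * infdist x K) \<partial>M n) \<le> e" using b by simp
      then have "1 - e \<le> measure (M n) (\<Union>x\<in>K. ball x b)"
        by (rule near_compact_if_small_integral[OF M K(2) b(1)])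
      also have "\<dots> \<le> measure (M n) (\<Union>x\<in>K. ball x d)"
      proof -
        note Mn = borel_probD[OF M[of n]]
        show ?thesis
        proof (rule finite_measure.finite_measure_mono[OF Mn(2)])
          show "(\<Union>x\<in>K. ball x b) \<subseteq> (\<Union>x\<in>K. ball x d)"
            using b(3) by (intro UN_mono subset_ball) simp_all
          show "(\<Union>x\<in>K. ball x d) \<in> sets (M n)"
            unfolding Mn(3) by (intro borel_open open_UN ballI open_ball)
        qed
      qed
      finally show ?thesis .
    qed
    then show "\<exists>K N. compact K \<and> (\<forall>n\<ge>N. 1 - e \<le> measure (M n) (\<Union>x\<in>K. ball x d))" using K(1) by blast
  qed
  have conv: "convergent (\<lambda>n. \<integral>x. f x \<partial>M n)" if f: "bl f" for f
  proof -
    obtain L B where LB: "L \<ge> 0" "B > 0" "\<And>x y. \<bar>f x - f y\<bar> \<le> L * dist x y" "\<And>x. \<bar>f x\<bar> \<le> B"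
      using blE[OF f] by metis
    define C where "C = L + 2 * B"
    have C: "C > 0" "L \<le> C" "2 * B \<le> C" using LB by (auto simp: C_def)
    define g where "g x = (f x + B) / C" for x
    have g01: "0 \<le> g x \<and> g x \<le> 1" for x using LB(4)[of x] C by (auto simp: g_def abs_le_iff)
    have lip: "\<bar>g x - g y\<bar> \<le> dist x y" for x y
    proof -
      have "\<bar>g x - g y\<bar> = \<bar>f x - f y\<bar> / C" using C by (simp add: g_def diff_divide_distrib[symmetric] abs_divide)
      also have "\<dots> \<le> L * dist x y / C" using LB(3)[of x y] C by (simp add: divide_right_mono)
      also have "\<dots> \<le> C * dist x y / C" using C by (intro divide_right_mono mult_right_mono) auto
      finally show ?thesis using C by simp
    qed
    have eq: "(\<integral>x. f x \<partial>M n) = C * (\<integral>x. g x \<partial>M n) - B" for n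
    proof -
      have "f x = C * g x - B" for x using C by (simp add: g_def)
      moreover have "bl g" using blI[of g 1 1] lip g01 by (simp add: abs_le_iff)
      ultimately show ?thesis using bl_integrable[OF M] prob
        by (simp add: Bochner_Integration.integral_diff finite_measure.integrable_const[OF borel_probD(2)[OF M]])
    qed
    have "Cauchy (\<lambda>n. \<integral>x. g x \<partial>M n)"
    proof (rule metric_CauchyI)
      fix e :: real assume e: "0 < e"
      have "0 < e / 3" using e by simp
      from cauchy[OF this] obtain N where N: "\<And>n. n \<ge> N \<Longrightarrow> \<bar>(\<integral>x. g x \<partial>M n) - (\<integral>x. g x \<partial>M N)\<bar> \<le> e / 3"
        using lip g01 by metis
      have "dist (\<integral>x. g x \<partial>M i) (\<integral>x. g x \<partial>M j) < e" if "i \<ge> N" "j \<ge> N" for i j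
        using N[OF that(1)] N[OF that(2)] e unfolding dist_real_def by linarith
      then show "\<exists>N. \<forall>i\<ge>N. \<forall>j\<ge>N. dist (\<integral>x. g x \<partial>M i) (\<integral>x. g x \<partial>M j) < e" by blast
    qed
    then have "(\<lambda>n. \<integral>x. g x \<partial>M n) \<longlonglongrightarrow> lim (\<lambda>n. \<integral>x. g x \<partial>M n)"
      using Cauchy_convergent convergent_LIMSEQ_iff by blast
    then have "(\<lambda>n. C * (\<integral>x. g x \<partial>M n) - B) \<longlonglongrightarrow> C * lim (\<lambda>n. \<integral>x. g x \<partial>M n) - B"
      by (intro tendsto_intros)
    then show ?thesis unfolding eq by (rule convergentI)
  qed
  define L where "L f = lim (\<lambda>n. \<integral>x. f x \<partial>M n)" for f :: "'a \<Rightarrow> real"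
  have L: "(\<lambda>n. \<integral>x. f x \<partial>M n) \<longlonglongrightarrow> L f" if "bl f" for f
    unfolding L_def using conv[OF that] by (simp add: convergent_LIMSEQ_iff)
  interpret L: tight_functional L
  proof
    show "L (\<lambda>x. f x + g x) = L f + L g" if "bl f" "bl g" for f g
    proof (rule LIMSEQ_unique[OF L])
      show "(\<lambda>n. \<integral>x. f x + g x \<partial>M n) \<longlonglongrightarrow> L f + L g"
        using tendsto_add[OF L[OF that(1)] L[OF that(2)]]
        by (simp add: bl_integrable[OF M that(1)] bl_integrable[OF M that(2)])
    qed (intro bl_add that)
    show "L (\<lambda>x. c * f x) = c * L f" if "bl f" for f c
    proof (rule LIMSEQ_unique[OF L])
      show "(\<lambda>n. \<integral>x. c * f x \<partial>M n) \<longlonglongrightarrow> c * L f"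
        using tendsto_mult_left[OF L[OF that]] by simp
    qed (intro bl_cmult that)
    show "L f \<le> L g" if "bl f" "bl g" "\<And>x. f x \<le> g x" for f g
      using that by (intro LIMSEQ_le[OF L L]) (auto intro!: exI integral_mono bl_integrable[OF M])
    show "L (\<lambda>_. 1) = 1"
      by (rule LIMSEQ_unique[OF L]) (simp_all only: bl_const prob tendsto_const)
    show "\<exists>K. compact K \<and> (\<forall>f. bl f \<longrightarrow> (\<forall>x. 0 \<le> f x \<and> f x \<le> 1) \<longrightarrow> (\<forall>x\<in>K. f x = 0) \<longrightarrow> L f \<le> e)"
      if e: "0 < e" for e
    proof -
      obtain K where K: "compact K" "\<And>n. 1 - e \<le> measure (M n) K" using tight[OF e] by blast
      have small: "L f \<le> e" if f: "bl f" "\<And>x. 0 \<le> f x \<and> f x \<le> 1" "\<And>x. x \<in> K \<Longrightarrow> f x = 0" for f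
      proof (rule LIMSEQ_le_const2[OF L[OF f(1)]])
        have "(\<integral>x. f x \<partial>M n) \<le> e" for n
        proof -
          note Mn = borel_probD[OF M[of n]]
          interpret Mn: prob_space "M n" by (rule Mn)
          have Km: "K \<in> sets (M n)" using K(1) Mn(3) borel_compact by auto
          have cK: "- K \<in> sets (M n)" using Km Mn(4) by (metis Compl_eq_Diff_UNIV sets.compl_sets)
          have "(\<integral>x. f x \<partial>M n) \<le> (\<integral>x. indicator (- K) x \<partial>M n)"
            using f cK by (intro integral_mono bl_integrable[OF M f(1)])
              (auto simp: Mn.emeasure_eq_measure split: split_indicator)
          also have "\<dots> = 1 - measure (M n) K"
            using Mn.prob_compl[OF Km] Mn(4) by (simp add: Compl_eq_Diff_UNIV)
          finally show ?thesis using K(2)[of n] by linarith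
        qed
        then show "\<exists>N. \<forall>n\<ge>N. (\<integral>x. f x \<partial>M n) \<le> e" by blast
      qed
      show ?thesis
      proof (intro exI[of _ K] conjI allI impI K(1))
        fix f assume f: "bl f" "\<forall>x. 0 \<le> f x \<and> f x \<le> 1" "\<forall>x\<in>K. f x = 0"
        show "L f \<le> e" by (rule small[OF f(1) f(2)[rule_format] f(3)[rule_format]])
      qed
    qed
  qed
  have "(\<lambda>n. \<integral>x. f x \<partial>M n) \<longlonglongrightarrow> (\<integral>x. f x \<partial>L.representing)" if "bl f" for f
    using L[OF that] by (simp only: L.L_eq_integral[OF that])
  with L.borel_prob_representing show ?thesis by blast
qed

section \<open>Gaussian averages\<close>

lemma std_normal_borel_prob: "borel_prob std_normal_distribution"
  using real_dist_normal_dist by (simp add: borel_prob_def real_distribution_def)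

lemma std_normal_symmetric:
  assumes [measurable]: "f \<in> borel_measurable borel"
  shows "(\<integral>\<^sup>+z. f (- z) \<partial>std_normal_distribution) = (\<integral>\<^sup>+z. f z \<partial>std_normal_distribution)"
proof -
  have "(\<integral>\<^sup>+z. f z \<partial>std_normal_distribution) = (\<integral>\<^sup>+z. ennreal (std_normal_density z) * f z \<partial>lborel)"
    by (subst nn_integral_density) simp_all
  also have "\<dots> = (\<integral>\<^sup>+z. ennreal (std_normal_density z) * f z \<partial>distr lborel borel uminus)"
    by (simp only: lborel_distr_uminus)
  also have "\<dots> = (\<integral>\<^sup>+z. ennreal (std_normal_density (- z)) * f (- z) \<partial>lborel)"
    by (subst nn_integral_distr) simp_all
  also have "\<dots> = (\<integral>\<^sup>+z. f (- z) \<partial>std_normal_distribution)"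
    by (subst nn_integral_density) (simp_all add: normal_density_def)
  finally show ?thesis by simp
qed

lemma std_normal_second_moment: "(\<integral>\<^sup>+z. ennreal (z\<^sup>2) \<partial>std_normal_distribution) = 1"
proof -
  have "(\<integral>z. z\<^sup>2 \<partial>std_normal_distribution) = 1" "integrable std_normal_distribution (\<lambda>z. z\<^sup>2)"
    using std_normal_distribution_even_moments[of 1] by simp_all
  then show ?thesis by (subst nn_integral_eq_integral) auto
qed

definition gauss_line :: "'h::real_normed_vector \<Rightarrow> 'h measure" where
  "gauss_line v = distr std_normal_distribution borel (\<lambda>z. z *\<^sub>R v)"

lemma borel_prob_gauss_line:
  "borel_prob (gauss_line v :: 'h::{real_normed_vector, second_countable_topology} measure)"
  unfolding gauss_line_def by (rule borel_prob_distr[OF std_normal_borel_prob]) simp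

text \<open>
  The centred Gaussian law with covariance \<open>c\<close> times the projection to the first \<open>n\<close> basis vectors.
\<close>

primrec gauss :: "real \<Rightarrow> nat \<Rightarrow> 'h::real_inner measure" where
  "gauss c 0 = dirac 0"
| "gauss c (Suc n) = gauss c n \<^bold>* gauss_line (sqrt c *\<^sub>R onb n)"

lemma borel_prob_gauss [simp]:
  "borel_prob (gauss c n :: 'h::{real_inner, second_countable_topology} measure)"
  by (induction n) (simp_all add: borel_prob_conv borel_prob_gauss_line)

lemma char_fun_gauss_line:
  fixes v :: "'h::{real_inner, second_countable_topology}"
  shows "char_fun (gauss_line v) x = of_real (exp (- ((v \<bullet> x)\<^sup>2 / 2)))"
proof -
  have "char_fun (gauss_line v) x = char std_normal_distribution (v \<bullet> x)"
    unfolding char_fun_def gauss_line_def char_def by (subst integral_distr) (simp_all add: mult.commute)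
  then show ?thesis by (simp add: char_std_normal_distribution)
qed

lemma char_fun_gauss:
  fixes x :: "'h::{real_inner, second_countable_topology}"
  assumes c: "0 \<le> c"
  shows "char_fun (gauss c n) x = of_real (exp (- (c / 2 * (norm (onb_proj n x))\<^sup>2)))"
proof (induction n)
  case 0
  then show ?case by (simp add: char_fun_dirac onb_proj_def)
next
  case (Suc n)
  have "exp (- (c / 2 * (norm (onb_proj (Suc n) x))\<^sup>2))
      = exp (- (c / 2 * (norm (onb_proj n x))\<^sup>2)) * exp (- ((sqrt c *\<^sub>R onb n \<bullet> x)\<^sup>2 / 2))"
    using c by (simp add: norm_onb_proj exp_add[symmetric] algebra_simps power_mult_distrib inner_commute)
  then show ?case
    by (simp only: gauss.simps char_fun_conv[OF borel_prob_gauss borel_prob_gauss_line] Suc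
        char_fun_gauss_line of_real_mult)
qed

text \<open>
  Add the coordinates one by one. By the symmetry of the new coordinate, the integrand may be replaced
  by its average over both signs, and the parallelogram identity splits this average.
\<close>

lemma gauss_quadratic_form:
  fixes q :: "'h::{real_inner, second_countable_topology} \<Rightarrow> real"
  assumes q [measurable]: "q \<in> borel_measurable borel" and q0: "\<And>x. 0 \<le> q x"
    and par: "\<And>x y. q (x + y) + q (x - y) = 2 * q x + 2 * q y"
    and hom: "\<And>r x. q (r *\<^sub>R x) = r\<^sup>2 * q x" and c: "0 \<le> c"
  shows "(\<integral>\<^sup>+\<xi>. ennreal (q \<xi>) \<partial>gauss c n) = (\<Sum>i<n. ennreal (c * q (onb i)))"
proof (induction n)
  case 0
  have "q 0 = 0" using hom[of 0 0] by simp
  then show ?case by (simp add: nn_integral_return)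
next
  case (Suc n)
  define v where "v = sqrt c *\<^sub>R (onb n :: 'h)"
  let ?G = "gauss c n :: 'h measure" and ?N = std_normal_distribution
  interpret G: prob_space ?G using borel_probD[OF borel_prob_gauss] by blast
  interpret N: prob_space ?N using borel_probD[OF std_normal_borel_prob] by blast
  have [measurable_cong]: "sets ?G = sets borel" using borel_probD[OF borel_prob_gauss] by blast
  define I where "I s = (\<integral>\<^sup>+x. \<integral>\<^sup>+z. ennreal (q (x + (s * z) *\<^sub>R v)) \<partial>?N \<partial>?G)" for s
  have I1: "(\<integral>\<^sup>+\<xi>. ennreal (q \<xi>) \<partial>gauss c (Suc n)) = I 1"
    unfolding I_def gauss.simps v_def[symmetric]
    by (subst nn_integral_conv[OF borel_prob_gauss borel_prob_gauss_line])
      (simp_all add: gauss_line_def nn_integral_distr)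
  have "I 1 = I (-1)"
    unfolding I_def
  proof (rule nn_integral_cong)
    fix x
    show "(\<integral>\<^sup>+z. ennreal (q (x + (1 * z) *\<^sub>R v)) \<partial>?N) = (\<integral>\<^sup>+z. ennreal (q (x + (- 1 * z) *\<^sub>R v)) \<partial>?N)"
      using std_normal_symmetric[of "\<lambda>z. ennreal (q (x + z *\<^sub>R v))"] by simp
  qed
  then have "I 1 + I 1 = I 1 + I (-1)" by simp
  also have "\<dots> = (\<integral>\<^sup>+x. \<integral>\<^sup>+z. ennreal (q (x + z *\<^sub>R v)) + ennreal (q (x - z *\<^sub>R v)) \<partial>?N \<partial>?G)"
    unfolding I_def by (simp add: nn_integral_add)
  also have "\<dots> = (\<integral>\<^sup>+x. \<integral>\<^sup>+z. 2 * ennreal (q x) + 2 * ennreal (q v) * ennreal (z\<^sup>2) \<partial>?N \<partial>?G)"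
  proof (intro nn_integral_cong)
    fix x z
    have "ennreal (q (x + z *\<^sub>R v)) + ennreal (q (x - z *\<^sub>R v)) = ennreal (2 * q x + 2 * q v * z\<^sup>2)"
      using q0 by (simp add: par hom mult_ac flip: ennreal_plus)
    also have "\<dots> = 2 * ennreal (q x) + 2 * ennreal (q v) * ennreal (z\<^sup>2)"
      using q0[of x] q0[of v] by (simp add: ennreal_plus ennreal_mult)
    finally show "ennreal (q (x + z *\<^sub>R v)) + ennreal (q (x - z *\<^sub>R v)) = 2 * ennreal (q x) + 2 * ennreal (q v) * ennreal (z\<^sup>2)" .
  qed
  also have "\<dots> = (\<integral>\<^sup>+x. 2 * ennreal (q x) + 2 * ennreal (q v) \<partial>?G)"
    using N.emeasure_space_1
    by (simp add: nn_integral_add nn_integral_cmult std_normal_second_moment)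
  also have "\<dots> = 2 * (\<integral>\<^sup>+x. ennreal (q x) \<partial>?G) + 2 * ennreal (q v)"
    using G.emeasure_space_1 by (simp add: nn_integral_add nn_integral_cmult)
  finally have "2 * I 1 = 2 * ((\<integral>\<^sup>+x. ennreal (q x) \<partial>?G) + ennreal (q v))"
    unfolding distrib_left mult_2[of "I 1"] .
  then have "I 1 = (\<integral>\<^sup>+x. ennreal (q x) \<partial>?G) + ennreal (q v)"
    by (subst (asm) ennreal_mult_cancel_left) auto
  moreover have "q v = c * q (onb n)" using c by (simp add: v_def hom)
  ultimately show ?case unfolding I1 using Suc by simp
qed

lemma prob_integral_abs_le:
  fixes f :: "'a \<Rightarrow> real"
  assumes "prob_space M" "\<And>x. \<bar>f x\<bar> \<le> B"
  shows "\<bar>\<integral>x. f x \<partial>M\<bar> \<le> B"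
proof (cases "integrable M f")
  case True
  interpret prob_space M by fact
  have "\<bar>\<integral>x. f x \<partial>M\<bar> \<le> (\<integral>x. \<bar>f x\<bar> \<partial>M)" by (rule integral_abs_bound)
  also have "\<dots> \<le> B" using True assms(2) by (intro integral_le_const) auto
  finally show ?thesis .
next
  case False
  then show ?thesis using order_trans[OF abs_ge_zero assms(2)] by (simp add: not_integrable_integral_eq)
qed

lemma integral_swap_bounded:
  fixes f :: "'a::{second_countable_topology} \<Rightarrow> 'b::{second_countable_topology} \<Rightarrow> real"
  assumes M: "borel_prob M" and N: "borel_prob N"
    and f: "(\<lambda>(x, y). f x y) \<in> borel_measurable (borel \<Otimes>\<^sub>M borel)" and B: "\<And>x y. \<bar>f x y\<bar> \<le> B"
  shows "(\<integral>x. \<integral>y. f x y \<partial>N \<partial>M) = (\<integral>y. \<integral>x. f x y \<partial>M \<partial>N)"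
proof -
  note M' = borel_probD[OF M] and N' = borel_probD[OF N]
  interpret M: prob_space M by (rule M')
  interpret N: prob_space N by (rule N')
  interpret P: pair_prob_space M N ..
  have "(\<lambda>(x, y). f x y) \<in> borel_measurable (M \<Otimes>\<^sub>M N)"
    using f by (simp add: measurable_cong_sets[OF sets_pair_measure_cong[OF M'(3) N'(3)] refl])
  then have "integrable (M \<Otimes>\<^sub>M N) (\<lambda>(x, y). f x y)"
    using B by (intro P.integrable_const_bound[where B=B]) auto
  then show ?thesis by (rule P.Fubini_integral[symmetric])
qed

subsection \<open>The average of \<open>1 - cos\<close> and its second moment\<close>

text \<open>
  The characteristic function of \<^const>\<open>gauss\<close>, as a real function.
\<close>

definition damp :: "real \<Rightarrow> nat \<Rightarrow> 'h::real_inner \<Rightarrow> real" where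
  "damp c n x = exp (- (c / 2 * (norm (onb_proj n x))\<^sup>2))"

lemma damp_bounds: "0 \<le> c \<Longrightarrow> 0 < damp c n x \<and> damp c n x \<le> 1"
  by (simp add: damp_def)

lemma onb_proj_measurable [measurable]:
  "onb_proj n \<in> borel_measurable (borel :: 'h::{real_inner, second_countable_topology} measure)"
  unfolding onb_proj_def[abs_def] by measurable

lemma damp_measurable [measurable]:
  "damp c n \<in> borel_measurable (borel :: 'h::{real_inner, second_countable_topology} measure)"
  unfolding damp_def[abs_def] by measurable

context
  fixes c :: real and n :: nat and \<gamma> :: "'h::{real_inner, second_countable_topology} measure"
  assumes c: "0 \<le> c" and \<gamma>: "\<gamma> = gauss c n"
begin

lemma gauss_prob: "borel_prob \<gamma>" by (simp add: \<gamma>)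

lemma gauss_cos: "(\<integral>\<xi>. cos (\<xi> \<bullet> x) \<partial>\<gamma>) = damp c n x"
proof -
  note g = borel_probD[OF gauss_prob]
  have "damp c n x = Re (char_fun \<gamma> x)" unfolding \<gamma> char_fun_gauss[OF c] damp_def by simp
  also have "\<dots> = (\<integral>\<xi>. cos (\<xi> \<bullet> x) \<partial>\<gamma>)"
    unfolding char_fun_def by (subst integral_Re[symmetric, OF char_fun_integrable[OF g(2,3)]]) (simp add: Re_exp)
  finally show ?thesis ..
qed

lemma gauss_integrable_cos: "integrable \<gamma> (\<lambda>\<xi>. cos (\<xi> \<bullet> x))"
  using borel_probD[OF gauss_prob] by (intro integrable_bounded_borel[where B=1]) auto

lemma gauss_measure: "measure \<gamma> (space \<gamma>) = 1" "measure \<gamma> UNIV = 1"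
  using prob_space.prob_space[OF borel_probD(1)[OF gauss_prob]] borel_probD(4)[OF gauss_prob] by simp_all

lemma gauss_const: "(\<integral>\<xi>. a \<partial>\<gamma>) = (a :: real)" "integrable \<gamma> (\<lambda>_. a)"
  using finite_measure.integrable_const[OF borel_probD(2)[OF gauss_prob]]
  by (simp_all add: gauss_measure)

lemma gauss_one_minus_cos: "(\<integral>\<xi>. 1 - cos (\<xi> \<bullet> x) \<partial>\<gamma>) = 1 - damp c n x"
  by (simp add: gauss_integrable_cos gauss_const(2) gauss_measure gauss_cos)

text \<open>
  With \<open>w = damp c n x\<close> the left side is \<open>3/2 - 2 w + w^4 / 2\<close>, which is divisible by \<open>(1 - w)\<^sup>2\<close>.
\<close>

lemma gauss_one_minus_cos_square: "(\<integral>\<xi>. (1 - cos (\<xi> \<bullet> x))\<^sup>2 \<partial>\<gamma>) \<le> 3 * (1 - damp c n x)\<^sup>2"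
proof -
  define w where "w = damp c n x"
  have w: "0 < w" "w \<le> 1" using damp_bounds[OF c] by (auto simp: w_def)
  have two: "damp c n (2 *\<^sub>R x) = w ^ 4"
  proof -
    have "onb_proj n (2 *\<^sub>R x) = 2 *\<^sub>R onb_proj n x" by (simp add: onb_proj_def scaleR_sum_right)
    then show ?thesis by (simp add: w_def damp_def power_mult_distrib flip: exp_of_nat_mult)
  qed
  have "(1 - cos (\<xi> \<bullet> x))\<^sup>2 = 3/2 - 2 * cos (\<xi> \<bullet> x) + (1/2) * cos (\<xi> \<bullet> (2 *\<^sub>R x))" for \<xi>
  proof -
    have "cos (\<xi> \<bullet> (2 *\<^sub>R x)) = 2 * (cos (\<xi> \<bullet> x))\<^sup>2 - 1"
      by (metis cos_double_cos inner_scaleR_right)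
    then show ?thesis by (simp add: power2_eq_square algebra_simps del: inner_scaleR_right)
  qed
  then have "(\<integral>\<xi>. (1 - cos (\<xi> \<bullet> x))\<^sup>2 \<partial>\<gamma>) = (\<integral>\<xi>. 3/2 - 2 * cos (\<xi> \<bullet> x) + (1/2) * cos (\<xi> \<bullet> (2 *\<^sub>R x)) \<partial>\<gamma>)"
    by (simp only:)
  also have "\<dots> = 3/2 - 2 * w + (1/2) * w ^ 4"
    using gauss_integrable_cos[of x] gauss_integrable_cos[of "2 *\<^sub>R x"]
    by (simp add: gauss_const(2) gauss_measure gauss_cos two del: inner_scaleR_right) (simp add: w_def)
  also have "\<dots> = (1 - w)\<^sup>2 * ((w\<^sup>2 + 2 * w + 3) / 2)"
    by (simp add: power2_eq_square power4_eq_xxxx field_simps)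
  also have "\<dots> \<le> (1 - w)\<^sup>2 * 3"
  proof (rule mult_left_mono)
    have "w\<^sup>2 \<le> 1" using w by (simp add: power_le_one)
    then show "(w\<^sup>2 + 2 * w + 3) / 2 \<le> 3" using w by simp
  qed simp
  finally show ?thesis by (simp add: w_def)
qed

text \<open>
  Cauchy--Schwarz in the form \<open>2 u v \<le> \<alpha> u\<^sup>2 + v\<^sup>2 / \<alpha>\<close> with the optimal \<open>\<alpha>\<close>. If the average of
  \<open>1 - cos (\<xi> \<bullet> x)\<close> vanishes, then so does the average of its square.
\<close>

lemma gauss_one_minus_cos_product:
  "(\<integral>\<xi>. (1 - cos (\<xi> \<bullet> x)) * (1 - cos (\<xi> \<bullet> y)) \<partial>\<gamma>) \<le> 3 * (1 - damp c n x) * (1 - damp c n y)"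
proof -
  note g = borel_probD[OF gauss_prob]
  define a where "a z = 1 - damp c n z" for z :: 'h
  define q where "q z \<xi> = 1 - cos (\<xi> \<bullet> z)" for z \<xi> :: 'h
  have a0: "0 \<le> a z" for z using damp_bounds[OF c, of n z] by (simp add: a_def)
  have q02: "0 \<le> q z \<xi>" "q z \<xi> \<le> 2" for z \<xi>
    unfolding q_def using cos_le_one[of "\<xi> \<bullet> z"] cos_ge_minus_one[of "\<xi> \<bullet> z"] by linarith+
  have q2: "\<bar>(q z \<xi>)\<^sup>2\<bar> \<le> 4" for z \<xi> using q02 power_mono[of "q z \<xi>" 2 2] by simp
  have int1: "integrable \<gamma> (\<lambda>\<xi>. (q z \<xi>)\<^sup>2)" for z
    by (rule integrable_bounded_borel[OF g(2,3), where B=4]) (use q2 in \<open>simp_all add: q_def\<close>)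
  have int2: "integrable \<gamma> (\<lambda>\<xi>. q z \<xi> * q u \<xi>)" for z u
  proof (rule integrable_bounded_borel[OF g(2,3), where B=4])
    show "norm (q z \<xi> * q u \<xi>) \<le> 4" for \<xi>
      using mult_mono[OF q02(2) q02(2), of u \<xi> z \<xi>] q02(1) by (simp add: abs_mult mult.commute)
  qed (simp add: q_def)
  have sq: "(\<integral>\<xi>. (q z \<xi>)\<^sup>2 \<partial>\<gamma>) \<le> 3 * (a z)\<^sup>2" for z
    unfolding q_def a_def by (rule gauss_one_minus_cos_square)
  have am: "(\<integral>\<xi>. q x \<xi> * q y \<xi> \<partial>\<gamma>) \<le> (\<alpha> * (3 * (a x)\<^sup>2) + (1 / \<alpha>) * (3 * (a y)\<^sup>2)) / 2" if \<alpha>: "0 < \<alpha>" for \<alpha>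
  proof -
    have "q x \<xi> * q y \<xi> \<le> (\<alpha> * (q x \<xi>)\<^sup>2 + (1 / \<alpha>) * (q y \<xi>)\<^sup>2) / 2" for \<xi>
    proof -
      have "0 \<le> (\<alpha> * q x \<xi> - q y \<xi>)\<^sup>2 / \<alpha>" using \<alpha> by simp
      also have "\<dots> = \<alpha> * (q x \<xi>)\<^sup>2 + (1 / \<alpha>) * (q y \<xi>)\<^sup>2 - 2 * (q x \<xi> * q y \<xi>)"
        using \<alpha> by (simp add: power2_eq_square field_simps)
      finally show ?thesis by simp
    qed
    then have "(\<integral>\<xi>. q x \<xi> * q y \<xi> \<partial>\<gamma>) \<le> (\<integral>\<xi>. (\<alpha> * (q x \<xi>)\<^sup>2 + (1 / \<alpha>) * (q y \<xi>)\<^sup>2) / 2 \<partial>\<gamma>)"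
      by (intro integral_mono int2) (auto intro!: integrable_divide integrable_add integrable_mult_right int1)
    also have "\<dots> = (\<alpha> * (\<integral>\<xi>. (q x \<xi>)\<^sup>2 \<partial>\<gamma>) + (1 / \<alpha>) * (\<integral>\<xi>. (q y \<xi>)\<^sup>2 \<partial>\<gamma>)) / 2"
      using int1 by simp
    also have "\<dots> \<le> (\<alpha> * (3 * (a x)\<^sup>2) + (1 / \<alpha>) * (3 * (a y)\<^sup>2)) / 2"
      using \<alpha> by (intro divide_right_mono add_mono mult_left_mono sq) auto
    finally show ?thesis .
  qed
  have null: "(\<integral>\<xi>. q x \<xi> * q y \<xi> \<partial>\<gamma>) \<le> 0" if z: "z \<in> {x, y}" "a z = 0" for z
  proof -
    have "(\<integral>\<xi>. q z \<xi> \<partial>\<gamma>) = 0" using z(2) gauss_one_minus_cos[of z] by (simp add: q_def a_def)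
    moreover have "(\<integral>\<xi>. q x \<xi> * q y \<xi> \<partial>\<gamma>) \<le> (\<integral>\<xi>. 2 * q z \<xi> \<partial>\<gamma>)"
    proof (rule integral_mono[OF int2])
      show "integrable \<gamma> (\<lambda>\<xi>. 2 * q z \<xi>)" unfolding q_def by (simp add: gauss_integrable_cos gauss_const(2))
      show "q x \<xi> * q y \<xi> \<le> 2 * q z \<xi>" for \<xi>
        using z(1) mult_right_mono[OF q02(2)[of x \<xi>] q02(1)[of y \<xi>]]
          mult_left_mono[OF q02(2)[of y \<xi>] q02(1)[of x \<xi>]] by auto
    qed
    ultimately show ?thesis by simp
  qed
  show ?thesis
  proof (cases "a x = 0 \<or> a y = 0")
    case True
    then have "(\<integral>\<xi>. q x \<xi> * q y \<xi> \<partial>\<gamma>) \<le> 0" using null[of x] null[of y] by auto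
    with True show ?thesis by (auto simp: q_def a_def)
  next
    case False
    then have pos: "0 < a x" "0 < a y" using a0[of x] a0[of y] by auto
    have "(\<integral>\<xi>. q x \<xi> * q y \<xi> \<partial>\<gamma>) \<le> (a y / a x * (3 * (a x)\<^sup>2) + (1 / (a y / a x)) * (3 * (a y)\<^sup>2)) / 2"
      using pos by (intro am) simp
    also have "\<dots> = 3 * a x * a y" using pos by (simp add: power2_eq_square field_simps)
    finally show ?thesis by (simp add: q_def a_def)
  qed
qed

text \<open>
  Integrating the product estimate against \<open>\<rho>\<close> in both variables bounds the second moment of the random
  variable \<open>A\<close> by the square of its mean, with a constant that depends neither on \<open>\<rho>\<close> nor on the dimension.
\<close>

lemma gauss_second_moment:
  fixes \<rho> :: "'h measure"
  assumes \<rho>: "borel_prob \<rho>"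
  defines "A \<equiv> \<lambda>\<xi>. \<integral>x. 1 - cos (\<xi> \<bullet> x) \<partial>\<rho>"
  shows "(\<integral>\<xi>. A \<xi> \<partial>\<gamma>) = (\<integral>x. 1 - damp c n x \<partial>\<rho>)"
    and "(\<integral>\<xi>. (A \<xi>)\<^sup>2 \<partial>\<gamma>) \<le> 3 * (\<integral>\<xi>. A \<xi> \<partial>\<gamma>)\<^sup>2"
proof -
  note r = borel_probD[OF \<rho>]
  interpret \<rho>: prob_space \<rho> by (rule r)
  let ?q = "\<lambda>\<xi> x :: 'h. 1 - cos (\<xi> \<bullet> x)"
  let ?a = "\<lambda>x :: 'h. 1 - damp c n x"
  have q02: "0 \<le> ?q \<xi> x" "?q \<xi> x \<le> 2" for \<xi> x
    using cos_le_one[of "\<xi> \<bullet> x"] cos_ge_minus_one[of "\<xi> \<bullet> x"] by linarith+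
  have a01: "0 \<le> ?a x" "?a x \<le> 1" for x using damp_bounds[OF c, of n x] by auto
  have int_a: "integrable \<rho> ?a"
    using a01 by (intro integrable_bounded_borel[OF r(2,3), where B=1]) auto
  show first: "(\<integral>\<xi>. A \<xi> \<partial>\<gamma>) = (\<integral>x. ?a x \<partial>\<rho>)"
    unfolding A_def gauss_one_minus_cos[symmetric]
    using q02 by (intro integral_swap_bounded[where B=2] gauss_prob \<rho>) auto
  have sq: "(A \<xi>)\<^sup>2 = (\<integral>x. \<integral>y. ?q \<xi> x * ?q \<xi> y \<partial>\<rho> \<partial>\<rho>)" for \<xi>
    unfolding A_def power2_eq_square by simp
  have q4: "\<bar>?q \<xi> x * ?q \<xi> y\<bar> \<le> 4" for \<xi> x y
    using mult_mono[OF q02(2) q02(2), of \<xi> x \<xi> y] q02(1) by (simp add: abs_mult mult.commute)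
  have bnd: "\<bar>\<integral>y. ?q \<xi> x * ?q \<xi> y \<partial>\<rho>\<bar> \<le> 4" for \<xi> x
    by (rule prob_integral_abs_le[OF r(1) q4])
  have [measurable_cong]: "sets \<rho> = sets borel" by (rule r)
  have "(\<integral>\<xi>. (A \<xi>)\<^sup>2 \<partial>\<gamma>) = (\<integral>\<xi>. \<integral>x. \<integral>y. ?q \<xi> x * ?q \<xi> y \<partial>\<rho> \<partial>\<rho> \<partial>\<gamma>)" by (simp only: sq)
  also have "\<dots> = (\<integral>x. \<integral>\<xi>. \<integral>y. ?q \<xi> x * ?q \<xi> y \<partial>\<rho> \<partial>\<gamma> \<partial>\<rho>)"
    using bnd by (intro integral_swap_bounded[where B=4] gauss_prob \<rho>) simp_all
  also have "\<dots> = (\<integral>x. \<integral>y. \<integral>\<xi>. ?q \<xi> x * ?q \<xi> y \<partial>\<gamma> \<partial>\<rho> \<partial>\<rho>)"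
    using q4 by (intro Bochner_Integration.integral_cong refl integral_swap_bounded[where B=4] gauss_prob \<rho>) simp_all
  finally have step: "(\<integral>\<xi>. (A \<xi>)\<^sup>2 \<partial>\<gamma>) = (\<integral>x. \<integral>y. \<integral>\<xi>. ?q \<xi> x * ?q \<xi> y \<partial>\<gamma> \<partial>\<rho> \<partial>\<rho>)" .
  have prodeq: "(\<integral>y. 3 * ?a x * ?a y \<partial>\<rho>) = (3 * (\<integral>y. ?a y \<partial>\<rho>)) * ?a x" for x
    by (subst integral_mult_right_zero) (simp only: mult_ac)
  have "(\<integral>x. \<integral>y. \<integral>\<xi>. ?q \<xi> x * ?q \<xi> y \<partial>\<gamma> \<partial>\<rho> \<partial>\<rho>) \<le> (\<integral>x. \<integral>y. 3 * ?a x * ?a y \<partial>\<rho> \<partial>\<rho>)"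
  proof -
    have [measurable_cong]: "sets \<gamma> = sets borel" by (rule borel_probD[OF gauss_prob])
    interpret \<gamma>: prob_space \<gamma> by (rule borel_probD[OF gauss_prob])
    have g4: "\<bar>\<integral>\<xi>. ?q \<xi> x * ?q \<xi> y \<partial>\<gamma>\<bar> \<le> 4" for x y
      by (rule prob_integral_abs_le[OF \<gamma>.prob_space_axioms q4])
    have i1: "integrable \<rho> (\<lambda>y. \<integral>\<xi>. ?q \<xi> x * ?q \<xi> y \<partial>\<gamma>)" for x
      using g4 by (intro integrable_bounded_borel[OF r(2,3), where B=4]) simp_all
    have in1: "(\<integral>y. \<integral>\<xi>. ?q \<xi> x * ?q \<xi> y \<partial>\<gamma> \<partial>\<rho>) \<le> (\<integral>y. 3 * ?a x * ?a y \<partial>\<rho>)" for x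
      by (intro integral_mono i1 integrable_mult_right int_a gauss_one_minus_cos_product)
    have g4': "\<bar>\<integral>y. \<integral>\<xi>. ?q \<xi> x * ?q \<xi> y \<partial>\<gamma> \<partial>\<rho>\<bar> \<le> 4" for x
      by (rule prob_integral_abs_le[OF r(1) g4])
    show ?thesis
    proof (rule integral_mono)
      show "integrable \<rho> (\<lambda>x. \<integral>y. \<integral>\<xi>. ?q \<xi> x * ?q \<xi> y \<partial>\<gamma> \<partial>\<rho>)"
        using g4' by (intro integrable_bounded_borel[OF r(2,3), where B=4]) simp_all
      show "integrable \<rho> (\<lambda>x. \<integral>y. 3 * ?a x * ?a y \<partial>\<rho>)"
        unfolding prodeq by (intro integrable_mult_right int_a)
    qed (rule in1)
  qed
  also have "\<dots> = 3 * (\<integral>x. ?a x \<partial>\<rho>)\<^sup>2"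
    unfolding prodeq by (subst integral_mult_right_zero) (simp only: power2_eq_square mult_ac)
  finally have "(\<integral>x. \<integral>y. \<integral>\<xi>. ?q \<xi> x * ?q \<xi> y \<partial>\<gamma> \<partial>\<rho> \<partial>\<rho>) \<le> 3 * (\<integral>x. ?a x \<partial>\<rho>)\<^sup>2" .
  with step show "(\<integral>\<xi>. (A \<xi>)\<^sup>2 \<partial>\<gamma>) \<le> 3 * (\<integral>\<xi>. A \<xi> \<partial>\<gamma>)\<^sup>2" by (simp only: first)
qed

end

section \<open>Infinitely divisible laws under Gaussian averaging\<close>

definition symm :: "'h::real_normed_vector measure \<Rightarrow> 'h measure" where
  "symm M = M \<^bold>* distr M borel uminus"

context
  fixes M :: "'h::{real_inner, second_countable_topology} measure"
  assumes M: "borel_prob M"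
begin

lemma borel_prob_uminus: "borel_prob (distr M borel uminus)"
  by (rule borel_prob_distr[OF M]) simp

lemma borel_prob_symm: "borel_prob (symm M)"
  unfolding symm_def by (rule borel_prob_conv[OF M borel_prob_uminus])

lemma char_fun_uminus: "char_fun (distr M borel uminus) \<xi> = cnj (char_fun M \<xi>)"
proof -
  have [measurable_cong]: "sets M = sets borel" using borel_probD[OF M] by blast
  have "char_fun (distr M borel uminus) \<xi> = (CLINT x|M. cnj (iexp (x \<bullet> \<xi>)))"
    unfolding char_fun_def by (subst integral_distr) (simp_all add: exp_cnj)
  then show ?thesis by (simp add: char_fun_def)
qed

lemma char_fun_symm: "char_fun (symm M) \<xi> = of_real ((norm (char_fun M \<xi>))\<^sup>2)"
  unfolding symm_def char_fun_conv[OF M borel_prob_uminus] char_fun_uminus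
  by (metis complex_norm_square)

lemma integral_one_minus_cos: "(\<integral>x. 1 - cos (\<xi> \<bullet> x) \<partial>M) = 1 - Re (char_fun M \<xi>)"
proof -
  note M' = borel_probD[OF M]
  have int: "integrable M (\<lambda>x. cos (\<xi> \<bullet> x))"
    by (rule integrable_bounded_borel[OF M'(2,3), where B=1]) simp_all
  have "Re (char_fun M \<xi>) = (\<integral>x. Re (iexp (x \<bullet> \<xi>)) \<partial>M)"
    unfolding char_fun_def by (rule integral_Re[symmetric, OF char_fun_integrable[OF M'(2,3)]])
  also have "\<dots> = (\<integral>x. cos (\<xi> \<bullet> x) \<partial>M)" by (simp add: Re_exp inner_commute)
  moreover have "measure M UNIV = 1" using prob_space.prob_space[OF M'(1)] M'(4) by simp
  ultimately show ?thesis
    using int by (subst Bochner_Integration.integral_diff)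
      (simp_all add: finite_measure.integrable_const[OF M'(2)] M'(4))
qed

lemma borel_prob_conv_power: "borel_prob (conv_power M n)"
  by (induction n) (simp_all add: borel_prob_conv M)

lemma char_fun_conv_power: "char_fun (conv_power M n) \<xi> = char_fun M \<xi> ^ n"
  by (induction n) (simp_all add: char_fun_dirac char_fun_conv M borel_prob_conv_power)

end

lemma exp_minus_le_quadratic:
  fixes x :: real
  assumes "0 \<le> x"
  shows "exp (- x) \<le> 1 - x + x\<^sup>2 / 2"
proof -
  have pos: "0 < 1 + x + x\<^sup>2 / 2" using assms by (simp add: add_pos_nonneg)
  have "exp (- x) = inverse (exp x)" by (rule exp_minus)
  also have "\<dots> \<le> inverse (1 + x + x\<^sup>2 / 2)"
    using exp_lower_Taylor_quadratic[OF assms] pos by (intro le_imp_inverse_le)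
  also have "\<dots> \<le> 1 - x + x\<^sup>2 / 2"
  proof -
    have "1 \<le> (1 - x + x\<^sup>2 / 2) * (1 + x + x\<^sup>2 / 2)"
      using assms by (simp add: algebra_simps power2_eq_square)
    then show ?thesis using pos by (simp add: field_simps)
  qed
  finally show ?thesis .
qed

text \<open>
  A reverse Jensen inequality: once the second moment is controlled by the squared mean, a mean of
  \<open>1 - exp (- A)\<close> below \<open>1/6\<close> forces a mean of \<open>A\<close> below \<open>1/3\<close>. Otherwise one may replace \<open>A\<close> by
  \<open>\<theta> A\<close> with \<open>\<theta> = 1 / (3 \<integral> A) \<le> 1\<close> and use \<open>1 - exp (- x) \<ge> x - x\<^sup>2 / 2\<close>.
\<close>

lemma mean_bound_from_laplace:
  fixes A :: "'a::topological_space \<Rightarrow> real"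
  assumes \<gamma>: "borel_prob \<gamma>" and A: "A \<in> borel_measurable borel" "\<And>x. 0 \<le> A x" "\<And>x. A x \<le> B"
    and second: "(\<integral>x. (A x)\<^sup>2 \<partial>\<gamma>) \<le> 3 * (\<integral>x. A x \<partial>\<gamma>)\<^sup>2"
    and small: "(\<integral>x. 1 - exp (- A x) \<partial>\<gamma>) < 1 / 6"
  shows "(\<integral>x. A x \<partial>\<gamma>) < 1 / 3"
proof (rule ccontr)
  note g = borel_probD[OF \<gamma>]
  define \<mu> where "\<mu> = (\<integral>x. A x \<partial>\<gamma>)"
  assume "\<not> (\<integral>x. A x \<partial>\<gamma>) < 1 / 3"
  then have \<mu>: "1 / 3 \<le> \<mu>" by (simp add: \<mu>_def)
  define \<theta> where "\<theta> = 1 / (3 * \<mu>)"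
  have \<theta>: "0 < \<theta>" "\<theta> \<le> 1" "\<theta> * \<mu> = 1 / 3" using \<mu> by (auto simp: \<theta>_def field_simps)
  have iA: "integrable \<gamma> A"
    using A by (intro integrable_bounded_borel[OF g(2,3), where B=B]) auto
  have iA2: "integrable \<gamma> (\<lambda>x. (A x)\<^sup>2)"
  proof (rule integrable_bounded_borel[OF g(2,3), where B="B\<^sup>2"])
    show "norm ((A x)\<^sup>2) \<le> B\<^sup>2" for x using power_mono[OF A(3,2), of x 2] by simp
  qed (use A(1) in measurable)
  have ie: "integrable \<gamma> (\<lambda>x. 1 - exp (- A x))"
  proof (rule integrable_bounded_borel[OF g(2,3), where B=1])
    show "norm (1 - exp (- A x)) \<le> 1" for x using A(2)[of x] by simp
  qed (use A(1) in measurable)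
  have "\<theta> * A x - \<theta>\<^sup>2 / 2 * (A x)\<^sup>2 \<le> 1 - exp (- A x)" for x
  proof -
    have "exp (- A x) \<le> exp (- (\<theta> * A x))" using \<theta> A(2)[of x] by (simp add: mult_left_le_one_le)
    also have "\<dots> \<le> 1 - \<theta> * A x + (\<theta> * A x)\<^sup>2 / 2"
      using \<theta> A(2)[of x] by (intro exp_minus_le_quadratic) simp
    finally show ?thesis by (simp add: power_mult_distrib)
  qed
  then have "(\<integral>x. \<theta> * A x - \<theta>\<^sup>2 / 2 * (A x)\<^sup>2 \<partial>\<gamma>) \<le> (\<integral>x. 1 - exp (- A x) \<partial>\<gamma>)"
    by (intro integral_mono ie Bochner_Integration.integrable_diff integrable_mult_right iA iA2)
  also have "(\<integral>x. \<theta> * A x - \<theta>\<^sup>2 / 2 * (A x)\<^sup>2 \<partial>\<gamma>) = \<theta> * \<mu> - \<theta>\<^sup>2 / 2 * (\<integral>x. (A x)\<^sup>2 \<partial>\<gamma>)"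
    unfolding \<mu>_def using iA iA2 by simp
  finally have "\<theta> * \<mu> - \<theta>\<^sup>2 / 2 * (3 * \<mu>\<^sup>2) < 1 / 6"
    using small mult_left_mono[OF second, of "\<theta>\<^sup>2 / 2"] by (simp add: \<mu>_def)
  moreover have "\<theta>\<^sup>2 * \<mu>\<^sup>2 = (1 / 3)\<^sup>2" unfolding \<theta>(3)[symmetric] by (simp add: power_mult_distrib)
  moreover have "\<theta>\<^sup>2 / 2 * (3 * \<mu>\<^sup>2) = 3 / 2 * (\<theta>\<^sup>2 * \<mu>\<^sup>2)" by simp
  ultimately have "1 / 3 - 3 / 2 * (1 / 3)\<^sup>2 < (1 / 6 :: real)" using \<theta>(3) by simp
  then show False by (simp add: power2_eq_square)
qed

text \<open>
  The \<open>n\<close>-th convolution root supplies the finite measure \<open>n \<cdot> symm N\<close>, whose \<open>1 - cos\<close> averages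
  \<open>n (1 - exp (- Q / n))\<close> increase to \<open>Q\<close>. The second moment of these averages is controlled, so the
  reverse Jensen inequality applies to them, and Fatou's lemma gives the bound for \<open>Q\<close>.
\<close>

theorem infinitely_divisible_gauss_bound:
  fixes M :: "'h::{real_inner, second_countable_topology} measure"
  assumes M: "infinitely_divisible M" and c: "0 \<le> c"
    and Q [measurable]: "Q \<in> borel_measurable borel" and Q0: "\<And>\<xi>. 0 \<le> Q \<xi>"
    and MQ: "\<And>\<xi>. (norm (char_fun M \<xi>))\<^sup>2 = exp (- Q \<xi>)"
    and small: "(\<integral>\<xi>. 1 - exp (- Q \<xi>) \<partial>gauss c n) < 1 / 6"
  shows "(\<integral>\<^sup>+\<xi>. ennreal (Q \<xi>) \<partial>gauss c n) \<le> ennreal (1 / 3)"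
proof -
  define \<gamma> :: "'h measure" where "\<gamma> = gauss c n"
  have \<gamma>: "borel_prob \<gamma>" by (simp add: \<gamma>_def)
  note g = borel_probD[OF \<gamma>]
  have [measurable_cong]: "sets \<gamma> = sets borel" by (rule g)
  define A where "A k \<xi> = real (Suc k) * (1 - exp (- (Q \<xi> / real (Suc k))))" for k \<xi>
  have A0: "0 \<le> A k \<xi>" for k \<xi> using Q0[of \<xi>] by (simp add: A_def)
  have AQ: "A k \<xi> \<le> Q \<xi>" for k \<xi>
  proof -
    have "1 - exp (- (Q \<xi> / real (Suc k))) \<le> Q \<xi> / real (Suc k)"
      using exp_ge_add_one_self[of "- (Q \<xi> / real (Suc k))"] by linarith
    then have "A k \<xi> \<le> real (Suc k) * (Q \<xi> / real (Suc k))" unfolding A_def by (rule mult_left_mono) simp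
    then show ?thesis by simp
  qed
  have A_meas [measurable]: "A k \<in> borel_measurable borel" for k unfolding A_def[abs_def] by measurable
  have bound: "(\<integral>\<xi>. A k \<xi> \<partial>\<gamma>) < 1 / 3" for k
  proof -
    obtain N where N: "borel_prob N" "M = conv_power N (Suc k)"
      using M unfolding infinitely_divisible_def by (metis le_add1 plus_1_eq_Suc)
    have root: "(norm (char_fun N \<xi>))\<^sup>2 = exp (- (Q \<xi> / real (Suc k)))" for \<xi>
    proof (rule power_eq_imp_eq_base[where n="Suc k"])
      have "((norm (char_fun N \<xi>))\<^sup>2) ^ Suc k = (norm (char_fun M \<xi>))\<^sup>2"
        unfolding N(2) char_fun_conv_power[OF N(1)] norm_power
        by (simp only: power_mult[symmetric] mult.commute[of 2])
      also have "\<dots> = exp (- (Q \<xi> / real (Suc k))) ^ Suc k"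
        unfolding MQ exp_of_nat_mult[symmetric] by simp
      finally show "((norm (char_fun N \<xi>))\<^sup>2) ^ Suc k = exp (- (Q \<xi> / real (Suc k))) ^ Suc k" .
    qed auto
    note sN = borel_prob_symm[OF N(1)]
    define D where "D \<xi> = (\<integral>x. 1 - cos (\<xi> \<bullet> x) \<partial>symm N)" for \<xi>
    have D: "A k \<xi> = real (Suc k) * D \<xi>" for \<xi>
      unfolding A_def D_def integral_one_minus_cos[OF sN] char_fun_symm[OF N(1)] root by simp
    show ?thesis
    proof (rule mean_bound_from_laplace[OF \<gamma> A_meas A0])
      show "A k \<xi> \<le> real (Suc k)" for \<xi> by (simp add: A_def)
      have "(\<integral>\<xi>. (A k \<xi>)\<^sup>2 \<partial>\<gamma>) = (real (Suc k))\<^sup>2 * (\<integral>\<xi>. (D \<xi>)\<^sup>2 \<partial>\<gamma>)"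
        unfolding D power_mult_distrib by (rule integral_mult_right_zero)
      also have "\<dots> \<le> (real (Suc k))\<^sup>2 * (3 * (\<integral>\<xi>. D \<xi> \<partial>\<gamma>)\<^sup>2)"
        unfolding D_def by (intro mult_left_mono gauss_second_moment(2)[OF c \<gamma>_def sN]) simp
      also have "\<dots> = 3 * (\<integral>\<xi>. A k \<xi> \<partial>\<gamma>)\<^sup>2"
        unfolding D by (subst integral_mult_right_zero) (simp add: power_mult_distrib)
      finally show "(\<integral>\<xi>. (A k \<xi>)\<^sup>2 \<partial>\<gamma>) \<le> 3 * (\<integral>\<xi>. A k \<xi> \<partial>\<gamma>)\<^sup>2" .
      have "(\<integral>\<xi>. 1 - exp (- A k \<xi>) \<partial>\<gamma>) \<le> (\<integral>\<xi>. 1 - exp (- Q \<xi>) \<partial>\<gamma>)"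
      proof (rule integral_mono)
        show "1 - exp (- A k \<xi>) \<le> 1 - exp (- Q \<xi>)" for \<xi> using AQ[of k \<xi>] by simp
      qed (use A0 Q0 in \<open>auto intro!: integrable_bounded_borel[OF g(2,3), where B=1]\<close>)
      then show "(\<integral>\<xi>. 1 - exp (- A k \<xi>) \<partial>\<gamma>) < 1 / 6" using small by (simp add: \<gamma>_def)
    qed
  qed
  have lim: "(\<lambda>k. A k \<xi>) \<longlonglongrightarrow> Q \<xi>" for \<xi>
  proof (rule tendsto_sandwich)
    have "(\<lambda>k. Q \<xi> - (Q \<xi>)\<^sup>2 / 2 * (1 / real (Suc k))) \<longlonglongrightarrow> Q \<xi> - (Q \<xi>)\<^sup>2 / 2 * 0"
      by (intro tendsto_intros LIMSEQ_Suc[OF lim_1_over_n])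
    then show "(\<lambda>k. Q \<xi> - (Q \<xi>)\<^sup>2 / 2 * (1 / real (Suc k))) \<longlonglongrightarrow> Q \<xi>" by simp
    have "Q \<xi> - (Q \<xi>)\<^sup>2 / 2 * (1 / real (Suc k)) \<le> A k \<xi>" for k
    proof -
      have "Q \<xi> / real (Suc k) - (Q \<xi> / real (Suc k))\<^sup>2 / 2 \<le> 1 - exp (- (Q \<xi> / real (Suc k)))"
        using exp_minus_le_quadratic[of "Q \<xi> / real (Suc k)"] Q0[of \<xi>] by simp
      then have "real (Suc k) * (Q \<xi> / real (Suc k) - (Q \<xi> / real (Suc k))\<^sup>2 / 2) \<le> A k \<xi>"
        unfolding A_def by (rule mult_left_mono) simp
      moreover have "real (Suc k) * (Q \<xi> / real (Suc k) - (Q \<xi> / real (Suc k))\<^sup>2 / 2)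
          = Q \<xi> - (Q \<xi>)\<^sup>2 / 2 * (1 / real (Suc k))"
        by (simp add: power2_eq_square field_simps del: of_nat_Suc)
      ultimately show ?thesis by simp
    qed
    then show "eventually (\<lambda>k. Q \<xi> - (Q \<xi>)\<^sup>2 / 2 * (1 / real (Suc k)) \<le> A k \<xi>) sequentially" by simp
  qed (use AQ in auto)
  have "(\<integral>\<^sup>+\<xi>. ennreal (Q \<xi>) \<partial>\<gamma>) = (\<integral>\<^sup>+\<xi>. liminf (\<lambda>k. ennreal (A k \<xi>)) \<partial>\<gamma>)"
    by (intro nn_integral_cong lim_imp_Liminf[symmetric] tendsto_ennrealI lim) simp
  also have "\<dots> \<le> liminf (\<lambda>k. \<integral>\<^sup>+\<xi>. ennreal (A k \<xi>) \<partial>\<gamma>)"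
    by (rule nn_integral_liminf) measurable
  also have "\<dots> \<le> liminf (\<lambda>k. ennreal (1 / 3))"
  proof (intro Liminf_mono always_eventually allI)
    fix k
    have "integrable \<gamma> (A k)"
      using A0 by (intro integrable_bounded_borel[OF g(2,3), where B="real (Suc k)"]) (auto simp: A_def)
    then have "(\<integral>\<^sup>+\<xi>. ennreal (A k \<xi>) \<partial>\<gamma>) = ennreal (\<integral>\<xi>. A k \<xi> \<partial>\<gamma>)"
      using A0 by (intro nn_integral_eq_integral) auto
    then show "(\<integral>\<^sup>+\<xi>. ennreal (A k \<xi>) \<partial>\<gamma>) \<le> ennreal (1 / 3)"
      using bound[of k] by (auto intro: ennreal_leI less_imp_le)
  qed
  also have "\<dots> = ennreal (1 / 3)" by (simp add: Liminf_const)
  finally show ?thesis by (simp add: \<gamma>_def)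
qed

section \<open>Continuous logarithms and roots\<close>

text \<open>
  The difference takes values in \<open>2 \<pi> \<i> \<int>\<close>, a discrete set.
\<close>

lemma continuous_log_unique:
  fixes f g :: "'h::real_normed_vector \<Rightarrow> complex"
  assumes f: "continuous_on UNIV f" and g: "continuous_on UNIV g" and 0: "f 0 = g 0"
    and exp: "\<And>x. exp (f x) = exp (g x)"
  shows "f x = g x"
proof -
  define d where "d x = f x - g x" for x
  have d1: "exp (d x) = 1" for x by (simp add: d_def exp_diff exp)
  have "d constant_on UNIV"
  proof (rule continuous_discrete_range_constant)
    show "continuous_on UNIV d" unfolding d_def by (intro continuous_intros f g)
    fix x :: 'h
    have "2 * pi \<le> norm (d y - d x)" if "d y \<noteq> d x" for y
    proof -
      obtain k where k: "Re (d y - d x) = 0" "Im (d y - d x) = of_int (2 * k) * pi"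
        using d1[of x] d1[of y] exp_eq_1[of "d y - d x"] by (auto simp: exp_diff)
      then have "k \<noteq> 0" using that by (auto simp: complex_eq_iff)
      then have "1 \<le> \<bar>real_of_int k\<bar>" by linarith
      then have "2 * pi \<le> \<bar>Im (d y - d x)\<bar>" unfolding k(2) by (simp add: abs_mult)
      also have "\<dots> \<le> norm (d y - d x)" by (rule abs_Im_le_cmod)
      finally show ?thesis .
    qed
    then show "\<exists>e>0. \<forall>y. y \<in> UNIV \<and> d y \<noteq> d x \<longrightarrow> e \<le> norm (d y - d x)"
      by (intro exI[of _ "2 * pi"]) simp
  qed (rule connected_UNIV)
  then have "d x = d 0" by (auto simp: constant_on_def)
  then show ?thesis using 0 by (simp add: d_def)
qed

text \<open>
  The quotient takes values in the finite set of roots of unity.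
\<close>

lemma continuous_root_unique:
  fixes h f :: "'h::real_normed_vector \<Rightarrow> complex"
  assumes h: "continuous_on UNIV h" and f: "continuous_on UNIV f" and 0: "h 0 = 1" "f 0 = 0"
    and n: "n \<ge> 1" and root: "\<And>x. h x ^ n = exp (- f x)"
  shows "h x = exp (- (f x / of_nat n))"
proof -
  define k where "k x = h x * exp (f x / of_nat n)" for x
  have kn: "k x ^ n = 1" for x
    using n by (simp add: k_def power_mult_distrib root exp_of_nat_mult[symmetric] exp_minus)
  have "k constant_on UNIV"
  proof (rule continuous_finite_range_constant)
    show "continuous_on UNIV k" unfolding k_def by (intro continuous_intros h f) (use n in auto)
    have "finite {z::complex. z ^ n = 1}" using n by (intro finite_roots_unity) auto
    then show "finite (k ` UNIV)" by (rule finite_subset[rotated]) (use kn in auto)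
  qed (rule connected_UNIV)
  then have "k x = k 0" by (auto simp: constant_on_def)
  then have "h x * exp (f x / of_nat n) = 1" using 0 by (simp add: k_def)
  then show ?thesis by (simp add: exp_minus field_simps)
qed

section \<open>Levy exponents\<close>

definition levy_kernel :: "'h::real_inner \<Rightarrow> 'h \<Rightarrow> complex" where
  "levy_kernel \<xi> x = iexp (\<xi> \<bullet> x) - 1 - \<i> * complex_of_real ((\<xi> \<bullet> x) / (1 + (norm x)\<^sup>2))"

definition small_mass :: "'h::real_normed_vector measure \<Rightarrow> ennreal" where
  "small_mass m = (\<integral>\<^sup>+x. ennreal (min 1 ((norm x)\<^sup>2)) \<partial>m)"

lemma levy_kernel_measurable [measurable]:
  "levy_kernel \<xi> \<in> borel_measurable (borel :: 'h::{real_inner, second_countable_topology} measure)"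
  unfolding levy_kernel_def[abs_def] by measurable

text \<open>
  The quadratic form in the numerator is kept in this shape so that its Gaussian average can be computed.
\<close>

lemma levy_kernel_bound:
  "norm (levy_kernel \<xi> x) \<le> ((\<xi> \<bullet> x)\<^sup>2 / 2 + 2 * (norm x)\<^sup>2) / (1 + (norm x)\<^sup>2)"
proof -
  define u r where "u = \<xi> \<bullet> x" and "r = (norm x)\<^sup>2"
  have r: "0 \<le> r" by (simp add: r_def)
  have "(iexp u - 1 - \<i> * of_real u) + of_real r * (iexp u - 1) = of_real (1 + r) * levy_kernel \<xi> x"
  proof -
    have gen: "(E - 1 - \<i> * v) + c * (E - 1) = (1 + c) * (E - 1 - \<i> * w)" if "(1 + c) * w = v" for E v c w :: complex
      unfolding that[symmetric] by (simp add: algebra_simps)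
    have "(1 + r) * (u / (1 + r)) = u" using r by (simp add: add_nonneg_eq_0_iff)
    then have "(1 + complex_of_real r) * complex_of_real (u / (1 + r)) = complex_of_real u"
      by (metis of_real_1 of_real_add of_real_mult)
    from gen[OF this] show ?thesis
      unfolding levy_kernel_def u_def[symmetric] r_def[symmetric] of_real_add of_real_1 .
  qed
  moreover have "norm (complex_of_real (1 + r) * levy_kernel \<xi> x) = (1 + r) * norm (levy_kernel \<xi> x)"
    unfolding norm_mult norm_of_real using r by simp
  ultimately have "(1 + r) * norm (levy_kernel \<xi> x) = norm ((iexp u - 1 - \<i> * of_real u) + of_real r * (iexp u - 1))"
    by simp
  also have "\<dots> \<le> norm (iexp u - 1 - \<i> * of_real u) + norm (of_real r * (iexp u - 1))"
    by (rule norm_triangle_ineq)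
  also have "norm (iexp u - 1 - \<i> * of_real u) \<le> u\<^sup>2 / 2"
    using iexp_approx1[of u 1] by (simp add: numeral_2_eq_2 diff_diff_eq)
  also have "norm (of_real r * (iexp u - 1)) \<le> r * 2"
  proof -
    have "norm (iexp u - 1) \<le> norm (iexp u) + norm (1::complex)" by (rule norm_triangle_ineq4)
    then have "norm (iexp u - 1) \<le> 2" by simp
    then show ?thesis using r by (simp add: norm_mult mult_left_mono)
  qed
  finally show ?thesis using r by (simp add: u_def[symmetric] r_def[symmetric] field_simps)
qed

lemma ratio_le_min: "(norm x)\<^sup>2 / (1 + (norm x)\<^sup>2) \<le> min 1 ((norm x)\<^sup>2)"
proof -
  have "0 \<le> (norm x)\<^sup>2" by simp
  then have "0 < 1 + (norm x)\<^sup>2" by linarith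
  then show ?thesis by (simp add: divide_le_eq algebra_simps)
qed

lemma levy_kernel_bound_min:
  "norm (levy_kernel \<xi> x) \<le> (2 + (norm \<xi>)\<^sup>2) * min 1 ((norm x)\<^sup>2)"
proof -
  have "(\<xi> \<bullet> x)\<^sup>2 \<le> (norm \<xi>)\<^sup>2 * (norm x)\<^sup>2"
    using power_mono[OF Cauchy_Schwarz_ineq2[of \<xi> x] abs_ge_zero, of 2] by (simp add: power_mult_distrib)
  also have "\<dots> \<le> 2 * ((norm \<xi>)\<^sup>2 * (norm x)\<^sup>2)" by simp
  finally have "(\<xi> \<bullet> x)\<^sup>2 / 2 + 2 * (norm x)\<^sup>2 \<le> (2 + (norm \<xi>)\<^sup>2) * (norm x)\<^sup>2"
    by (simp add: algebra_simps)
  then have "((\<xi> \<bullet> x)\<^sup>2 / 2 + 2 * (norm x)\<^sup>2) / (1 + (norm x)\<^sup>2)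
      \<le> (2 + (norm \<xi>)\<^sup>2) * (norm x)\<^sup>2 / (1 + (norm x)\<^sup>2)"
    by (rule divide_right_mono) simp
  also have "\<dots> \<le> (2 + (norm \<xi>)\<^sup>2) * min 1 ((norm x)\<^sup>2)"
    using mult_left_mono[OF ratio_le_min[of x], of "2 + (norm \<xi>)\<^sup>2"] by simp
  finally show ?thesis using levy_kernel_bound[of \<xi> x] by linarith
qed

lemma levy_measureD:
  assumes "levy_measure m"
  shows "sets m = sets borel" "sigma_finite_measure m" "emeasure m {0} = 0" "small_mass m < \<infinity>"
    "space m = UNIV"
  using assms sets_eq_imp_space_eq[of m borel] by (auto simp: levy_measure_def small_mass_def)

lemma levy_measureI:
  fixes m :: "'h::real_normed_vector measure"
  assumes s: "sets m = sets borel" and z: "emeasure m {0} = 0" and f: "small_mass m < \<infinity>"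
  shows "levy_measure m"
proof -
  have [measurable_cong]: "sets m = sets borel" by fact
  define A where "A n = {x::'h. 1 / real (Suc n) \<le> norm x}" for n
  have Am: "A n \<in> sets m" for n unfolding A_def s by (intro borel_closed closed_Collect_le continuous_intros)
  have fin: "emeasure m (A n) \<noteq> \<infinity>" for n
  proof -
    define e where "e = (1 / real (Suc n))\<^sup>2"
    have e: "0 < e" "e \<le> 1" by (auto simp: e_def power_le_one)
    have "ennreal e * emeasure m (A n) = (\<integral>\<^sup>+x. ennreal e * indicator (A n) x \<partial>m)"
      using Am by (simp add: nn_integral_cmult_indicator)
    also have "\<dots> \<le> small_mass m"
      unfolding small_mass_def
    proof (rule nn_integral_mono)
      fix x
      show "ennreal e * indicator (A n) x \<le> ennreal (min 1 ((norm x)\<^sup>2))"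
      proof (cases "x \<in> A n")
        case True
        then have "e \<le> (norm x)\<^sup>2" unfolding A_def e_def by (intro power_mono) auto
        then show ?thesis using True e by (simp add: ennreal_leI)
      qed simp
    qed
    finally have "ennreal e * emeasure m (A n) < \<infinity>" using f by (rule order.strict_trans1)
    then show ?thesis using e by (auto simp: ennreal_mult_less_top)
  qed
  have "sigma_finite_measure m"
  proof (unfold_locales, intro exI conjI)
    show "countable (insert {0} (range A))" by simp
    show "insert {0} (range A) \<subseteq> sets m" using Am s by auto
    have "x = 0 \<or> (\<exists>n. x \<in> A n)" for x :: 'h
    proof (cases "x = 0")
      case False
      then obtain n where "1 / real (Suc n) < norm x" using nat_approx_posE[of "norm x"] by auto
      then show ?thesis by (auto simp: A_def intro: less_imp_le)
    qed simp
    then show "\<Union> (insert {0} (range A)) = space m" using sets_eq_imp_space_eq[OF s] by auto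
    show "\<forall>a\<in>insert {0} (range A). emeasure m a \<noteq> \<infinity>" using fin z by auto
  qed
  then show ?thesis using assms by (simp add: levy_measure_def small_mass_def)
qed

context
  fixes m :: "'h::{real_inner, second_countable_topology} measure"
  assumes m: "levy_measure m"
begin

lemma integrable_min_norm: "integrable m (\<lambda>x. min 1 ((norm x)\<^sup>2))"
proof -
  have [measurable_cong]: "sets m = sets borel" using levy_measureD[OF m] by blast
  show ?thesis
    using levy_measureD(4)[OF m] by (intro integrableI_nonneg) (auto simp: small_mass_def)
qed

lemma integrable_dominated:
  fixes f :: "'h \<Rightarrow> 'b::{banach, second_countable_topology}"
  assumes "f \<in> borel_measurable borel" "\<And>x. norm (f x) \<le> C * min 1 ((norm x)\<^sup>2)"
  shows "integrable m f"
proof (rule Bochner_Integration.integrable_bound)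
  show "integrable m (\<lambda>x. C * min 1 ((norm x)\<^sup>2))" by (intro integrable_mult_right integrable_min_norm)
  show "f \<in> borel_measurable m"
    using assms(1) by (simp add: measurable_cong_sets[OF levy_measureD(1)[OF m] refl])
  show "AE x in m. norm (f x) \<le> norm (C * min 1 ((norm x)\<^sup>2))"
    using order_trans[OF assms(2) abs_ge_self] by simp
qed

lemma integrable_levy_kernel: "integrable m (levy_kernel \<xi>)"
  by (rule integrable_dominated[OF _ levy_kernel_bound_min]) simp

lemma levy_exponent_kernel:
  "levy_exponent a R m \<xi> = - \<i> * complex_of_real (a \<bullet> \<xi>) + complex_of_real (1/2 * (R \<xi> \<bullet> \<xi>))
     - (CLINT x|m. levy_kernel \<xi> x)"
  by (simp add: levy_exponent_def levy_kernel_def)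

lemma levy_exponent_0 [simp]: "levy_exponent a R m 0 = 0"
  by (simp add: levy_exponent_kernel levy_kernel_def)

lemma continuous_levy_exponent: "continuous_on UNIV (levy_exponent a R m)"
proof -
  have [measurable_cong]: "sets m = sets borel" using levy_measureD[OF m] by blast
  have "continuous_on UNIV (\<lambda>\<xi>. CLINT x|m. levy_kernel \<xi> x)"
    unfolding continuous_on_sequentially comp_def
  proof (intro allI ballI impI)
    fix X and \<xi> :: 'h
    assume X: "(\<forall>n. X n \<in> UNIV) \<and> X \<longlonglongrightarrow> \<xi>"
    then obtain K where K: "\<And>n. norm (X n) \<le> K" using convergent_imp_Bseq[of X] by (auto simp: convergent_def Bseq_def)
    show "(\<lambda>n. CLINT x|m. levy_kernel (X n) x) \<longlonglongrightarrow> (CLINT x|m. levy_kernel \<xi> x)"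
    proof (rule integral_dominated_convergence[where w="\<lambda>x. (2 + K\<^sup>2) * min 1 ((norm x)\<^sup>2)"])
      show "integrable m (\<lambda>x. (2 + K\<^sup>2) * min 1 ((norm x)\<^sup>2))"
        by (intro integrable_mult_right integrable_min_norm)
      show "AE x in m. (\<lambda>n. levy_kernel (X n) x) \<longlonglongrightarrow> levy_kernel \<xi> x"
      proof (intro always_eventually allI)
        fix x :: 'h
        have "1 + (norm x)\<^sup>2 \<noteq> 0" using zero_le_power2[of "norm x"] by linarith
        then show "(\<lambda>n. levy_kernel (X n) x) \<longlonglongrightarrow> levy_kernel \<xi> x"
          unfolding levy_kernel_def using X by (intro tendsto_intros) auto
      qed
      show "AE x in m. norm (levy_kernel (X n) x) \<le> (2 + K\<^sup>2) * min 1 ((norm x)\<^sup>2)" for n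
      proof (intro always_eventually allI)
        fix x :: 'h
        have "(norm (X n))\<^sup>2 \<le> K\<^sup>2" using K[of n] by (intro power_mono) auto
        then have "(2 + (norm (X n))\<^sup>2) * min 1 ((norm x)\<^sup>2) \<le> (2 + K\<^sup>2) * min 1 ((norm x)\<^sup>2)"
          by (intro mult_right_mono) auto
        then show "norm (levy_kernel (X n) x) \<le> (2 + K\<^sup>2) * min 1 ((norm x)\<^sup>2)"
          using levy_kernel_bound_min[of "X n" x] by linarith
      qed
    qed simp_all
  qed
  then show ?thesis
    unfolding levy_exponent_kernel by (intro continuous_intros)
qed

lemma one_minus_cos_bound: "1 - cos (h \<bullet> x) \<le> (2 + (norm h)\<^sup>2) * min 1 ((norm x)\<^sup>2)"
proof -
  have "1 - cos (h \<bullet> x) = - Re (levy_kernel h x)" by (simp add: levy_kernel_def Re_exp)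
  also have "\<dots> \<le> norm (levy_kernel h x)" using abs_Re_le_cmod[of "levy_kernel h x"] by linarith
  finally show ?thesis using levy_kernel_bound_min[of h x] by linarith
qed

lemma integrable_one_minus_cos: "integrable m (\<lambda>x. 1 - cos (h \<bullet> x))"
proof (rule integrable_dominated)
  show "norm (1 - cos (h \<bullet> x)) \<le> (2 + (norm h)\<^sup>2) * min 1 ((norm x)\<^sup>2)" for x
    using one_minus_cos_bound[of h x] cos_le_one[of "h \<bullet> x"] by simp
qed simp

lemma Re_levy_exponent:
  "Re (levy_exponent a R m \<xi>) = 1/2 * (R \<xi> \<bullet> \<xi>) + (\<integral>x. 1 - cos (\<xi> \<bullet> x) \<partial>m)"
proof -
  have "Re (CLINT x|m. levy_kernel \<xi> x) = (\<integral>x. Re (levy_kernel \<xi> x) \<partial>m)"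
    by (rule integral_Re[symmetric, OF integrable_levy_kernel])
  also have "\<dots> = (\<integral>x. - (1 - cos (\<xi> \<bullet> x)) \<partial>m)"
    by (intro Bochner_Integration.integral_cong) (simp_all add: levy_kernel_def Re_exp)
  also have "\<dots> = - (\<integral>x. 1 - cos (\<xi> \<bullet> x) \<partial>m)" by (rule Bochner_Integration.integral_minus)
  finally show ?thesis by (simp add: levy_exponent_kernel)
qed

section \<open>Recovering the triplet from second differences\<close>

text \<open>
  The finite measure \<open>(1 - cos (h \<bullet> x)) m(dx)\<close>: together with the atom \<open>R h \<bullet> h / 2\<close> at \<open>0\<close> it has
  the symmetric second difference of the exponent as its characteristic function.
\<close>

definition cos_measure :: "'h \<Rightarrow> 'h measure" where
  "cos_measure h = density m (\<lambda>x. ennreal (1 - cos (h \<bullet> x)))"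

lemma sets_cos_measure: "sets (cos_measure h) = sets borel"
  using levy_measureD[OF m] by (simp add: cos_measure_def)

lemma finite_cos_measure: "finite_measure (cos_measure h)"
proof (rule finite_measureI)
  have [measurable_cong]: "sets m = sets borel" using levy_measureD[OF m] by blast
  have "emeasure (cos_measure h) (space (cos_measure h)) = (\<integral>\<^sup>+x. ennreal (1 - cos (h \<bullet> x)) \<partial>m)"
    by (simp add: cos_measure_def emeasure_density cong: nn_integral_cong)
  also have "\<dots> < \<infinity>"
    using integrable_one_minus_cos[of h] cos_le_one[of "h \<bullet> _"]
    by (subst nn_integral_eq_integral) auto
  finally show "emeasure (cos_measure h) (space (cos_measure h)) \<noteq> \<infinity>" by simp
qed

lemma emeasure_cos_measure:
  assumes "A \<in> sets borel"
  shows "emeasure (cos_measure h) A = (\<integral>\<^sup>+x. ennreal (1 - cos (h \<bullet> x)) * indicator A x \<partial>m)"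
proof -
  have [measurable_cong]: "sets m = sets borel" using levy_measureD[OF m] by blast
  show ?thesis unfolding cos_measure_def using assms by (intro emeasure_density) auto
qed

text \<open>
  The drift is linear and cancels, the quadratic form contributes a constant by the parallelogram
  identity, and the compensator in the kernel is linear as well.
\<close>

lemma levy_exponent_second_difference:
  fixes R :: "'h \<Rightarrow>\<^sub>L 'h"
  assumes sym: "\<And>x y. R x \<bullet> y = x \<bullet> R y"
  shows "(levy_exponent a R m (\<xi> + h) + levy_exponent a R m (\<xi> - h)) / 2 - levy_exponent a R m \<xi>
    = of_real (1/2 * (R h \<bullet> h)) + char_fun (cos_measure h) \<xi>"
proof -
  have [measurable_cong]: "sets m = sets borel" using levy_measureD[OF m] by blast
  have quad: "R (\<xi> + h) \<bullet> (\<xi> + h) + R (\<xi> - h) \<bullet> (\<xi> - h) = 2 * (R \<xi> \<bullet> \<xi>) + 2 * (R h \<bullet> h)"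
    by (simp add: blinfun.add_right blinfun.diff_right inner_simps)
  have "char_fun (cos_measure h) \<xi> = (CLINT x|m. (1 - cos (h \<bullet> x)) *\<^sub>R iexp (x \<bullet> \<xi>))"
    unfolding char_fun_def cos_measure_def by (subst integral_density) simp_all
  also have "\<dots> = (CLINT x|m. levy_kernel \<xi> x - (levy_kernel (\<xi> + h) x + levy_kernel (\<xi> - h) x) / 2)"
  proof (rule Bochner_Integration.integral_cong[OF refl])
    fix x
    have "complex_of_real (cos (h \<bullet> x)) = (iexp (h \<bullet> x) + iexp (- (h \<bullet> x))) / 2"
      by (simp add: cos_of_real[symmetric] cos_exp_eq)
    moreover have "iexp ((\<xi> + h) \<bullet> x) = iexp (\<xi> \<bullet> x) * iexp (h \<bullet> x)"
      "iexp ((\<xi> - h) \<bullet> x) = iexp (\<xi> \<bullet> x) * iexp (- (h \<bullet> x))"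
      using iexp_add[of "\<xi> \<bullet> x" "h \<bullet> x"] iexp_add[of "\<xi> \<bullet> x" "- (h \<bullet> x)"] by (simp_all add: inner_add_left inner_diff_left)
    moreover have "(\<xi> + h) \<bullet> x / (1 + (norm x)\<^sup>2) + (\<xi> - h) \<bullet> x / (1 + (norm x)\<^sup>2) = 2 * (\<xi> \<bullet> x / (1 + (norm x)\<^sup>2))"
      by (simp add: inner_add_left inner_diff_left add_divide_distrib diff_divide_distrib)
    then have "complex_of_real ((\<xi> + h) \<bullet> x / (1 + (norm x)\<^sup>2)) + complex_of_real ((\<xi> - h) \<bullet> x / (1 + (norm x)\<^sup>2))
        = 2 * complex_of_real (\<xi> \<bullet> x / (1 + (norm x)\<^sup>2))"
      by (metis of_real_add of_real_mult of_real_numeral)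
    moreover have gen: "(1 - (P + Q) / 2) * E = E - 1 - \<i> * u - ((E * P - 1 - \<i> * v) + (E * Q - 1 - \<i> * w)) / 2"
      if "v + w = 2 * u" for P Q E u v w :: complex
    proof -
      have w: "w = 2 * u - v" using that by (simp add: algebra_simps)
      show ?thesis unfolding w by (simp add: field_simps)
    qed
    ultimately show "(1 - cos (h \<bullet> x)) *\<^sub>R iexp (x \<bullet> \<xi>) =
        levy_kernel \<xi> x - (levy_kernel (\<xi> + h) x + levy_kernel (\<xi> - h) x) / 2"
      unfolding levy_kernel_def scaleR_conv_of_real of_real_diff of_real_1 inner_commute[of x \<xi>]
      by (simp only: gen)
  qed
  also have "\<dots> = (CLINT x|m. levy_kernel \<xi> x) - (CLINT x|m. (levy_kernel (\<xi> + h) x + levy_kernel (\<xi> - h) x) / 2)"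
    by (intro Bochner_Integration.integral_diff integrable_divide Bochner_Integration.integrable_add integrable_levy_kernel)
  also have "(CLINT x|m. (levy_kernel (\<xi> + h) x + levy_kernel (\<xi> - h) x) / 2)
      = (CLINT x|m. levy_kernel (\<xi> + h) x + levy_kernel (\<xi> - h) x) / 2"
    by (rule integral_divide_zero)
  also have "(CLINT x|m. levy_kernel (\<xi> + h) x + levy_kernel (\<xi> - h) x)
      = (CLINT x|m. levy_kernel (\<xi> + h) x) + (CLINT x|m. levy_kernel (\<xi> - h) x)"
    by (intro Bochner_Integration.integral_add integrable_levy_kernel)
  finally have cf: "char_fun (cos_measure h) \<xi> = (CLINT x|m. levy_kernel \<xi> x)
      - ((CLINT x|m. levy_kernel (\<xi> + h) x) + (CLINT x|m. levy_kernel (\<xi> - h) x)) / 2" .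
  have gen: "((- \<i> * (p + q) + q1 / 2 - K1) + (- \<i> * (p - q) + q2 / 2 - K2)) / 2 - (- \<i> * p + q0 / 2 - K0)
      = qh / 2 + (K0 - (K1 + K2) / 2)"
    if "q1 + q2 = 2 * q0 + 2 * qh" for p q q0 q1 q2 qh K0 K1 K2 :: complex
  proof -
    have q2: "q2 = 2 * q0 + 2 * qh - q1" using that by (simp add: algebra_simps)
    show ?thesis unfolding q2 by (simp add: field_simps)
  qed
  have "complex_of_real (R (\<xi> + h) \<bullet> (\<xi> + h)) + of_real (R (\<xi> - h) \<bullet> (\<xi> - h)) = 2 * of_real (R \<xi> \<bullet> \<xi>) + 2 * of_real (R h \<bullet> h)"
    using quad by (metis of_real_add of_real_mult of_real_numeral)
  note gen' = gen[OF this]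
  have half: "complex_of_real (1 / 2 * r) = complex_of_real r / 2" for r by simp
  show ?thesis
    unfolding levy_exponent_kernel cf half inner_add_right[of a] inner_diff_right[of a] of_real_add of_real_diff
    by (rule gen')
qed

end

section \<open>Sums of measures\<close>

definition madd :: "'a measure \<Rightarrow> 'a measure \<Rightarrow> 'a measure" where
  "madd M N = measure_of (space M) (sets M) (\<lambda>A. emeasure M A + emeasure N A)"

lemma sets_madd [simp, measurable_cong]: "sets (madd M N) = sets M"
  by (simp add: madd_def)

lemma space_madd [simp]: "space (madd M N) = space M"
  by (simp add: madd_def space_measure_of_conv)

context
  fixes M N :: "'a measure"
  assumes sets_eq: "sets N = sets M"
begin

lemma emeasure_madd: "emeasure (madd M N) A = emeasure M A + emeasure N A"
proof (cases "A \<in> sets M")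
  case True
  have "countably_additive (sets M) (\<lambda>A. emeasure M A + emeasure N A)"
  proof (rule countably_additiveI)
    fix A :: "nat \<Rightarrow> 'a set" assume A: "range A \<subseteq> sets M" "disjoint_family A"
    then have "(\<Sum>i. emeasure M (A i)) = emeasure M (\<Union>i. A i)" "(\<Sum>i. emeasure N (A i)) = emeasure N (\<Union>i. A i)"
      using sets_eq by (auto intro!: suminf_emeasure)
    then show "(\<Sum>i. emeasure M (A i) + emeasure N (A i)) = emeasure M (\<Union>i. A i) + emeasure N (\<Union>i. A i)"
      by (subst suminf_add[symmetric]) auto
  qed
  then show ?thesis
    unfolding madd_def using True
    by (intro emeasure_measure_of_sigma sets.sigma_algebra_axioms) (auto simp: positive_def)
next
  case False
  then show ?thesis using sets_eq by (simp add: emeasure_notin_sets)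
qed

lemma nn_integral_madd:
  assumes "f \<in> borel_measurable M"
  shows "(\<integral>\<^sup>+x. f x \<partial>madd M N) = (\<integral>\<^sup>+x. f x \<partial>M) + (\<integral>\<^sup>+x. f x \<partial>N)"
  using assms
proof induction
  case (cong f g)
  have "space N = space M" using sets_eq by (rule sets_eq_imp_space_eq)
  then have "(\<integral>\<^sup>+x. g x \<partial>K) = (\<integral>\<^sup>+x. f x \<partial>K)" if "space K = space M" for K
    using cong(3) that by (intro nn_integral_cong) simp
  then show ?case using cong(4) \<open>space N = space M\<close> by simp
next
  case (set A)
  then show ?case using sets_eq by (simp add: emeasure_madd)
next
  case (mult u c)
  then have "u \<in> borel_measurable N" "u \<in> borel_measurable (madd M N)"
    by (simp_all add: measurable_cong_sets[OF sets_eq refl] measurable_cong_sets[OF sets_madd refl])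
  then show ?case using mult by (simp add: nn_integral_cmult distrib_left)
next
  case (add u v)
  then have "u \<in> borel_measurable N" "u \<in> borel_measurable (madd M N)"
     "v \<in> borel_measurable N" "v \<in> borel_measurable (madd M N)"
    by (simp_all add: measurable_cong_sets[OF sets_eq refl] measurable_cong_sets[OF sets_madd refl])
  then show ?case using add by (simp add: nn_integral_add ac_simps)
next
  case (seq U)
  then have "U i \<in> borel_measurable N" "U i \<in> borel_measurable (madd M N)" for i
    by (simp_all add: measurable_cong_sets[OF sets_eq refl] measurable_cong_sets[OF sets_madd refl])
  moreover have "incseq (\<lambda>i. \<integral>\<^sup>+x. U i x \<partial>K)" for K
    using seq(3) by (auto simp: incseq_def le_fun_def intro!: nn_integral_mono)
  ultimately show ?case
    using seq by (simp add: nn_integral_monotone_convergence_SUP image_comp ennreal_SUP_add)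
qed

end

lemma finite_measure_madd:
  assumes "finite_measure M" "finite_measure N" "sets N = sets M"
  shows "finite_measure (madd M N)"
proof -
  interpret M: finite_measure M by fact
  interpret N: finite_measure N by fact
  show ?thesis
    by (rule finite_measureI) (simp add: emeasure_madd[OF assms(3)] M.emeasure_eq_measure
        N.emeasure_eq_measure flip: ennreal_plus)
qed

lemma integrable_madd:
  fixes f :: "'a \<Rightarrow> 'b::{banach, second_countable_topology}"
  assumes NM: "sets N = sets M" and M: "integrable M f" and N: "integrable N f"
  shows "integrable (madd M N) f"
proof (rule integrableI_bounded)
  have f: "f \<in> borel_measurable M" using M by simp
  then show "f \<in> borel_measurable (madd M N)" by (simp add: measurable_cong_sets[OF sets_madd refl])
  have fn: "(\<lambda>x. ennreal (norm (f x))) \<in> borel_measurable M" using f by simp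
  show "(\<integral>\<^sup>+x. ennreal (norm (f x)) \<partial>madd M N) < \<infinity>"
    unfolding nn_integral_madd[OF NM fn] using M N by (simp add: integrable_iff_bounded)
qed

lemma integral_madd_real:
  fixes f :: "'a \<Rightarrow> real"
  assumes NM: "sets N = sets M" and M: "integrable M f" and N: "integrable N f"
  shows "(\<integral>x. f x \<partial>madd M N) = (\<integral>x. f x \<partial>M) + (\<integral>x. f x \<partial>N)"
proof -
  have fm: "(\<lambda>x. ennreal (s * f x)) \<in> borel_measurable M" for s
    using M by simp
  have nn: "(\<integral>\<^sup>+x. ennreal (s * f x) \<partial>K) < \<top>" if "integrable K f" for K s
    using integrableD(2)[OF integrable_mult_right[OF that, of s]] by (simp add: less_top)
  have eq: "enn2real (\<integral>\<^sup>+x. ennreal (s * f x) \<partial>madd M N)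
      = enn2real (\<integral>\<^sup>+x. ennreal (s * f x) \<partial>M) + enn2real (\<integral>\<^sup>+x. ennreal (s * f x) \<partial>N)" for s
    unfolding nn_integral_madd[OF NM fm] by (rule enn2real_plus) (intro nn M N)+
  show ?thesis
    using eq[of 1] eq[of "-1"] M N integrable_madd[OF assms] by (simp add: real_lebesgue_integral_def)
qed

lemma integral_madd:
  fixes f :: "'a \<Rightarrow> complex"
  assumes NM: "sets N = sets M" and M: "integrable M f" and N: "integrable N f"
  shows "(\<integral>x. f x \<partial>madd M N) = (\<integral>x. f x \<partial>M) + (\<integral>x. f x \<partial>N)"
  by (rule complex_eqI)
    (simp_all only: integral_Re[symmetric] integral_Im[symmetric] integrable_madd[OF assms] M N
      plus_complex.sel integral_madd_real[OF NM] integrable_Re integrable_Im)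

lemma char_fun_madd:
  fixes M N :: "'h::{real_inner, second_countable_topology} measure"
  assumes M: "finite_measure M" "sets M = sets borel" and N: "finite_measure N" "sets N = sets borel"
  shows "char_fun (madd M N) \<xi> = char_fun M \<xi> + char_fun N \<xi>"
  unfolding char_fun_def using M N by (intro integral_madd char_fun_integrable) simp_all

lemma AE_off_zero:
  assumes K: "sets K = sets borel" "emeasure K {0::'h::real_normed_vector} = 0"
  shows "AE x in K. x \<noteq> 0"
  using K by (intro AE_I[where N="{0}"]) auto

lemma density_cancel:
  fixes M N :: "'h::real_normed_vector measure"
  assumes M: "sets M = sets borel" "emeasure M {0} = 0"
    and N: "sets N = sets borel" "emeasure N {0} = 0"
    and w [measurable]: "w \<in> borel_measurable borel" and w0: "\<And>x. x \<noteq> 0 \<Longrightarrow> 0 < w x \<and> w x < (\<top> :: ennreal)"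
    and eq: "density M w = density N w"
  shows "M = N"
proof (rule measure_eqI)
  fix A assume "A \<in> sets M"
  then have A [measurable]: "A \<in> sets borel" using M by simp
  have "emeasure K A = (\<integral>\<^sup>+x. indicator A x / w x \<partial>density K w)"
    if K: "sets K = sets borel" "emeasure K {0} = 0" for K
  proof -
    have [measurable_cong]: "sets K = sets borel" by fact
    have "(\<integral>\<^sup>+x. indicator A x / w x \<partial>density K w) = (\<integral>\<^sup>+x. w x * (indicator A x / w x) \<partial>K)"
      by (rule nn_integral_density) measurable
    also have "\<dots> = (\<integral>\<^sup>+x. indicator A x \<partial>K)"
    proof (rule nn_integral_cong_AE)
      show "AE x in K. w x * (indicator A x / w x) = indicator A x"
        using AE_off_zero[OF K]
      proof eventually_elim
        case (elim x)
        then have "w x / w x = 1" using w0[of x] by (intro ennreal_divide_self) auto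
        then show ?case by (simp add: ennreal_times_divide split: split_indicator)
      qed
    qed
    also have "\<dots> = emeasure K A" using A K by simp
    finally show ?thesis by simp
  qed
  then show "emeasure M A = emeasure N A" using M N eq by simp
qed (use M N in simp)

text \<open>
  The image of a Levy measure under an operator with a kernel may have an atom, even of infinite mass, at the origin.
  A Levy measure has none, so it is removed.
\<close>

definition push_off_zero :: "('h::real_normed_vector \<Rightarrow>\<^sub>L 'h) \<Rightarrow> 'h measure \<Rightarrow> 'h measure" where
  "push_off_zero T m = density (push T m) (indicator (- {0}))"

lemma sets_push_off_zero [simp]: "sets (push_off_zero T m) = sets borel"
  by (simp add: push_off_zero_def)

lemma nn_integral_push_off_zero:
  assumes m: "sets m = sets borel" and f [measurable]: "f \<in> borel_measurable borel"
  shows "(\<integral>\<^sup>+x. f x \<partial>push_off_zero T m) = (\<integral>\<^sup>+x. indicator (- {0}) (T x) * f (T x) \<partial>m)"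
proof -
  have [measurable_cong]: "sets m = sets borel" by fact
  have "(\<integral>\<^sup>+x. f x \<partial>push_off_zero T m) = (\<integral>\<^sup>+x. indicator (- {0}) x * f x \<partial>push T m)"
    unfolding push_off_zero_def by (rule nn_integral_density) measurable
  then show ?thesis by (simp add: nn_integral_distr)
qed

lemma emeasure_push_off_zero_0:
  assumes m: "sets m = sets borel"
  shows "emeasure (push_off_zero T m) {0} = 0"
proof -
  have "emeasure (push_off_zero T m) {0} = (\<integral>\<^sup>+x. indicator {0} x \<partial>push_off_zero T m)" by simp
  also have "\<dots> = (\<integral>\<^sup>+x. 0 \<partial>m)"
    unfolding nn_integral_push_off_zero[OF m borel_measurable_indicator[OF borel_singleton[OF sets.empty_sets]]]
    by (intro nn_integral_cong) (simp split: split_indicator)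
  finally show ?thesis by simp
qed

lemma exists_dense_sequence:
  "\<exists>d :: nat \<Rightarrow> 'h::second_countable_topology. \<forall>G. open G \<longrightarrow> G \<noteq> {} \<longrightarrow> (\<exists>j. d j \<in> G)"
proof -
  obtain D :: "'h set" where D: "countable D" "\<And>X. open X \<Longrightarrow> X \<noteq> {} \<Longrightarrow> \<exists>d\<in>D. d \<in> X"
    using countable_dense_setE by blast
  have "D \<noteq> {}" using D(2)[of UNIV] by auto
  then have "range (from_nat_into D) = D" using D(1) by (simp add: range_from_nat_into)
  then show ?thesis using D(2) by (intro exI[of _ "from_nat_into D"]) (metis rangeE)
qed

text \<open>
  A measure off the origin is determined by the finite measures \<open>(1 - cos (h \<bullet> x)) m(dx)\<close>: a weighted
  sum over a dense sequence of \<open>h\<close> has a strictly positive density.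
\<close>

lemma measure_eq_if_cos_measures_eq:
  fixes M N :: "'h::{real_inner, second_countable_topology} measure"
  assumes M: "sets M = sets borel" "emeasure M {0} = 0"
    and N: "sets N = sets borel" "emeasure N {0} = 0"
    and eq: "\<And>h A. A \<in> sets borel \<Longrightarrow> (\<integral>\<^sup>+x. ennreal (1 - cos (h \<bullet> x)) * indicator A x \<partial>M)
      = (\<integral>\<^sup>+x. ennreal (1 - cos (h \<bullet> x)) * indicator A x \<partial>N)"
  shows "M = N"
proof -
  obtain d :: "nat \<Rightarrow> 'h" where d: "\<And>G. open G \<Longrightarrow> G \<noteq> {} \<Longrightarrow> \<exists>j. d j \<in> G"
    using exists_dense_sequence by blast
  define k where "k j x = ennreal (1 - cos (d j \<bullet> x))" for j x
  have k_meas [measurable]: "k j \<in> borel_measurable borel" for j unfolding k_def[abs_def] by measurable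
  define w where "w x = (\<Sum>j. ennreal ((1/2) ^ j) * k j x)" for x
  have w [measurable]: "w \<in> borel_measurable borel" unfolding w_def[abs_def] by measurable
  show ?thesis
  proof (rule density_cancel[OF M N w])
    fix x :: 'h assume x: "x \<noteq> 0"
    have "open {h. cos (h \<bullet> x) < 1}" by (intro open_Collect_less continuous_intros)
    moreover have "(pi / (x \<bullet> x)) *\<^sub>R x \<in> {h. cos (h \<bullet> x) < 1}" using x by simp
    ultimately obtain j where "cos (d j \<bullet> x) < 1" using d by blast
    then have "0 < ennreal ((1/2) ^ j) * k j x" by (simp add: k_def ennreal_zero_less_mult_iff)
    also have "\<dots> = (\<Sum>i\<in>{j}. ennreal ((1/2) ^ i) * k i x)" by simp
    also have "\<dots> \<le> w x" unfolding w_def by (rule sum_le_suminf) auto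
    finally have "0 < w x" .
    moreover have "w x \<le> (\<Sum>j. ennreal ((1/2) ^ j * 2))"
      unfolding w_def
    proof (intro suminf_le)
      fix j
      have "1 - cos (d j \<bullet> x) \<le> 2" using cos_ge_minus_one[of "d j \<bullet> x"] by linarith
      then have "k j x \<le> ennreal 2" unfolding k_def by (rule ennreal_leI)
      then have "ennreal ((1/2) ^ j) * k j x \<le> ennreal ((1/2) ^ j) * ennreal 2" by (rule mult_left_mono) simp
      then show "ennreal ((1/2) ^ j) * k j x \<le> ennreal ((1/2) ^ j * 2)" by (simp add: ennreal_mult)
    qed auto
    moreover have "(\<Sum>j. ennreal ((1/2) ^ j * 2)) = ennreal 4"
    proof (rule suminf_ennreal_eq)
      have "(\<lambda>j. (1/2::real) ^ j) sums (1 / (1 - 1/2))" by (rule geometric_sums) simp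
      from sums_mult2[OF this, of 2] show "(\<lambda>j. (1/2::real) ^ j * 2) sums 4" by simp
    qed simp
    ultimately show "0 < w x \<and> w x < \<top>" using order.strict_trans1[of "w x" "ennreal 4" \<top>] by simp
  next
    have dens: "emeasure (density K w) A = (\<Sum>j. ennreal ((1/2) ^ j) * (\<integral>\<^sup>+x. k j x * indicator A x \<partial>K))"
      if K: "sets K = sets borel" and A [measurable]: "A \<in> sets borel" for K A
    proof -
      have [measurable_cong]: "sets K = sets borel" by fact
      have "emeasure (density K w) A = (\<integral>\<^sup>+x. w x * indicator A x \<partial>K)"
        by (rule emeasure_density) measurable
      also have "\<dots> = (\<integral>\<^sup>+x. (\<Sum>j. ennreal ((1/2) ^ j) * (k j x * indicator A x)) \<partial>K)"
        unfolding w_def by (simp only: mult.assoc[symmetric] ennreal_suminf_multc)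
      also have "\<dots> = (\<Sum>j. \<integral>\<^sup>+x. ennreal ((1/2) ^ j) * (k j x * indicator A x) \<partial>K)"
        by (rule nn_integral_suminf) measurable
      also have "\<dots> = (\<Sum>j. ennreal ((1/2) ^ j) * (\<integral>\<^sup>+x. k j x * indicator A x \<partial>K))"
        by (intro suminf_cong nn_integral_cmult) measurable
      finally show ?thesis .
    qed
    show "density M w = density N w"
    proof (rule measure_eqI)
      fix A assume "A \<in> sets (density M w)"
      then have A: "A \<in> sets borel" using M by simp
      show "emeasure (density M w) A = emeasure (density N w) A"
        unfolding dens[OF M(1) A] dens[OF N(1) A] k_def eq[OF A] ..
    qed (use M N in simp)
  qed
qed

lemma char_fun_atom:
  assumes "0 \<le> r"
  shows "char_fun (density (dirac (0::'h::{real_inner, second_countable_topology})) (\<lambda>_. ennreal r)) \<xi> = of_real r"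
  unfolding char_fun_def using assms
  by (subst integral_density) (simp_all add: integral_return scaleR_conv_of_real)

text \<open>
  Second differences turn the identity of exponents into an identity of finite measures, each consisting of an
  atom at the origin and a density \<open>1 - cos (h \<bullet> x)\<close>. The atoms give the covariance operators and the
  rest gives the Levy measures.
\<close>

theorem triplet_difference:
  fixes R1 R2 R3 :: "'h::{real_inner, complete_space, second_countable_topology} \<Rightarrow>\<^sub>L 'h"
  assumes sym: "\<And>x y. R1 x \<bullet> y = x \<bullet> R1 y" "\<And>x y. R2 x \<bullet> y = x \<bullet> R2 y" "\<And>x y. R3 x \<bullet> y = x \<bullet> R3 y"
    and pos: "\<And>x. 0 \<le> R1 x \<bullet> x" "\<And>x. 0 \<le> R2 x \<bullet> x" "\<And>x. 0 \<le> R3 x \<bullet> x"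
    and m: "levy_measure m1" "levy_measure m2" "levy_measure m3"
    and adj: "\<And>x y. blinfun_apply T' x \<bullet> y = x \<bullet> blinfun_apply T y"
    and eq: "\<And>\<xi>. levy_exponent a1 R1 m1 \<xi> = levy_exponent a2 R2 m2 \<xi> + levy_exponent a3 R3 m3 (T' \<xi>)"
  shows "R1 h \<bullet> h = R2 h \<bullet> h + R3 (T' h) \<bullet> T' h" and "m1 = madd m2 (push_off_zero T m3)"
proof -
  note s1 = levy_measureD[OF m(1)] and s2 = levy_measureD[OF m(2)] and s3 = levy_measureD[OF m(3)]
  have [measurable_cong]: "sets m1 = sets borel" "sets m2 = sets borel" "sets m3 = sets borel"
    using s1 s2 s3 by auto
  define C2 where "C2 h = push T (cos_measure m3 (T' h))" for h
  have C2s: "sets (C2 h) = sets borel" for h by (simp add: C2_def)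
  have Tm: "blinfun_apply T \<in> measurable (cos_measure m3 k) borel" for k
    by (simp add: measurable_cong_sets[OF sets_cos_measure[OF m(3)] refl])
  have C2f: "finite_measure (C2 h)" for h
    unfolding C2_def by (intro finite_measure.finite_measure_distr finite_cos_measure[OF m(3)] Tm)
  have C2c: "char_fun (C2 h) \<xi> = char_fun (cos_measure m3 (T' h)) (T' \<xi>)" for h \<xi>
    unfolding C2_def by (rule char_fun_push[OF sets_cos_measure[OF m(3)] adj])
  define r1 where "r1 h = 1/2 * (R1 h \<bullet> h)" for h
  define r2 where "r2 h = 1/2 * (R2 h \<bullet> h) + 1/2 * (R3 (T' h) \<bullet> T' h)" for h
  have r0: "0 \<le> r1 h" "0 \<le> r2 h" for h using pos by (auto simp: r1_def r2_def)
  define atom where "atom r = density (dirac (0::'h)) (\<lambda>_. ennreal r)" for r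
  have ats: "sets (atom r) = sets borel" for r by (simp add: atom_def)
  have ate: "emeasure (atom r) A = ennreal r * indicator A 0" if "A \<in> sets borel" for r A
    using that unfolding atom_def by (subst emeasure_density) (auto simp: nn_integral_return nn_integral_cmult_indicator)
  have atf: "finite_measure (atom r)" for r
    using ate[of UNIV r] by (intro finite_measureI) (simp add: atom_def ats)
  have atc: "char_fun (atom r) \<xi> = of_real r" if "0 \<le> r" for r \<xi>
    unfolding atom_def by (rule char_fun_atom[OF that])
  note c1f = finite_cos_measure[OF m(1)] and c1s = sets_cos_measure[OF m(1)]
  note c2f = finite_cos_measure[OF m(2)] and c2s = sets_cos_measure[OF m(2)]
  have maddf: "finite_measure (madd K L)" if "finite_measure K" "sets K = sets borel" "finite_measure L" "sets L = sets borel"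
    for K L :: "'h measure"
    using that by (intro finite_measure_madd) simp_all
  have ident: "madd (atom (r1 h)) (cos_measure m1 h) = madd (atom (r2 h)) (madd (cos_measure m2 h) (C2 h))" for h
  proof (rule char_fun_unique)
    show "finite_measure (madd (atom (r1 h)) (cos_measure m1 h))"
      by (intro maddf atf ats c1f c1s)
    show "finite_measure (madd (atom (r2 h)) (madd (cos_measure m2 h) (C2 h)))"
      using c2s by (intro maddf atf ats c2f C2f C2s) auto
    fix \<xi>
    let ?sd = "\<lambda>f. (f (\<xi> + h) + f (\<xi> - h)) / 2 - f \<xi> :: complex"
    have lin: "T' (\<xi> + h) = T' \<xi> + T' h" "T' (\<xi> - h) = T' \<xi> - T' h"
      by (simp_all add: blinfun.add_right blinfun.diff_right)
    have "?sd (levy_exponent a1 R1 m1) = ?sd (levy_exponent a2 R2 m2)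
        + ((levy_exponent a3 R3 m3 (T' \<xi> + T' h) + levy_exponent a3 R3 m3 (T' \<xi> - T' h)) / 2 - levy_exponent a3 R3 m3 (T' \<xi>))"
      unfolding eq lin by (simp add: field_simps)
    then have "of_real (r1 h) + char_fun (cos_measure m1 h) \<xi>
        = of_real (r2 h) + (char_fun (cos_measure m2 h) \<xi> + char_fun (C2 h) \<xi>)"
      unfolding levy_exponent_second_difference[OF m(1) sym(1)] levy_exponent_second_difference[OF m(2) sym(2)]
        levy_exponent_second_difference[OF m(3) sym(3)] r1_def r2_def C2c of_real_add
      by (simp only: ac_simps)
    then show "char_fun (madd (atom (r1 h)) (cos_measure m1 h)) \<xi>
        = char_fun (madd (atom (r2 h)) (madd (cos_measure m2 h) (C2 h))) \<xi>"
      using maddf[OF c2f c2s C2f C2s, of h h] c2s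
      by (simp add: char_fun_madd atf ats c1f c1s c2f C2f C2s atc r0)
  qed (simp_all add: ats)
  have em: "ennreal (r1 h) * indicator A 0 + emeasure (cos_measure m1 h) A
      = ennreal (r2 h) * indicator A 0 + (emeasure (cos_measure m2 h) A + emeasure (C2 h) A)"
    if "A \<in> sets borel" for h A
    using arg_cong[OF ident[of h], of "\<lambda>K. emeasure K A"]
    by (simp add: emeasure_madd ats c1s c2s C2s ate[OF that])
  have C2e: "emeasure (C2 h) A = (\<integral>\<^sup>+x. ennreal (1 - cos (h \<bullet> T x)) * indicator A (T x) \<partial>m3)"
    if "A \<in> sets borel" for h A
  proof -
    have "emeasure (C2 h) A = emeasure (cos_measure m3 (T' h)) (T -` A \<inter> space (cos_measure m3 (T' h)))"
      unfolding C2_def by (rule emeasure_distr[OF Tm that])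
    also have "space (cos_measure m3 (T' h)) = UNIV"
      using sets_eq_imp_space_eq[OF sets_cos_measure[OF m(3)]] by simp
    also have "T -` A \<inter> UNIV = T -` A" by simp
    also have "emeasure (cos_measure m3 (T' h)) (T -` A) = (\<integral>\<^sup>+x. ennreal (1 - cos (T' h \<bullet> x)) * indicator (T -` A) x \<partial>m3)"
      using measurable_sets[OF blinfun_measurable that, of T] by (intro emeasure_cos_measure[OF m(3)]) simp
    finally show ?thesis by (simp add: adj indicator_vimage)
  qed
  have "r1 h = r2 h"
  proof -
    have "emeasure (cos_measure K h) {0} = 0" if "levy_measure K" for K
      unfolding emeasure_cos_measure[OF that borel_singleton[OF sets.empty_sets]]
      by (intro nn_integral_zero' AE_I2) (simp split: split_indicator)
    moreover have "emeasure (C2 h) {0} = 0"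
      unfolding C2e[OF borel_singleton[OF sets.empty_sets]]
      by (intro nn_integral_zero' AE_I2) (simp split: split_indicator)
    ultimately show ?thesis using em[of "{0}" h] m r0 by simp
  qed
  then show "R1 h \<bullet> h = R2 h \<bullet> h + R3 (T' h) \<bullet> T' h" by (simp add: r1_def r2_def)
  show "m1 = madd m2 (push_off_zero T m3)"
  proof (rule measure_eq_if_cos_measures_eq)
    show "emeasure (madd m2 (push_off_zero T m3)) {0} = 0"
      by (subst emeasure_madd) (simp_all add: s2 emeasure_push_off_zero_0 s3)
    fix h :: 'h and A :: "'h set" assume A [measurable]: "A \<in> sets borel"
    let ?k = "\<lambda>x. ennreal (1 - cos (h \<bullet> x))"
    have A': "A - {0} \<in> sets borel" by measurable
    have cut: "?k x * indicator A x = ?k x * indicator (A - {0}) x" for x by (simp split: split_indicator)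
    have "(\<integral>\<^sup>+x. ?k x * indicator A x \<partial>m1) = emeasure (cos_measure m1 h) (A - {0})"
      unfolding cut emeasure_cos_measure[OF m(1) A'] ..
    also have "\<dots> = emeasure (cos_measure m2 h) (A - {0}) + emeasure (C2 h) (A - {0})"
      using em[OF A', of h] by simp
    also have "\<dots> = (\<integral>\<^sup>+x. ?k x * indicator A x \<partial>m2) + (\<integral>\<^sup>+x. ?k x * indicator A x \<partial>push_off_zero T m3)"
    proof -
      have "emeasure (C2 h) (A - {0}) = (\<integral>\<^sup>+x. indicator (- {0}) (T x) * (?k (T x) * indicator A (T x)) \<partial>m3)"
        unfolding C2e[OF A'] by (intro nn_integral_cong) (simp split: split_indicator)
      then show ?thesis
        unfolding cut[symmetric] emeasure_cos_measure[OF m(2) A']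
        by (subst nn_integral_push_off_zero) (simp_all add: s3)
    qed
    also have "\<dots> = (\<integral>\<^sup>+x. ?k x * indicator A x \<partial>madd m2 (push_off_zero T m3))"
      by (rule nn_integral_madd[symmetric]) (simp_all add: s2)
    finally show "(\<integral>\<^sup>+x. ?k x * indicator A x \<partial>m1) = (\<integral>\<^sup>+x. ?k x * indicator A x \<partial>madd m2 (push_off_zero T m3))" .
  qed (use s1 s2 in simp_all)
qed

section \<open>Bounds for the triplets of factors\<close>

lemma min_le_one_minus_exp:
  fixes c r :: real
  assumes c: "0 < c" and r: "0 \<le> r"
  shows "min 1 r \<le> (2 + c) / c * (1 - exp (- (c / 2 * r)))"
proof -
  define q where "q = min 1 r"
  have q: "0 \<le> q" "q \<le> 1" "q \<le> r" using r by (auto simp: q_def)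
  define u where "u = c / 2 * q"
  have u: "0 \<le> u" "u \<le> c / 2" using q c by (auto simp: u_def mult_left_le)
  have "exp (- (c / 2 * r)) \<le> exp (- u)" unfolding u_def using q c by simp
  also have "\<dots> = inverse (exp u)" by (rule exp_minus)
  also have "\<dots> \<le> inverse (1 + u)" using u exp_ge_add_one_self[of u] by (intro le_imp_inverse_le) auto
  finally have "1 - inverse (1 + u) \<le> 1 - exp (- (c / 2 * r))" by simp
  moreover have "1 - inverse (1 + u) = u / (1 + u)" using u by (simp add: field_simps)
  moreover have "u / (1 + c / 2) \<le> u / (1 + u)" using u c by (intro divide_left_mono) auto
  ultimately have "u / (1 + c / 2) \<le> 1 - exp (- (c / 2 * r))" by simp
  then have "(2 + c) / c * (u / (1 + c / 2)) \<le> (2 + c) / c * (1 - exp (- (c / 2 * r)))"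
    using c by (intro mult_left_mono) auto
  moreover have "(2 + c) / c * (u / (1 + c / 2)) = q"
  proof -
    have "1 + c / 2 = (2 + c) / 2" "2 + c \<noteq> 0" using c by auto
    then show ?thesis using c by (simp add: u_def)
  qed
  ultimately show ?thesis by (simp add: q_def)
qed

lemma damp_tendsto:
  fixes x :: "'h::{real_inner, second_countable_topology}"
  shows "(\<lambda>n. damp c n x) \<longlonglongrightarrow> exp (- (c / 2 * (norm x)\<^sup>2))"
  unfolding damp_def by (intro tendsto_intros norm_onb_proj_tendsto)

lemma damp_ge:
  fixes x :: "'h::{real_inner, second_countable_topology}"
  assumes "0 \<le> c"
  shows "exp (- (c / 2 * (norm x)\<^sup>2)) \<le> damp c n x"
  unfolding damp_def using assms norm_onb_proj_le[of n x] by (simp add: mult_left_mono power_mono)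

lemma gauss_inner_square:
  fixes x :: "'h::{real_inner, second_countable_topology}"
  assumes c: "0 \<le> c"
  shows "(\<integral>\<^sup>+\<xi>. ennreal ((\<xi> \<bullet> x)\<^sup>2) \<partial>gauss c n) = ennreal (c * (norm (onb_proj n x))\<^sup>2)"
proof -
  have "(\<integral>\<^sup>+\<xi>. ennreal ((\<xi> \<bullet> x)\<^sup>2) \<partial>gauss c n) = (\<Sum>i<n. ennreal (c * (onb i \<bullet> x)\<^sup>2))"
    by (rule gauss_quadratic_form)
      (simp_all add: c inner_simps power2_eq_square algebra_simps)
  also have "\<dots> = ennreal (\<Sum>i<n. c * (onb i \<bullet> x)\<^sup>2)" using c by (intro sum_ennreal) simp
  also have "(\<Sum>i<n. c * (onb i \<bullet> x)\<^sup>2) = c * (norm (onb_proj n x))\<^sup>2"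
    by (simp add: norm_onb_proj sum_distrib_left inner_commute)
  finally show ?thesis .
qed

lemma gauss_operator:
  fixes R :: "'h::{real_inner, second_countable_topology} \<Rightarrow>\<^sub>L 'h"
  assumes c: "0 \<le> c" and R: "\<And>x. 0 \<le> R x \<bullet> x"
  shows "(\<integral>\<^sup>+\<xi>. ennreal (R \<xi> \<bullet> \<xi>) \<partial>gauss c n) = (\<Sum>i<n. ennreal (c * (R (onb i) \<bullet> onb i)))"
proof (rule gauss_quadratic_form)
  show "(\<lambda>\<xi>. R \<xi> \<bullet> \<xi>) \<in> borel_measurable borel"
    by (intro borel_measurable_continuous_onI continuous_intros)
  show "R (x + y) \<bullet> (x + y) + R (x - y) \<bullet> (x - y) = 2 * (R x \<bullet> x) + 2 * (R y \<bullet> y)" for x y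
    by (simp add: blinfun.add_right blinfun.diff_right inner_simps)
  show "R (r *\<^sub>R x) \<bullet> r *\<^sub>R x = r\<^sup>2 * (R x \<bullet> x)" for r x
    by (simp add: blinfun.scaleR_right power2_eq_square)
qed (use c R in auto)

lemma covariance_operatorD:
  assumes "covariance_operator R"
  shows "\<And>x y. R x \<bullet> y = x \<bullet> R y" "\<And>x. 0 \<le> R x \<bullet> x" "op_trace R < \<infinity>"
  using assms by (auto simp: covariance_operator_def)

lemma nn_integral_swap_gauss:
  fixes m :: "'h::{real_inner, second_countable_topology} measure" and f :: "'h \<Rightarrow> 'h \<Rightarrow> ennreal"
  assumes m: "levy_measure m" and f: "(\<lambda>(\<xi>, x). f \<xi> x) \<in> borel_measurable (borel \<Otimes>\<^sub>M borel)"
  shows "(\<integral>\<^sup>+\<xi>. \<integral>\<^sup>+x. f \<xi> x \<partial>m \<partial>gauss c n) = (\<integral>\<^sup>+x. \<integral>\<^sup>+\<xi>. f \<xi> x \<partial>gauss c n \<partial>m)"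
proof -
  have gp: "borel_prob (gauss c n :: 'h measure)" by simp
  note g = borel_probD[OF gp] and m' = levy_measureD[OF m]
  interpret G: prob_space "gauss c n :: 'h measure" by (rule g)
  interpret m: sigma_finite_measure m by (rule m')
  interpret P: pair_sigma_finite "gauss c n :: 'h measure" m ..
  have "(\<lambda>(\<xi>, x). f \<xi> x) \<in> borel_measurable (gauss c n \<Otimes>\<^sub>M m)"
    using f by (simp add: measurable_cong_sets[OF sets_pair_measure_cong[OF g(3) m'(1)] refl])
  then show ?thesis by (rule P.Fubini'[symmetric])
qed

text \<open>
  Dominated convergence as \<open>c\<close> tends to \<open>0\<close>.
\<close>

lemma small_c_exists:
  fixes N :: "'h::{real_inner, second_countable_topology} measure"
  assumes N: "borel_prob N" and e: "0 < e"
  shows "\<exists>c>0. (\<integral>x. 1 - exp (- (c / 2 * (norm x)\<^sup>2)) \<partial>N) < e"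
proof -
  note N' = borel_probD[OF N]
  have [measurable_cong]: "sets N = sets borel" by (rule N')
  interpret prob_space N by (rule N')
  define c where "c k = 1 / real (Suc k)" for k
  have c: "0 < c k" for k by (simp add: c_def)
  have "(\<lambda>k. \<integral>x. 1 - exp (- (c k / 2 * (norm x)\<^sup>2)) \<partial>N) \<longlonglongrightarrow> (\<integral>x. 0 \<partial>N)"
  proof (rule integral_dominated_convergence[where w="\<lambda>_. 1"])
    show "AE x in N. (\<lambda>k. 1 - exp (- (c k / 2 * (norm x)\<^sup>2))) \<longlonglongrightarrow> 0"
    proof (intro always_eventually allI)
      fix x
      have "(\<lambda>k. 1 - exp (- (c k / 2 * (norm x)\<^sup>2))) \<longlonglongrightarrow> 1 - exp (- (0 / 2 * (norm x)\<^sup>2))"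
        unfolding c_def by (intro tendsto_intros LIMSEQ_Suc[OF lim_1_over_n]) auto
      then show "(\<lambda>k. 1 - exp (- (c k / 2 * (norm x)\<^sup>2))) \<longlonglongrightarrow> 0" by simp
    qed
    show "AE x in N. norm (1 - exp (- (c k / 2 * (norm x)\<^sup>2))) \<le> 1" for k
      using c[of k] by simp
  qed simp_all
  then have "eventually (\<lambda>k. (\<integral>x. 1 - exp (- (c k / 2 * (norm x)\<^sup>2)) \<partial>N) < e) sequentially"
    by (rule order_tendstoD(2)) (use e in simp)
  then obtain k where "(\<integral>x. 1 - exp (- (c k / 2 * (norm x)\<^sup>2)) \<partial>N) < e"
    using eventually_happens by fastforce
  then show ?thesis using c by blast
qed

text \<open>
  The characteristic function of a factor \<open>M\<close> of \<open>\<nu>\<close> has at least the modulus of that of \<open>\<nu>\<close>, so a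
  Gaussian average of \<open>1 - (norm (char_fun M \<xi>))\<^sup>2\<close> is at most the integral of
  \<open>1 - exp (- c \<bar>x\<bar>\<^sup>2 / 2)\<close> against the symmetrised \<open>\<nu>\<close>, whatever the dimension of the Gaussian. For
  small \<open>c\<close> this is below \<open>1/6\<close>, which bounds the trace and the Levy measure. The
  bound for \<open>R\<close> itself comes from a ball of radius \<open>r\<close> on which \<open>char_fun \<nu>\<close> is close to \<open>1\<close>.
\<close>

theorem factor_bound:
  fixes \<nu> :: "'h::{real_inner, second_countable_topology} measure"
  assumes \<nu>: "borel_prob \<nu>"
  shows "\<exists>C. \<forall>M a R m \<eta>. has_triplet M a R m \<longrightarrow> borel_prob \<eta> \<longrightarrow> \<nu> = M \<^bold>* \<eta> \<longrightarrow>
    op_trace R \<le> ennreal C \<and> small_mass m \<le> ennreal C \<and> (\<forall>x. R x \<bullet> x \<le> C * (norm x)\<^sup>2)"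
proof -
  note sv = borel_prob_symm[OF \<nu>] and \<nu>' = borel_probD[OF \<nu>]
  obtain c where c: "0 < c" "(\<integral>x. 1 - exp (- (c / 2 * (norm x)\<^sup>2)) \<partial>symm \<nu>) < 1 / 6"
    using small_c_exists[OF sv, of "1/6"] by auto
  have "isCont (char_fun \<nu>) 0"
    using continuous_char_fun[OF \<nu>'(2,3)] by (simp add: continuous_on_eq_continuous_at)
  then obtain d where d: "0 < d" "\<And>\<xi>. dist \<xi> 0 < d \<Longrightarrow> dist (char_fun \<nu> \<xi>) (char_fun \<nu> 0) < 1 / 4"
    unfolding continuous_at_eps_delta by (metis zero_less_divide_1_iff zero_less_numeral)
  define r where "r = d / 2"
  have r: "0 < r" "r < d" using d(1) by (auto simp: r_def)
  define C where "C = 1 / (3 * c) + (2 + c) / (3 * c) + 1 / r\<^sup>2"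
  have C: "1 / (3 * c) \<le> C" "(2 + c) / (3 * c) \<le> C" "1 / r\<^sup>2 \<le> C" using c(1) by (auto simp: C_def)
  show ?thesis
  proof (intro exI[of _ C] allI impI)
    fix M a R m \<eta>
    assume trip: "has_triplet M a R m" and \<eta>: "borel_prob \<eta>" and fac: "\<nu> = M \<^bold>* \<eta>"
    have idiv: "infinitely_divisible M" and cov: "covariance_operator R" and m: "levy_measure m"
      and cf: "\<And>\<xi>. char_fun M \<xi> = exp (- levy_exponent a R m \<xi>)"
      using trip by (auto simp: has_triplet_def)
    have M: "borel_prob M" using idiv by (simp add: infinitely_divisible_def)
    note R = covariance_operatorD[OF cov]
    have [measurable_cong]: "sets m = sets borel" by (rule levy_measureD[OF m])
    define J where "J \<xi> = (\<integral>x. 1 - cos (\<xi> \<bullet> x) \<partial>m)" for \<xi>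
    have J0: "0 \<le> J \<xi>" for \<xi> unfolding J_def by (intro integral_nonneg_AE) simp
    define Q where "Q \<xi> = R \<xi> \<bullet> \<xi> + 2 * J \<xi>" for \<xi>
    have Qre: "Q \<xi> = 2 * Re (levy_exponent a R m \<xi>)" for \<xi>
      unfolding Q_def J_def Re_levy_exponent[OF m] by simp
    have Q0: "0 \<le> Q \<xi>" for \<xi> using R(2)[of \<xi>] J0[of \<xi>] by (simp add: Q_def)
    have Qm: "Q \<in> borel_measurable borel"
      unfolding Qre by (intro borel_measurable_continuous_onI continuous_intros continuous_levy_exponent[OF m])
    have MQ: "(norm (char_fun M \<xi>))\<^sup>2 = exp (- Q \<xi>)" for \<xi>
      unfolding cf Qre by (simp add: norm_exp_eq_Re exp_double[symmetric])
    have le: "norm (char_fun \<nu> \<xi>) \<le> norm (char_fun M \<xi>)" for \<xi>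
      unfolding fac char_fun_conv[OF M \<eta>] norm_mult
      using char_fun_bound[OF \<eta>, of \<xi>] by (simp add: mult_left_le)
    have main: "(\<integral>\<^sup>+\<xi>. ennreal (Q \<xi>) \<partial>gauss c n) \<le> ennreal (1 / 3)" for n
    proof (rule infinitely_divisible_gauss_bound[OF idiv _ Qm Q0 MQ])
      have gp: "borel_prob (gauss c n :: 'h measure)" by simp
      note g = borel_probD[OF gp]
      have "(\<integral>\<xi>. 1 - exp (- Q \<xi>) \<partial>gauss c n) \<le> (\<integral>\<xi>. \<integral>x. 1 - cos (\<xi> \<bullet> x) \<partial>symm \<nu> \<partial>gauss c n)"
      proof (rule integral_mono)
        show "integrable (gauss c n) (\<lambda>\<xi>. 1 - exp (- Q \<xi>))"
          using Q0 Qm by (intro integrable_bounded_borel[OF g(2,3), where B=1]) auto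
        have [measurable]: "char_fun \<nu> \<in> borel_measurable borel"
          by (intro borel_measurable_continuous_onI continuous_char_fun \<nu>')
        have "norm (1 - (norm (char_fun \<nu> \<xi>))\<^sup>2) \<le> 1" for \<xi>
          using char_fun_bound[OF \<nu>, of \<xi>] by (simp add: power_le_one)
        then show "integrable (gauss c n) (\<lambda>\<xi>. \<integral>x. 1 - cos (\<xi> \<bullet> x) \<partial>symm \<nu>)"
          unfolding integral_one_minus_cos[OF sv] char_fun_symm[OF \<nu>] Re_complex_of_real
          by (intro integrable_bounded_borel[OF g(2,3), where B=1]) measurable
        show "1 - exp (- Q \<xi>) \<le> (\<integral>x. 1 - cos (\<xi> \<bullet> x) \<partial>symm \<nu>)" for \<xi>
          unfolding integral_one_minus_cos[OF sv] char_fun_symm[OF \<nu>] Re_complex_of_real MQ[symmetric]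
          using power_mono[OF le norm_ge_zero, of \<xi> 2] by simp
      qed
      also have "\<dots> = (\<integral>x. 1 - damp c n x \<partial>symm \<nu>)"
        using c by (intro gauss_second_moment(1) sv) auto
      also have "\<dots> \<le> (\<integral>x. 1 - exp (- (c / 2 * (norm x)\<^sup>2)) \<partial>symm \<nu>)"
      proof (rule integral_mono)
        note s = borel_probD[OF sv]
        have "norm (1 - damp c n x) \<le> 1" for x :: 'h using damp_bounds[of c n x] c by auto
        then show "integrable (symm \<nu>) (\<lambda>x. 1 - damp c n x)"
          by (intro integrable_bounded_borel[OF s(2,3), where B=1]) measurable
        show "integrable (symm \<nu>) (\<lambda>x. 1 - exp (- (c / 2 * (norm x)\<^sup>2)))"
          using c by (intro integrable_bounded_borel[OF s(2,3), where B=1]) auto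
        show "1 - damp c n x \<le> 1 - exp (- (c / 2 * (norm x)\<^sup>2))" for x :: 'h
          using damp_ge[of c x n] c by simp
      qed
      also have "\<dots> < 1 / 6" by (rule c(2))
      finally show "(\<integral>\<xi>. 1 - exp (- Q \<xi>) \<partial>gauss c n) < 1 / 6" .
    qed (use c in simp)
    have trace: "op_trace R \<le> ennreal (1 / (3 * c))"
    proof -
      have part: "(\<Sum>i<n. ennreal (c * (R (onb i) \<bullet> onb i))) \<le> ennreal (1 / 3)" for n
      proof -
        have "(\<Sum>i<n. ennreal (c * (R (onb i) \<bullet> onb i))) = (\<integral>\<^sup>+\<xi>. ennreal (R \<xi> \<bullet> \<xi>) \<partial>gauss c n)"
          using c R by (intro gauss_operator[symmetric]) auto
        also have "\<dots> \<le> (\<integral>\<^sup>+\<xi>. ennreal (Q \<xi>) \<partial>gauss c n)"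
          using J0 by (intro nn_integral_mono ennreal_leI) (simp add: Q_def)
        also note main
        finally show ?thesis .
      qed
      have "ennreal c * op_trace R = (\<Sum>i. ennreal (c * (R (onb i) \<bullet> onb i)))"
        unfolding op_trace_onb using c R by (simp add: ennreal_mult)
      also have "\<dots> \<le> ennreal (1 / 3)"
        unfolding suminf_eq_SUP by (intro SUP_least part)
      finally have "ennreal (1 / c) * (ennreal c * op_trace R) \<le> ennreal (1 / c) * ennreal (1 / 3)"
        by (rule mult_left_mono) simp
      moreover have "ennreal (1 / c) * (ennreal c * op_trace R) = op_trace R"
        using c by (simp add: mult.assoc[symmetric] flip: ennreal_mult)
      moreover have "ennreal (1 / c) * ennreal (1 / 3) = ennreal (1 / (3 * c))"
        using c by (simp add: mult.commute flip: ennreal_mult)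
      ultimately show ?thesis by simp
    qed
    have damped: "(\<integral>\<^sup>+x. ennreal (1 - damp c n x) \<partial>m) \<le> ennreal (1 / 3)" for n
    proof -
      have "(\<integral>\<^sup>+x. ennreal (1 - damp c n x) \<partial>m) = (\<integral>\<^sup>+x. \<integral>\<^sup>+\<xi>. ennreal (1 - cos (\<xi> \<bullet> x)) \<partial>gauss c n \<partial>m)"
      proof (rule nn_integral_cong)
        fix x :: 'h
        have gp: "borel_prob (gauss c n :: 'h measure)" by simp
        note g = borel_probD[OF gp]
        have "integrable (gauss c n) (\<lambda>\<xi>. 1 - cos (\<xi> \<bullet> x))"
          using cos_ge_minus_one[of "_ \<bullet> x"]
          by (intro Bochner_Integration.integrable_diff finite_measure.integrable_const[OF g(2)]
              integrable_bounded_borel[OF g(2,3), where B=1]) auto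
        then have "(\<integral>\<^sup>+\<xi>. ennreal (1 - cos (\<xi> \<bullet> x)) \<partial>gauss c n) = ennreal (\<integral>\<xi>. 1 - cos (\<xi> \<bullet> x) \<partial>gauss c n)"
          by (intro nn_integral_eq_integral) auto
        then show "ennreal (1 - damp c n x) = (\<integral>\<^sup>+\<xi>. ennreal (1 - cos (\<xi> \<bullet> x)) \<partial>gauss c n)"
          using c gauss_one_minus_cos[of c "gauss c n" n x] by simp
      qed
      also have "\<dots> = (\<integral>\<^sup>+\<xi>. \<integral>\<^sup>+x. ennreal (1 - cos (\<xi> \<bullet> x)) \<partial>m \<partial>gauss c n)"
        by (rule nn_integral_swap_gauss[OF m, symmetric]) measurable
      also have "\<dots> \<le> (\<integral>\<^sup>+\<xi>. ennreal (Q \<xi>) \<partial>gauss c n)"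
      proof (rule nn_integral_mono)
        fix \<xi>
        have "(\<integral>\<^sup>+x. ennreal (1 - cos (\<xi> \<bullet> x)) \<partial>m) = ennreal (J \<xi>)"
          unfolding J_def by (intro nn_integral_eq_integral integrable_one_minus_cos[OF m]) auto
        also have "\<dots> \<le> ennreal (Q \<xi>)" using J0[of \<xi>] R(2)[of \<xi>] by (intro ennreal_leI) (simp add: Q_def)
        finally show "(\<integral>\<^sup>+x. ennreal (1 - cos (\<xi> \<bullet> x)) \<partial>m) \<le> ennreal (Q \<xi>)" .
      qed
      also note main
      finally show ?thesis .
    qed
    have mass: "small_mass m \<le> ennreal ((2 + c) / (3 * c))"
    proof -
      have "(\<integral>\<^sup>+x. ennreal (1 - exp (- (c / 2 * (norm x)\<^sup>2))) \<partial>m)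
          = (\<integral>\<^sup>+x. liminf (\<lambda>n. ennreal (1 - damp c n x)) \<partial>m)"
        by (intro nn_integral_cong lim_imp_Liminf[symmetric] tendsto_ennrealI tendsto_intros damp_tendsto) simp
      also have "\<dots> \<le> liminf (\<lambda>n. \<integral>\<^sup>+x. ennreal (1 - damp c n x) \<partial>m)"
        by (rule nn_integral_liminf) measurable
      also have "\<dots> \<le> liminf (\<lambda>n. ennreal (1 / 3))"
        by (intro Liminf_mono always_eventually allI damped)
      also have "\<dots> = ennreal (1 / 3)" by (simp add: Liminf_const)
      finally have fat: "(\<integral>\<^sup>+x. ennreal (1 - exp (- (c / 2 * (norm x)\<^sup>2))) \<partial>m) \<le> ennreal (1 / 3)" .
      have "small_mass m \<le> (\<integral>\<^sup>+x. ennreal ((2 + c) / c) * ennreal (1 - exp (- (c / 2 * (norm x)\<^sup>2))) \<partial>m)"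
        unfolding small_mass_def
      proof (rule nn_integral_mono)
        fix x :: 'h
        show "ennreal (min 1 ((norm x)\<^sup>2)) \<le> ennreal ((2 + c) / c) * ennreal (1 - exp (- (c / 2 * (norm x)\<^sup>2)))"
          using min_le_one_minus_exp[OF c(1), of "(norm x)\<^sup>2"] c by (subst ennreal_mult[symmetric]) (auto intro: ennreal_leI)
      qed
      also have "\<dots> = ennreal ((2 + c) / c) * (\<integral>\<^sup>+x. ennreal (1 - exp (- (c / 2 * (norm x)\<^sup>2))) \<partial>m)"
        by (rule nn_integral_cmult) measurable
      also have "\<dots> \<le> ennreal ((2 + c) / c) * ennreal (1 / 3)" using fat by (rule mult_left_mono) simp
      also have "\<dots> = ennreal ((2 + c) / (3 * c))" using c by (simp add: mult.commute flip: ennreal_mult)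
      finally show ?thesis .
    qed
    have quad: "R x \<bullet> x \<le> 1 / r\<^sup>2 * (norm x)\<^sup>2" for x
    proof (cases "x = 0")
      case False
      define \<xi> where "\<xi> = (r / norm x) *\<^sub>R x"
      have "norm \<xi> = r" using False r by (simp add: \<xi>_def)
      then have "dist (char_fun \<nu> \<xi>) (char_fun \<nu> 0) < 1 / 4" using r by (intro d) simp
      then have "norm (1 - char_fun \<nu> \<xi>) < 1 / 4" by (simp add: char_fun_0[OF \<nu>] dist_norm norm_minus_commute)
      moreover have "1 - norm (char_fun \<nu> \<xi>) \<le> norm (1 - char_fun \<nu> \<xi>)"
        using norm_triangle_ineq2[of 1 "char_fun \<nu> \<xi>"] by simp
      ultimately have "3 / 4 \<le> norm (char_fun M \<xi>)" using le[of \<xi>] by linarith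
      then have "(3 / 4)\<^sup>2 \<le> exp (- Q \<xi>)" unfolding MQ[symmetric] by (rule power_mono) simp
      moreover have "exp (-1) \<le> (1 / 2 :: real)" using exp_ge_add_one_self[of 1] by (simp add: exp_minus field_simps)
      moreover have "(3 / 4)\<^sup>2 = (9 / 16 :: real)" by (simp add: power2_eq_square)
      ultimately have "exp (- 1) < exp (- Q \<xi>)" by linarith
      then have "Q \<xi> \<le> 1" by simp
      then have "R \<xi> \<bullet> \<xi> \<le> 1" using J0[of \<xi>] by (simp add: Q_def)
      moreover have "R \<xi> \<bullet> \<xi> = (r / norm x)\<^sup>2 * (R x \<bullet> x)"
        by (simp add: \<xi>_def blinfun.scaleR_right power2_eq_square)
      ultimately show ?thesis using False r by (simp add: field_simps)
    qed simp
    show "op_trace R \<le> ennreal C \<and> small_mass m \<le> ennreal C \<and> (\<forall>x. R x \<bullet> x \<le> C * (norm x)\<^sup>2)"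
    proof (intro conjI allI)
      show "op_trace R \<le> ennreal C" using trace ennreal_leI[OF C(1)] by (rule order_trans)
      show "small_mass m \<le> ennreal C" using mass ennreal_leI[OF C(2)] by (rule order_trans)
      show "R x \<bullet> x \<le> C * (norm x)\<^sup>2" for x
        using quad[of x] mult_right_mono[OF C(3), of "(norm x)\<^sup>2"] by simp
    qed
  qed
qed

section \<open>Small triplets give measures near the origin\<close>

lemma one_minus_Re_exp_le:
  assumes "0 \<le> Re z"
  shows "1 - Re (exp (- z)) \<le> 2 * norm z"
proof -
  have "1 - exp (- Re z) \<le> Re z" using exp_ge_add_one_self[of "- Re z"] by linarith
  moreover have "1 - cos (Im z) \<le> \<bar>Im z\<bar>"
  proof -
    have "cos 0 - cos (Im z) \<le> \<bar>cos (Im z) - cos 0\<bar>" by simp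
    also have "\<dots> \<le> \<bar>Im z - 0\<bar>"
    proof -
      have "norm (cos (Im z) - cos 0) \<le> 1 * norm (Im z - 0)"
        by (rule field_differentiable_bound[where S=UNIV and f'="\<lambda>x. - sin x"])
          (auto intro!: derivative_eq_intros)
      then show ?thesis by simp
    qed
    finally show ?thesis by simp
  qed
  moreover have "exp (- Re z) * (1 - cos (Im z)) \<le> 1 * (1 - cos (Im z))"
    using assms by (intro mult_right_mono) auto
  ultimately have parts: "1 - exp (- Re z) \<le> Re z" "exp (- Re z) * (1 - cos (Im z)) \<le> \<bar>Im z\<bar>"
    by simp_all
  have "1 - Re (exp (- z)) = (1 - exp (- Re z)) + exp (- Re z) * (1 - cos (Im z))"
    by (simp add: Re_exp algebra_simps)
  also have "\<dots> \<le> Re z + \<bar>Im z\<bar>" by (intro add_mono parts)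
  also have "\<dots> \<le> 2 * norm z" using abs_Re_le_cmod[of z] abs_Im_le_cmod[of z] by linarith
  finally show ?thesis .
qed

text \<open>
  The average of \<open>1 - Re (char_fun \<rho> \<xi>)\<close> over \<open>gauss 1 n\<close> is the integral of \<open>1 - damp 1 n x\<close> against \<open>\<rho>\<close>. It is
  at most twice the average of the modulus of the exponent, in which the quadratic form contributes
  partial traces and the kernel a multiple of \<open>min 1 \<bar>x\<bar>\<^sup>2\<close>. The factor \<open>\<theta>\<close> makes the bound
  apply to convolution roots.
\<close>

theorem increment_bound:
  fixes \<rho> :: "'h::{real_inner, second_countable_topology} measure" and R :: "'h \<Rightarrow>\<^sub>L 'h"
  assumes \<rho>: "borel_prob \<rho>" and R: "\<And>x. 0 \<le> R x \<bullet> x" and m: "levy_measure m"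
    and \<theta>: "0 \<le> \<theta>" "\<theta> \<le> 1"
    and cf: "\<And>\<xi>. char_fun \<rho> \<xi> = exp (- (of_real \<theta> * levy_exponent 0 R m \<xi>))"
  shows "(\<integral>\<^sup>+x. ennreal (1 - exp (- (1 / 2 * (norm x)\<^sup>2))) \<partial>\<rho>) \<le> op_trace R + 5 * small_mass m"
proof -
  note r = borel_probD[OF \<rho>]
  have [measurable_cong]: "sets m = sets borel" "sets \<rho> = sets borel" by (rule levy_measureD[OF m], rule r)
  define S where "S \<xi> x = ((\<xi> \<bullet> x)\<^sup>2 / 2 + 2 * (norm x)\<^sup>2) / (1 + (norm x)\<^sup>2)" for \<xi> x :: 'h
  have S0: "0 \<le> S \<xi> x" for \<xi> x unfolding S_def by simp
  have Sm: "(\<lambda>(\<xi>, x). ennreal (S \<xi> x)) \<in> borel_measurable (borel \<Otimes>\<^sub>M borel)"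
    unfolding S_def by measurable
  have Re_kernel: "0 \<le> Re (levy_exponent 0 R m \<xi>)" for \<xi>
    unfolding Re_levy_exponent[OF m] using R[of \<xi>] by (intro add_nonneg_nonneg integral_nonneg_AE) auto
  have pointwise: "ennreal (1 - Re (char_fun \<rho> \<xi>)) \<le> ennreal (R \<xi> \<bullet> \<xi>) + 2 * (\<integral>\<^sup>+x. ennreal (S \<xi> x) \<partial>m)" for \<xi>
  proof -
    have "1 - Re (char_fun \<rho> \<xi>) \<le> 2 * norm (of_real \<theta> * levy_exponent 0 R m \<xi>)"
      unfolding cf using \<theta> Re_kernel[of \<xi>] by (intro one_minus_Re_exp_le) simp
    also have "\<dots> \<le> 2 * norm (levy_exponent 0 R m \<xi>)"
      using \<theta> by (simp add: norm_mult mult_left_le_one_le)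
    also have "norm (levy_exponent 0 R m \<xi>) \<le> 1/2 * (R \<xi> \<bullet> \<xi>) + norm (CLINT x|m. levy_kernel \<xi> x)"
      unfolding levy_exponent_kernel[OF m]
      using norm_triangle_ineq4[of "complex_of_real (1/2 * (R \<xi> \<bullet> \<xi>))" "CLINT x|m. levy_kernel \<xi> x"] R[of \<xi>]
      by (simp del: of_real_mult of_real_divide)
    finally have "1 - Re (char_fun \<rho> \<xi>) \<le> R \<xi> \<bullet> \<xi> + 2 * norm (CLINT x|m. levy_kernel \<xi> x)" by simp
    then have "ennreal (1 - Re (char_fun \<rho> \<xi>)) \<le> ennreal (R \<xi> \<bullet> \<xi> + 2 * norm (CLINT x|m. levy_kernel \<xi> x))"
      by (rule ennreal_leI)
    also have "\<dots> = ennreal (R \<xi> \<bullet> \<xi>) + 2 * ennreal (norm (CLINT x|m. levy_kernel \<xi> x))"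
      using R[of \<xi>] by (simp add: ennreal_plus ennreal_mult)
    also have "ennreal (norm (CLINT x|m. levy_kernel \<xi> x)) \<le> (\<integral>\<^sup>+x. ennreal (norm (levy_kernel \<xi> x)) \<partial>m)"
      by (rule integral_norm_bound_ennreal[OF integrable_levy_kernel[OF m]])
    also have "\<dots> \<le> (\<integral>\<^sup>+x. ennreal (S \<xi> x) \<partial>m)"
      unfolding S_def by (intro nn_integral_mono ennreal_leI levy_kernel_bound)
    finally show ?thesis by (simp add: add_left_mono mult_left_mono)
  qed
  have average: "(\<integral>\<^sup>+x. ennreal (1 - damp 1 n x) \<partial>\<rho>) \<le> op_trace R + 5 * small_mass m" for n
  proof -
    have gp: "borel_prob (gauss 1 n :: 'h measure)" by simp
    note g = borel_probD[OF gp]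
    have [measurable_cong]: "sets (gauss 1 n :: 'h measure) = sets borel" by (rule g)
    have [measurable]: "char_fun \<rho> \<in> borel_measurable borel"
      by (intro borel_measurable_continuous_onI continuous_char_fun r)
    have re01: "0 \<le> 1 - Re (char_fun \<rho> \<xi>)" "1 - Re (char_fun \<rho> \<xi>) \<le> 2" for \<xi>
      using char_fun_bound[OF \<rho>, of \<xi>] abs_Re_le_cmod[of "char_fun \<rho> \<xi>"] by linarith+
    have d01: "norm (1 - damp 1 n x) \<le> 1" for x :: 'h using damp_bounds[of 1 n x] by auto
    have "(\<integral>\<^sup>+x. ennreal (1 - damp 1 n x) \<partial>\<rho>) = ennreal (\<integral>x. 1 - damp 1 n x \<partial>\<rho>)"
      using damp_bounds[of 1 n]
      by (intro nn_integral_eq_integral integrable_bounded_borel[OF r(2,3) _ d01]) auto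
    also have "(\<integral>x. 1 - damp 1 n x \<partial>\<rho>) = (\<integral>\<xi>. 1 - Re (char_fun \<rho> \<xi>) \<partial>gauss 1 n)"
      using gauss_second_moment(1)[of 1 "gauss 1 n" n \<rho>] \<rho> by (simp only: integral_one_minus_cos[OF \<rho>])
    also have "ennreal \<dots> = (\<integral>\<^sup>+\<xi>. ennreal (1 - Re (char_fun \<rho> \<xi>)) \<partial>gauss 1 n)"
      using re01 by (intro nn_integral_eq_integral[symmetric] integrable_bounded_borel[OF g(2,3), where B=2]) auto
    also have "\<dots> \<le> (\<integral>\<^sup>+\<xi>. ennreal (R \<xi> \<bullet> \<xi>) + 2 * (\<integral>\<^sup>+x. ennreal (S \<xi> x) \<partial>m) \<partial>gauss 1 n)"
      by (intro nn_integral_mono pointwise)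
    also have "\<dots> = (\<integral>\<^sup>+\<xi>. ennreal (R \<xi> \<bullet> \<xi>) \<partial>gauss 1 n) + 2 * (\<integral>\<^sup>+\<xi>. \<integral>\<^sup>+x. ennreal (S \<xi> x) \<partial>m \<partial>gauss 1 n)"
    proof -
      interpret sigma_finite_measure m by (rule levy_measureD[OF m])
      have [measurable]: "(\<lambda>\<xi>. R \<xi> \<bullet> \<xi>) \<in> borel_measurable borel"
        by (intro borel_measurable_continuous_onI continuous_intros)
      have [measurable]: "(\<lambda>\<xi>. \<integral>\<^sup>+x. ennreal (S \<xi> x) \<partial>m) \<in> borel_measurable borel"
        using Sm by (intro borel_measurable_nn_integral)
          (simp add: measurable_cong_sets[OF sets_pair_measure_cong[OF refl levy_measureD(1)[OF m]] refl])
      show ?thesis by (subst nn_integral_add) (simp_all add: nn_integral_cmult)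
    qed
    also have "(\<integral>\<^sup>+\<xi>. ennreal (R \<xi> \<bullet> \<xi>) \<partial>gauss 1 n) \<le> op_trace R"
    proof -
      have "(\<integral>\<^sup>+\<xi>. ennreal (R \<xi> \<bullet> \<xi>) \<partial>gauss 1 n) = (\<Sum>i<n. ennreal (R (onb i) \<bullet> onb i))"
        using gauss_operator[of 1 R n] R by simp
      also have "\<dots> \<le> op_trace R" unfolding op_trace_onb by (rule sum_le_suminf) auto
      finally show ?thesis .
    qed
    also have "2 * (\<integral>\<^sup>+\<xi>. \<integral>\<^sup>+x. ennreal (S \<xi> x) \<partial>m \<partial>gauss 1 n) \<le> 5 * small_mass m"
    proof -
      have inner: "2 * (\<integral>\<^sup>+\<xi>. ennreal (S \<xi> x) \<partial>gauss 1 n) \<le> 5 * ennreal (min 1 ((norm x)\<^sup>2))" for x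
      proof -
        define q where "q = (norm x)\<^sup>2"
        have q: "0 \<le> q" by (simp add: q_def)
        have "2 * (\<integral>\<^sup>+\<xi>. ennreal (S \<xi> x) \<partial>gauss 1 n)
            = (\<integral>\<^sup>+\<xi>. ennreal (1 / (1 + q)) * ennreal ((\<xi> \<bullet> x)\<^sup>2) + ennreal (4 * q / (1 + q)) \<partial>gauss 1 n)"
        proof -
          have "2 * ennreal (S \<xi> x) = ennreal (1 / (1 + q)) * ennreal ((\<xi> \<bullet> x)\<^sup>2) + ennreal (4 * q / (1 + q))" for \<xi>
          proof -
            have "2 * S \<xi> x = 1 / (1 + q) * (\<xi> \<bullet> x)\<^sup>2 + 4 * q / (1 + q)"
              unfolding S_def q_def[symmetric] using q by (simp add: add_nonneg_eq_0_iff field_simps)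
            then have "ennreal (2 * S \<xi> x) = ennreal (1 / (1 + q) * (\<xi> \<bullet> x)\<^sup>2 + 4 * q / (1 + q))" by simp
            then show ?thesis using S0[of \<xi> x] q by (simp add: ennreal_plus ennreal_mult del: times_divide_eq_left times_divide_eq_right)
          qed
          then show ?thesis
            by (subst nn_integral_cmult[symmetric]) (simp_all add: S_def)
        qed
        also have "\<dots> = ennreal (1 / (1 + q)) * (\<integral>\<^sup>+\<xi>. ennreal ((\<xi> \<bullet> x)\<^sup>2) \<partial>gauss 1 n) + ennreal (4 * q / (1 + q))"
          using prob_space.emeasure_space_1[OF g(1)]
          by (simp add: nn_integral_add nn_integral_cmult)
        also have "\<dots> = ennreal (1 / (1 + q) * (norm (onb_proj n x))\<^sup>2 + 4 * q / (1 + q))"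
          using gauss_inner_square[of 1 n x] q
          by (simp add: ennreal_plus ennreal_mult del: times_divide_eq_left times_divide_eq_right)
        also have "\<dots> \<le> ennreal (5 * min 1 q)"
        proof (rule ennreal_leI)
          have "(norm (onb_proj n x))\<^sup>2 \<le> q"
            unfolding q_def by (intro power_mono norm_onb_proj_le) simp
          then have "1 / (1 + q) * (norm (onb_proj n x))\<^sup>2 \<le> 1 / (1 + q) * q" using q by (intro mult_left_mono) auto
          moreover have "q / (1 + q) \<le> min 1 q" using ratio_le_min[of x] by (simp add: q_def)
          moreover have "1 / (1 + q) * q = q / (1 + q)" "4 * q / (1 + q) = 4 * (q / (1 + q))" by simp_all
          ultimately show "1 / (1 + q) * (norm (onb_proj n x))\<^sup>2 + 4 * q / (1 + q) \<le> 5 * min 1 q" by linarith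
        qed
        finally show ?thesis using q by (simp add: q_def ennreal_mult)
      qed
      have "2 * (\<integral>\<^sup>+\<xi>. \<integral>\<^sup>+x. ennreal (S \<xi> x) \<partial>m \<partial>gauss 1 n) = 2 * (\<integral>\<^sup>+x. \<integral>\<^sup>+\<xi>. ennreal (S \<xi> x) \<partial>gauss 1 n \<partial>m)"
        by (simp only: nn_integral_swap_gauss[OF m Sm])
      also have "\<dots> = (\<integral>\<^sup>+x. 2 * (\<integral>\<^sup>+\<xi>. ennreal (S \<xi> x) \<partial>gauss 1 n) \<partial>m)"
      proof -
        interpret G: prob_space "gauss 1 n :: 'h measure" by (rule g)
        have "(\<lambda>(x, \<xi>). ennreal (S \<xi> x)) \<in> borel_measurable (borel \<Otimes>\<^sub>M gauss 1 n)"
          unfolding S_def by measurable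
        then have "(\<lambda>x. \<integral>\<^sup>+\<xi>. ennreal (S \<xi> x) \<partial>gauss 1 n) \<in> borel_measurable borel"
          by (rule G.borel_measurable_nn_integral)
        then show ?thesis by (intro nn_integral_cmult[symmetric]) simp
      qed
      also have "\<dots> \<le> (\<integral>\<^sup>+x. 5 * ennreal (min 1 ((norm x)\<^sup>2)) \<partial>m)" by (intro nn_integral_mono inner)
      also have "\<dots> = 5 * small_mass m" unfolding small_mass_def by (rule nn_integral_cmult) measurable
      finally show ?thesis .
    qed
    finally show ?thesis by (simp add: add_mono)
  qed
  have "(\<integral>\<^sup>+x. ennreal (1 - exp (- (1 / 2 * (norm x)\<^sup>2))) \<partial>\<rho>) = (\<integral>\<^sup>+x. liminf (\<lambda>n. ennreal (1 - damp 1 n x)) \<partial>\<rho>)"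
    by (intro nn_integral_cong lim_imp_Liminf[symmetric] tendsto_ennrealI tendsto_intros damp_tendsto) simp
  also have "\<dots> \<le> liminf (\<lambda>n. \<integral>\<^sup>+x. ennreal (1 - damp 1 n x) \<partial>\<rho>)"
    by (rule nn_integral_liminf) measurable
  also have "\<dots> \<le> liminf (\<lambda>n. op_trace R + 5 * small_mass m)"
    by (intro Liminf_mono always_eventually allI average)
  also have "\<dots> = op_trace R + 5 * small_mass m" by (simp add: Liminf_const)
  finally show ?thesis .
qed

text \<open>
  The mean displacement caused by an independent summand with law \<open>\<rho>\<close>, truncated at \<open>1\<close>.
\<close>

definition displacement :: "'h::real_normed_vector measure \<Rightarrow> real" where
  "displacement \<rho> = (\<integral>x. min 1 (norm x) \<partial>\<rho>)"

text \<open>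
  Jensen's inequality for the square, together with \<open>min 1 r \<le> 3 (1 - exp (- r / 2))\<close>.
\<close>

lemma displacement_le:
  fixes \<rho> :: "'h::{real_inner, second_countable_topology} measure"
  assumes \<rho>: "borel_prob \<rho>" and b: "0 \<le> b"
    and le: "(\<integral>\<^sup>+x. ennreal (1 - exp (- (1 / 2 * (norm x)\<^sup>2))) \<partial>\<rho>) \<le> ennreal b"
  shows "displacement \<rho> \<le> sqrt (3 * b)"
proof -
  note r = borel_probD[OF \<rho>]
  interpret prob_space \<rho> by (rule r)
  let ?e = "\<lambda>x::'h. 1 - exp (- (1 / 2 * (norm x)\<^sup>2))" and ?f = "\<lambda>x::'h. min 1 (norm x)"
  have ie: "integrable \<rho> ?e" by (rule integrable_bounded_borel[OF r(2,3), where B=1]) auto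
  have if1: "integrable \<rho> ?f" by (rule integrable_bounded_borel[OF r(2,3), where B=1]) auto
  have f2: "(?f x)\<^sup>2 \<le> 1" for x by (rule power_le_one) auto
  have if2: "integrable \<rho> (\<lambda>x. (?f x)\<^sup>2)"
    by (rule integrable_bounded_borel[OF r(2,3), where B=1]) (use f2 in auto)
  have "ennreal (\<integral>x. ?e x \<partial>\<rho>) \<le> ennreal b"
    using le nn_integral_eq_integral[OF ie] by simp
  then have eb: "(\<integral>x. ?e x \<partial>\<rho>) \<le> b" using b by (simp add: ennreal_le_iff)
  have "(\<integral>x. ?f x \<partial>\<rho>)\<^sup>2 \<le> (\<integral>x. (?f x)\<^sup>2 \<partial>\<rho>)"
  proof -
    define a where "a = (\<integral>x. ?f x \<partial>\<rho>)"
    have "0 \<le> (\<integral>x. (?f x - a)\<^sup>2 \<partial>\<rho>)" by (intro integral_nonneg_AE) auto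
    also have "(\<integral>x. (?f x - a)\<^sup>2 \<partial>\<rho>) = (\<integral>x. (?f x)\<^sup>2 - 2 * a * ?f x + a\<^sup>2 \<partial>\<rho>)"
      by (simp add: power2_diff algebra_simps)
    also have "\<dots> = (\<integral>x. (?f x)\<^sup>2 \<partial>\<rho>) - 2 * a * a + a\<^sup>2"
      using if1 if2 by (simp add: prob_space a_def[symmetric] del: min_less_iff_conj)
    finally show ?thesis by (simp add: a_def[symmetric] power2_eq_square)
  qed
  also have "\<dots> \<le> (\<integral>x. 3 * ?e x \<partial>\<rho>)"
  proof (rule integral_mono[OF if2])
    show "integrable \<rho> (\<lambda>x. 3 * ?e x)" by (intro integrable_mult_right ie)
    show "(?f x)\<^sup>2 \<le> 3 * ?e x" for x :: 'h
    proof -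
      have "(?f x)\<^sup>2 = min 1 ((norm x)\<^sup>2)"
      proof (cases "norm x \<le> 1")
        case True
        then show ?thesis by (simp add: min_absorb2 power_le_one)
      next
        case False
        then have "1 \<le> (norm x)\<^sup>2" by (intro one_le_power) simp
        then show ?thesis using False by simp
      qed
      also have "\<dots> \<le> 3 * ?e x" using min_le_one_minus_exp[of 1 "(norm x)\<^sup>2"] by simp
      finally show ?thesis .
    qed
  qed
  also have "\<dots> \<le> 3 * b" using eb by (subst integral_mult_right_zero) simp
  finally show ?thesis unfolding displacement_def by (rule real_le_rsqrt)
qed

lemma conv_displacement:
  fixes M \<rho> :: "'h::{real_normed_vector, second_countable_topology} measure"
  assumes M: "borel_prob M" and \<rho>: "borel_prob \<rho>"
    and f: "bl f" "\<And>x y. \<bar>f (x + y) - f x\<bar> \<le> C * min 1 (norm y)" and C: "0 \<le> C"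
  shows "\<bar>(\<integral>x. f x \<partial>(M \<^bold>* \<rho>)) - (\<integral>x. f x \<partial>M)\<bar> \<le> C * displacement \<rho>"
proof -
  note m = borel_probD[OF M] and r = borel_probD[OF \<rho>]
  interpret M: prob_space M by (rule m)
  interpret \<rho>: prob_space \<rho> by (rule r)
  obtain B where B: "\<And>x. \<bar>f x\<bar> \<le> B" using f(1) by (elim blE) blast
  note [measurable] = bl_measurable[OF f(1)]
  have [measurable_cong]: "sets M = sets borel" "sets \<rho> = sets borel" by (rule m, rule r)
  have if1: "integrable \<rho> (\<lambda>y. f (x + y))" for x
    by (rule integrable_bounded_borel[OF r(2,3), where B=B]) (use B in auto)
  have imin: "integrable \<rho> (\<lambda>y. C * min 1 (norm y))"
    using C by (intro integrable_mult_right integrable_bounded_borel[OF r(2,3), where B=1]) auto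
  have diff: "\<bar>(\<integral>y. f (x + y) \<partial>\<rho>) - f x\<bar> \<le> C * displacement \<rho>" for x
  proof -
    have "(\<integral>y. f (x + y) \<partial>\<rho>) - f x = (\<integral>y. f (x + y) - f x \<partial>\<rho>)"
      using if1 by (simp add: \<rho>.prob_space)
    also have "\<bar>\<dots>\<bar> \<le> (\<integral>y. \<bar>f (x + y) - f x\<bar> \<partial>\<rho>)" by (rule integral_abs_bound)
    also have "\<dots> \<le> (\<integral>y. C * min 1 (norm y) \<partial>\<rho>)"
      using if1 by (intro integral_mono imin integrable_abs Bochner_Integration.integrable_diff f) auto
    also have "\<dots> = C * displacement \<rho>" unfolding displacement_def by (rule integral_mult_right_zero)
    finally show ?thesis .
  qed
  have bnd: "\<bar>\<integral>y. f (x + y) \<partial>\<rho>\<bar> \<le> B" for x by (rule prob_integral_abs_le[OF r(1) B])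
  have "(\<integral>x. f x \<partial>(M \<^bold>* \<rho>)) = (\<integral>x. \<integral>y. f (x + y) \<partial>\<rho> \<partial>M)"
    using B by (intro integral_conv[OF M \<rho>, where B=B]) auto
  moreover have "integrable M (\<lambda>x. \<integral>y. f (x + y) \<partial>\<rho>)"
    using bnd by (intro integrable_bounded_borel[OF m(2,3), where B=B]) auto
  ultimately have "(\<integral>x. f x \<partial>(M \<^bold>* \<rho>)) - (\<integral>x. f x \<partial>M) = (\<integral>x. (\<integral>y. f (x + y) \<partial>\<rho>) - f x \<partial>M)"
    using bl_integrable[OF M f(1)] by simp
  then show ?thesis using prob_integral_abs_le[OF m(1) diff] by simp
qed

text \<open>
  A family along \<open>s \<rightarrow> -\<infinity>\<close> whose members differ by convolution with measures near the origin
  converges weakly: it is Cauchy in the bounded Lipschitz distance, which is estimated in the same way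
  for both directions of the convolution.
\<close>

theorem convolution_cauchy_converges:
  fixes M :: "real \<Rightarrow> 'h::{real_normed_vector, polish_space} measure"
  assumes M: "\<And>s. s \<le> t \<Longrightarrow> borel_prob (M s)"
    and small: "\<And>e. 0 < e \<Longrightarrow> \<exists>s0\<le>t. \<forall>s\<le>s0. \<forall>s'\<le>s. \<exists>\<rho>. borel_prob \<rho> \<and> displacement \<rho> \<le> e \<and>
      (M s' = M s \<^bold>* \<rho> \<or> M s = M s' \<^bold>* \<rho>)"
  shows "\<exists>N. borel_prob N \<and> weakly_converges M N at_bot"
proof -
  have close: "\<exists>s0\<le>t. \<forall>s\<le>s0. \<forall>s'\<le>s. \<forall>f C. bl f \<and> (\<forall>x y. \<bar>f (x + y) - f x\<bar> \<le> C * min 1 (norm y)) \<and> 0 \<le> C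
      \<longrightarrow> \<bar>(\<integral>x. f x \<partial>M s') - (\<integral>x. f x \<partial>M s)\<bar> \<le> C * e" if "0 < e" for e
  proof -
    obtain s0 where s0: "s0 \<le> t" "\<And>s s'. s \<le> s0 \<Longrightarrow> s' \<le> s \<Longrightarrow> \<exists>\<rho>. borel_prob \<rho> \<and> displacement \<rho> \<le> e \<and>
      (M s' = M s \<^bold>* \<rho> \<or> M s = M s' \<^bold>* \<rho>)" using small[OF \<open>0 < e\<close>] by blast
    show ?thesis
    proof (intro exI[of _ s0] conjI s0(1) allI impI)
      fix s s' C and f :: "'h \<Rightarrow> real"
      assume s: "s \<le> s0" "s' \<le> s" and f: "bl f \<and> (\<forall>x y. \<bar>f (x + y) - f x\<bar> \<le> C * min 1 (norm y)) \<and> 0 \<le> C"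
      obtain \<rho> where \<rho>: "borel_prob \<rho>" "displacement \<rho> \<le> e" "M s' = M s \<^bold>* \<rho> \<or> M s = M s' \<^bold>* \<rho>"
        using s0(2)[OF s] by blast
      have Ms: "borel_prob (M s)" "borel_prob (M s')" using s s0(1) by (auto intro!: M)
      have "\<bar>(\<integral>x. f x \<partial>M s') - (\<integral>x. f x \<partial>M s)\<bar> \<le> C * displacement \<rho>"
        using \<rho>(3)
      proof
        assume "M s' = M s \<^bold>* \<rho>"
        then show ?thesis using conv_displacement[OF Ms(1) \<rho>(1), of f C] f by simp
      next
        assume "M s = M s' \<^bold>* \<rho>"
        then show ?thesis using conv_displacement[OF Ms(2) \<rho>(1), of f C] f by (simp add: abs_minus_commute)
      qed
      also have "\<dots> \<le> C * e" using \<rho>(2) f by (intro mult_left_mono) auto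
      finally show "\<bar>(\<integral>x. f x \<partial>M s') - (\<integral>x. f x \<partial>M s)\<bar> \<le> C * e" .
    qed
  qed
  have Mn: "borel_prob (M (t - real n))" for n by (rule M) simp
  have "\<exists>N. borel_prob N \<and> (\<forall>f. bl f \<longrightarrow> (\<lambda>n. \<integral>x. f x \<partial>M (t - real n)) \<longlonglongrightarrow> (\<integral>x. f x \<partial>N))"
  proof (rule bounded_lipschitz_complete[OF Mn])
    fix e :: real assume e: "0 < e"
    from close[OF e] obtain s0 where s0: "s0 \<le> t" "\<forall>s\<le>s0. \<forall>s'\<le>s. \<forall>f C. bl f \<and> (\<forall>x y. \<bar>f (x + y) - f x\<bar> \<le> C * min 1 (norm y)) \<and> 0 \<le> C
      \<longrightarrow> \<bar>(\<integral>x. f x \<partial>M s') - (\<integral>x. f x \<partial>M s)\<bar> \<le> C * e" by (elim exE conjE)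
    obtain N where N: "t - s0 \<le> real N" using real_arch_simple by blast
    show "\<exists>N. \<forall>n\<ge>N. \<forall>f. (\<forall>x y. \<bar>f x - f y\<bar> \<le> dist x y) \<and> (\<forall>x. 0 \<le> f x \<and> f x \<le> 1) \<longrightarrow>
        \<bar>(\<integral>x. f x \<partial>M (t - real n)) - (\<integral>x. f x \<partial>M (t - real N))\<bar> \<le> e"
    proof (intro exI[of _ N] allI impI)
      fix n and f :: "'h \<Rightarrow> real"
      assume n: "N \<le> n" and f: "(\<forall>x y. \<bar>f x - f y\<bar> \<le> dist x y) \<and> (\<forall>x. 0 \<le> f x \<and> f x \<le> 1)"
      have "bl f" using f by (intro blI[of f 1 1]) (auto simp: abs_le_iff)
      moreover have "\<bar>f (x + y) - f x\<bar> \<le> 1 * min 1 (norm y)" for x y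
      proof -
        have "\<bar>f (x + y) - f x\<bar> \<le> dist (x + y) x" using f by blast
        moreover have "0 \<le> f (x + y)" "f (x + y) \<le> 1" "0 \<le> f x" "f x \<le> 1" using f by blast+
        ultimately show ?thesis by (simp add: dist_norm abs_le_iff)
      qed
      moreover have "t - real N \<le> s0" "t - real n \<le> t - real N" using N n by auto
      ultimately have "\<bar>(\<integral>x. f x \<partial>M (t - real n)) - (\<integral>x. f x \<partial>M (t - real N))\<bar> \<le> 1 * e"
        using s0(2) by (metis zero_le_one)
      then show "\<bar>(\<integral>x. f x \<partial>M (t - real n)) - (\<integral>x. f x \<partial>M (t - real N))\<bar> \<le> e" by simp
    qed
  qed
  then obtain N where N: "borel_prob N" "\<And>f. bl f \<Longrightarrow> (\<lambda>n. \<integral>x. f x \<partial>M (t - real n)) \<longlonglongrightarrow> (\<integral>x. f x \<partial>N)" by blast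
  have "weakly_converges M N at_bot"
  proof (rule weakly_converges_lipschitz[OF _ N(1)])
    show "eventually (\<lambda>s. borel_prob (M s)) at_bot"
      using eventually_le_at_bot[of t] by eventually_elim (rule M)
    fix f :: "'h \<Rightarrow> real" assume f: "bl f"
    obtain L B where LB: "L \<ge> 0" "B > 0" "\<And>x y. \<bar>f x - f y\<bar> \<le> L * dist x y" "\<And>x. \<bar>f x\<bar> \<le> B"
      using blE[OF f] by metis
    define C where "C = L + 2 * B"
    have C: "0 < C" using LB by (simp add: C_def)
    have fC: "\<bar>f (x + y) - f x\<bar> \<le> C * min 1 (norm y)" for x y
    proof (cases "norm y \<le> 1")
      case True
      have "\<bar>f (x + y) - f x\<bar> \<le> L * norm y" using LB(3)[of "x + y" x] by (simp add: dist_norm)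
      also have "\<dots> \<le> C * norm y" using LB by (intro mult_right_mono) (auto simp: C_def)
      finally show ?thesis using True by simp
    next
      case False
      have "\<bar>f (x + y) - f x\<bar> \<le> 2 * B" using LB(4)[of "x + y"] LB(4)[of x] by linarith
      then show ?thesis using False LB by (simp add: C_def)
    qed
    show "((\<lambda>s. \<integral>x. f x \<partial>M s) \<longlongrightarrow> (\<integral>x. f x \<partial>N)) at_bot"
    proof (rule tendstoI)
      fix e :: real assume e: "0 < e"
      have "0 < e / (2 * C)" using e C by simp
      from close[OF this] obtain s0 where s0: "s0 \<le> t" "\<forall>s\<le>s0. \<forall>s'\<le>s. \<forall>f C'. bl f \<and> (\<forall>x y. \<bar>f (x + y) - f x\<bar> \<le> C' * min 1 (norm y)) \<and> 0 \<le> C'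
        \<longrightarrow> \<bar>(\<integral>x. f x \<partial>M s') - (\<integral>x. f x \<partial>M s)\<bar> \<le> C' * (e / (2 * C))" by (elim exE conjE)
      have "eventually (\<lambda>n. dist (\<integral>x. f x \<partial>M (t - real n)) (\<integral>x. f x \<partial>N) < e / 2) sequentially"
        using N(2)[OF f] e by (intro tendstoD) auto
      moreover have "eventually (\<lambda>n. t - s0 \<le> real n) sequentially"
        by (rule eventually_sequentiallyI[of "nat \<lceil>t - s0\<rceil>"]) linarith
      ultimately have "eventually (\<lambda>n. dist (\<integral>x. f x \<partial>M (t - real n)) (\<integral>x. f x \<partial>N) < e / 2 \<and> t - s0 \<le> real n) sequentially"
        by (rule eventually_conj)
      then obtain n where n: "dist (\<integral>x. f x \<partial>M (t - real n)) (\<integral>x. f x \<partial>N) < e / 2" "t - s0 \<le> real n"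
        using eventually_happens by fastforce
      show "eventually (\<lambda>s. dist (\<integral>x. f x \<partial>M s) (\<integral>x. f x \<partial>N) < e) at_bot"
        using eventually_le_at_bot[of "t - real n"]
      proof eventually_elim
        case (elim s)
        have "t - real n \<le> s0" using n(2) by simp
        then have "\<bar>(\<integral>x. f x \<partial>M s) - (\<integral>x. f x \<partial>M (t - real n))\<bar> \<le> C * (e / (2 * C))"
          using s0(2)[rule_format, of "t - real n" s f C] elim f fC C by simp
        also have "\<dots> = e / 2" using C by simp
        finally show ?case using n(1) unfolding dist_real_def by linarith
      qed
    qed
  qed
  with N(1) show ?thesis by blast
qed

section \<open>Laws with a given triplet\<close>

lemma has_tripletD:
  assumes "has_triplet M a R m"
  shows "infinitely_divisible M" "borel_prob M" "covariance_operator R" "levy_measure m"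
    "\<And>\<xi>. char_fun M \<xi> = exp (- levy_exponent a R m \<xi>)"
  using assms by (auto simp: has_triplet_def infinitely_divisible_def)

lemma id_law_eq:
  fixes M :: "'h::{real_inner, second_countable_topology} measure"
  assumes "has_triplet M a R m"
  shows "id_law a R m = M"
  unfolding id_law_def
proof (rule the_equality)
  show "has_triplet M a R m" by (rule assms)
  fix N assume "has_triplet N a R m"
  then show "N = M" using has_tripletD[OF assms] by (intro borel_prob_eqI) (auto dest: has_tripletD)
qed

lemma levy_exponent_drift:
  fixes m :: "'h::{real_inner, second_countable_topology} measure"
  assumes "levy_measure m"
  shows "levy_exponent a R m \<xi> = levy_exponent 0 R m \<xi> - \<i> * of_real (a \<bullet> \<xi>)"
  by (simp add: levy_exponent_kernel[OF assms])

lemma char_fun_shift: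
  fixes M :: "'h::{real_inner, second_countable_topology} measure"
  assumes "borel_prob M"
  shows "char_fun (dirac a \<^bold>* M) \<xi> = iexp (a \<bullet> \<xi>) * char_fun M \<xi>"
  by (simp add: char_fun_conv[OF borel_prob_dirac assms] char_fun_dirac)

lemma infinitely_divisible_shift:
  fixes M :: "'h::{real_inner, second_countable_topology} measure"
  assumes "infinitely_divisible M"
  shows "infinitely_divisible (dirac a \<^bold>* M)"
proof -
  have M: "borel_prob M" using assms by (simp add: infinitely_divisible_def)
  have "\<exists>N. borel_prob N \<and> dirac a \<^bold>* M = conv_power N n" if n: "n \<ge> 1" for n
  proof -
    obtain N where N: "borel_prob N" "M = conv_power N n" using assms n by (auto simp: infinitely_divisible_def)
    define N' where "N' = dirac ((1 / real n) *\<^sub>R a) \<^bold>* N"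
    have N': "borel_prob N'" unfolding N'_def by (intro borel_prob_conv borel_prob_dirac N)
    have "dirac a \<^bold>* M = conv_power N' n"
    proof (rule borel_prob_eqI)
      fix \<xi>
      have "iexp ((1 / real n) *\<^sub>R a \<bullet> \<xi>) ^ n = iexp (a \<bullet> \<xi>)"
        using n by (simp add: exp_of_nat_mult[symmetric])
      moreover have "char_fun M \<xi> = char_fun N \<xi> ^ n"
        unfolding N(2) by (rule char_fun_conv_power[OF N(1)])
      moreover have "char_fun N' \<xi> = iexp ((1 / real n) *\<^sub>R a \<bullet> \<xi>) * char_fun N \<xi>"
        unfolding N'_def by (rule char_fun_shift[OF N(1)])
      ultimately show "char_fun (dirac a \<^bold>* M) \<xi> = char_fun (conv_power N' n) \<xi>"
        unfolding char_fun_shift[OF M] char_fun_conv_power[OF N'] by (simp only: power_mult_distrib)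
    qed (intro borel_prob_conv borel_prob_dirac M borel_prob_conv_power N')+
    then show ?thesis using N' by blast
  qed
  then show ?thesis using borel_prob_conv[OF borel_prob_dirac M] by (simp add: infinitely_divisible_def)
qed

lemma has_triplet_shift:
  fixes M :: "'h::{real_inner, second_countable_topology} measure"
  assumes "has_triplet M a R m"
  shows "has_triplet (dirac b \<^bold>* M) (b + a) R m"
proof -
  note M = has_tripletD[OF assms]
  have "char_fun (dirac b \<^bold>* M) \<xi> = exp (- levy_exponent (b + a) R m \<xi>)" for \<xi>
  proof -
    have "levy_exponent (b + a) R m \<xi> = levy_exponent a R m \<xi> - \<i> * of_real (b \<bullet> \<xi>)"
      unfolding levy_exponent_drift[OF M(4), of a] levy_exponent_drift[OF M(4), of "b + a"]
      by (simp add: inner_add_left algebra_simps)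
    then show ?thesis
      unfolding char_fun_shift[OF M(2)] M(5) exp_add[symmetric] by simp
  qed
  then show ?thesis
    unfolding has_triplet_def by (intro conjI allI infinitely_divisible_shift M(1,3,4))
qed

text \<open>
  The characteristic function of a root and \<open>exp (- \<psi> / n)\<close>, with \<open>\<psi>\<close> the exponent, are continuous and
  have the same \<open>n\<close>-th power, so uniqueness of continuous roots applies.
\<close>

lemma has_triplet_root:
  fixes M :: "'h::{real_inner, second_countable_topology} measure"
  assumes "has_triplet M a R m" and n: "n \<ge> 1"
  shows "\<exists>N. borel_prob N \<and> (\<forall>\<xi>. char_fun N \<xi> = exp (- (levy_exponent a R m \<xi> / of_nat n)))"
proof -
  note M = has_tripletD[OF assms(1)]
  obtain N where N: "borel_prob N" "M = conv_power N n"
    using M(1) n by (auto simp: infinitely_divisible_def)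
  have "char_fun N \<xi> = exp (- (levy_exponent a R m \<xi> / of_nat n))" for \<xi>
  proof (rule continuous_root_unique[OF _ continuous_levy_exponent[OF M(4)] _ _ n])
    show "continuous_on UNIV (char_fun N)" using borel_probD[OF N(1)] by (intro continuous_char_fun)
    show "char_fun N x ^ n = exp (- levy_exponent a R m x)" for x
      unfolding M(5)[symmetric] N(2) char_fun_conv_power[OF N(1)] ..
  qed (simp_all add: char_fun_0[OF N(1)] levy_exponent_0[OF M(4)])
  then show ?thesis using N(1) by blast
qed

section \<open>Weak limits and characteristic functions\<close>

lemma weakly_converges_char_fun:
  fixes M :: "'i \<Rightarrow> 'h::{real_inner, second_countable_topology} measure"
  assumes M: "eventually (\<lambda>i. borel_prob (M i)) F" and N: "borel_prob N" and conv: "weakly_converges M N F"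
  shows "((\<lambda>i. char_fun (M i) \<xi>) \<longlongrightarrow> char_fun N \<xi>) F"
proof -
  have parts: "char_fun K \<xi> = Complex (\<integral>x. cos (x \<bullet> \<xi>) \<partial>K) (\<integral>x. sin (x \<bullet> \<xi>) \<partial>K)" if "borel_prob K" for K
  proof -
    note K = borel_probD[OF that]
    show ?thesis
      unfolding char_fun_def
      by (rule complex_eqI)
        (simp_all add: integral_Re[symmetric, OF char_fun_integrable[OF K(2,3)]]
          integral_Im[symmetric, OF char_fun_integrable[OF K(2,3)]] Re_exp Im_exp)
  qed
  have "((\<lambda>i. Complex (\<integral>x. cos (x \<bullet> \<xi>) \<partial>M i) (\<integral>x. sin (x \<bullet> \<xi>) \<partial>M i)) \<longlongrightarrow>
      Complex (\<integral>x. cos (x \<bullet> \<xi>) \<partial>N) (\<integral>x. sin (x \<bullet> \<xi>) \<partial>N)) F"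
  proof (rule tendsto_Complex)
    have "continuous_on UNIV (\<lambda>x. cos (x \<bullet> \<xi>)) \<and> bounded (range (\<lambda>x. cos (x \<bullet> \<xi>)))"
      by (auto intro!: continuous_intros boundedI[of _ 1])
    then show "((\<lambda>i. \<integral>x. cos (x \<bullet> \<xi>) \<partial>M i) \<longlongrightarrow> (\<integral>x. cos (x \<bullet> \<xi>) \<partial>N)) F"
      using conv unfolding weakly_converges_def by blast
    have "continuous_on UNIV (\<lambda>x. sin (x \<bullet> \<xi>)) \<and> bounded (range (\<lambda>x. sin (x \<bullet> \<xi>)))"
      by (auto intro!: continuous_intros boundedI[of _ 1])
    then show "((\<lambda>i. \<integral>x. sin (x \<bullet> \<xi>) \<partial>M i) \<longlongrightarrow> (\<integral>x. sin (x \<bullet> \<xi>) \<partial>N)) F"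
      using conv unfolding weakly_converges_def by blast
  qed
  moreover have "eventually (\<lambda>i. Complex (\<integral>x. cos (x \<bullet> \<xi>) \<partial>M i) (\<integral>x. sin (x \<bullet> \<xi>) \<partial>M i) = char_fun (M i) \<xi>) F"
    using M by eventually_elim (simp add: parts)
  ultimately show ?thesis
    unfolding parts[OF N] by (rule Lim_transform_eventually)
qed

lemma weakly_converges_cong:
  fixes N :: "'a::topological_space measure"
  assumes "eventually (\<lambda>i. M i = M' i) F" "weakly_converges M N F"
  shows "weakly_converges M' N F"
  unfolding weakly_converges_def
proof (intro allI impI)
  fix f :: "'a \<Rightarrow> real" assume "continuous_on UNIV f \<and> bounded (range f)"
  then have "((\<lambda>i. \<integral>x. f x \<partial>M i) \<longlongrightarrow> (\<integral>x. f x \<partial>N)) F"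
    using assms(2) unfolding weakly_converges_def by blast
  then show "((\<lambda>i. \<integral>x. f x \<partial>M' i) \<longlongrightarrow> (\<integral>x. f x \<partial>N)) F"
    by (rule Lim_transform_eventually) (use assms(1) in \<open>eventually_elim, simp\<close>)
qed

lemma antimono_tendsto_at_bot:
  fixes f :: "real \<Rightarrow> 'a::{complete_linorder, linorder_topology}"
  assumes anti: "\<And>s s'. s' \<le> s \<Longrightarrow> s \<le> t \<Longrightarrow> f s \<le> f s'"
  shows "(f \<longlongrightarrow> (SUP s\<in>{..t}. f s)) at_bot"
    and "(SUP s\<in>{..t}. f s) = (SUP n. f (t - real n))"
proof -
  show "(f \<longlongrightarrow> (SUP s\<in>{..t}. f s)) at_bot"
  proof (rule order_tendstoI)
    fix a assume "a < (SUP s\<in>{..t}. f s)"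
    then obtain s0 where s0: "s0 \<le> t" "a < f s0" by (auto simp: less_SUP_iff)
    show "eventually (\<lambda>s. a < f s) at_bot"
      using eventually_le_at_bot[of s0]
    proof eventually_elim
      case (elim s)
      then show ?case using anti[of s s0] s0 by (simp add: order_less_le_trans)
    qed
  next
    fix a assume a: "(SUP s\<in>{..t}. f s) < a"
    show "eventually (\<lambda>s. f s < a) at_bot"
      using eventually_le_at_bot[of t]
    proof eventually_elim
      case (elim s)
      then have "f s \<le> (SUP s\<in>{..t}. f s)" by (intro SUP_upper) simp
      then show ?case using a by (rule order_le_less_trans)
    qed
  qed
  show "(SUP s\<in>{..t}. f s) = (SUP n. f (t - real n))"
  proof (rule antisym)
    show "(SUP s\<in>{..t}. f s) \<le> (SUP n. f (t - real n))"
    proof (rule SUP_least)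
      fix s assume s: "s \<in> {..t}"
      obtain n where "t - s \<le> real n" using real_arch_simple by blast
      then have "f s \<le> f (t - real n)" using s by (intro anti) auto
      also have "\<dots> \<le> (SUP n. f (t - real n))" by (rule SUP_upper) simp
      finally show "f s \<le> (SUP n. f (t - real n))" .
    qed
    show "(SUP n. f (t - real n)) \<le> (SUP s\<in>{..t}. f s)"
      by (intro SUP_least SUP_upper) simp
  qed
qed

lemma antimono_bounded_small_increments:
  fixes v :: "real \<Rightarrow> real"
  assumes anti: "\<And>s s'. s' \<le> s \<Longrightarrow> s \<le> t \<Longrightarrow> v s \<le> v s'" and bd: "\<And>s. s \<le> t \<Longrightarrow> v s \<le> B" and e: "0 < e"
  shows "\<exists>s0\<le>t. \<forall>s\<le>s0. \<forall>s'\<le>s. v s' - v s \<le> e"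
proof -
  define S where "S = (SUP s\<in>{..t}. v s)"
  have bdd: "bdd_above (v ` {..t})" using bd by (intro bdd_aboveI2) auto
  have "S - e < S" using e by simp
  then obtain s0 where s0: "s0 \<le> t" "S - e < v s0" unfolding S_def using less_cSUP_iff[of "{..t}" v] bdd by auto
  have "v s' - v s \<le> e" if "s \<le> s0" "s' \<le> s" for s s'
  proof -
    have "v s' \<le> S" unfolding S_def using that s0 by (intro cSUP_upper bdd) auto
    moreover have "v s0 \<le> v s" using that s0 by (intro anti) auto
    ultimately show ?thesis using s0 by linarith
  qed
  then show ?thesis using s0(1) by blast
qed

section \<open>Evolution data\<close>

locale evolution_data =
  fixes U :: "real \<Rightarrow> real \<Rightarrow> 'h::{real_inner, banach, polish_space} \<Rightarrow>\<^sub>L 'h"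
    and \<mu> :: "real \<Rightarrow> real \<Rightarrow> 'h measure"
    and a :: "real \<Rightarrow> real \<Rightarrow> 'h"
    and R :: "real \<Rightarrow> real \<Rightarrow> 'h \<Rightarrow>\<^sub>L 'h"
    and m :: "real \<Rightarrow> real \<Rightarrow> 'h measure"
    and \<nu>' :: "real \<Rightarrow> 'h measure"
  assumes U: "evolution_family U"
    and triplet: "\<And>t s. s \<le> t \<Longrightarrow> has_triplet (\<mu> t s) (a t s) (R t s) (m t s)"
    and skew: "\<And>t r s. s \<le> r \<Longrightarrow> r \<le> t \<Longrightarrow> \<mu> t s = \<mu> t r \<^bold>* push (U t r) (\<mu> r s)"
    and system: "evolution_system (mehler U \<mu>) \<nu>'"
begin

lemmas \<mu> = has_tripletD[OF triplet]

lemma cov: "s \<le> t \<Longrightarrow> R t s x \<bullet> y = x \<bullet> R t s y" "s \<le> t \<Longrightarrow> 0 \<le> R t s x \<bullet> x" "s \<le> t \<Longrightarrow> op_trace (R t s) < \<infinity>"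
  using covariance_operatorD[OF \<mu>(3)] by auto

lemma \<nu>': "borel_prob (\<nu>' t)"
  using system by (simp add: evolution_system_def)

lemma push_\<nu>': "borel_prob (push (U t s) (\<nu>' s))"
  by (rule borel_prob_push[OF \<nu>'])

text \<open>Testing the evolution system with indicators identifies it as a convolution.\<close>

lemma \<nu>'_factor:
  assumes st: "s \<le> t"
  shows "\<nu>' t = \<mu> t s \<^bold>* push (U t s) (\<nu>' s)"
proof -
  let ?P = "push (U t s) (\<nu>' s)"
  note P = borel_probD[OF push_\<nu>'[of t s]] and n = borel_probD[OF \<nu>'] and mu = borel_probD[OF \<mu>(2)[OF st]]
  have PM: "borel_prob (?P \<^bold>* \<mu> t s)" and MP: "borel_prob (\<mu> t s \<^bold>* ?P)"
    by (intro borel_prob_conv push_\<nu>' \<mu>(2)[OF st])+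
  have "\<nu>' t = ?P \<^bold>* \<mu> t s"
  proof (rule measure_eqI)
    fix A assume "A \<in> sets (\<nu>' t)"
    then have A [measurable]: "A \<in> sets borel" by (simp add: n)
    have [measurable_cong]: "sets (\<mu> t s) = sets borel" "sets (\<nu>' s) = sets borel" by (simp_all add: n mu)
    interpret mu: prob_space "\<mu> t s" by (rule mu)
    have ind: "(indicator A :: 'h \<Rightarrow> real) \<in> borel_measurable borel" "bounded (range (indicator A :: 'h \<Rightarrow> real))"
      by (auto intro!: boundedI[of _ 1] simp: indicator_def)
    have "measure (\<nu>' t) A = (\<integral>x. indicator A x \<partial>\<nu>' t)" using n(4)[of t] by simp
    also have "\<dots> = (\<integral>x. mehler U \<mu> s t (indicator A) x \<partial>\<nu>' s)"
      using system st ind unfolding evolution_system_def by metis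
    also have "\<dots> = (\<integral>x. \<integral>y. indicator A (U t s x + y) \<partial>\<mu> t s \<partial>\<nu>' s)"
      unfolding mehler_def by (rule refl)
    also have "\<dots> = (\<integral>z. \<integral>y. indicator A (z + y) \<partial>\<mu> t s \<partial>?P)"
      by (rule integral_distr[symmetric]) measurable
    also have "\<dots> = (\<integral>x. indicator A x \<partial>(?P \<^bold>* \<mu> t s))"
      by (rule integral_conv[OF push_\<nu>' \<mu>(2)[OF st], symmetric, where B=1]) (auto simp: indicator_def)
    also have "\<dots> = measure (?P \<^bold>* \<mu> t s) A" using borel_probD(4)[OF PM] by simp
    finally show "emeasure (\<nu>' t) A = emeasure (?P \<^bold>* \<mu> t s) A"
      using finite_measure.emeasure_eq_measure[OF n(2)[of t]]
        finite_measure.emeasure_eq_measure[OF borel_probD(2)[OF PM]] by metis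
  qed (simp add: n borel_probD(3)[OF PM])
  also have "\<dots> = \<mu> t s \<^bold>* ?P"
    by (rule borel_prob_eqI[OF PM MP])
      (simp add: char_fun_conv[OF push_\<nu>' \<mu>(2)[OF st]] char_fun_conv[OF \<mu>(2)[OF st] push_\<nu>'])
  finally show ?thesis .
qed

text \<open>
  The adjoint of \<open>U t s\<close>, through which \<open>push (U t s)\<close> acts on characteristic functions.
\<close>

definition adj :: "real \<Rightarrow> real \<Rightarrow> 'h \<Rightarrow>\<^sub>L 'h" where
  "adj t s = (SOME T :: 'h \<Rightarrow>\<^sub>L 'h. \<forall>x y. T x \<bullet> y = x \<bullet> U t s y)"

lemma adj: "adj t s x \<bullet> y = x \<bullet> U t s y"
  using someI_ex[OF adjoint_exists[of "U t s"]] unfolding adj_def by blast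

lemma char_fun_push_U:
  assumes "borel_prob M"
  shows "char_fun (push (U t s) M) \<xi> = char_fun M (adj t s \<xi>)"
  by (rule char_fun_push[OF borel_probD(3)[OF assms]]) (rule adj)

text \<open>
  The skew convolution equation holds for characteristic functions, hence for their continuous
  logarithms.
\<close>

lemma exponent_skew:
  assumes sr: "s \<le> r" "r \<le> t"
  shows "levy_exponent (a t s) (R t s) (m t s) \<xi>
    = levy_exponent (a t r) (R t r) (m t r) \<xi> + levy_exponent (a r s) (R r s) (m r s) (adj t r \<xi>)"
proof -
  have st: "s \<le> t" using sr by simp
  note c = continuous_levy_exponent[OF \<mu>(4)]
  have "- levy_exponent (a t s) (R t s) (m t s) \<xi>
    = - (levy_exponent (a t r) (R t r) (m t r) \<xi> + levy_exponent (a r s) (R r s) (m r s) (adj t r \<xi>))"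
  proof (rule continuous_log_unique[where f="\<lambda>\<xi>. - levy_exponent (a t s) (R t s) (m t s) \<xi>"])
    show "continuous_on UNIV (\<lambda>\<xi>. - levy_exponent (a t s) (R t s) (m t s) \<xi>)"
      by (intro continuous_on_minus c st)
    show "continuous_on UNIV (\<lambda>\<xi>. - (levy_exponent (a t r) (R t r) (m t r) \<xi> + levy_exponent (a r s) (R r s) (m r s) (adj t r \<xi>)))"
      by (intro continuous_on_minus continuous_on_add c sr
          continuous_on_compose2[OF c[OF sr(1)] _ subset_UNIV]) (intro continuous_intros)
    show "- levy_exponent (a t s) (R t s) (m t s) 0
      = - (levy_exponent (a t r) (R t r) (m t r) 0 + levy_exponent (a r s) (R r s) (m r s) (adj t r 0))"
      by (simp add: levy_exponent_0[OF \<mu>(4)] st sr)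
    show "exp (- levy_exponent (a t s) (R t s) (m t s) x)
      = exp (- (levy_exponent (a t r) (R t r) (m t r) x + levy_exponent (a r s) (R r s) (m r s) (adj t r x)))" for x
    proof -
      have "char_fun (\<mu> t s) x = char_fun (\<mu> t r) x * char_fun (\<mu> r s) (adj t r x)"
        unfolding skew[OF sr] char_fun_conv[OF \<mu>(2)[OF sr(2)] borel_prob_push[OF \<mu>(2)[OF sr(1)]]]
          char_fun_push_U[OF \<mu>(2)[OF sr(1)]] ..
      then show ?thesis unfolding \<mu>(5)[OF st] \<mu>(5)[OF sr(1)] \<mu>(5)[OF sr(2)]
        by (simp only: minus_add_distrib exp_add)
    qed
  qed
  then show ?thesis by (simp only: neg_equal_iff_equal)
qed

abbreviation incr_m :: "real \<Rightarrow> real \<Rightarrow> real \<Rightarrow> 'h measure" where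
  "incr_m t s s' \<equiv> push_off_zero (U t s) (m s s')"

text \<open>
  The second triplet in the skew convolution equation is that of \<open>\<mu> s s'\<close>, transported by \<open>U t s\<close>.
\<close>

lemma triplet_increment:
  assumes s: "s' \<le> s" "s \<le> t"
  shows "R t s' h \<bullet> h = R t s h \<bullet> h + R s s' (adj t s h) \<bullet> adj t s h"
    and "m t s' = madd (m t s) (incr_m t s s')"
proof -
  have st: "s' \<le> t" using s by simp
  note d = triplet_difference[OF cov(1)[OF st] cov(1)[OF s(2)] cov(1)[OF s(1)] cov(2)[OF st] cov(2)[OF s(2)]
      cov(2)[OF s(1)] \<mu>(4)[OF st] \<mu>(4)[OF s(2)] \<mu>(4)[OF s(1)] adj exponent_skew[OF s]]
  show "R t s' h \<bullet> h = R t s h \<bullet> h + R s s' (adj t s h) \<bullet> adj t s h" by (rule d(1))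
  show "m t s' = madd (m t s) (incr_m t s s')" by (rule d(2))
qed

lemma sets_m: "s \<le> t \<Longrightarrow> sets (m t s) = sets borel"
  by (rule levy_measureD[OF \<mu>(4)])

lemma nn_integral_m_increment:
  assumes s: "s' \<le> s" "s \<le> t" and f: "f \<in> borel_measurable borel"
  shows "(\<integral>\<^sup>+x. f x \<partial>m t s') = (\<integral>\<^sup>+x. f x \<partial>m t s) + (\<integral>\<^sup>+x. f x \<partial>incr_m t s s')"
  unfolding triplet_increment(2)[OF s]
  by (rule nn_integral_madd) (simp_all add: sets_m s f measurable_cong_sets[OF sets_m refl])

lemma incr_levy:
  assumes s: "s' \<le> s" "s \<le> t"
  shows "levy_measure (incr_m t s s')" "small_mass (m t s') = small_mass (m t s) + small_mass (incr_m t s s')"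
proof -
  show eq: "small_mass (m t s') = small_mass (m t s) + small_mass (incr_m t s s')"
    unfolding small_mass_def by (rule nn_integral_m_increment[OF s]) measurable
  have "small_mass (incr_m t s s') \<le> small_mass (m t s')" unfolding eq by simp
  also have "\<dots> < \<infinity>" using s by (intro levy_measureD[OF \<mu>(4)]) simp
  finally show "levy_measure (incr_m t s s')"
    using sets_m[OF s(1)] by (intro levy_measureI) (simp_all add: emeasure_push_off_zero_0)
qed

lemma incr_R:
  assumes s: "s' \<le> s" "s \<le> t"
  shows "0 \<le> (R t s' - R t s) x \<bullet> x" "op_trace (R t s') = op_trace (R t s) + op_trace (R t s' - R t s)"
proof -
  show pos: "0 \<le> (R t s' - R t s) x \<bullet> x" for x
    using triplet_increment(1)[OF s, of x] cov(2)[OF s(1), of "adj t s x"]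
    by (simp add: blinfun.diff_left inner_diff_left)
  have "op_trace (R t s') = (\<Sum>n. ennreal (R t s (onb n) \<bullet> onb n) + ennreal ((R t s' - R t s) (onb n) \<bullet> onb n))"
    unfolding op_trace_onb
  proof (rule suminf_cong)
    fix n
    have "R t s' (onb n) \<bullet> onb n = R t s (onb n) \<bullet> onb n + (R t s' - R t s) (onb n) \<bullet> onb n"
      by (simp add: blinfun.diff_left inner_diff_left)
    then show "ennreal (R t s' (onb n) \<bullet> onb n) = ennreal (R t s (onb n) \<bullet> onb n) + ennreal ((R t s' - R t s) (onb n) \<bullet> onb n)"
      using cov(2)[OF s(2), of "onb n"] pos[of "onb n"] by (simp add: ennreal_plus)
  qed
  also have "\<dots> = op_trace (R t s) + op_trace (R t s' - R t s)"
    unfolding op_trace_onb by (rule suminf_add[symmetric]) auto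
  finally show "op_trace (R t s') = op_trace (R t s) + op_trace (R t s' - R t s)" .
qed

text \<open>
  The exponent of the centred law \<open>dirac (- a t s) \<^bold>* \<mu> t s\<close>.
\<close>

abbreviation \<kappa> :: "real \<Rightarrow> real \<Rightarrow> 'h \<Rightarrow> complex" where
  "\<kappa> t s \<xi> \<equiv> levy_exponent 0 (R t s) (m t s) \<xi>"

lemma \<kappa>_increment:
  assumes s: "s' \<le> s" "s \<le> t"
  shows "\<kappa> t s' \<xi> = \<kappa> t s \<xi> + levy_exponent 0 (R t s' - R t s) (incr_m t s s') \<xi>"
proof -
  have st: "s' \<le> t" using s by simp
  note L = incr_levy(1)[OF s]
  have "(CLINT x|m t s'. levy_kernel \<xi> x) = (CLINT x|m t s. levy_kernel \<xi> x) + (CLINT x|incr_m t s s'. levy_kernel \<xi> x)"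
    unfolding triplet_increment(2)[OF s]
    by (rule integral_madd) (simp_all add: sets_m[OF s(2)] integrable_levy_kernel[OF L] integrable_levy_kernel[OF \<mu>(4)[OF s(2)]])
  then show ?thesis
    unfolding levy_exponent_kernel[OF L] levy_exponent_kernel[OF \<mu>(4)[OF s(2)]] levy_exponent_kernel[OF \<mu>(4)[OF st]]
    by (simp add: blinfun.diff_left inner_diff_left algebra_simps)
qed

lemma triplet_bounds:
  "\<exists>C. \<forall>s\<le>t. op_trace (R t s) \<le> ennreal C \<and> small_mass (m t s) \<le> ennreal C \<and> (\<forall>x. R t s x \<bullet> x \<le> C * (norm x)\<^sup>2)"
  using factor_bound[OF \<nu>'[of t]] triplet push_\<nu>' \<nu>'_factor by meson

text \<open>
  A convolution root of order \<open>n\<close> of the centred law. All orders are needed to see that the limit of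
  the centred laws is infinitely divisible.
\<close>

definition root :: "nat \<Rightarrow> real \<Rightarrow> real \<Rightarrow> 'h measure" where
  "root n t s = (SOME N. borel_prob N \<and> (\<forall>\<xi>. char_fun N \<xi> = exp (- (\<kappa> t s \<xi> / of_nat n))))"

lemma root:
  assumes n: "n \<ge> 1" and st: "s \<le> t"
  shows "borel_prob (root n t s)" "char_fun (root n t s) \<xi> = exp (- (\<kappa> t s \<xi> / of_nat n))"
proof -
  have "has_triplet (dirac (- a t s) \<^bold>* \<mu> t s) 0 (R t s) (m t s)"
    using has_triplet_shift[OF triplet[OF st], of "- a t s"] by simp
  from has_triplet_root[OF this n]
  have "borel_prob (root n t s) \<and> (\<forall>\<xi>. char_fun (root n t s) \<xi> = exp (- (\<kappa> t s \<xi> / of_nat n)))"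
    unfolding root_def by (rule someI_ex)
  then show "borel_prob (root n t s)" "char_fun (root n t s) \<xi> = exp (- (\<kappa> t s \<xi> / of_nat n))" by auto
qed

text \<open>
  Transport a root of \<open>\<mu> s s'\<close> by \<open>U t s\<close> and correct the drift by a translation.
\<close>

lemma increment_root:
  assumes n: "n \<ge> 1" and s: "s' \<le> s" "s \<le> t"
  shows "\<exists>\<rho>. borel_prob \<rho> \<and> (\<forall>\<xi>. char_fun \<rho> \<xi> = exp (- ((\<kappa> t s' \<xi> - \<kappa> t s \<xi>) / of_nat n)))"
proof -
  have st: "s' \<le> t" using s by simp
  obtain N where N: "borel_prob N"
    "\<And>\<xi>. char_fun N \<xi> = exp (- (levy_exponent (a s s') (R s s') (m s s') \<xi> / of_nat n))"
    using has_triplet_root[OF triplet[OF s(1)] n] by blast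
  define b where "b = (1 / real n) *\<^sub>R (a t s - a t s')"
  define \<rho> where "\<rho> = dirac b \<^bold>* push (U t s) N"
  have PN: "borel_prob (push (U t s) N)" by (rule borel_prob_push[OF N(1)])
  have "char_fun \<rho> \<xi> = exp (- ((\<kappa> t s' \<xi> - \<kappa> t s \<xi>) / of_nat n))" for \<xi>
  proof -
    have "levy_exponent (a s s') (R s s') (m s s') (adj t s \<xi>)
        = (\<kappa> t s' \<xi> - \<kappa> t s \<xi>) + \<i> * of_real ((a t s - a t s') \<bullet> \<xi>)"
      using exponent_skew[OF s, of \<xi>] levy_exponent_drift[OF \<mu>(4)[OF s(2)], of "a t s" "R t s" \<xi>]
        levy_exponent_drift[OF \<mu>(4)[OF st], of "a t s'" "R t s'" \<xi>]
      by (simp add: inner_diff_left algebra_simps)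
    moreover have "\<i> * of_real (b \<bullet> \<xi>) = \<i> * of_real ((a t s - a t s') \<bullet> \<xi>) / of_nat n" by (simp add: b_def)
    ultimately have "\<i> * of_real (b \<bullet> \<xi>) + - (levy_exponent (a s s') (R s s') (m s s') (adj t s \<xi>) / of_nat n)
        = - ((\<kappa> t s' \<xi> - \<kappa> t s \<xi>) / of_nat n)"
      by (simp add: add_divide_distrib diff_divide_distrib)
    then show ?thesis
      unfolding \<rho>_def char_fun_shift[OF PN] char_fun_push_U[OF N(1)] N(2) exp_add[symmetric] by simp
  qed
  moreover have "borel_prob \<rho>" unfolding \<rho>_def by (intro borel_prob_conv borel_prob_dirac PN)
  ultimately show ?thesis by blast
qed

text \<open>
  The quantity \<open>op_trace (R t s) + 5 * small_mass (m t s)\<close> is monotone in \<open>s\<close> and bounded, so that its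
  increments are eventually small; they bound the displacement of the roots of the increments.
\<close>

lemma small_increments:
  assumes n: "n \<ge> 1" and e: "0 < e"
  shows "\<exists>s0\<le>t. \<forall>s\<le>s0. \<forall>s'\<le>s. \<exists>\<rho>. borel_prob \<rho> \<and> displacement \<rho> \<le> e \<and>
    (\<forall>\<xi>. char_fun \<rho> \<xi> = exp (- ((\<kappa> t s' \<xi> - \<kappa> t s \<xi>) / of_nat n)))"
proof -
  obtain C where C: "\<And>s. s \<le> t \<Longrightarrow> op_trace (R t s) \<le> ennreal C \<and> small_mass (m t s) \<le> ennreal C"
    using triplet_bounds[of t] by blast
  define V where "V s = op_trace (R t s) + 5 * small_mass (m t s)" for s
  define v where "v s = enn2real (V s)" for s
  have Vfin: "V s \<le> ennreal (6 * \<bar>C\<bar>)" if "s \<le> t" for s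
  proof -
    have le: "ennreal C \<le> ennreal \<bar>C\<bar>" by (rule ennreal_leI) simp
    have "V s \<le> ennreal \<bar>C\<bar> + 5 * ennreal \<bar>C\<bar>"
      unfolding V_def using C[OF that] le by (intro add_mono mult_left_mono) (auto intro: order_trans)
    also have "\<dots> = ennreal (\<bar>C\<bar> + 5 * \<bar>C\<bar>)" by (subst ennreal_plus) (simp_all add: ennreal_mult)
    also have "\<bar>C\<bar> + 5 * \<bar>C\<bar> = 6 * \<bar>C\<bar>" by simp
    finally show ?thesis .
  qed
  have Vv: "V s = ennreal (v s)" "0 \<le> v s" if "s \<le> t" for s
    using order.strict_trans1[OF Vfin[OF that]] by (simp_all add: v_def)
  have Vadd: "V s' = V s + (op_trace (R t s' - R t s) + 5 * small_mass (incr_m t s s'))" if "s' \<le> s" "s \<le> t" for s s'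
    unfolding V_def incr_R(2)[OF that] incr_levy(2)[OF that] by (simp add: algebra_simps)
  have vanti: "v s \<le> v s'" if s: "s' \<le> s" "s \<le> t" for s s'
  proof -
    have "V s \<le> V s'" unfolding Vadd[OF s] by simp
    then show ?thesis using Vv[of s] Vv[of s'] s by (simp add: ennreal_le_iff)
  qed
  have vbd: "v s \<le> 6 * \<bar>C\<bar>" if "s \<le> t" for s
    using Vfin[OF that] Vv[OF that] by (simp add: ennreal_le_iff)
  \<comment> \<open>solves \<open>sqrt (3 * d) = e\<close>\<close>
  define d where "d = e\<^sup>2 / 3"
  have d: "0 < d" using e by (simp add: d_def)
  have "\<exists>s0\<le>t. \<forall>s\<le>s0. \<forall>s'\<le>s. v s' - v s \<le> d"
    by (rule antimono_bounded_small_increments[where B="6 * \<bar>C\<bar>"]) (erule (1) vanti, erule vbd, rule d)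
  then obtain s0
    where s01: "s0 \<le> t" and s02: "\<forall>s\<le>s0. \<forall>s'\<le>s. v s' - v s \<le> d" by (elim exE conjE)
  note s0 = s01 s02[rule_format]
  show ?thesis
  proof (intro exI[of _ s0] conjI s0(1) allI impI)
    fix s s' assume ss: "s \<le> s0" "s' \<le> s"
    have s: "s' \<le> s" "s \<le> t" using ss s0(1) by auto
    obtain \<rho> where \<rho>: "borel_prob \<rho>" "\<And>\<xi>. char_fun \<rho> \<xi> = exp (- ((\<kappa> t s' \<xi> - \<kappa> t s \<xi>) / of_nat n))"
      using increment_root[OF n s] by blast
    let ?W = "op_trace (R t s' - R t s) + 5 * small_mass (incr_m t s s')"
    have "?W \<le> ennreal d"
    proof -
      have "ennreal (v s') = ennreal (v s) + ?W" using Vadd[OF s] Vv[of s] Vv[of s'] s by simp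
      moreover have "ennreal (v s') \<le> ennreal (v s) + ennreal d"
      proof -
        have "ennreal (v s') \<le> ennreal (v s + d)" using s0(2)[OF ss] by (intro ennreal_leI) simp
        then show ?thesis using Vv(2)[OF s(2)] d by (simp add: ennreal_plus)
      qed
      ultimately have "ennreal (v s) + ?W \<le> ennreal (v s) + ennreal d" by simp
      then show ?thesis by (subst (asm) ennreal_add_left_cancel_le) auto
    qed
    moreover have "(\<integral>\<^sup>+x. ennreal (1 - exp (- (1 / 2 * (norm x)\<^sup>2))) \<partial>\<rho>) \<le> ?W"
    proof (rule increment_bound[OF \<rho>(1) incr_R(1)[OF s] incr_levy(1)[OF s]])
      show "char_fun \<rho> \<xi> = exp (- (of_real (1 / real n) * levy_exponent 0 (R t s' - R t s) (incr_m t s s') \<xi>))" for \<xi>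
        unfolding \<rho>(2) \<kappa>_increment[OF s, of \<xi>] by simp
    qed (use n in auto)
    ultimately have "displacement \<rho> \<le> sqrt (3 * d)"
      using d by (intro displacement_le[OF \<rho>(1)]) auto
    also have "\<dots> = e" using e by (simp add: d_def)
    finally show "\<exists>\<rho>. borel_prob \<rho> \<and> displacement \<rho> \<le> e \<and>
      (\<forall>\<xi>. char_fun \<rho> \<xi> = exp (- ((\<kappa> t s' \<xi> - \<kappa> t s \<xi>) / of_nat n)))" using \<rho> by blast
  qed
qed

lemma roots_converge:
  assumes n: "n \<ge> 1"
  shows "\<exists>N. borel_prob N \<and> weakly_converges (root n t) N at_bot"
proof (rule convolution_cauchy_converges[where t=t])
  show "borel_prob (root n t s)" if "s \<le> t" for s by (rule root[OF n that])
  fix e :: real assume e: "0 < e"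
  obtain s0 where s0: "s0 \<le> t" "\<And>s s'. s \<le> s0 \<Longrightarrow> s' \<le> s \<Longrightarrow> \<exists>\<rho>. borel_prob \<rho> \<and> displacement \<rho> \<le> e \<and>
    (\<forall>\<xi>. char_fun \<rho> \<xi> = exp (- ((\<kappa> t s' \<xi> - \<kappa> t s \<xi>) / of_nat n)))"
    using small_increments[OF n e, of t] by blast
  show "\<exists>s0\<le>t. \<forall>s\<le>s0. \<forall>s'\<le>s. \<exists>\<rho>. borel_prob \<rho> \<and> displacement \<rho> \<le> e \<and>
      (root n t s' = root n t s \<^bold>* \<rho> \<or> root n t s = root n t s' \<^bold>* \<rho>)"
  proof (intro exI[of _ s0] conjI s0(1) allI impI)
    fix s s' assume ss: "s \<le> s0" "s' \<le> s"
    have s: "s \<le> t" "s' \<le> t" using ss s0(1) by auto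
    obtain \<rho> where \<rho>: "borel_prob \<rho>" "displacement \<rho> \<le> e"
      "\<And>\<xi>. char_fun \<rho> \<xi> = exp (- ((\<kappa> t s' \<xi> - \<kappa> t s \<xi>) / of_nat n))" using s0(2)[OF ss] by blast
    have "root n t s' = root n t s \<^bold>* \<rho>"
      by (rule borel_prob_eqI)
        (simp_all add: root[OF n] s borel_prob_conv \<rho>(1) char_fun_conv \<rho>(3) diff_divide_distrib flip: exp_add)
    then show "\<exists>\<rho>. borel_prob \<rho> \<and> displacement \<rho> \<le> e \<and>
      (root n t s' = root n t s \<^bold>* \<rho> \<or> root n t s = root n t s' \<^bold>* \<rho>)" using \<rho> by blast
  qed
qed

text \<open>
  The complementary factor: it completes the centred law at time \<open>s\<close> to \<open>\<nu>' t\<close>.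
\<close>

definition \<eta> :: "real \<Rightarrow> real \<Rightarrow> 'h measure" where
  "\<eta> t s = dirac (a t s) \<^bold>* push (U t s) (\<nu>' s)"

lemma borel_prob_\<eta>: "borel_prob (\<eta> t s)"
  unfolding \<eta>_def by (intro borel_prob_conv borel_prob_dirac push_\<nu>')

lemma char_fun_push_\<nu>':
  assumes st: "s \<le> t"
  shows "char_fun (push (U t s) (\<nu>' s)) \<xi> = char_fun (\<nu>' t) \<xi> * exp (levy_exponent (a t s) (R t s) (m t s) \<xi>)"
  unfolding \<nu>'_factor[OF st] char_fun_conv[OF \<mu>(2)[OF st] push_\<nu>'] \<mu>(5)[OF st]
  by (simp add: exp_minus)

lemma char_fun_\<eta>:
  assumes st: "s \<le> t"
  shows "char_fun (\<eta> t s) \<xi> = char_fun (\<nu>' t) \<xi> * exp (\<kappa> t s \<xi>)"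
  unfolding \<eta>_def char_fun_shift[OF push_\<nu>'] char_fun_push_\<nu>'[OF st]
    levy_exponent_drift[OF \<mu>(4)[OF st], of "a t s"]
  by (simp add: exp_diff)

text \<open>
  As \<open>s\<close> decreases, the centred law gains the increment as a factor, so \<open>\<eta> t s\<close> loses it: here the
  law at the larger time is the law at the smaller time convolved with the increment.
\<close>

lemma \<eta>_converges: "\<exists>N. borel_prob N \<and> weakly_converges (\<eta> t) N at_bot"
proof (rule convolution_cauchy_converges[where t=t])
  show "borel_prob (\<eta> t s)" for s by (rule borel_prob_\<eta>)
  fix e :: real assume e: "0 < e"
  have one: "(1::nat) \<le> 1" by simp
  obtain s0 where s0: "s0 \<le> t" "\<And>s s'. s \<le> s0 \<Longrightarrow> s' \<le> s \<Longrightarrow> \<exists>\<rho>. borel_prob \<rho> \<and> displacement \<rho> \<le> e \<and>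
    (\<forall>\<xi>. char_fun \<rho> \<xi> = exp (- ((\<kappa> t s' \<xi> - \<kappa> t s \<xi>) / of_nat 1)))"
    using small_increments[OF one e, of t] by blast
  show "\<exists>s0\<le>t. \<forall>s\<le>s0. \<forall>s'\<le>s. \<exists>\<rho>. borel_prob \<rho> \<and> displacement \<rho> \<le> e \<and>
      (\<eta> t s' = \<eta> t s \<^bold>* \<rho> \<or> \<eta> t s = \<eta> t s' \<^bold>* \<rho>)"
  proof (intro exI[of _ s0] conjI s0(1) allI impI)
    fix s s' assume ss: "s \<le> s0" "s' \<le> s"
    have s: "s \<le> t" "s' \<le> t" using ss s0(1) by auto
    obtain \<rho> where \<rho>: "borel_prob \<rho>" "displacement \<rho> \<le> e"
      "\<And>\<xi>. char_fun \<rho> \<xi> = exp (- ((\<kappa> t s' \<xi> - \<kappa> t s \<xi>) / of_nat 1))" using s0(2)[OF ss] by blast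
    have "\<eta> t s = \<eta> t s' \<^bold>* \<rho>"
      by (rule borel_prob_eqI)
        (simp_all add: borel_prob_\<eta> s borel_prob_conv \<rho>(1) char_fun_conv \<rho>(3) char_fun_\<eta> mult.assoc flip: exp_add)
    then show "\<exists>\<rho>. borel_prob \<rho> \<and> displacement \<rho> \<le> e \<and>
      (\<eta> t s' = \<eta> t s \<^bold>* \<rho> \<or> \<eta> t s = \<eta> t s' \<^bold>* \<rho>)" using \<rho> by blast
  qed
qed

end

section \<open>The limiting triplet\<close>

lemma tendsto_enn2real_finite:
  assumes "(u \<longlongrightarrow> x) F" "x < \<top>"
  shows "((\<lambda>n. enn2real (u n)) \<longlongrightarrow> enn2real x) F"
  using assms by (intro tendsto_enn2real) simp_all

context evolution_data
begin

lemma eventually_before: "(\<And>s. s \<le> t \<Longrightarrow> P s) \<Longrightarrow> eventually P (at_bot :: real filter)"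
  using eventually_le_at_bot[of t] by (rule eventually_mono)

lemma m_antimono_integral:
  assumes "s' \<le> s" "s \<le> t" "f \<in> borel_measurable borel"
  shows "(\<integral>\<^sup>+x. f x \<partial>m t s) \<le> (\<integral>\<^sup>+x. f x \<partial>m t s')"
  unfolding nn_integral_m_increment[OF assms] by simp

lemma emeasure_m_cut:
  assumes "s \<le> t" "A \<in> sets borel"
  shows "emeasure (m t s) (A - {0}) = (\<integral>\<^sup>+x. indicator A x \<partial>m t s)"
proof -
  note l = levy_measureD[OF \<mu>(4)[OF assms(1)]]
  have A: "A \<in> sets (m t s)" using assms(2) l(1) by simp
  have "emeasure (m t s) (A - {0}) = emeasure (m t s) A"
    by (rule emeasure_Diff_null_set) (use l A in \<open>auto intro!: null_setsI\<close>)
  then show ?thesis using A by simp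
qed

lemma mass_tendsto:
  assumes f: "f \<in> borel_measurable borel"
  shows "((\<lambda>s. \<integral>\<^sup>+x. f x \<partial>m t s) \<longlongrightarrow> (SUP n. \<integral>\<^sup>+x. f x \<partial>m t (t - real n))) at_bot"
  using antimono_tendsto_at_bot[of t "\<lambda>s. \<integral>\<^sup>+x. f x \<partial>m t s"] m_antimono_integral[OF _ _ f] by simp

lemma sets_m_inf [simp, measurable_cong]: "sets (m_inf m t) = sets borel"
  unfolding m_inf_def using sets.sigma_sets_eq[of "borel :: 'h measure"] by simp

lemma incseq_mass:
  "f \<in> borel_measurable borel \<Longrightarrow> incseq (\<lambda>n. \<integral>\<^sup>+x. f x \<partial>m t (t - real n))"
  by (intro incseq_SucI m_antimono_integral) auto

text \<open>
  By monotonicity the limit in the definition is a supremum along the sequence \<open>t - n\<close>, and countable suprema of increasing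
  sequences commute with countable sums. This identifies the limit as a measure.
\<close>

lemma emeasure_m_inf:
  assumes A: "A \<in> sets borel"
  shows "emeasure (m_inf m t) A = (SUP n. emeasure (m t (t - real n)) (A - {0}))"
proof -
  let ?F = "\<lambda>A. SUP n. emeasure (m t (t - real n)) (A - {0})"
  have F: "?F A = (SUP n. \<integral>\<^sup>+x. indicator A x \<partial>m t (t - real n))" if "A \<in> sets borel" for A
    using emeasure_m_cut[OF _ that, of "t - real _" t] by simp
  have Lim: "Lim at_bot (\<lambda>s. emeasure (m t s) (A - {0})) = ?F A" if B: "A \<in> sets borel" for A
  proof (rule tendsto_Lim[OF trivial_limit_at_bot_linorder])
    have ev: "eventually (\<lambda>s. (\<integral>\<^sup>+x. indicator A x \<partial>m t s) = emeasure (m t s) (A - {0})) at_bot"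
      using eventually_le_at_bot[of t] by eventually_elim (rule emeasure_m_cut[OF _ B, symmetric])
    have "((\<lambda>s. \<integral>\<^sup>+x. indicator A x \<partial>m t s) \<longlongrightarrow> ?F A) at_bot"
      unfolding F[OF B] by (rule mass_tendsto) (use B in simp)
    then show "((\<lambda>s. emeasure (m t s) (A - {0})) \<longlongrightarrow> ?F A) at_bot"
      using ev by (rule Lim_transform_eventually)
  qed
  have "countably_additive (sets borel) ?F"
  proof (rule countably_additiveI)
    fix A :: "nat \<Rightarrow> 'h set" assume A: "range A \<subseteq> sets borel" "disjoint_family A"
    have Ai: "A i \<in> sets borel" for i using A by auto
    have "(\<Sum>i. ?F (A i)) = (SUP n. \<Sum>i. emeasure (m t (t - real n)) (A i - {0}))"
    proof (rule ennreal_suminf_SUP_eq)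
      fix i show "incseq (\<lambda>n. emeasure (m t (t - real n)) (A i - {0}))"
        using incseq_mass[of "indicator (A i)" t] Ai[of i] by (simp add: emeasure_m_cut)
    qed
    also have "\<dots> = ?F (\<Union>i. A i)"
    proof (rule SUP_cong[OF refl])
      fix n
      have "(\<Sum>i. emeasure (m t (t - real n)) (A i - {0})) = emeasure (m t (t - real n)) (\<Union>i. A i - {0})"
        using Ai A(2) sets_m[of "t - real n" t]
        by (intro suminf_emeasure) (auto simp: disjoint_family_on_def)
      also have "(\<Union>i. A i - {0}) = (\<Union>i. A i) - {0}" by blast
      finally show "(\<Sum>i. emeasure (m t (t - real n)) (A i - {0})) = emeasure (m t (t - real n)) ((\<Union>i. A i) - {0})" .
    qed
    finally show "(\<Sum>i. ?F (A i)) = ?F (\<Union>i. A i)" .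
  qed
  moreover have "positive (sets borel) ?F" by (simp add: positive_def)
  moreover have "m_inf m t = measure_of UNIV (sets borel) ?F"
    unfolding m_inf_def
  proof (rule measure_of_eq)
    show "Lim at_bot (\<lambda>s. emeasure (m t s) (A - {0})) = ?F A" if "A \<in> sigma_sets UNIV (sets borel)" for A
      using Lim that sets.sigma_sets_eq[of "borel :: 'h measure"] by simp
  qed simp
  moreover have "sigma_algebra UNIV (sets (borel :: 'h measure))" by (metis sets.sigma_algebra_axioms space_borel)
  ultimately show ?thesis using A by (simp add: emeasure_measure_of_sigma)
qed

lemma nn_integral_m_inf:
  assumes "f \<in> borel_measurable borel"
  shows "(\<integral>\<^sup>+x. f x \<partial>m_inf m t) = (SUP n. \<integral>\<^sup>+x. f x \<partial>m t (t - real n))"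
  using assms
proof induction
  case (cong f g)
  have "f = g" using cong(3) by (intro ext) simp
  then show ?case using cong(4) by simp
next
  case (set A)
  then show ?case by (simp add: emeasure_m_inf emeasure_m_cut)
next
  case (mult u c)
  then show ?case
    by (simp add: nn_integral_cmult SUP_mult_left_ennreal measurable_cong_sets[OF sets_m_inf refl]
        measurable_cong_sets[OF sets_m refl])
next
  case (add u v)
  have "(\<integral>\<^sup>+x. v x + u x \<partial>m_inf m t) = (\<integral>\<^sup>+x. v x \<partial>m_inf m t) + (\<integral>\<^sup>+x. u x \<partial>m_inf m t)"
    using add by (intro nn_integral_add) (simp_all add: measurable_cong_sets[OF sets_m_inf refl])
  also have "\<dots> = (SUP n. (\<integral>\<^sup>+x. v x \<partial>m t (t - real n)) + (\<integral>\<^sup>+x. u x \<partial>m t (t - real n)))"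
    unfolding add.IH using add by (intro ennreal_SUP_add[symmetric] incseq_mass)
  also have "\<dots> = (SUP n. \<integral>\<^sup>+x. v x + u x \<partial>m t (t - real n))"
    using add by (intro SUP_cong refl nn_integral_add[symmetric]) (simp_all add: measurable_cong_sets[OF sets_m refl])
  finally show ?case .
next
  case (seq V)
  have "(\<integral>\<^sup>+x. (SUP i. V i x) \<partial>m_inf m t) = (SUP i. \<integral>\<^sup>+x. V i x \<partial>m_inf m t)"
    using seq by (intro nn_integral_monotone_convergence_SUP) (simp_all add: measurable_cong_sets[OF sets_m_inf refl])
  also have "\<dots> = (SUP n. SUP i. \<integral>\<^sup>+x. V i x \<partial>m t (t - real n))"
    unfolding seq.IH by (rule SUP_commute)
  also have "\<dots> = (SUP n. \<integral>\<^sup>+x. (SUP i. V i x) \<partial>m t (t - real n))"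
    using seq by (intro SUP_cong refl nn_integral_monotone_convergence_SUP[symmetric])
      (simp_all add: measurable_cong_sets[OF sets_m refl])
  finally show ?case by (simp add: image_comp)
qed

lemma nn_integral_m_tendsto:
  assumes "f \<in> borel_measurable borel"
  shows "((\<lambda>s. \<integral>\<^sup>+x. f x \<partial>m t s) \<longlongrightarrow> (\<integral>\<^sup>+x. f x \<partial>m_inf m t)) at_bot"
  unfolding nn_integral_m_inf[OF assms] by (rule mass_tendsto[OF assms])

lemma levy_m_inf: "levy_measure (m_inf m t)"
proof (rule levy_measureI)
  show "emeasure (m_inf m t) {0} = 0" by (simp add: emeasure_m_inf)
  obtain C where C: "\<And>s. s \<le> t \<Longrightarrow> small_mass (m t s) \<le> ennreal C" using triplet_bounds[of t] by blast
  have "small_mass (m_inf m t) = (SUP n. small_mass (m t (t - real n)))"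
    unfolding small_mass_def by (rule nn_integral_m_inf) measurable
  also have "\<dots> \<le> ennreal C" by (intro SUP_least C) simp
  finally show "small_mass (m_inf m t) < \<infinity>" by (simp add: order.strict_trans1)
qed simp

lemma emeasure_m_tendsto:
  assumes A: "A \<in> sets borel" "0 \<notin> A"
  shows "((\<lambda>s. emeasure (m t s) A) \<longlongrightarrow> emeasure (m_inf m t) A) at_bot"
proof -
  have "(\<integral>\<^sup>+x. indicator A x \<partial>m_inf m t) = emeasure (m_inf m t) A"
    using A(1) by (intro nn_integral_indicator) simp
  moreover have "((\<lambda>s. \<integral>\<^sup>+x. indicator A x \<partial>m t s) \<longlongrightarrow> (\<integral>\<^sup>+x. indicator A x \<partial>m_inf m t)) at_bot"
    by (rule nn_integral_m_tendsto) (use A in simp)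
  ultimately have "((\<lambda>s. \<integral>\<^sup>+x. indicator A x \<partial>m t s) \<longlongrightarrow> emeasure (m_inf m t) A) at_bot"
    by simp
  moreover have "eventually (\<lambda>s. (\<integral>\<^sup>+x. indicator A x \<partial>m t s) = emeasure (m t s) A) at_bot"
    using eventually_le_at_bot[of t] by eventually_elim (simp add: A(1) sets_m)
  ultimately show ?thesis by (rule Lim_transform_eventually)
qed

text \<open>
  Monotone convergence for the positive and negative parts of the real and imaginary part.
\<close>

lemma integral_kernel_tendsto:
  "((\<lambda>s. CLINT x|m t s. levy_kernel \<xi> x) \<longlongrightarrow> (CLINT x|m_inf m t. levy_kernel \<xi> x)) at_bot"
proof -
  have real: "((\<lambda>s. \<integral>x. g x \<partial>m t s) \<longlongrightarrow> (\<integral>x. g x \<partial>m_inf m t)) at_bot"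
    if g: "g \<in> borel_measurable borel" "\<And>x. norm (g x) \<le> C * min 1 ((norm x)\<^sup>2)" for g :: "'h \<Rightarrow> real" and C
  proof -
    have int: "integrable K g" if "levy_measure K" for K by (rule integrable_dominated[OF that g])
    have part: "((\<lambda>s. enn2real (\<integral>\<^sup>+x. ennreal (c * g x) \<partial>m t s)) \<longlongrightarrow> enn2real (\<integral>\<^sup>+x. ennreal (c * g x) \<partial>m_inf m t)) at_bot" for c
    proof (rule tendsto_enn2real_finite)
      show "((\<lambda>s. \<integral>\<^sup>+x. ennreal (c * g x) \<partial>m t s) \<longlongrightarrow> (\<integral>\<^sup>+x. ennreal (c * g x) \<partial>m_inf m t)) at_bot"
        using g(1) by (intro nn_integral_m_tendsto) simp
      show "(\<integral>\<^sup>+x. ennreal (c * g x) \<partial>m_inf m t) < \<top>"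
        using integrableD(2)[OF integrable_mult_right[OF int[OF levy_m_inf], of t c]] by (simp add: less_top)
    qed
    have lim: "((\<lambda>s. enn2real (\<integral>\<^sup>+x. ennreal (1 * g x) \<partial>m t s) - enn2real (\<integral>\<^sup>+x. ennreal (- 1 * g x) \<partial>m t s)) \<longlongrightarrow>
       enn2real (\<integral>\<^sup>+x. ennreal (1 * g x) \<partial>m_inf m t) - enn2real (\<integral>\<^sup>+x. ennreal (- 1 * g x) \<partial>m_inf m t)) at_bot"
      by (intro tendsto_diff part)
    have ev: "eventually (\<lambda>s. enn2real (\<integral>\<^sup>+x. ennreal (1 * g x) \<partial>m t s) - enn2real (\<integral>\<^sup>+x. ennreal (- 1 * g x) \<partial>m t s)
        = (\<integral>x. g x \<partial>m t s)) at_bot"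
      using eventually_le_at_bot[of t] by eventually_elim (simp add: real_lebesgue_integral_def[OF int] \<mu>(4))
    have eq: "enn2real (\<integral>\<^sup>+x. ennreal (1 * g x) \<partial>m_inf m t) - enn2real (\<integral>\<^sup>+x. ennreal (- 1 * g x) \<partial>m_inf m t)
        = (\<integral>x. g x \<partial>m_inf m t)"
      by (simp add: real_lebesgue_integral_def[OF int[OF levy_m_inf]])
    show ?thesis using lim ev unfolding eq by (rule Lim_transform_eventually)
  qed
  have bound: "\<bar>Re (levy_kernel \<xi> x)\<bar> \<le> (2 + (norm \<xi>)\<^sup>2) * min 1 ((norm x)\<^sup>2)"
    "\<bar>Im (levy_kernel \<xi> x)\<bar> \<le> (2 + (norm \<xi>)\<^sup>2) * min 1 ((norm x)\<^sup>2)" for x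
    using abs_Re_le_cmod[of "levy_kernel \<xi> x"] abs_Im_le_cmod[of "levy_kernel \<xi> x"] levy_kernel_bound_min[of \<xi> x]
    by linarith+
  have lim: "((\<lambda>s. Complex (\<integral>x. Re (levy_kernel \<xi> x) \<partial>m t s) (\<integral>x. Im (levy_kernel \<xi> x) \<partial>m t s)) \<longlongrightarrow>
      Complex (\<integral>x. Re (levy_kernel \<xi> x) \<partial>m_inf m t) (\<integral>x. Im (levy_kernel \<xi> x) \<partial>m_inf m t)) at_bot"
    using bound by (intro tendsto_Complex real[where C="2 + (norm \<xi>)\<^sup>2"]) simp_all
  have split: "Complex (\<integral>x. Re (levy_kernel \<xi> x) \<partial>K) (\<integral>x. Im (levy_kernel \<xi> x) \<partial>K) = (CLINT x|K. levy_kernel \<xi> x)"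
    if "levy_measure K" for K
    using integral_Re[OF integrable_levy_kernel[OF that], of \<xi>] integral_Im[OF integrable_levy_kernel[OF that], of \<xi>]
    by (simp add: complex_eq_iff)
  have "eventually (\<lambda>s. Complex (\<integral>x. Re (levy_kernel \<xi> x) \<partial>m t s) (\<integral>x. Im (levy_kernel \<xi> x) \<partial>m t s)
      = (CLINT x|m t s. levy_kernel \<xi> x)) at_bot"
    using eventually_le_at_bot[of t] by eventually_elim (rule split[OF \<mu>(4)])
  with lim show ?thesis unfolding split[OF levy_m_inf] by (rule Lim_transform_eventually)
qed

lemma R_quadratic_tendsto: "\<exists>l. ((\<lambda>s. R t s x \<bullet> x) \<longlongrightarrow> l) at_bot"
proof -
  obtain C where C: "\<And>s. s \<le> t \<Longrightarrow> R t s x \<bullet> x \<le> C * (norm x)\<^sup>2" using triplet_bounds[of t] by blast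
  let ?f = "\<lambda>s. ennreal (R t s x \<bullet> x)"
  define S where "S = (SUP s\<in>{..t}. ?f s)"
  have "?f s \<le> ?f s'" if s: "s' \<le> s" "s \<le> t" for s s'
    using incr_R(1)[OF s, of x] by (intro ennreal_leI) (simp add: blinfun.diff_left inner_diff_left)
  then have "(?f \<longlongrightarrow> S) at_bot" unfolding S_def by (intro antimono_tendsto_at_bot(1)) auto
  moreover have "S \<le> ennreal (C * (norm x)\<^sup>2)" unfolding S_def by (intro SUP_least ennreal_leI C) simp
  then have "S < \<top>" by (simp add: order.strict_trans1)
  ultimately have "((\<lambda>s. enn2real (?f s)) \<longlongrightarrow> enn2real S) at_bot" by (rule tendsto_enn2real_finite)
  moreover have "eventually (\<lambda>s. enn2real (?f s) = R t s x \<bullet> x) at_bot"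
    using eventually_le_at_bot[of t] by eventually_elim (simp add: cov(2))
  ultimately show ?thesis by (blast intro: Lim_transform_eventually)
qed

text \<open>
  The quadratic forms converge by monotonicity; polarisation gives a limiting bilinear form, which is
  bounded because the quadratic forms are uniformly bounded.
\<close>

lemma R_tendsto_exists: "\<exists>S :: 'h \<Rightarrow>\<^sub>L 'h. \<forall>x y. ((\<lambda>s. R t s x \<bullet> y) \<longlongrightarrow> S x \<bullet> y) at_bot"
proof -
  obtain q where q: "\<And>x. ((\<lambda>s. R t s x \<bullet> x) \<longlongrightarrow> q x) at_bot" using R_quadratic_tendsto[of t] by metis
  define b where "b x y = (q (x + y) - q (x - y)) / 4" for x y
  have polar: "(R t s (x + y) \<bullet> (x + y) - R t s (x - y) \<bullet> (x - y)) / 4 = R t s x \<bullet> y" if "s \<le> t" for s x y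
    using cov(1)[OF that, of y x] by (simp add: blinfun.add_right blinfun.diff_right inner_simps inner_commute)
  have b: "((\<lambda>s. R t s x \<bullet> y) \<longlongrightarrow> b x y) at_bot" for x y
  proof -
    have "((\<lambda>s. (R t s (x + y) \<bullet> (x + y) - R t s (x - y) \<bullet> (x - y)) / 4) \<longlongrightarrow> b x y) at_bot"
      unfolding b_def by (intro tendsto_intros q) simp
    moreover have "eventually (\<lambda>s. (R t s (x + y) \<bullet> (x + y) - R t s (x - y) \<bullet> (x - y)) / 4 = R t s x \<bullet> y) at_bot"
      using eventually_le_at_bot[of t] by eventually_elim (rule polar)
    ultimately show ?thesis by (rule Lim_transform_eventually)
  qed
  have unique: "u = v" if "((\<lambda>s. R t s x \<bullet> y) \<longlongrightarrow> u) at_bot" "((\<lambda>s. R t s x \<bullet> y) \<longlongrightarrow> v) at_bot" for x y u v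
    using that by (intro tendsto_unique[OF trivial_limit_at_bot_linorder])
  obtain C where C: "\<And>s x. s \<le> t \<Longrightarrow> R t s x \<bullet> x \<le> C * (norm x)\<^sup>2" using triplet_bounds[of t] by blast
  have q0: "0 \<le> q x" and qC: "q x \<le> C * (norm x)\<^sup>2" for x
  proof -
    show "0 \<le> q x"
      by (rule tendsto_lowerbound[OF q]) (rule eventually_before, erule cov(2), simp)
    show "q x \<le> C * (norm x)\<^sup>2"
      by (rule tendsto_upperbound[OF q]) (rule eventually_before, erule C, simp)
  qed
  have scale: "b (r *\<^sub>R x) y = r * b x y" "b x (r *\<^sub>R y) = r * b x y" for r x y
    by (rule unique[OF b]; simp add: blinfun.scaleR_right; intro tendsto_intros b)+
  have unit: "\<bar>b x y\<bar> \<le> C" if "norm x = 1" "norm y = 1" for x y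
  proof -
    have par: "(norm (x + y))\<^sup>2 + (norm (x - y))\<^sup>2 = 4"
      using that by (simp add: power2_norm_eq_inner inner_simps inner_commute) (simp add: dot_square_norm)
    have "0 \<le> (norm (x + y))\<^sup>2" "0 \<le> (norm (x - y))\<^sup>2" by simp_all
    moreover have "0 \<le> C" using q0[of x] qC[of x] that by simp
    moreover have "(norm (x + y))\<^sup>2 \<le> 4" "(norm (x - y))\<^sup>2 \<le> 4" using par calculation(1,2) by linarith+
    ultimately have "C * (norm (x + y))\<^sup>2 \<le> C * 4" "C * (norm (x - y))\<^sup>2 \<le> C * 4"
      by (simp_all only: mult_left_mono)
    then show ?thesis unfolding b_def using q0[of "x + y"] q0[of "x - y"] qC[of "x + y"] qC[of "x - y"]
      by (simp add: abs_le_iff)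
  qed
  have "bounded_bilinear b"
  proof
    show "b (x + x') y = b x y + b x' y" for x x' y
      by (rule unique[OF b]) (simp add: blinfun.add_right inner_add_left; intro tendsto_intros b)
    show "b x (y + y') = b x y + b x y'" for x y y'
      by (rule unique[OF b]) (simp add: inner_add_right; intro tendsto_intros b)
    show "b (r *\<^sub>R x) y = r *\<^sub>R b x y" "b x (r *\<^sub>R y) = r *\<^sub>R b x y" for r x y by (simp_all add: scale)
    have "norm (b x y) \<le> norm x * norm y * C" for x y
    proof (cases "x = 0 \<or> y = 0")
      case True
      then show ?thesis using scale(1)[of 0 0 y] scale(2)[of x 0 0] by auto
    next
      case False
      have "b x y = norm x * (norm y * b (x /\<^sub>R norm x) (y /\<^sub>R norm y))"
        using False by (simp add: scale field_simps)
      moreover have "\<bar>b (x /\<^sub>R norm x) (y /\<^sub>R norm y)\<bar> \<le> C" using False by (intro unit) auto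
      ultimately show ?thesis by (simp add: abs_mult mult.assoc mult_left_mono)
    qed
    then show "\<exists>K. \<forall>x y. norm (b x y) \<le> norm x * norm y * K" by blast
  qed
  from bounded_bilinear_form_operator[OF this] obtain S :: "'h \<Rightarrow>\<^sub>L 'h" where "\<And>x y. S x \<bullet> y = b x y" by blast
  then show ?thesis using b by (intro exI[of _ S]) simp
qed

lemma R_inf: "((\<lambda>s. R t s x \<bullet> y) \<longlongrightarrow> R_inf R t x \<bullet> y) at_bot"
proof -
  let ?P = "\<lambda>S :: 'h \<Rightarrow>\<^sub>L 'h. \<forall>x y. ((\<lambda>s. R t s x \<bullet> y) \<longlongrightarrow> S x \<bullet> y) at_bot"
  have "\<exists>!S. ?P S"
  proof (rule ex_ex1I[OF R_tendsto_exists])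
    fix S S' assume "?P S" "?P S'"
    then have "S x \<bullet> y = S' x \<bullet> y" for x y
      by (intro tendsto_unique[OF trivial_limit_at_bot_linorder, of "\<lambda>s. R t s x \<bullet> y"]) auto
    then show "S = S'" by (intro blinfun_eqI vector_eq_rdot[THEN iffD1]) auto
  qed
  then have "?P (R_inf R t)" unfolding R_inf_def by (rule theI')
  then show ?thesis by blast
qed

lemma covariance_R_inf: "covariance_operator (R_inf R t)"
  unfolding covariance_operator_def
proof (intro conjI allI)
  fix x y
  have "((\<lambda>s. R t s y \<bullet> x) \<longlongrightarrow> R_inf R t x \<bullet> y) at_bot"
    by (rule Lim_transform_eventually[OF R_inf])
      (rule eventually_before[of t], metis cov(1) inner_commute)
  then have "R_inf R t x \<bullet> y = R_inf R t y \<bullet> x"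
    using R_inf by (intro tendsto_unique[OF trivial_limit_at_bot_linorder])
  then show "R_inf R t x \<bullet> y = x \<bullet> R_inf R t y" by (simp add: inner_commute)
  show pos: "0 \<le> R_inf R t x \<bullet> x" for x
    by (rule tendsto_lowerbound[OF R_inf]) (rule eventually_before, erule cov(2), simp)
next
  obtain C where C: "\<And>s. s \<le> t \<Longrightarrow> op_trace (R t s) \<le> ennreal C" using triplet_bounds[of t] by blast
  have "(\<Sum>i<n. ennreal (R_inf R t (onb i) \<bullet> onb i)) \<le> ennreal C" for n
  proof (rule tendsto_upperbound[where F=at_bot and f="\<lambda>s. \<Sum>i<n. ennreal (R t s (onb i) \<bullet> onb i)"])
    show "((\<lambda>s. \<Sum>i<n. ennreal (R t s (onb i) \<bullet> onb i)) \<longlongrightarrow> (\<Sum>i<n. ennreal (R_inf R t (onb i) \<bullet> onb i))) at_bot"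
      by (intro tendsto_sum tendsto_ennrealI R_inf)
    show "eventually (\<lambda>s. (\<Sum>i<n. ennreal (R t s (onb i) \<bullet> onb i)) \<le> ennreal C) at_bot"
      using eventually_le_at_bot[of t]
    proof eventually_elim
      case (elim s)
      have "(\<Sum>i<n. ennreal (R t s (onb i) \<bullet> onb i)) \<le> op_trace (R t s)"
        unfolding op_trace_onb by (rule sum_le_suminf) auto
      then show ?case using C[OF elim] by (rule order_trans)
    qed
  qed simp
  then have "op_trace (R_inf R t) \<le> ennreal C" unfolding op_trace_onb suminf_eq_SUP by (intro SUP_least)
  then show "op_trace (R_inf R t) < \<infinity>" by (simp add: order.strict_trans1)
qed

abbreviation \<kappa>_inf :: "real \<Rightarrow> 'h \<Rightarrow> complex" where
  "\<kappa>_inf t \<xi> \<equiv> levy_exponent 0 (R_inf R t) (m_inf m t) \<xi>"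

lemma \<kappa>_tendsto: "((\<lambda>s. \<kappa> t s \<xi>) \<longlongrightarrow> \<kappa>_inf t \<xi>) at_bot"
proof -
  have "((\<lambda>s. - \<i> * complex_of_real (0 \<bullet> \<xi>) + complex_of_real (1/2 * (R t s \<xi> \<bullet> \<xi>)) - (CLINT x|m t s. levy_kernel \<xi> x))
      \<longlongrightarrow> \<kappa>_inf t \<xi>) at_bot"
    unfolding levy_exponent_kernel[OF levy_m_inf] by (intro tendsto_intros R_inf integral_kernel_tendsto)
  then show ?thesis
    by (rule Lim_transform_eventually)
      (rule eventually_before, erule levy_exponent_kernel[OF \<mu>(4), symmetric])
qed

definition root_inf :: "nat \<Rightarrow> real \<Rightarrow> 'h measure" where
  "root_inf n t = (SOME N. borel_prob N \<and> weakly_converges (root n t) N at_bot)"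

lemma root_inf:
  assumes n: "n \<ge> 1"
  shows "borel_prob (root_inf n t)" "weakly_converges (root n t) (root_inf n t) at_bot"
    "char_fun (root_inf n t) \<xi> = exp (- (\<kappa>_inf t \<xi> / of_nat n))"
proof -
  have *: "borel_prob (root_inf n t) \<and> weakly_converges (root n t) (root_inf n t) at_bot"
    unfolding root_inf_def using roots_converge[OF n, of t] by (rule someI_ex)
  then show "borel_prob (root_inf n t)" "weakly_converges (root n t) (root_inf n t) at_bot" by auto
  have ev: "eventually (\<lambda>s. borel_prob (root n t s)) at_bot"
    using eventually_le_at_bot[of t] by eventually_elim (rule root[OF n])
  have "((\<lambda>s. char_fun (root n t s) \<xi>) \<longlongrightarrow> char_fun (root_inf n t) \<xi>) at_bot"
    using * by (intro weakly_converges_char_fun[OF ev]) auto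
  moreover have "((\<lambda>s. char_fun (root n t s) \<xi>) \<longlongrightarrow> exp (- (\<kappa>_inf t \<xi> / of_nat n))) at_bot"
  proof (rule Lim_transform_eventually)
    show "((\<lambda>s. exp (- (\<kappa> t s \<xi> / of_nat n))) \<longlongrightarrow> exp (- (\<kappa>_inf t \<xi> / of_nat n))) at_bot"
      using n by (intro tendsto_intros \<kappa>_tendsto) simp
    show "eventually (\<lambda>s. exp (- (\<kappa> t s \<xi> / of_nat n)) = char_fun (root n t s) \<xi>) at_bot"
      using eventually_le_at_bot[of t] by eventually_elim (simp add: root[OF n])
  qed
  ultimately show "char_fun (root_inf n t) \<xi> = exp (- (\<kappa>_inf t \<xi> / of_nat n))"
    by (intro tendsto_unique[OF trivial_limit_at_bot_linorder])
qed

lemma root_1_triplet: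
  assumes st: "s \<le> t"
  shows "has_triplet (root 1 t s) 0 (R t s) (m t s)"
proof -
  have one: "(1::nat) \<le> 1" by simp
  have h: "has_triplet (dirac (- a t s) \<^bold>* \<mu> t s) 0 (R t s) (m t s)"
    using has_triplet_shift[OF triplet[OF st], of "- a t s"] by simp
  note h' = has_tripletD[OF h]
  have "root 1 t s = dirac (- a t s) \<^bold>* \<mu> t s"
    by (rule borel_prob_eqI) (simp_all add: root[OF one st] h' del: One_nat_def)
  then show ?thesis using h by simp
qed

text \<open>
  The limit is infinitely divisible because the limits of the roots of order \<open>n\<close> are its roots.
\<close>

lemma root_inf_1_triplet: "has_triplet (root_inf 1 t) 0 (R_inf R t) (m_inf m t)"
proof -
  have one: "(1::nat) \<le> 1" by simp
  have "\<exists>N. borel_prob N \<and> root_inf 1 t = conv_power N n" if n: "n \<ge> 1" for n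
  proof (intro exI conjI)
    show "borel_prob (root_inf n t)" by (rule root_inf[OF n])
    show "root_inf 1 t = conv_power (root_inf n t) n"
    proof (rule borel_prob_eqI)
      show "char_fun (root_inf 1 t) \<xi> = char_fun (conv_power (root_inf n t) n) \<xi>" for \<xi>
        using n by (simp add: char_fun_conv_power root_inf[OF n] root_inf[OF one] exp_of_nat_mult[symmetric] del: One_nat_def)
    qed (simp_all add: root_inf[OF n] root_inf[OF one] borel_prob_conv_power del: One_nat_def)
  qed
  then have "infinitely_divisible (root_inf 1 t)"
    using root_inf(1)[OF one] by (simp add: infinitely_divisible_def)
  moreover have "char_fun (root_inf 1 t) \<xi> = exp (- \<kappa>_inf t \<xi>)" for \<xi>
    unfolding root_inf(3)[OF one] by simp
  ultimately show ?thesis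
    unfolding has_triplet_def by (intro conjI allI covariance_R_inf levy_m_inf)
qed

definition \<eta>_inf :: "real \<Rightarrow> 'h measure" where
  "\<eta>_inf t = (SOME N. borel_prob N \<and> weakly_converges (\<eta> t) N at_bot)"

lemma \<eta>_inf:
  "borel_prob (\<eta>_inf t)" "weakly_converges (\<eta> t) (\<eta>_inf t) at_bot"
  "char_fun (\<eta>_inf t) \<xi> = char_fun (\<nu>' t) \<xi> * exp (\<kappa>_inf t \<xi>)"
proof -
  have *: "borel_prob (\<eta>_inf t) \<and> weakly_converges (\<eta> t) (\<eta>_inf t) at_bot"
    unfolding \<eta>_inf_def using \<eta>_converges[of t] by (rule someI_ex)
  then show "borel_prob (\<eta>_inf t)" "weakly_converges (\<eta> t) (\<eta>_inf t) at_bot" by auto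
  have "((\<lambda>s. char_fun (\<eta> t s) \<xi>) \<longlongrightarrow> char_fun (\<eta>_inf t) \<xi>) at_bot"
    using * by (intro weakly_converges_char_fun) (auto simp: borel_prob_\<eta>)
  moreover have "((\<lambda>s. char_fun (\<eta> t s) \<xi>) \<longlongrightarrow> char_fun (\<nu>' t) \<xi> * exp (\<kappa>_inf t \<xi>)) at_bot"
  proof (rule Lim_transform_eventually)
    show "((\<lambda>s. char_fun (\<nu>' t) \<xi> * exp (\<kappa> t s \<xi>)) \<longlongrightarrow> char_fun (\<nu>' t) \<xi> * exp (\<kappa>_inf t \<xi>)) at_bot"
      by (intro tendsto_intros \<kappa>_tendsto)
    show "eventually (\<lambda>s. char_fun (\<nu>' t) \<xi> * exp (\<kappa> t s \<xi>) = char_fun (\<eta> t s) \<xi>) at_bot"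
      using eventually_le_at_bot[of t] by eventually_elim (simp add: char_fun_\<eta>)
  qed
  ultimately show "char_fun (\<eta>_inf t) \<xi> = char_fun (\<nu>' t) \<xi> * exp (\<kappa>_inf t \<xi>)"
    by (intro tendsto_unique[OF trivial_limit_at_bot_linorder])
qed

theorem centred_laws_converge:
  "(SUP s\<in>{..t}. op_trace (R t s)) < \<infinity>"
  "(SUP s\<in>{..t}. \<integral>\<^sup>+x. ennreal (min 1 ((norm x)\<^sup>2)) \<partial>m t s) < \<infinity>"
  "weakly_converges (\<lambda>s. id_law 0 (R t s) (m t s)) (id_law 0 (R_inf R t) (m_inf m t)) at_bot"
proof -
  obtain C where C: "\<And>s. s \<le> t \<Longrightarrow> op_trace (R t s) \<le> ennreal C \<and> small_mass (m t s) \<le> ennreal C"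
    using triplet_bounds[of t] by blast
  have "(SUP s\<in>{..t}. op_trace (R t s)) \<le> ennreal C" using C by (intro SUP_least) auto
  then show "(SUP s\<in>{..t}. op_trace (R t s)) < \<infinity>" by (simp add: order.strict_trans1)
  have "(SUP s\<in>{..t}. \<integral>\<^sup>+x. ennreal (min 1 ((norm x)\<^sup>2)) \<partial>m t s) \<le> ennreal C"
    using C unfolding small_mass_def by (intro SUP_least) auto
  then show "(SUP s\<in>{..t}. \<integral>\<^sup>+x. ennreal (min 1 ((norm x)\<^sup>2)) \<partial>m t s) < \<infinity>" by (simp add: order.strict_trans1)
  show "weakly_converges (\<lambda>s. id_law 0 (R t s) (m t s)) (id_law 0 (R_inf R t) (m_inf m t)) at_bot"
    unfolding id_law_eq[OF root_inf_1_triplet]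
  proof (rule weakly_converges_cong)
    show "weakly_converges (root 1 t) (root_inf 1 t) at_bot" by (rule root_inf) simp
    show "eventually (\<lambda>s. root 1 t s = id_law 0 (R t s) (m t s)) at_bot"
      using eventually_le_at_bot[of t] by eventually_elim (simp add: id_law_eq[OF root_1_triplet])
  qed
qed

theorem centred_limit_factor: "\<nu>' t = id_law 0 (R_inf R t) (m_inf m t) \<^bold>* \<eta>_inf t"
  unfolding id_law_eq[OF root_inf_1_triplet]
proof (rule borel_prob_eqI)
  have one: "(1::nat) \<le> 1" by simp
  show "char_fun (\<nu>' t) \<xi> = char_fun (root_inf 1 t \<^bold>* \<eta>_inf t) \<xi>" for \<xi>
    by (simp add: char_fun_conv root_inf[OF one] \<eta>_inf exp_minus del: One_nat_def)
  show "borel_prob (root_inf 1 t \<^bold>* \<eta>_inf t)" by (intro borel_prob_conv root_inf[OF one] \<eta>_inf)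
qed (rule \<nu>')

end

section \<open>Zeros, shifts and drifts\<close>

text \<open>
  A symmetric law \<open>\<rho>\<close> satisfies \<open>1 - char_fun \<rho> (2 *\<^sub>R \<xi>) \<le> 4 * (1 - char_fun \<rho> \<xi>)\<close>. Applied to the
  symmetrised roots of all orders this shows that a zero at \<open>2 *\<^sub>R \<xi>\<close> forces a zero at \<open>\<xi>\<close>, and near the origin
  there are none.
\<close>

lemma infinitely_divisible_nonzero:
  fixes M :: "'h::{real_inner, second_countable_topology} measure"
  assumes "infinitely_divisible M"
  shows "char_fun M \<xi> \<noteq> 0"
proof -
  have M: "borel_prob M" using assms by (simp add: infinitely_divisible_def)
  have double: "char_fun M (2 *\<^sub>R \<xi>) \<noteq> 0" if nz: "char_fun M \<xi> \<noteq> 0" for \<xi>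
  proof
    assume zero: "char_fun M (2 *\<^sub>R \<xi>) = 0"
    have le: "(norm (char_fun M \<xi>))\<^sup>2 \<le> (3 / 4) ^ k" if k: "k \<ge> 1" for k
    proof -
      obtain N where N: "borel_prob N" "M = conv_power N k"
        using assms k by (auto simp: infinitely_divisible_def)
      note s = borel_prob_symm[OF N(1)] and s' = borel_probD[OF borel_prob_symm[OF N(1)]]
      have MN: "char_fun M x = char_fun N x ^ k" for x unfolding N(2) by (rule char_fun_conv_power[OF N(1)])
      have N0: "char_fun N (2 *\<^sub>R \<xi>) = 0" using zero k unfolding MN by simp
      have int: "integrable (symm N) (\<lambda>x. 1 - cos (c * (\<xi> \<bullet> x)))" for c
      proof (rule integrable_bounded_borel[OF s'(2,3), where B=2])
        show "norm (1 - cos (c * (\<xi> \<bullet> x))) \<le> 2" for x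
          using cos_ge_minus_one[of "c * (\<xi> \<bullet> x)"] cos_le_one[of "c * (\<xi> \<bullet> x)"] unfolding real_norm_def by linarith
      qed simp
      have "1 = (\<integral>x. 1 - cos ((2 *\<^sub>R \<xi>) \<bullet> x) \<partial>symm N)"
        unfolding integral_one_minus_cos[OF s] char_fun_symm[OF N(1)] N0 by simp
      also have "\<dots> \<le> (\<integral>x. 4 * (1 - cos (\<xi> \<bullet> x)) \<partial>symm N)"
      proof (rule integral_mono)
        show "1 - cos ((2 *\<^sub>R \<xi>) \<bullet> x) \<le> 4 * (1 - cos (\<xi> \<bullet> x))" for x
        proof -
          have "1 - cos (2 * (\<xi> \<bullet> x)) = 2 * (1 - cos (\<xi> \<bullet> x)) * (1 + cos (\<xi> \<bullet> x))"
            by (simp only: cos_double_cos) (simp add: power2_eq_square algebra_simps)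
          also have "\<dots> \<le> 2 * (1 - cos (\<xi> \<bullet> x)) * 2" by (intro mult_left_mono) auto
          finally show ?thesis by simp
        qed
      qed (use int[of 2] integrable_mult_right[OF int[of 1], of 4] in simp_all)
      also have "\<dots> = 4 * (1 - (norm (char_fun N \<xi>))\<^sup>2)"
        unfolding integral_mult_right_zero integral_one_minus_cos[OF s] char_fun_symm[OF N(1)] by simp
      finally have "(norm (char_fun N \<xi>))\<^sup>2 \<le> 3 / 4" by simp
      then have "((norm (char_fun N \<xi>))\<^sup>2) ^ k \<le> (3 / 4) ^ k" by (rule power_mono) simp
      then show ?thesis unfolding MN norm_power by (simp add: power_mult[symmetric] mult.commute)
    qed
    have "(\<lambda>k. (3 / 4 :: real) ^ k) \<longlonglongrightarrow> 0" by (rule LIMSEQ_power_zero) simp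
    then have "(norm (char_fun M \<xi>))\<^sup>2 \<le> 0" by (rule LIMSEQ_le_const) (use le in blast)
    then show False using nz by simp
  qed
  have pow: "char_fun M (2 ^ j *\<^sub>R \<xi>) \<noteq> 0" if "char_fun M \<xi> \<noteq> 0" for j \<xi>
  proof (induction j)
    case (Suc j)
    from double[OF this] show ?case by (simp add: mult.commute)
  qed (use that in simp)
  have "(\<lambda>j. char_fun M ((1/2) ^ j *\<^sub>R \<xi>)) \<longlonglongrightarrow> char_fun M (0 *\<^sub>R \<xi>)"
  proof (rule continuous_on_tendsto_compose[OF continuous_char_fun])
    show "(\<lambda>j. (1/2) ^ j *\<^sub>R \<xi>) \<longlonglongrightarrow> 0 *\<^sub>R \<xi>"
      by (intro tendsto_scaleR LIMSEQ_power_zero tendsto_const) simp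
  qed (use borel_probD[OF M] in auto)
  then have "eventually (\<lambda>j. char_fun M ((1/2) ^ j *\<^sub>R \<xi>) \<noteq> 0) sequentially"
    by (rule tendsto_imp_eventually_ne) (simp add: char_fun_0[OF M])
  then obtain j where "char_fun M ((1/2) ^ j *\<^sub>R \<xi>) \<noteq> 0" using eventually_happens by fastforce
  from pow[OF this, of j] show ?thesis by (simp add: power_mult_distrib[symmetric])
qed

text \<open>
  Test with the multiple of \<open>u - v\<close> at which the quotient of the two sides would be \<open>-1\<close>.
\<close>

lemma iexp_inner_eq_imp_eq:
  fixes u v :: "'h::real_inner"
  assumes "\<And>\<xi>. iexp (u \<bullet> \<xi>) = iexp (v \<bullet> \<xi>)"
  shows "u = v"
proof (rule ccontr)
  assume ne: "u \<noteq> v"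
  define d where "d = u - v"
  have d: "d \<noteq> 0" using ne by (simp add: d_def)
  have "iexp (d \<bullet> \<xi>) = 1" for \<xi>
    using assms[of \<xi>] by (simp add: d_def inner_diff_left right_diff_distrib exp_diff)
  from this[of "(pi / (d \<bullet> d)) *\<^sub>R d"] have "iexp pi = 1" using d by simp
  then show False using exp_pi_i by (simp add: mult.commute)
qed

lemma infinitely_divisible_dirac:
  "infinitely_divisible (dirac (0 :: 'h::{real_inner, second_countable_topology}))"
proof -
  have "dirac (0::'h) = conv_power (dirac 0) n" for n
    by (rule borel_prob_eqI) (simp_all add: borel_prob_conv_power char_fun_conv_power char_fun_dirac)
  then show ?thesis unfolding infinitely_divisible_def using borel_prob_dirac by blast
qed

lemma integral_shift:
  fixes M :: "'h::{real_normed_vector, second_countable_topology} measure"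
  assumes M: "borel_prob M" and f: "bl f"
  shows "(\<integral>x. f x \<partial>(dirac b \<^bold>* M)) = (\<integral>x. f (b + x) \<partial>M)"
proof -
  obtain B where B: "\<And>x. \<bar>f x\<bar> \<le> B" using f by (elim blE) blast
  note [measurable] = bl_measurable[OF f]
  interpret prob_space M by (rule borel_probD[OF M])
  have [measurable_cong]: "sets M = sets borel" by (rule borel_probD[OF M])
  have "(\<integral>x. f x \<partial>(dirac b \<^bold>* M)) = (\<integral>z. \<integral>x. f (z + x) \<partial>M \<partial>dirac b)"
    using B by (intro integral_conv[OF borel_prob_dirac M, where B=B]) auto
  also have "\<dots> = (\<integral>x. f (b + x) \<partial>M)" by (rule integral_return) simp_all
  finally show ?thesis .
qed

lemma bl_translate: "bl f \<Longrightarrow> bl (\<lambda>x. f (b + x))"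
  for f :: "'h::real_normed_vector \<Rightarrow> real"
proof -
  assume "bl f"
  then obtain L B where LB: "\<And>x y. \<bar>f x - f y\<bar> \<le> L * dist x y" "\<And>x. \<bar>f x\<bar> \<le> B" unfolding bl_def by blast
  show ?thesis
  proof (rule blI)
    show "\<bar>f (b + x) - f (b + y)\<bar> \<le> L * dist x y" for x y using LB(1)[of "b + x" "b + y"] by simp
  qed (rule LB(2))
qed

text \<open>
  A Lipschitz function changes by at most a multiple of the distance between \<open>b i\<close> and \<open>b0\<close>.
\<close>

lemma weakly_converges_shift:
  fixes M :: "'i \<Rightarrow> 'h::{real_normed_vector, second_countable_topology} measure"
  assumes M: "\<And>i. borel_prob (M i)" and N: "borel_prob N" and conv: "weakly_converges M N F"
    and b: "(b \<longlongrightarrow> b0) F"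
  shows "weakly_converges (\<lambda>i. dirac (b i) \<^bold>* M i) (dirac b0 \<^bold>* N) F"
proof (rule weakly_converges_lipschitz)
  show "eventually (\<lambda>i. borel_prob (dirac (b i) \<^bold>* M i)) F"
    by (intro always_eventually allI borel_prob_conv borel_prob_dirac M)
  show "borel_prob (dirac b0 \<^bold>* N)" by (intro borel_prob_conv borel_prob_dirac N)
  fix f :: "'h \<Rightarrow> real" assume f: "bl f"
  obtain L B where LB: "L \<ge> 0" "B > 0" "\<And>x y. \<bar>f x - f y\<bar> \<le> L * dist x y" "\<And>x. \<bar>f x\<bar> \<le> B"
    using blE[OF f] by metis
  have "bounded (range (\<lambda>x. f (b0 + x)))" using LB(4) by (intro boundedI[of _ B]) auto
  then have main: "((\<lambda>i. \<integral>x. f (b0 + x) \<partial>M i) \<longlongrightarrow> (\<integral>x. f (b0 + x) \<partial>N)) F"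
    using conv bl_continuous[OF bl_translate[OF f]] unfolding weakly_converges_def by blast
  have "((\<lambda>i. (\<integral>x. f (b i + x) \<partial>M i) - (\<integral>x. f (b0 + x) \<partial>M i)) \<longlongrightarrow> 0) F"
  proof (rule Lim_null_comparison)
    show "((\<lambda>i. L * dist (b i) b0) \<longlongrightarrow> 0) F"
      using tendsto_mult_left[OF tendsto_dist[OF b tendsto_const[of b0]], of L] by simp
    show "eventually (\<lambda>i. norm ((\<integral>x. f (b i + x) \<partial>M i) - (\<integral>x. f (b0 + x) \<partial>M i)) \<le> L * dist (b i) b0) F"
    proof (intro always_eventually allI)
      fix i
      have "\<bar>f (b i + x) - f (b0 + x)\<bar> \<le> L * dist (b i) b0" for x
        using LB(3)[of "b i + x" "b0 + x"] by simp
      then have "\<bar>\<integral>x. f (b i + x) - f (b0 + x) \<partial>M i\<bar> \<le> L * dist (b i) b0"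
        by (rule prob_integral_abs_le[OF borel_probD(1)[OF M]])
      then show "norm ((\<integral>x. f (b i + x) \<partial>M i) - (\<integral>x. f (b0 + x) \<partial>M i)) \<le> L * dist (b i) b0"
        using bl_integrable[OF M bl_translate[OF f]] by simp
    qed
  qed
  from tendsto_add[OF this main]
  show "((\<lambda>i. \<integral>x. f x \<partial>(dirac (b i) \<^bold>* M i)) \<longlongrightarrow> (\<integral>x. f x \<partial>(dirac b0 \<^bold>* N))) F"
    by (simp add: integral_shift[OF M f] integral_shift[OF N f])
qed

text \<open>
  If the laws \<open>P\<^sub>n\<close> and their translates by \<open>b\<^sub>n\<close> are both weakly convergent, then by tightness the
  \<open>b\<^sub>n\<close> stay in a compact set of differences.
\<close>

lemma translations_compact:
  fixes P :: "nat \<Rightarrow> 'h::{real_normed_vector, polish_space} measure"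
  assumes P: "\<And>n. borel_prob (P n)" "borel_prob P0" "weakly_converges P P0 sequentially"
    and E: "borel_prob E0" "weakly_converges (\<lambda>n. dirac (b n) \<^bold>* P n) E0 sequentially"
  shows "\<exists>K. compact K \<and> (\<forall>n. b n \<in> K)"
proof -
  have En: "borel_prob (dirac (b n) \<^bold>* P n)" for n by (intro borel_prob_conv borel_prob_dirac P)
  have "0 < (1/4::real)" by simp
  obtain K1 where K1: "compact K1" "\<And>n. 1 - 1/4 \<le> measure (P n) K1"
    using tight_weakly_convergent[OF P \<open>0 < 1/4\<close>] by blast
  obtain K2 where K2: "compact K2" "\<And>n. 1 - 1/4 \<le> measure (dirac (b n) \<^bold>* P n) K2"
    using tight_weakly_convergent[OF En E \<open>0 < 1/4\<close>] by blast
  have "b n \<in> {x - y | x y. x \<in> K2 \<and> y \<in> K1}" for n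
  proof -
    note p = borel_probD[OF P(1)[of n]]
    interpret prob_space "P n" by (rule p)
    have [measurable_cong]: "sets (P n) = sets borel" by (rule p)
    have K2b [measurable]: "K2 \<in> sets borel" using K2(1) by (rule borel_compact)
    define T where "T = {x. b n + x \<in> K2}"
    have T: "T \<in> sets (P n)" unfolding T_def p(3) by measurable
    have "emeasure (dirac (b n) \<^bold>* P n) K2 = (\<integral>\<^sup>+z. \<integral>\<^sup>+x. indicator K2 (z + x) \<partial>P n \<partial>dirac (b n))"
      using nn_integral_conv[OF borel_prob_dirac P(1), of "indicator K2" "b n" n] borel_probD(3)[OF En[of n]]
      by simp
    also have "\<dots> = (\<integral>\<^sup>+x. indicator K2 (b n + x) \<partial>P n)" by (rule nn_integral_return) simp_all
    also have "\<dots> = (\<integral>\<^sup>+x. indicator T x \<partial>P n)" by (intro nn_integral_cong) (simp add: T_def indicator_def)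
    also have "\<dots> = emeasure (P n) T" using T by simp
    finally have "measure (dirac (b n) \<^bold>* P n) K2 = measure (P n) T" by (simp add: measure_def)
    then have mT: "3/4 \<le> measure (P n) T" using K2(2)[of n] by simp
    have "T \<inter> K1 \<noteq> {}"
    proof
      assume "T \<inter> K1 = {}"
      then have "measure (P n) (T \<union> K1) = measure (P n) T + measure (P n) K1"
        using T K1(1) p(3) by (intro finite_measure_Union) (auto intro: borel_compact)
      then show False using mT K1(2)[of n] prob_le_1[of "T \<union> K1"] by simp
    qed
    then obtain x where "b n + x \<in> K2" "x \<in> K1" by (auto simp: T_def)
    then show ?thesis by (intro CollectI exI[of _ "b n + x"] exI[of _ x]) simp
  qed
  moreover have "compact {x - y | x y. x \<in> K2 \<and> y \<in> K1}" using compact_differences[OF K2(1) K1(1)] .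
  ultimately show ?thesis by blast
qed

lemma weakly_converges_compose:
  "weakly_converges M N F \<Longrightarrow> filterlim g F G \<Longrightarrow> weakly_converges (\<lambda>i. M (g i)) N G"
  unfolding weakly_converges_def using filterlim_compose by blast

context evolution_data
begin

abbreviation P :: "real \<Rightarrow> real \<Rightarrow> 'h measure" where
  "P t s \<equiv> push (U t s) (\<nu>' s)"

lemma P_char_tendsto:
  assumes "H4 U \<nu>' \<sigma>"
  shows "((\<lambda>s. char_fun (P t s) \<xi>) \<longlongrightarrow> char_fun (\<sigma> t) \<xi>) at_bot"
  using assms unfolding H4_def
  by (intro weakly_converges_char_fun) (auto simp: push_\<nu>')

text \<open>
  The phase \<open>iexp (a t s \<bullet> \<xi>)\<close> is the quotient of the characteristic functions of two convergent families,
  and the denominator does not vanish in the limit. Compactness of the drifts along sequences then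
  upgrades the convergence of all phases to convergence in norm.
\<close>

lemma drift_converges:
  assumes H4: "H4 U \<nu>' \<sigma>" and nz: "\<And>\<xi>. char_fun (\<sigma> t) \<xi> \<noteq> 0"
  shows "\<exists>l. ((\<lambda>s. a t s) \<longlongrightarrow> l) at_bot"
proof -
  have \<sigma>: "borel_prob (\<sigma> t)" and conv: "weakly_converges (\<lambda>s. P t s) (\<sigma> t) at_bot"
    using H4 by (auto simp: H4_def)
  define g where "g \<xi> = char_fun (\<eta>_inf t) \<xi> / char_fun (\<sigma> t) \<xi>" for \<xi>
  have phase: "((\<lambda>s. iexp (a t s \<bullet> \<xi>)) \<longlongrightarrow> g \<xi>) at_bot" for \<xi>
  proof (rule Lim_transform_eventually)
    have "((\<lambda>s. char_fun (\<eta> t s) \<xi>) \<longlongrightarrow> char_fun (\<eta>_inf t) \<xi>) at_bot"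
      by (rule weakly_converges_char_fun[OF _ \<eta>_inf(1,2)]) (simp add: borel_prob_\<eta>)
    then show "((\<lambda>s. char_fun (\<eta> t s) \<xi> / char_fun (P t s) \<xi>) \<longlongrightarrow> g \<xi>) at_bot"
      unfolding g_def by (intro tendsto_divide P_char_tendsto[OF H4] nz)
    have "eventually (\<lambda>s. char_fun (P t s) \<xi> \<noteq> 0) at_bot"
      by (rule tendsto_imp_eventually_ne[OF P_char_tendsto[OF H4] nz])
    then show "eventually (\<lambda>s. char_fun (\<eta> t s) \<xi> / char_fun (P t s) \<xi> = iexp (a t s \<bullet> \<xi>)) at_bot"
      by eventually_elim (simp add: \<eta>_def char_fun_shift[OF push_\<nu>'])
  qed
  \<comment> \<open>along every sequence there is a cluster point, and it is determined by \<open>g\<close>\<close>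
  have cluster: "\<exists>l r. strict_mono r \<and> (\<lambda>n. a t (S (r n))) \<longlonglongrightarrow> l \<and> (\<forall>\<xi>. iexp (l \<bullet> \<xi>) = g \<xi>)"
    if S: "filterlim S at_bot sequentially" for S :: "nat \<Rightarrow> real"
  proof -
    have "\<exists>K. compact K \<and> (\<forall>n. a t (S n) \<in> K)"
    proof (rule translations_compact)
      show "weakly_converges (\<lambda>n. P t (S n)) (\<sigma> t) sequentially" by (rule weakly_converges_compose[OF conv S])
      show "weakly_converges (\<lambda>n. dirac (a t (S n)) \<^bold>* P t (S n)) (\<eta>_inf t) sequentially"
        using weakly_converges_compose[OF \<eta>_inf(2) S] by (simp add: \<eta>_def)
    qed (simp_all add: push_\<nu>' \<sigma> \<eta>_inf(1))
    then obtain K where K: "compact K" "\<And>n. a t (S n) \<in> K" by blast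
    obtain l r where lr: "strict_mono r" "((\<lambda>n. a t (S n)) \<circ> r) \<longlonglongrightarrow> l"
      using K unfolding compact_def by metis
    have l: "(\<lambda>n. a t (S (r n))) \<longlonglongrightarrow> l" using lr(2) by (simp add: comp_def)
    have "iexp (l \<bullet> \<xi>) = g \<xi>" for \<xi>
    proof (rule LIMSEQ_unique)
      show "(\<lambda>n. iexp (a t (S (r n)) \<bullet> \<xi>)) \<longlonglongrightarrow> iexp (l \<bullet> \<xi>)" by (intro tendsto_intros l)
      show "(\<lambda>n. iexp (a t (S (r n)) \<bullet> \<xi>)) \<longlonglongrightarrow> g \<xi>"
        by (rule filterlim_compose[OF phase filterlim_compose[OF S filterlim_subseq[OF lr(1)]]])
    qed
    then show ?thesis using lr(1) l by blast
  qed
  have at_bot: "filterlim S at_bot sequentially" if "\<And>n. S n \<le> - real n" for S :: "nat \<Rightarrow> real"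
    unfolding filterlim_at_bot
  proof
    fix Z :: real
    obtain N where N: "- Z \<le> real N" using real_arch_simple by blast
    show "eventually (\<lambda>n. S n \<le> Z) sequentially"
    proof (rule eventually_sequentiallyI[of N])
      fix n assume "N \<le> n"
      then have "real N \<le> real n" by simp
      then show "S n \<le> Z" using N that[of n] by linarith
    qed
  qed
  obtain l where l: "\<And>\<xi>. iexp (l \<bullet> \<xi>) = g \<xi>" using cluster[OF at_bot[of "\<lambda>n. - real n"]] by blast
  have "((\<lambda>s. a t s) \<longlongrightarrow> l) at_bot"
  proof (rule ccontr)
    assume "\<not> ?thesis"
    then obtain e where e: "0 < e" "\<not> eventually (\<lambda>s. dist (a t s) l < e) at_bot" unfolding tendsto_iff by blast
    have "\<exists>s\<le>- real n. e \<le> dist (a t s) l" for n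
      using e(2) unfolding eventually_at_bot_linorder by (metis not_le)
    then obtain S where S: "\<And>n. S n \<le> - real n" "\<And>n. e \<le> dist (a t (S n)) l" by metis
    obtain l' r where l': "strict_mono r" "(\<lambda>n. a t (S (r n))) \<longlonglongrightarrow> l'" "\<And>\<xi>. iexp (l' \<bullet> \<xi>) = g \<xi>"
      using cluster[OF at_bot[OF S(1)]] by blast
    have "l' = l" by (rule iexp_inner_eq_imp_eq) (simp only: l l'(3))
    then have "(\<lambda>n. dist (a t (S (r n))) l) \<longlonglongrightarrow> 0" using tendsto_dist_iff[THEN iffD1, OF l'(2)] by simp
    then have "e \<le> 0" by (rule LIMSEQ_le_const) (use S(2) in blast)
    then show False using e(1) by simp
  qed
  then show ?thesis by blast
qed

lemma a_inf_tendsto: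
  assumes "H3 a"
  shows "((\<lambda>s. a t s) \<longlongrightarrow> a_inf a t) at_bot"
proof -
  obtain l where l: "((\<lambda>s. a t s) \<longlongrightarrow> l) at_bot" using assms by (auto simp: H3_def)
  then have "a_inf a t = l" unfolding a_inf_def by (rule tendsto_Lim[OF trivial_limit_at_bot_linorder])
  then show ?thesis using l by simp
qed

abbreviation \<nu>_lim :: "real \<Rightarrow> 'h measure" where
  "\<nu>_lim t \<equiv> id_law (a_inf a t) (R_inf R t) (m_inf m t)"

lemma \<nu>_lim_triplet: "has_triplet (\<nu>_lim t) (a_inf a t) (R_inf R t) (m_inf m t)"
proof -
  have "has_triplet (dirac (a_inf a t) \<^bold>* root_inf 1 t) (a_inf a t) (R_inf R t) (m_inf m t)"
    using has_triplet_shift[OF root_inf_1_triplet, of "a_inf a t" t] by simp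
  then show ?thesis using id_law_eq by metis
qed

text \<open>
  Pass to the limit in the characteristic functions of \<open>\<nu>' t = \<mu> t s \<^bold>* push (U t s) (\<nu>' s)\<close>.
\<close>

lemma limit_decomposition:
  assumes H4: "H4 U \<nu>' \<sigma>" and H3: "H3 a"
  shows "\<nu>' t = \<nu>_lim t \<^bold>* \<sigma> t"
proof (rule borel_prob_eqI)
  note T = has_tripletD[OF \<nu>_lim_triplet[of t]]
  have \<sigma>: "borel_prob (\<sigma> t)" using H4 by (simp add: H4_def)
  show "borel_prob (\<nu>' t)" by (rule \<nu>')
  show "borel_prob (\<nu>_lim t \<^bold>* \<sigma> t)" by (intro borel_prob_conv T \<sigma>)
  fix \<xi>
  let ?\<psi> = "\<lambda>s. levy_exponent (a t s) (R t s) (m t s) \<xi>"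
  have "((\<lambda>s. \<kappa> t s \<xi> - \<i> * of_real (a t s \<bullet> \<xi>)) \<longlongrightarrow> \<kappa>_inf t \<xi> - \<i> * of_real (a_inf a t \<bullet> \<xi>)) at_bot"
    by (intro tendsto_intros \<kappa>_tendsto a_inf_tendsto[OF H3])
  then have "(?\<psi> \<longlongrightarrow> levy_exponent (a_inf a t) (R_inf R t) (m_inf m t) \<xi>) at_bot"
    unfolding levy_exponent_drift[OF levy_m_inf, of "a_inf a t", symmetric]
    by (rule Lim_transform_eventually)
      (rule eventually_before[of t], erule levy_exponent_drift[OF \<mu>(4), symmetric])
  then have "((\<lambda>s. exp (- ?\<psi> s) * char_fun (P t s) \<xi>) \<longlongrightarrow> char_fun (\<nu>_lim t) \<xi> * char_fun (\<sigma> t) \<xi>) at_bot"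
    unfolding T(5) by (intro tendsto_intros P_char_tendsto[OF H4])
  moreover have "eventually (\<lambda>s. exp (- ?\<psi> s) * char_fun (P t s) \<xi> = char_fun (\<nu>' t) \<xi>) at_bot"
    by (rule eventually_before[of t]) (simp add: char_fun_push_\<nu>' exp_minus)
  ultimately have "((\<lambda>s::real. char_fun (\<nu>' t) \<xi>) \<longlongrightarrow> char_fun (\<nu>_lim t) \<xi> * char_fun (\<sigma> t) \<xi>) at_bot"
    by (rule Lim_transform_eventually)
  then show "char_fun (\<nu>' t) \<xi> = char_fun (\<nu>_lim t \<^bold>* \<sigma> t) \<xi>"
    unfolding char_fun_conv[OF T(2) \<sigma>] by (rule tendsto_unique[OF trivial_limit_at_bot_linorder tendsto_const])
qed

text \<open>
  Since \<open>U t r = U t s o\<^sub>L U s r\<close>, the family for \<open>t\<close> is the image of the family for \<open>s\<close>.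
\<close>

lemma limit_invariance:
  assumes H4: "H4 U \<nu>' \<sigma>" and st: "s \<le> t"
  shows "\<sigma> t = push (U t s) (\<sigma> s)"
proof (rule borel_prob_eqI)
  have \<sigma>: "borel_prob (\<sigma> t)" for t using H4 by (simp add: H4_def)
  show "borel_prob (\<sigma> t)" "borel_prob (push (U t s) (\<sigma> s))" by (intro \<sigma> borel_prob_push)+
  fix \<xi>
  have step: "char_fun (P t r) \<xi> = char_fun (P s r) (adj t s \<xi>)" if r: "r \<le> s" for r
  proof -
    have "U t s o\<^sub>L U s r = U t r" using U r st by (simp add: evolution_family_def)
    then have comp: "U t r = U t s o\<^sub>L U s r" ..
    have apply_comp: "blinfun_apply (U t s o\<^sub>L U s r) = (\<lambda>x. U t s (U s r x))" by (rule ext) simp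
    have "P t r = push (U t s) (P s r)"
      unfolding comp by (subst distr_distr) (simp_all add: apply_comp comp_def measurable_cong_sets[OF borel_probD(3)[OF \<nu>'] refl])
    then show ?thesis by (simp only: char_fun_push_U[OF push_\<nu>'])
  qed
  have "((\<lambda>r. char_fun (P s r) (adj t s \<xi>)) \<longlongrightarrow> char_fun (\<sigma> s) (adj t s \<xi>)) at_bot"
    by (rule P_char_tendsto[OF H4])
  then have "((\<lambda>r. char_fun (P t r) \<xi>) \<longlongrightarrow> char_fun (\<sigma> s) (adj t s \<xi>)) at_bot"
    by (rule Lim_transform_eventually) (rule eventually_before[of s], erule step[symmetric])
  then show "char_fun (\<sigma> t) \<xi> = char_fun (push (U t s) (\<sigma> s)) \<xi>"
    unfolding char_fun_push_U[OF \<sigma>]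
    by (rule tendsto_unique[OF trivial_limit_at_bot_linorder P_char_tendsto[OF H4]])
qed

lemma H4_from_H3:
  assumes H3: "H3 a"
  shows "H4 U \<nu>' (\<lambda>t. dirac (- a_inf a t) \<^bold>* \<eta>_inf t)"
  unfolding H4_def
proof (intro allI conjI)
  fix t
  show "borel_prob (dirac (- a_inf a t) \<^bold>* \<eta>_inf t)" by (intro borel_prob_conv borel_prob_dirac \<eta>_inf)
  have eq: "dirac (- a t s) \<^bold>* \<eta> t s = P t s" for s
    by (rule borel_prob_eqI)
      (simp_all add: borel_prob_conv borel_prob_\<eta> push_\<nu>' char_fun_shift \<eta>_def mult.assoc[symmetric] flip: exp_add)
  have "weakly_converges (\<lambda>s. dirac (- a t s) \<^bold>* \<eta> t s) (dirac (- a_inf a t) \<^bold>* \<eta>_inf t) at_bot"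
    by (intro weakly_converges_shift borel_prob_\<eta> \<eta>_inf tendsto_minus a_inf_tendsto[OF H3])
  then show "weakly_converges (\<lambda>s. P t s) (dirac (- a_inf a t) \<^bold>* \<eta>_inf t) at_bot" by (simp only: eq)
qed

lemma H3_from_H4:
  assumes "H4 U \<nu>' \<sigma>" "\<And>t. infinitely_divisible (\<sigma> t)"
  shows "H3 a"
  unfolding H3_def using drift_converges[OF assms(1) infinitely_divisible_nonzero[OF assms(2)]] by blast

lemma dirac_limit_determines:
  assumes "H4 U \<nu>' (\<lambda>t. dirac 0)"
  shows "\<nu>' t = \<nu>_lim t"
proof -
  have "\<nu>' t = \<nu>_lim t \<^bold>* dirac 0"
    using assms infinitely_divisible_dirac by (intro limit_decomposition H3_from_H4) auto
  also have "\<dots> = \<nu>_lim t"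
    using has_tripletD(2)[OF \<nu>_lim_triplet[of t]]
    by (intro borel_prob_eqI) (simp_all add: borel_prob_conv char_fun_conv char_fun_dirac)
  finally show ?thesis .
qed

end

theorem theorem4p10:
  fixes U :: "real \<Rightarrow> real \<Rightarrow> 'h::{real_inner, banach, polish_space} \<Rightarrow>\<^sub>L 'h"
    and \<mu> :: "real \<Rightarrow> real \<Rightarrow> 'h measure"
    and a :: "real \<Rightarrow> real \<Rightarrow> 'h"
    and R :: "real \<Rightarrow> real \<Rightarrow> 'h \<Rightarrow>\<^sub>L 'h"
    and m :: "real \<Rightarrow> real \<Rightarrow> 'h measure"
    and \<nu>' :: "real \<Rightarrow> 'h measure"
  assumes U: "evolution_family U"
    and triplet: "\<And>t s. s \<le> t \<Longrightarrow> has_triplet (\<mu> t s) (a t s) (R t s) (m t s)"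
    and skew: "\<And>t r s. s \<le> r \<Longrightarrow> r \<le> t \<Longrightarrow> \<mu> t s = \<mu> t r \<^bold>* push (U t r) (\<mu> r s)"
    and system: "evolution_system (mehler U \<mu>) \<nu>'"
  shows
    \<comment> \<open>part (1), including that the limiting triplet is well defined\<close>
    "(\<forall>t. (SUP s\<in>{..t}. op_trace (R t s)) < \<infinity> \<and>
          (SUP s\<in>{..t}. \<integral>\<^sup>+x. ennreal (min 1 ((norm x)\<^sup>2)) \<partial>m t s) < \<infinity> \<and>
          (\<forall>x y. ((\<lambda>s. R t s x \<bullet> y) \<longlongrightarrow> R_inf R t x \<bullet> y) at_bot) \<and>
          (\<forall>A\<in>sets borel. 0 \<notin> A \<longrightarrow>
             ((\<lambda>s. emeasure (m t s) A) \<longlongrightarrow> emeasure (m_inf m t) A) at_bot) \<and>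
          (\<forall>s\<le>t. has_triplet (id_law 0 (R t s) (m t s)) 0 (R t s) (m t s)) \<and>
          has_triplet (id_law 0 (R_inf R t) (m_inf m t)) 0 (R_inf R t) (m_inf m t) \<and>
          weakly_converges (\<lambda>s. id_law 0 (R t s) (m t s)) (id_law 0 (R_inf R t) (m_inf m t)) at_bot)
     \<and>
     \<comment> \<open>part (2)\<close>
     (\<forall>t. \<exists>\<sigma>'. borel_prob \<sigma>' \<and>
          weakly_converges (\<lambda>s. dirac (a t s) \<^bold>* push (U t s) (\<nu>' s)) \<sigma>' at_bot \<and>
          \<nu>' t = id_law 0 (R_inf R t) (m_inf m t) \<^bold>* \<sigma>')
     \<and>
     \<comment> \<open>part (3)\<close>
     (\<forall>\<sigma>. H4 U \<nu>' \<sigma> \<and> (\<forall>t. infinitely_divisible (\<sigma> t)) \<longrightarrow>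
        H3 a \<and>
        (let \<nu> = (\<lambda>t. id_law (a_inf a t) (R_inf R t) (m_inf m t)) in
          (\<forall>t. has_triplet (\<nu> t) (a_inf a t) (R_inf R t) (m_inf m t)) \<and>
          (\<forall>t. factor (\<nu> t) (\<nu>' t)) \<and>
          (\<forall>t. \<nu>' t = \<nu> t \<^bold>* \<sigma> t) \<and>
          (\<forall>t s. s \<le> t \<longrightarrow> \<sigma> t = push (U t s) (\<sigma> s)) \<and>
          ((\<forall>t. \<sigma> t = dirac 0) \<longrightarrow>
             (\<forall>t. \<nu>' t = \<nu> t) \<and>
             (\<forall>\<nu>''. evolution_system (mehler U \<mu>) \<nu>'' \<and> H4 U \<nu>'' (\<lambda>t. dirac 0) \<longrightarrow> \<nu>'' = \<nu>'))))
     \<and>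
     \<comment> \<open>part (4)\<close>
     (H3 a \<longrightarrow>
        (\<exists>\<sigma>. H4 U \<nu>' \<sigma> \<and>
          (let \<nu> = (\<lambda>t. id_law (a_inf a t) (R_inf R t) (m_inf m t)) in
            (\<forall>t. has_triplet (\<nu> t) (a_inf a t) (R_inf R t) (m_inf m t)) \<and>
            (\<forall>t. \<nu>' t = \<nu> t \<^bold>* \<sigma> t) \<and>
            (\<forall>t s. s \<le> t \<longrightarrow> \<sigma> t = push (U t s) (\<sigma> s)))))"
proof -
  interpret D: evolution_data U \<mu> a R m \<nu>'
    by unfold_locales (fact U triplet skew system)+
  let ?\<nu> = "\<lambda>t. id_law (a_inf a t) (R_inf R t) (m_inf m t)"
  have one: "\<forall>t. (SUP s\<in>{..t}. op_trace (R t s)) < \<infinity> \<and>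
          (SUP s\<in>{..t}. \<integral>\<^sup>+x. ennreal (min 1 ((norm x)\<^sup>2)) \<partial>m t s) < \<infinity> \<and>
          (\<forall>x y. ((\<lambda>s. R t s x \<bullet> y) \<longlongrightarrow> R_inf R t x \<bullet> y) at_bot) \<and>
          (\<forall>A\<in>sets borel. 0 \<notin> A \<longrightarrow>
             ((\<lambda>s. emeasure (m t s) A) \<longlongrightarrow> emeasure (m_inf m t) A) at_bot) \<and>
          (\<forall>s\<le>t. has_triplet (id_law 0 (R t s) (m t s)) 0 (R t s) (m t s)) \<and>
          has_triplet (id_law 0 (R_inf R t) (m_inf m t)) 0 (R_inf R t) (m_inf m t) \<and>
          weakly_converges (\<lambda>s. id_law 0 (R t s) (m t s)) (id_law 0 (R_inf R t) (m_inf m t)) at_bot"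
  proof (intro allI conjI ballI impI)
    fix t
    show "has_triplet (id_law 0 (R t s) (m t s)) 0 (R t s) (m t s)" if "s \<le> t" for s
      unfolding id_law_eq[OF D.root_1_triplet[OF that]] by (rule D.root_1_triplet[OF that])
    show "has_triplet (id_law 0 (R_inf R t) (m_inf m t)) 0 (R_inf R t) (m_inf m t)"
      unfolding id_law_eq[OF D.root_inf_1_triplet] by (rule D.root_inf_1_triplet)
  qed (rule D.centred_laws_converge D.R_inf D.emeasure_m_tendsto, (assumption+)?)+
  have two: "\<forall>t. \<exists>\<sigma>'. borel_prob \<sigma>' \<and>
          weakly_converges (\<lambda>s. dirac (a t s) \<^bold>* push (U t s) (\<nu>' s)) \<sigma>' at_bot \<and>
          \<nu>' t = id_law 0 (R_inf R t) (m_inf m t) \<^bold>* \<sigma>'"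
  proof
    fix t
    show "\<exists>\<sigma>'. borel_prob \<sigma>' \<and>
          weakly_converges (\<lambda>s. dirac (a t s) \<^bold>* push (U t s) (\<nu>' s)) \<sigma>' at_bot \<and>
          \<nu>' t = id_law 0 (R_inf R t) (m_inf m t) \<^bold>* \<sigma>'"
      using D.\<eta>_inf(1,2)[of t] D.centred_limit_factor[of t] unfolding D.\<eta>_def
      by (intro exI[of _ "D.\<eta>_inf t"] conjI)
  qed
  have unique: "\<nu>'' = \<nu>'"
    if "H4 U \<nu>' (\<lambda>t. dirac 0)" "evolution_system (mehler U \<mu>) \<nu>''" "H4 U \<nu>'' (\<lambda>t. dirac 0)" for \<nu>''
  proof
    interpret E: evolution_data U \<mu> a R m \<nu>''
      by unfold_locales (fact U triplet skew that(2))+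
    show "\<nu>'' t = \<nu>' t" for t
      using E.dirac_limit_determines[OF that(3)] D.dirac_limit_determines[OF that(1)] by simp
  qed
  have three: "H3 a \<and>
        (let \<nu> = ?\<nu> in
          (\<forall>t. has_triplet (\<nu> t) (a_inf a t) (R_inf R t) (m_inf m t)) \<and>
          (\<forall>t. factor (\<nu> t) (\<nu>' t)) \<and>
          (\<forall>t. \<nu>' t = \<nu> t \<^bold>* \<sigma> t) \<and>
          (\<forall>t s. s \<le> t \<longrightarrow> \<sigma> t = push (U t s) (\<sigma> s)) \<and>
          ((\<forall>t. \<sigma> t = dirac 0) \<longrightarrow>
             (\<forall>t. \<nu>' t = \<nu> t) \<and>
             (\<forall>\<nu>''. evolution_system (mehler U \<mu>) \<nu>'' \<and> H4 U \<nu>'' (\<lambda>t. dirac 0) \<longrightarrow> \<nu>'' = \<nu>')))"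
    if "H4 U \<nu>' \<sigma> \<and> (\<forall>t. infinitely_divisible (\<sigma> t))" for \<sigma>
  proof -
    have H4: "H4 U \<nu>' \<sigma>" and id: "infinitely_divisible (\<sigma> t)" for t using that by auto
    have H3: "H3 a" by (rule D.H3_from_H4[OF H4 id])
    note decomposition = D.limit_decomposition[OF H4 H3]
    have factors: "factor (?\<nu> t) (\<nu>' t)" for t
      unfolding factor_def using H4 decomposition[of t] by (intro exI[of _ "\<sigma> t"]) (simp add: H4_def)
    have H4_0: "H4 U \<nu>' (\<lambda>t. dirac 0)" if "\<forall>t. \<sigma> t = dirac 0"
    proof -
      have "\<sigma> = (\<lambda>t. dirac 0)" using that by (intro ext) simp
      then show ?thesis using H4 by simp
    qed
    show ?thesis
      unfolding Let_def
    proof (intro conjI allI impI H3 D.\<nu>_lim_triplet factors decomposition)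
      show "\<sigma> t = push (U t s) (\<sigma> s)" if "s \<le> t" for s t by (rule D.limit_invariance[OF H4 that])
      show "\<nu>' t = ?\<nu> t" if "\<forall>t. \<sigma> t = dirac 0" for t by (rule D.dirac_limit_determines[OF H4_0[OF that]])
      show "\<nu>'' = \<nu>'" if "\<forall>t. \<sigma> t = dirac 0"
        "evolution_system (mehler U \<mu>) \<nu>'' \<and> H4 U \<nu>'' (\<lambda>t. dirac 0)" for \<nu>''
        using unique[OF H4_0[OF that(1)]] that(2) by simp
    qed
  qed
  have four: "\<exists>\<sigma>. H4 U \<nu>' \<sigma> \<and>
          (let \<nu> = ?\<nu> in
            (\<forall>t. has_triplet (\<nu> t) (a_inf a t) (R_inf R t) (m_inf m t)) \<and>
            (\<forall>t. \<nu>' t = \<nu> t \<^bold>* \<sigma> t) \<and>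
            (\<forall>t s. s \<le> t \<longrightarrow> \<sigma> t = push (U t s) (\<sigma> s)))" if H3: "H3 a"
  proof -
    obtain \<sigma> where H4: "H4 U \<nu>' \<sigma>" using D.H4_from_H3[OF H3] by (rule that)
    show ?thesis
      unfolding Let_def
      by (intro exI[of _ \<sigma>] conjI allI impI H4 D.\<nu>_lim_triplet D.limit_decomposition[OF H4 H3] D.limit_invariance[OF H4])
  qed
  show ?thesis
    by (rule conjI[OF one conjI[OF two conjI]]) (intro allI impI, erule three, intro impI, erule four)
qed

end
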